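(* There is a forcing extension of $L$ by class forcing which satisfies $\mathrm{ZFC}+\neg\mathrm{BA}$.
   Context: The Ground Axiom ($\mathrm{GA}$) asserts that the universe is not a forcing extension of any inner model $W$ by nontrivial set forcing $P\in W$. The Bedrock Axiom ($\mathrm{BA}$) asserts that there is an inner model $W$ such that $V$ is a set-forcing extension of $W$ (possibly trivial) and $W\models\mathrm{GA}$. Class forcing means forcing with a definable proper-class partial order. *)

theory Defs
  imports Main "HOL-Library.Countable_Set"
begin

text \<open>
  A structure for the language of set theory is a carrier \<open>A\<close> together with a binary
  relation \<open>E\<close>, where \<open>E y x\<close> is read as ``\<open>y\<close> is a member of \<open>x\<close>''. Only the restriction
  of \<open>E\<close> to \<open>A\<close> matters, so a substructure is given by a smaller carrier and the same \<open>E\<close>.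
\<close>

section \<open>First-order formulas and definability\<close>

datatype fm = Mem nat nat | Eq nat nat | Neg fm | Conj fm fm | Forall nat fm

primrec fv :: "fm \<Rightarrow> nat set" where
  "fv (Mem i j) = {i, j}"
| "fv (Eq i j) = {i, j}"
| "fv (Neg \<phi>) = fv \<phi>"
| "fv (Conj \<phi> \<psi>) = fv \<phi> \<union> fv \<psi>"
| "fv (Forall i \<phi>) = fv \<phi> - {i}"

primrec sat :: "'a set \<Rightarrow> ('a \<Rightarrow> 'a \<Rightarrow> bool) \<Rightarrow> fm \<Rightarrow> (nat \<Rightarrow> 'a) \<Rightarrow> bool" where
  "sat A E (Mem i j) v \<longleftrightarrow> E (v i) (v j)"
| "sat A E (Eq i j) v \<longleftrightarrow> v i = v j"
| "sat A E (Neg \<phi>) v \<longleftrightarrow> \<not> sat A E \<phi> v"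
| "sat A E (Conj \<phi> \<psi>) v \<longleftrightarrow> sat A E \<phi> v \<and> sat A E \<psi> v"
| "sat A E (Forall i \<phi>) v \<longleftrightarrow> (\<forall>a\<in>A. sat A E \<phi> (v(i := a)))"

text \<open>
  Definability with parameters. Parameters are required to lie in \<open>A\<close> only for the variables
  that occur free, so that the empty structure has a definable subset as well; this is needed
  at the bottom of the constructible hierarchy.
\<close>

definition definable :: "'a set \<Rightarrow> ('a \<Rightarrow> 'a \<Rightarrow> bool) \<Rightarrow> 'a set \<Rightarrow> bool" where
  "definable A E X \<longleftrightarrow>
     (\<exists>\<phi> v. v ` (fv \<phi> - {0}) \<subseteq> A \<and> X = {a \<in> A. sat A E \<phi> (v(0 := a))})"

definition definable_rel :: "'a set \<Rightarrow> ('a \<Rightarrow> 'a \<Rightarrow> bool) \<Rightarrow> ('a \<times> 'a) set \<Rightarrow> bool" where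
  "definable_rel A E R \<longleftrightarrow>
     (\<exists>\<phi> v. v ` (fv \<phi> - {0, 1}) \<subseteq> A \<and>
        R = {(a, b). a \<in> A \<and> b \<in> A \<and> sat A E \<phi> (v(0 := a, 1 := b))})"

section \<open>Models of ZFC\<close>

definition elts :: "'a set \<Rightarrow> ('a \<Rightarrow> 'a \<Rightarrow> bool) \<Rightarrow> 'a \<Rightarrow> 'a set" where
  "elts A E x = {y \<in> A. E y x}"

definition is_opair :: "'a set \<Rightarrow> ('a \<Rightarrow> 'a \<Rightarrow> bool) \<Rightarrow> 'a \<Rightarrow> 'a \<Rightarrow> 'a \<Rightarrow> bool" where
  "is_opair A E z x y \<longleftrightarrow> x \<in> A \<and> y \<in> A \<and> z \<in> A \<and>
     (\<exists>s\<in>A. \<exists>t\<in>A. elts A E s = {x} \<and> elts A E t = {x, y} \<and> elts A E z = {s, t})"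

definition extensional_model :: "'a set \<Rightarrow> ('a \<Rightarrow> 'a \<Rightarrow> bool) \<Rightarrow> bool" where
  "extensional_model A E \<longleftrightarrow> (\<forall>x\<in>A. \<forall>y\<in>A. elts A E x = elts A E y \<longrightarrow> x = y)"

text \<open>
  The axioms are stated as what their satisfaction in \<open>(A, E)\<close> unfolds to; the two schemas
  quantify over the classes and class relations definable with parameters. Choice is the
  existence of a transversal for each set of nonempty, pairwise disjoint sets.
\<close>

definition ZFC :: "'a set \<Rightarrow> ('a \<Rightarrow> 'a \<Rightarrow> bool) \<Rightarrow> bool" where
  "ZFC A E \<longleftrightarrow>
     extensional_model A E \<and>
     (\<forall>x\<in>A. elts A E x \<noteq> {} \<longrightarrow> (\<exists>y\<in>elts A E x. elts A E y \<inter> elts A E x = {})) \<and>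
     (\<forall>x\<in>A. \<forall>y\<in>A. \<exists>z\<in>A. elts A E z = {x, y}) \<and>
     (\<forall>x\<in>A. \<exists>u\<in>A. elts A E u = (\<Union>y\<in>elts A E x. elts A E y)) \<and>
     (\<forall>x\<in>A. \<exists>p\<in>A. elts A E p = {y \<in> A. elts A E y \<subseteq> elts A E x}) \<and>
     (\<exists>w\<in>A. (\<exists>e\<in>elts A E w. elts A E e = {}) \<and>
        (\<forall>x\<in>elts A E w. \<exists>s\<in>elts A E w. elts A E s = insert x (elts A E x))) \<and>
     (\<forall>X. definable A E X \<longrightarrow> (\<forall>x\<in>A. \<exists>y\<in>A. elts A E y = elts A E x \<inter> X)) \<and>
     (\<forall>R. definable_rel A E R \<longrightarrow>
        (\<forall>x\<in>A. (\<forall>a\<in>elts A E x. \<exists>!b. (a, b) \<in> R) \<longrightarrow>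
           (\<exists>y\<in>A. \<forall>a\<in>elts A E x. \<exists>b\<in>elts A E y. (a, b) \<in> R))) \<and>
     (\<forall>x\<in>A. (\<forall>y\<in>elts A E x. elts A E y \<noteq> {}) \<and>
        (\<forall>y\<in>elts A E x. \<forall>z\<in>elts A E x. y \<noteq> z \<longrightarrow> elts A E y \<inter> elts A E z = {}) \<longrightarrow>
        (\<exists>c\<in>A. \<forall>y\<in>elts A E x. \<exists>!z. z \<in> elts A E c \<inter> elts A E y))"

definition mem_rel :: "'a set \<Rightarrow> ('a \<Rightarrow> 'a \<Rightarrow> bool) \<Rightarrow> ('a \<times> 'a) set" where
  "mem_rel A E = {(y, x). x \<in> A \<and> y \<in> elts A E x}"

text \<open>
  By Mostowski's theorem the countable well-founded models of ZFC are, up to isomorphism,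
  the countable transitive ones.
\<close>

definition countable_transitive_model :: "'a set \<Rightarrow> ('a \<Rightarrow> 'a \<Rightarrow> bool) \<Rightarrow> bool" where
  "countable_transitive_model A E \<longleftrightarrow> countable A \<and> wf (mem_rel A E) \<and> ZFC A E"

definition ordinal :: "'a set \<Rightarrow> ('a \<Rightarrow> 'a \<Rightarrow> bool) \<Rightarrow> 'a \<Rightarrow> bool" where
  "ordinal A E x \<longleftrightarrow> x \<in> A \<and>
     (\<forall>y\<in>elts A E x. elts A E y \<subseteq> elts A E x) \<and>
     (\<forall>y\<in>elts A E x. \<forall>z\<in>elts A E y. elts A E z \<subseteq> elts A E y)"

definition inner_model :: "'a set \<Rightarrow> ('a \<Rightarrow> 'a \<Rightarrow> bool) \<Rightarrow> 'a set \<Rightarrow> bool" where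
  "inner_model A E W \<longleftrightarrow> W \<subseteq> A \<and> definable A E W \<and>
     (\<forall>x\<in>W. elts A E x \<subseteq> W) \<and> {\<alpha>. ordinal A E \<alpha>} \<subseteq> W \<and> ZFC W E"

section \<open>The constructible universe of a well-founded model\<close>

definition Def_pow :: "'a set \<Rightarrow> ('a \<Rightarrow> 'a \<Rightarrow> bool) \<Rightarrow> 'a set \<Rightarrow> 'a set" where
  "Def_pow A E X = {x \<in> A. definable X E (elts A E x)}"

definition Lset :: "'a set \<Rightarrow> ('a \<Rightarrow> 'a \<Rightarrow> bool) \<Rightarrow> 'a \<Rightarrow> 'a set" where
  "Lset A E = wfrec (mem_rel A E) (\<lambda>f \<alpha>. \<Union>\<beta>\<in>elts A E \<alpha>. Def_pow A E (f \<beta>))"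

lemma Lset_unfold:
  assumes "wf (mem_rel A E)" and "\<alpha> \<in> A"
  shows "Lset A E \<alpha> = (\<Union>\<beta>\<in>elts A E \<alpha>. Def_pow A E (Lset A E \<beta>))"
  using assms unfolding Lset_def
  by (subst wfrec) (auto simp: mem_rel_def cut_def)

definition L :: "'a set \<Rightarrow> ('a \<Rightarrow> 'a \<Rightarrow> bool) \<Rightarrow> 'a set" where
  "L A E = (\<Union>\<alpha>\<in>{\<alpha>. ordinal A E \<alpha>}. Lset A E \<alpha>)"

section \<open>Forcing\<close>

text \<open>The pair \<open>(p, q) \<in> r\<close> means that \<open>p\<close> is stronger than or equal to \<open>q\<close>.\<close>

definition forcing_poset :: "'a set \<Rightarrow> ('a \<times> 'a) set \<Rightarrow> bool" where
  "forcing_poset P r \<longleftrightarrow> partial_order_on P r \<and> (\<exists>t\<in>P. \<forall>p\<in>P. (p, t) \<in> r)"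

definition dense_in :: "'a set \<Rightarrow> ('a \<times> 'a) set \<Rightarrow> 'a set \<Rightarrow> bool" where
  "dense_in P r D \<longleftrightarrow> D \<subseteq> P \<and> (\<forall>p\<in>P. \<exists>d\<in>D. (d, p) \<in> r)"

definition compatible :: "'a set \<Rightarrow> ('a \<times> 'a) set \<Rightarrow> 'a \<Rightarrow> 'a \<Rightarrow> bool" where
  "compatible P r p q \<longleftrightarrow> (\<exists>s\<in>P. (s, p) \<in> r \<and> (s, q) \<in> r)"

definition nontrivial_poset :: "'a set \<Rightarrow> ('a \<times> 'a) set \<Rightarrow> bool" where
  "nontrivial_poset P r \<longleftrightarrow>
     (\<forall>p\<in>P. \<exists>q\<in>P. \<exists>q'\<in>P. (q, p) \<in> r \<and> (q', p) \<in> r \<and> \<not> compatible P r q q')"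

definition filter_on :: "'a set \<Rightarrow> ('a \<times> 'a) set \<Rightarrow> 'a set \<Rightarrow> bool" where
  "filter_on P r G \<longleftrightarrow> G \<subseteq> P \<and> G \<noteq> {} \<and>
     (\<forall>p\<in>G. \<forall>q\<in>P. (p, q) \<in> r \<longrightarrow> q \<in> G) \<and>
     (\<forall>p\<in>G. \<forall>q\<in>G. \<exists>s\<in>G. (s, p) \<in> r \<and> (s, q) \<in> r)"

definition set_forcing :: "'a set \<Rightarrow> ('a \<Rightarrow> 'a \<Rightarrow> bool) \<Rightarrow> 'a set \<Rightarrow> ('a \<times> 'a) set \<Rightarrow> bool" where
  "set_forcing W E P r \<longleftrightarrow> forcing_poset P r \<and>
     (\<exists>c\<in>W. P = elts W E c) \<and>
     (\<exists>d\<in>W. r = {(p, q). \<exists>z\<in>elts W E d. is_opair W E z p q})"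

definition set_generic ::
  "'a set \<Rightarrow> ('a \<Rightarrow> 'a \<Rightarrow> bool) \<Rightarrow> 'a set \<Rightarrow> ('a \<times> 'a) set \<Rightarrow> 'a set \<Rightarrow> bool" where
  "set_generic W E P r G \<longleftrightarrow> filter_on P r G \<and>
     (\<forall>d\<in>W. dense_in P r (elts W E d) \<longrightarrow> G \<inter> elts W E d \<noteq> {})"

definition class_forcing :: "'a set \<Rightarrow> ('a \<Rightarrow> 'a \<Rightarrow> bool) \<Rightarrow> 'a set \<Rightarrow> ('a \<times> 'a) set \<Rightarrow> bool" where
  "class_forcing A E P r \<longleftrightarrow> forcing_poset P r \<and> definable A E P \<and> definable_rel A E r \<and>
     \<not> (\<exists>c\<in>A. P = elts A E c)"

definition class_generic ::
  "'a set \<Rightarrow> ('a \<Rightarrow> 'a \<Rightarrow> bool) \<Rightarrow> 'a set \<Rightarrow> ('a \<times> 'a) set \<Rightarrow> 'a set \<Rightarrow> bool" where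
  "class_generic A E P r G \<longleftrightarrow> filter_on P r G \<and>
     (\<forall>D. definable A E D \<and> dense_in P r D \<longrightarrow> G \<inter> D \<noteq> {})"

inductive_set names :: "'a set \<Rightarrow> ('a \<Rightarrow> 'a \<Rightarrow> bool) \<Rightarrow> 'a set \<Rightarrow> 'a set"
  for A :: "'a set" and E :: "'a \<Rightarrow> 'a \<Rightarrow> bool" and P :: "'a set" where
  "\<tau> \<in> A \<Longrightarrow> \<forall>z\<in>elts A E \<tau>. \<exists>\<sigma> p. \<sigma> \<in> names A E P \<and> p \<in> P \<and> is_opair A E z \<sigma> p
     \<Longrightarrow> \<tau> \<in> names A E P"

text \<open>
  \<open>(B, F)\<close> is the extension \<open>A[G]\<close>: its elements are exactly the values of the \<open>P\<close>-names in \<open>A\<close>,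
  evaluated by the usual recursion. For well-founded \<open>A\<close> this determines \<open>(B, F)\<close> up to
  isomorphism. If \<open>A\<close> is a transitive subclass of \<open>B\<close> and \<open>F = E\<close> is well-founded on \<open>B\<close>,
  the function \<open>val\<close> is uniquely determined and maps the canonical name of each element
  of \<open>A\<close> to that element, so the definition literally says \<open>B = A[G]\<close>.
\<close>

definition forcing_extension ::
  "'a set \<Rightarrow> ('a \<Rightarrow> 'a \<Rightarrow> bool) \<Rightarrow> 'a set \<Rightarrow> 'a set \<Rightarrow> 'b set \<Rightarrow> ('b \<Rightarrow> 'b \<Rightarrow> bool) \<Rightarrow> bool" where
  "forcing_extension A E P G B F \<longleftrightarrow> extensional_model B F \<and>
     (\<exists>val. val ` names A E P = B \<and>
        (\<forall>\<tau>\<in>names A E P. elts B F (val \<tau>) =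
           {val \<sigma> | \<sigma> p. \<sigma> \<in> names A E P \<and> p \<in> G \<and> (\<exists>z\<in>elts A E \<tau>. is_opair A E z \<sigma> p)}))"

section \<open>The Ground Axiom and the Bedrock Axiom\<close>

definition GA :: "'a set \<Rightarrow> ('a \<Rightarrow> 'a \<Rightarrow> bool) \<Rightarrow> bool" where
  "GA A E \<longleftrightarrow> \<not> (\<exists>W P r G. inner_model A E W \<and> set_forcing W E P r \<and> nontrivial_poset P r \<and>
     set_generic W E P r G \<and> forcing_extension W E P G A E)"

definition BA :: "'a set \<Rightarrow> ('a \<Rightarrow> 'a \<Rightarrow> bool) \<Rightarrow> bool" where
  "BA A E \<longleftrightarrow> (\<exists>W P r G. inner_model A E W \<and> set_forcing W E P r \<and>
     set_generic W E P r G \<and> forcing_extension W E P G A E \<and> GA W E)"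

end

theory Submission
  imports Defs "HOL-Library.Countable_Set_Type" "HOL-Library.Multiset"
begin

text \<open>
  After collapsing, \<open>M\<close> is a transitive set \<open>A\<close> of hereditarily countable sets and \<open>L\<close> is its
  constructible part \<open>K\<close>. The conditions are the partial functions \<open>p\<close> from \<open>K\<close> to \<open>2\<close> such that, for
  every limit ordinal \<open>b\<close>, the part of \<open>p\<close> below the next limit is an image of \<open>V_(b+1)\<close>; this is an
  Easton-support product adding new subsets at unboundedly many levels. Splitting conditions at \<open>b\<close>
  into a small lower and a closed upper part yields the forcing theorem and ZFC in \<open>N = K[G]\<close>.

  Let \<open>M a\<close> be the extension of \<open>K\<close> by the part of \<open>G\<close> above \<open>a\<close>; these models strictly decrease,
  and \<open>N\<close> is a set forcing extension of each. If \<open>W\<close> is a ground of \<open>N\<close> by a forcing of size below \<open>a\<close>,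
  the approximation and covering properties give \<open>M a \<subseteq> W\<close>, and \<open>M a\<close> is definable in \<open>W\<close> from
  the small subsets that lie in \<open>K\<close>. For \<open>b\<close> the next limit after \<open>a\<close>, \<open>W\<close> therefore lies strictly
  between \<open>M b\<close> and the set forcing extension \<open>N\<close> of \<open>M b\<close>. By the intermediate model theorem \<open>W\<close> is
  itself a set forcing extension of \<open>M b\<close>, nontrivial because \<open>W \<noteq> M b\<close>, so \<open>W\<close> violates GA.
\<close>

section \<open>Hereditarily countable sets\<close>

datatype hset = Hc (celts: "hset cset")

definition el :: "hset => hset set" where "el x = rcset (celts x)"
definition mk :: "hset set => hset" where "mk X = Hc (acset X)"
abbreviation mem :: "hset => hset => bool" where "mem y x \<equiv> y : el x"

lemma countable_el[simp, intro]: "countable (el x)"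
  unfolding el_def by (transfer) simp

lemma el_mk[simp]: "countable X ==> el (mk X) = X"
  unfolding el_def mk_def by (simp add: acset_inverse)

lemma el_Collect[simp]: "el (mk {y : el x. Q y}) = {y : el x. Q y}"
  by (rule el_mk) (rule countable_subset[OF _ countable_el[of x]], auto)

lemma mk_el[simp]: "mk (el x) = x"
  unfolding el_def mk_def by (simp add: rcset_inverse)

lemma ext_el: "el x = el y ==> x = y"
  by (metis mk_el)

lemma el_induct[case_names step]:
  assumes "!!x. (!!y. y : el x ==> Q y) ==> Q x"
  shows "Q x"
proof (induction x)
  case (Hc c)
  then show ?case using assms[of "Hc c"] unfolding el_def
    by (simp add: cset.set_map cin.rep_eq)
qed

lemma wf_mem: "wf {(y, x). y : el x}"
  unfolding wf_def by (auto intro: el_induct)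

lemma mem_not_refl[simp]: "x ~: el x"
  using wf_mem by (metis (no_types, lifting) case_prodI mem_Collect_eq wf_not_refl)

lemma mem_asym: "x : el y ==> y ~: el x"
  using wf_asym[OF wf_mem] by auto

definition TC :: "hset => hset set" where "TC x = {y. mem\<^sup>+\<^sup>+ y x}"
definition tc :: "hset => hset" where "tc x = mk (TC x)"

lemma TC_unfold: "TC x = el x Un (UN y:el x. TC y)"
  unfolding TC_def
  by (auto intro: tranclp.trancl_into_trancl) (metis (mono_tags) tranclp.cases)

lemma countable_TC[simp]: "countable (TC x)"
proof (induction x rule: el_induct)
  case (step x)
  then show ?case by (subst TC_unfold) auto
qed

lemma el_tc[simp]: "el (tc x) = TC x"
  by (simp add: tc_def)

lemma TC_el: "y : el x ==> y : TC x" by (subst TC_unfold) auto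
lemma TC_trans: "y : TC x ==> z : TC y ==> z : TC x"
  unfolding TC_def by auto
lemma TC_el_trans: "y : TC x ==> z : el y ==> z : TC x"
  using TC_trans TC_el by blast

lemma wf_TC: "wf {(y, x). y : TC x}"
proof -
  have "{(y, x). y : TC x} = {(y, x). y : el x}\<^sup>+"
    unfolding TC_def by (auto simp: trancl_def)
  then show ?thesis using wf_trancl[OF wf_mem] by simp
qed

lemma TC_induct[case_names step]:
  assumes "!!x. (!!y. y : TC x ==> Q y) ==> Q x"
  shows "Q x"
  using wf_TC assms by (rule wf_induct_rule) auto

lemma TC_not_refl[simp]: "x ~: TC x"
  using wf_TC by (metis (no_types, lifting) case_prodI mem_Collect_eq wf_not_refl)

definition zero :: hset where "zero = mk {}"
definition upair where "upair x y = mk {x, y}"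
definition pair where "pair x y = upair (upair x x) (upair x y)"
definition succ where "succ x = mk (insert x (el x))"
definition Uni where "Uni x = mk (\<Union>(el ` el x))"
definition one where "one = succ zero"

lemma el_zero[simp]: "el zero = {}" by (simp add: zero_def)
lemma el_upair[simp]: "el (upair x y) = {x, y}" by (simp add: upair_def)
lemma el_succ[simp]: "el (succ x) = insert x (el x)" by (simp add: succ_def)
lemma el_Uni[simp]: "el (Uni x) = \<Union>(el ` el x)" by (simp add: Uni_def)
lemma el_one[simp]: "el one = {zero}" by (simp add: one_def)
lemma one_neq_zero[simp]: "one ~= zero" "zero ~= one"
  by (metis el_one el_zero insert_not_empty)+

lemma upair_eq: "upair x y = upair a b \<longleftrightarrow> (x = a \<and> y = b) \<or> (x = b \<and> y = a)"
proof
  assume "upair x y = upair a b"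
  then have "el (upair x y) = el (upair a b)" by simp
  then show "(x = a \<and> y = b) \<or> (x = b \<and> y = a)" by (simp add: doubleton_eq_iff)
qed (auto simp: upair_def insert_commute)

lemma pair_inject[simp]: "pair x y = pair a b \<longleftrightarrow> x = a \<and> y = b"
  unfolding pair_def by (auto simp: upair_eq)

lemma pair_TC: "x : TC (pair x y)" "y : TC (pair x y)"
  unfolding pair_def by (auto simp: TC_unfold[of "upair _ _"])

lemma pair_el_TC: assumes "pair x y : el z" shows "x : TC z" "y : TC z"
  using assms pair_TC TC_trans TC_el by blast+

definition lam :: "hset => (hset => hset) => hset" where
  "lam x f = mk ((%y. pair y (f y)) ` el x)"
definition app :: "hset => hset => hset" where
  "app g x = mk {z : TC g. EX y. pair x y : el g \<and> z : el y}"

lemma el_lam[simp]: "el (lam x f) = (%y. pair y (f y)) ` el x"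
  by (simp add: lam_def)

lemma el_app: "el (app g x) = {z. EX y. pair x y : el g \<and> z : el y}"
proof -
  have "countable {z : TC g. EX y. pair x y : el g \<and> z : el y}"
    by (rule countable_subset[OF _ countable_TC[of g]]) auto
  moreover have "z : TC g" if "pair x y : el g" "z : el y" for y z
    using pair_el_TC(2)[OF that(1)] that(2) by (rule TC_el_trans)
  ultimately show ?thesis unfolding app_def by auto
qed

lemma app_unique: "pair x y : el g ==> (!!z. pair x z : el g ==> z = y) ==> app g x = y"
  by (rule ext_el, unfold el_app) blast

lemma app_lam[simp]: "y : el x ==> app (lam x f) y = f y"
  by (rule app_unique) auto

lemma lam_cong: "(!!y. y : el x ==> f y = g y) ==> lam x f = lam x g"
  by (rule ext_el) (auto intro!: image_cong)

text \<open>In \<open>dpred\<close> and \<open>dterm\<close>, the even variables of the defining formula read the environment and the odd ones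
  the parameters.\<close>

definition merge :: "(nat => hset) => (nat => hset) => nat => hset" where
  "merge e w k = (if even k then e (k div 2) else w (k div 2))"

definition dpred :: "hset set => ((nat => hset) => bool) => bool" where
  "dpred A \<Phi> \<longleftrightarrow> (EX \<phi> w. range w <= A \<and> (ALL e. range e <= A --> (\<Phi> e \<longleftrightarrow> sat A mem \<phi> (merge e w))))"

definition dterm :: "hset set => ((nat => hset) => hset) => bool" where
  "dterm A t \<longleftrightarrow> (ALL e. range e <= A --> t e : A) \<and> dpred A (%e. e 0 = t (%n. e (Suc n)))"

named_theorems dintro

primrec rename :: "(nat => nat) => fm => fm" where
  "rename f (Mem i j) = Mem (f i) (f j)"
| "rename f (Eq i j) = Eq (f i) (f j)"
| "rename f (Neg \<phi>) = Neg (rename f \<phi>)"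
| "rename f (Conj \<phi> \<psi>) = Conj (rename f \<phi>) (rename f \<psi>)"
| "rename f (Forall i \<phi>) = Forall (f i) (rename f \<phi>)"

lemma sat_rename: "inj f ==> sat A E (rename f \<phi>) v \<longleftrightarrow> sat A E \<phi> (v \<circ> f)"
proof (induction \<phi> arbitrary: v)
  case (Forall i \<phi>)
  have "v(f i := a) \<circ> f = (v \<circ> f)(i := a)" for a
    using Forall.prems by (auto simp: fun_eq_iff inj_eq)
  then show ?case unfolding rename.simps sat.simps Forall.IH[OF Forall.prems] by simp
qed auto

lemma sat_cong_fv: "(!!i. i : fv \<phi> ==> v i = w i) ==> sat A E \<phi> v \<longleftrightarrow> sat A E \<phi> w"
proof (induction \<phi> arbitrary: v w)
  case (Neg \<phi>) then show ?case by (metis fv.simps(3) sat.simps(3))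
next
  case (Conj \<phi> \<psi>) then show ?case by (metis UnCI fv.simps(4) sat.simps(4))
next
  case (Forall i \<phi>)
  have "sat A E \<phi> (v(i := a)) \<longleftrightarrow> sat A E \<phi> (w(i := a))" for a
    by (rule Forall.IH) (use Forall.prems in auto)
  then show ?case by simp
qed auto

lemma finite_fv[simp]: "finite (fv \<phi>)"
  by (induction \<phi>) auto

lemma inj_left_params: "inj (%k::nat. if even k then k else 2*(k - 1) + 1)"
  and inj_right_params: "inj (%k::nat. if even k then k else 2*(k - 1) + 3)"
  and inj_bind_var: "inj (%k::nat. if k = 0 then 1 else if even k then k - 2 else k + 2)"
  and inj_two_free_vars: "inj (%k::nat. if k < 2 then 2*k else 2*k + 1)"
  by (rule injI; simp split: if_splits; presburger)+

locale carrier =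
  fixes A :: "hset set"
  assumes nonempty: "A ~= {}"
begin

lemma dpred_cong: "dpred A \<Phi> ==> (!!e. range e <= A ==> \<Phi> e = \<Psi> e) ==> dpred A \<Psi>"
  unfolding dpred_def by auto

lemma dpred_neg[dintro]: "dpred A \<Phi> ==> dpred A (%e. \<not> \<Phi> e)"
  unfolding dpred_def by (metis sat.simps(3))

lemma dpredI: "range w <= A ==> (!!e. range e <= A ==> \<Phi> e \<longleftrightarrow> sat A mem \<phi> (merge e w)) ==> dpred A \<Phi>"
  unfolding dpred_def by blast

lemma dpred_conj[dintro]:
  assumes "dpred A \<Phi>" "dpred A \<Psi>" shows "dpred A (%e. \<Phi> e \<and> \<Psi> e)"
proof -
  obtain \<phi> w where \<phi>: "range w <= A" "!!e. range e <= A ==> \<Phi> e \<longleftrightarrow> sat A mem \<phi> (merge e w)"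
    using assms(1) unfolding dpred_def by metis
  obtain \<psi> u where \<psi>: "range u <= A" "!!e. range e <= A ==> \<Psi> e \<longleftrightarrow> sat A mem \<psi> (merge e u)"
    using assms(2) unfolding dpred_def by metis
  let ?f = "%k::nat. if even k then k else 2*(k - 1) + 1"
  let ?g = "%k::nat. if even k then k else 2*(k - 1) + 3"
  have m: "merge e (merge w u) \<circ> ?f = merge e w" "merge e (merge w u) \<circ> ?g = merge e u" for e
    by (auto simp: fun_eq_iff merge_def elim!: oddE)
  show ?thesis
  proof (rule dpredI)
    show "range (merge w u) <= A" using \<phi>(1) \<psi>(1) by (auto simp: merge_def)
    show "(\<Phi> e \<and> \<Psi> e) = sat A mem (Conj (rename ?f \<phi>) (rename ?g \<psi>)) (merge e (merge w u))" if "range e <= A" for e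
      using \<phi>(2) \<psi>(2) that by (simp only: sat.simps sat_rename[OF inj_left_params] sat_rename[OF inj_right_params] m)
  qed
qed

lemma dpred_ren:
  assumes "dpred A \<Phi>" "inj f" shows "dpred A (%e. \<Phi> (e \<circ> f))"
proof -
  obtain \<phi> w where \<phi>: "range w <= A" "!!e. range e <= A ==> \<Phi> e \<longleftrightarrow> sat A mem \<phi> (merge e w)"
    using assms(1) unfolding dpred_def by metis
  let ?f = "%k::nat. if even k then 2 * f (k div 2) else k"
  have inj: "inj ?f"
  proof (rule injI)
    fix x y assume "?f x = ?f y"
    then show "x = y" using injD[OF assms(2)]
      by (cases "even x"; cases "even y") (auto, metis dvd_mult_div_cancel)
  qed
  have m: "merge e w \<circ> ?f = merge (e \<circ> f) w" for e
    by (auto simp: fun_eq_iff merge_def)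
  show ?thesis
  proof (rule dpredI[OF \<phi>(1)])
    fix e :: "nat => hset" assume "range e <= A"
    then have "range (e \<circ> f) <= A" by auto
    then show "\<Phi> (e \<circ> f) = sat A mem (rename ?f \<phi>) (merge e w)" using \<phi>(2) by (simp only: sat_rename[OF inj] m)
  qed
qed

lemma dpred_all_upd:
  assumes "dpred A \<Phi>" shows "dpred A (%e. ALL x:A. \<Phi> (e(k := x)))"
proof -
  obtain \<phi> w where \<phi>: "range w <= A" "!!e. range e <= A ==> \<Phi> e \<longleftrightarrow> sat A mem \<phi> (merge e w)"
    using assms unfolding dpred_def by metis
  have m: "(merge e w)(2*k := x) = merge (e(k := x)) w" for e x
    by (auto simp: fun_eq_iff merge_def)
  show ?thesis
  proof (rule dpredI[OF \<phi>(1)])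
    fix e :: "nat => hset" assume e: "range e <= A"
    have "range (e(k := x)) <= A" if "x : A" for x using e that by (auto simp: image_subset_iff)
    then show "(ALL x:A. \<Phi> (e(k := x))) = sat A mem (Forall (2*k) \<phi>) (merge e w)" using \<phi>(2) by (simp add: m)
  qed
qed

lemma dpred_all[dintro]:
  assumes "dpred A (%e. \<Phi> (%n. e (Suc n)) (e 0))" shows "dpred A (%e. ALL x:A. \<Phi> e x)"
proof -
  obtain \<phi> w where \<phi>: "range w <= A" "!!e. range e <= A ==> \<Phi> (%n. e (Suc n)) (e 0) \<longleftrightarrow> sat A mem \<phi> (merge e w)"
    using assms unfolding dpred_def by metis
  let ?f = "%k::nat. if k = 0 then 1 else if even k then k - 2 else k + 2"
  let ?w = "%k. if k = 0 then w 0 else w (k - 1)"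
  have m: "(merge e ?w)(1 := x) \<circ> ?f = merge (%n. case n of 0 => x | Suc m => e m) w" for e x
    by (auto simp: fun_eq_iff merge_def split: nat.splits elim!: evenE oddE)
  show ?thesis
  proof (rule dpredI)
    show "range ?w <= A" using \<phi>(1) by auto
    fix e :: "nat => hset" assume e: "range e <= A"
    have "\<Phi> e x = sat A mem (rename ?f \<phi>) ((merge e ?w)(1 := x))" if "x : A" for x
    proof -
      have "range (%n. case n of 0 => x | Suc m => e m) <= A"
        using e that by (auto simp: image_subset_iff split: nat.splits)
      from \<phi>(2)[OF this] show ?thesis by (simp only: sat_rename[OF inj_bind_var] m) simp
    qed
    then show "(ALL x:A. \<Phi> e x) = sat A mem (Forall 1 (rename ?f \<phi>)) (merge e ?w)" by simp
  qed
qed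

lemma dpred_true: "dpred A (%_. True)"
  unfolding dpred_def by (rule exI[of _ "Eq 0 0"]) (use nonempty in auto)

lemma dpred_const[dintro]: "dpred A (%_. p)"
  using dpred_true dpred_neg[OF dpred_true] by (cases p) auto

lemma dpred_disj[dintro]:
  assumes "dpred A \<Phi>" "dpred A \<Psi>" shows "dpred A (%e. \<Phi> e \<or> \<Psi> e)"
proof -
  have "dpred A (%e. \<not> (\<not> \<Phi> e \<and> \<not> \<Psi> e))" by (intro dpred_neg dpred_conj assms)
  then show ?thesis by (rule dpred_cong) blast
qed
lemma dpred_imp[dintro]: "dpred A \<Phi> ==> dpred A \<Psi> ==> dpred A (%e. \<Phi> e --> \<Psi> e)"
  unfolding imp_conv_disj by (intro dpred_disj dpred_neg)
lemma dpred_iff[dintro]: "dpred A \<Phi> ==> dpred A \<Psi> ==> dpred A (%e. \<Phi> e \<longleftrightarrow> \<Psi> e)"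
  unfolding iff_conv_conj_imp by (intro dpred_conj dpred_imp)
lemma dpred_ex[dintro]:
  assumes "dpred A (%e. \<Phi> (%n. e (Suc n)) (e 0))" shows "dpred A (%e. EX x:A. \<Phi> e x)"
proof -
  have "dpred A (%e. \<not> (ALL x:A. \<not> \<Phi> e x))" by (intro dpred_neg dpred_all assms)
  then show ?thesis by (rule dpred_cong) blast
qed

lemma dpred_var_mem: "dpred A (%e. e i : el (e j))"
  unfolding dpred_def by (rule exI[of _ "Mem (2*i) (2*j)"]) (use nonempty in \<open>auto simp: merge_def\<close>)
lemma dpred_var_eq: "dpred A (%e. e i = e j)"
  unfolding dpred_def by (rule exI[of _ "Eq (2*i) (2*j)"]) (use nonempty in \<open>auto simp: merge_def\<close>)
lemma dpred_var_const: "a : A ==> dpred A (%e. e i = a)"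
  unfolding dpred_def
  by (rule exI[of _ "Eq (2*i) 1"], rule exI[of _ "%_. a"]) (auto simp: merge_def)

lemma dterm_var[dintro]: "dterm A (%e. e i)"
  unfolding dterm_def using dpred_var_eq by auto
lemma dterm_const[dintro]: "a : A ==> dterm A (%_. a)"
  unfolding dterm_def using dpred_var_const by auto

lemma dterm_in: "dterm A t ==> range e <= A ==> t e : A"
  unfolding dterm_def by auto
lemma dterm_constD: "dterm A (%_. a) ==> a : A"
  unfolding dterm_def using nonempty by auto

lemma dpred_sub:
  assumes "dterm A t" "dpred A (%e. \<Phi> (%n. e (Suc n)) (e 0))"
  shows "dpred A (%e. \<Phi> e (t e))"
proof -
  have "dpred A (%e. e 0 = t (%n. e (Suc n)))" using assms(1) by (simp add: dterm_def)
  from dpred_conj[OF this assms(2)]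
  have "dpred A (%e. EX x:A. x = t e \<and> \<Phi> e x)" by (intro dpred_ex)
  then show ?thesis by (rule dpred_cong) (use assms(1) in \<open>auto simp: dterm_def\<close>)
qed

lemma dterm_shift: "dterm A t ==> dterm A (%e. t (%n. e (Suc n)))"
proof -
  assume t: "dterm A t"
  let ?f = "%n. if n = 0 then 0 else Suc n"
  have "inj ?f" by (auto simp: inj_def)
  moreover have "dpred A (%e. e 0 = t (%n. e (Suc n)))" using t by (simp add: dterm_def)
  ultimately have "dpred A (%e. (e \<circ> ?f) 0 = t (%n. (e \<circ> ?f) (Suc n)))"
    by (rule dpred_ren[rotated])
  then show ?thesis using t by (auto simp: dterm_def image_subset_iff comp_def)
qed

lemma dpred_comp1: "dpred A (%e. Q (e 0)) ==> dterm A s ==> dpred A (%e. Q (s e))"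
  by (rule dpred_sub[where \<Phi>="%e x. Q x"])
lemma dpred_comp2: assumes "dpred A (%e. Q (e 0) (e 1))" "dterm A s" "dterm A t" shows "dpred A (%e. Q (s e) (t e))"
  by (rule dpred_sub[where \<Phi>="%e x. Q (s e) x" and t=t, OF assms(3)])
     (rule dpred_sub[where \<Phi>="%e x. Q x (e 0)", OF dterm_shift[OF assms(2)]], use assms(1) in simp)
lemma dpred_comp3: assumes "dpred A (%e. Q (e 0) (e 1) (e 2))" "dterm A s" "dterm A t" "dterm A u"
  shows "dpred A (%e. Q (s e) (t e) (u e))"
  by (rule dpred_sub[where \<Phi>="%e x. Q (s e) (t e) x" and t=u, OF assms(4)],
     rule dpred_sub[where \<Phi>="%e x. Q (s (%n. e (Suc n))) x (e 0)", OF dterm_shift[OF assms(3)]],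
     rule dpred_sub[where \<Phi>="%e x. Q x (e 0) (e (Suc 0))", OF dterm_shift[OF dterm_shift[OF assms(2)]]])
    (use assms(1) in \<open>simp add: numeral_2_eq_2\<close>)
lemma dpred_mem[dintro]: "dterm A s ==> dterm A t ==> dpred A (%e. s e : el (t e))"
  by (rule dpred_comp2[where Q="%x y. x : el y"]) (auto intro: dpred_var_mem)
lemma dpred_eq[dintro]: "dterm A s ==> dterm A t ==> dpred A (%e. s e = t e)"
  by (rule dpred_comp2[where Q="%x y. x = y"]) (auto intro: dpred_var_eq)

lemma dterm_sub:
  assumes "dterm A t" "dterm A (%e. f (%n. e (Suc n)) (e 0))"
  shows "dterm A (%e. f e (t e))"
proof -
  let ?f = "%n::nat. if n = 0 then 1 else if n = 1 then 0 else n"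
  have i: "inj ?f" by (auto simp: inj_def split: if_splits)
  have "dpred A (%e. e 0 = f (%n. e (Suc (Suc n))) (e 1))" using assms(2) by (simp add: dterm_def)
  from dpred_ren[OF this i] have "dpred A (%e. e 1 = f (%n. e (Suc (Suc n))) (e 0))"
    by (simp add: comp_def)
  then have "dpred A (%e. e 0 = f (%n. e (Suc n)) (t (%n. e (Suc n))))"
    by (intro dpred_sub[where \<Phi>="%e x. e 0 = f (%n. e (Suc n)) x", OF dterm_shift[OF assms(1)]]) simp
  moreover have "f e (t e) : A" if e: "range e <= A" for e
  proof -
    have "t e : A" using dterm_in[OF assms(1) e] .
    then have "range (%n. case n of 0 => t e | Suc m => e m) <= A"
      using e by (auto simp: image_subset_iff split: nat.splits)
    from dterm_in[OF assms(2) this] show ?thesis by simp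
  qed
  ultimately show ?thesis by (simp add: dterm_def)
qed

lemma dterm_comp1: "dterm A (%e. f (e 0)) ==> dterm A s ==> dterm A (%e. f (s e))"
  by (rule dterm_sub[where f="%e x. f x"])
lemma dterm_comp2: assumes "dterm A (%e. f (e 0) (e 1))" "dterm A s" "dterm A t" shows "dterm A (%e. f (s e) (t e))"
  by (rule dterm_sub[where f="%e x. f (s e) x" and t=t, OF assms(3)])
     (rule dterm_sub[where f="%e x. f x (e 0)", OF dterm_shift[OF assms(2)]], use assms(1) in simp)
lemma dterm_comp3: assumes "dterm A (%e. f (e 0) (e 1) (e 2))" "dterm A s" "dterm A t" "dterm A u"
  shows "dterm A (%e. f (s e) (t e) (u e))"
  by (rule dterm_sub[where f="%e x. f (s e) (t e) x" and t=u, OF assms(4)],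
     rule dterm_sub[where f="%e x. f (s (%n. e (Suc n))) x (e 0)", OF dterm_shift[OF assms(3)]],
     rule dterm_sub[where f="%e x. f x (e 0) (e (Suc 0))", OF dterm_shift[OF dterm_shift[OF assms(2)]]])
    (use assms(1) in \<open>simp add: numeral_2_eq_2\<close>)

lemma dterm_closed3: "dterm A (%e. f (e 0) (e 1) (e 2)) ==> x : A ==> y : A ==> z : A ==> f x y z : A"
  by (rule dterm_constD[OF dterm_comp3[OF _ dterm_const dterm_const dterm_const]])

lemma dpred_of_definable: assumes "definable A mem X" shows "dpred A (%e. e 0 : X)"
proof -
  obtain \<phi> v where v: "v ` (fv \<phi> - {0}) <= A" "X = {a : A. sat A mem \<phi> (v(0 := a))}"
    using assms unfolding definable_def by blast
  obtain a0 where "a0 : A" using nonempty by auto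
  let ?w = "%k. if v k : A then v k else a0"
  let ?f = "%k::nat. if k = 0 then 0 else 2*k+1"
  have inj: "inj ?f" by (auto simp: inj_def)
  show ?thesis
  proof (rule dpredI)
    show "range ?w <= A" using \<open>a0 : A\<close> by auto
    fix e :: "nat => hset" assume e: "range e <= A"
    have "sat A mem (rename ?f \<phi>) (merge e ?w) \<longleftrightarrow> sat A mem \<phi> (merge e ?w \<circ> ?f)" by (rule sat_rename[OF inj])
    also have "... \<longleftrightarrow> sat A mem \<phi> (v(0 := e 0))"
      by (rule sat_cong_fv) (use v(1) in \<open>auto simp: merge_def image_subset_iff\<close>)
    finally show "(e 0 : X) = sat A mem (rename ?f \<phi>) (merge e ?w)" using v(2) e by auto
  qed
qed

lemma definable_iff_dpred:
  assumes "X <= A" shows "definable A mem X \<longleftrightarrow> dpred A (%e. e 0 : X)"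
proof
  assume "dpred A (%e. e 0 : X)"
  then obtain \<phi> w where w: "range w <= A" "!!e. range e <= A ==> e 0 : X \<longleftrightarrow> sat A mem \<phi> (merge e w)"
    unfolding dpred_def by metis
  obtain a0 where a0: "a0 : A" using nonempty by auto
  have "(merge (%_. a0) w)(0 := a) = merge ((%_. a0)(0 := a)) w" for a
    by (auto simp: merge_def fun_eq_iff)
  moreover have "a : X \<longleftrightarrow> sat A mem \<phi> (merge ((%_. a0)(0 := a)) w)" if "a : A" for a
    using w(2)[of "(%_. a0)(0 := a)"] that a0 by (auto simp: image_subset_iff)
  ultimately have "X = {a : A. sat A mem \<phi> ((merge (%_. a0) w)(0 := a))}" using assms by auto
  moreover have "merge (%_. a0) w ` (fv \<phi> - {0}) <= A" using w(1) a0 by (auto simp: merge_def)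
  ultimately show "definable A mem X" unfolding definable_def by blast
qed (rule dpred_of_definable)

lemma dpred_of_definable_rel: assumes "definable_rel A mem R" shows "dpred A (%e. (e 0, e 1) : R)"
proof -
  obtain \<phi> v where v: "v ` (fv \<phi> - {0,1}) <= A" "R = {(a,b). a : A \<and> b : A \<and> sat A mem \<phi> (v(0 := a, 1 := b))}"
    using assms unfolding definable_rel_def by blast
  obtain a0 where "a0 : A" using nonempty by auto
  let ?w = "%k. if v k : A then v k else a0"
  let ?f = "%k::nat. if k < 2 then 2*k else 2*k+1"
  show ?thesis
  proof (rule dpredI)
    show "range ?w <= A" using \<open>a0 : A\<close> by auto
    fix e :: "nat => hset" assume e: "range e <= A"
    have "sat A mem (rename ?f \<phi>) (merge e ?w) \<longleftrightarrow> sat A mem \<phi> (merge e ?w \<circ> ?f)" by (rule sat_rename[OF inj_two_free_vars])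
    also have "... \<longleftrightarrow> sat A mem \<phi> (v(0 := e 0, 1 := e 1))"
      by (rule sat_cong_fv) (use v(1) in \<open>auto simp: merge_def image_subset_iff\<close>)
    finally show "((e 0, e 1) : R) = sat A mem (rename ?f \<phi>) (merge e ?w)" using v(2) e by auto
  qed
qed

lemma definable_rel_iff_dpred:
  assumes "R <= A \<times> A" shows "definable_rel A mem R \<longleftrightarrow> dpred A (%e. (e 0, e 1) : R)"
proof
  assume "dpred A (%e. (e 0, e 1) : R)"
  then obtain \<phi> w where w: "range w <= A" "!!e. range e <= A ==> (e 0, e 1) : R \<longleftrightarrow> sat A mem \<phi> (merge e w)"
    unfolding dpred_def by metis
  obtain a0 where a0: "a0 : A" using nonempty by auto
  let ?f = "%k::nat. if k = 2 then 1 else if k = 1 then 2 else k"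
  have inj: "inj ?f" by (auto simp: inj_def split: if_splits)
  let ?v = "merge (%_. a0) w \<circ> ?f"
  have "?v(0 := a, 1 := b) \<circ> ?f = merge ((%_. a0)(0 := a, 1 := b)) w" for a b
    by (auto simp: merge_def fun_eq_iff elim!: evenE oddE)
  moreover have "(a,b) : R \<longleftrightarrow> sat A mem \<phi> (merge ((%_. a0)(0 := a, 1 := b)) w)" if "a : A" "b : A" for a b
    using w(2)[of "(%_. a0)(0 := a, 1 := b)"] that a0 by (auto simp: image_subset_iff)
  ultimately have "R = {(a,b). a : A \<and> b : A \<and> sat A mem (rename ?f \<phi>) (?v(0 := a, 1 := b))}"
    using assms by (auto simp: sat_rename[OF inj])
  moreover have "?v ` (fv (rename ?f \<phi>) - {0,1}) <= A" using w(1) a0 by (auto simp: merge_def)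
  ultimately show "definable_rel A mem R" unfolding definable_rel_def by blast
qed (rule dpred_of_definable_rel)

end

section \<open>Transitive models, recursion and rank\<close>

definition recF :: "(hset => hset => hset) => hset => hset" where
  "recF H = wfrec {(y, x). y : TC x} (%f x. H x (lam (tc x) f))"

lemma recF: "recF H x = H x (lam (tc x) (recF H))"
proof -
  have "lam (tc x) (cut (recF H) {(y, x). y : TC x} x) = lam (tc x) (recF H)"
    by (rule lam_cong) (simp add: cut_def)
  then show ?thesis unfolding recF_def by (subst wfrec[OF wf_TC]) simp
qed

definition attempt where
  "attempt H x f \<longleftrightarrow> f = lam (tc x) (app f) \<and> (ALL z:el (tc x). app f z = H z (lam (tc z) (app f)))"

lemma attempt_recF: "attempt H x (lam (tc x) (recF H))"
  unfolding attempt_def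
proof (intro conjI ballI)
  show "lam (tc x) (recF H) = lam (tc x) (app (lam (tc x) (recF H)))"
    by (rule lam_cong) simp
  fix z assume z: "z : el (tc x)"
  have "lam (tc z) (app (lam (tc x) (recF H))) = lam (tc z) (recF H)"
    by (rule lam_cong) (use z TC_trans in auto)
  then show "app (lam (tc x) (recF H)) z = H z (lam (tc z) (app (lam (tc x) (recF H))))"
    using z recF[of H z] by simp
qed

lemma attempt_iff: "attempt H x f \<longleftrightarrow> f = lam (tc x) (recF H)"
proof
  assume f: "attempt H x f"
  have "z : TC x ==> app f z = recF H z" for z
  proof (induction z rule: TC_induct)
    case (step z)
    have "lam (tc z) (app f) = lam (tc z) (recF H)"
      by (rule lam_cong) (use step TC_trans in auto)
    then show ?case using f step(2) recF[of H z] unfolding attempt_def by simp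
  qed
  then have "lam (tc x) (app f) = lam (tc x) (recF H)" by (intro lam_cong) auto
  then show "f = lam (tc x) (recF H)" using f unfolding attempt_def by simp
qed (simp only: attempt_recF)

primrec vn :: "nat => hset" where "vn 0 = zero" | "vn (Suc n) = succ (vn n)"
definition omega where "omega = mk (range vn)"
lemma el_omega[simp]: "el omega = range vn" by (simp add: omega_def)

definition Ord where
  "Ord x \<longleftrightarrow> (ALL y:el x. el y <= el x) \<and> (ALL y:el x. ALL z:el y. el z <= el y)"

lemma Ord_in: "Ord x ==> y : el x ==> Ord y" unfolding Ord_def by blast
lemma Ord_trans: "Ord x ==> y : el x ==> z : el y ==> z : el x" unfolding Ord_def by blast
lemma Ord_zero[simp]: "Ord zero" by (simp add: Ord_def)
lemma Ord_succ[simp]: "Ord x ==> Ord (succ x)" unfolding Ord_def by auto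
lemma Ord_UN: assumes "countable S" "!!x. x : S ==> Ord x" shows "Ord (mk (\<Union>(el ` S)))"
proof -
  have "el (mk (\<Union>(el ` S))) = \<Union>(el ` S)" using assms(1) by simp
  moreover have "el y <= \<Union>(el ` S)" if "y : \<Union>(el ` S)" for y
    using that assms(2) Ord_trans by blast
  moreover have "el z <= el y" if "y : \<Union>(el ` S)" "z : el y" for y z
    using that assms(2) Ord_in[of _ y] unfolding Ord_def by blast
  ultimately show ?thesis unfolding Ord_def by simp
qed

lemma Ord_linear: "Ord x ==> Ord y ==> x : el y \<or> x = y \<or> y : el x"
proof (induction x arbitrary: y rule: el_induct)
  case (step x)
  note IHx = step
  show ?case using IHx(3)
  proof (induction y rule: el_induct)
    case (step y)
    show ?case
    proof (rule ccontr)
      assume c: "\<not> ?case"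
      have "z : el y" if z: "z : el x" for z
        using IHx(1)[OF z Ord_in[OF IHx(2) z] step.prems] c z Ord_trans[OF IHx(2) z] by blast
      moreover have "z : el x" if z: "z : el y" for z
        using step.IH[OF z Ord_in[OF step.prems z]] c z Ord_trans[OF step.prems z] by blast
      ultimately have "x = y" by (intro ext_el) blast
      then show False using c by simp
    qed
  qed
qed

lemma Ord_subset: "Ord x ==> Ord y ==> el x <= el y \<longleftrightarrow> x = y \<or> x : el y"
  using Ord_linear[of x y] Ord_trans mem_not_refl by blast

lemma Ord_least: "Q a ==> Ord a ==> EX b. Ord b \<and> Q b \<and> (ALL c:el b. \<not> Q c)"
proof (induction a rule: el_induct)
  case (step x) then show ?case using Ord_in by blast
qed

lemma Ord_succ_le: "Ord x ==> y : el x ==> succ y = x \<or> succ y : el x"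
proof -
  assume a: "Ord x" "y : el x"
  then have "el (succ y) <= el x" using Ord_trans[OF a] by auto
  then show ?thesis using Ord_subset[of "succ y" x] Ord_in[OF a] a(1) by simp
qed

lemma Ord_vn[simp]: "Ord (vn n)" by (induction n) auto
lemma Ord_omega[simp]: "Ord omega"
  unfolding Ord_def
proof (intro conjI ballI)
  show "el y <= el omega" if "y : el omega" for y
  proof -
    have "el (vn n) <= range vn" for n by (induction n) auto
    then show ?thesis using that by auto
  qed
  show "el z <= el y" if "y : el omega" "z : el y" for y z
    using that Ord_vn unfolding Ord_def by auto
qed

lemma vn_mem: "vn m : el (vn n) \<longleftrightarrow> m < n"
proof -
  have a: "m < n ==> vn m : el (vn n)" for m n by (induction n) (auto simp: less_Suc_eq)
  show ?thesis using a[of m n] a[of n m] mem_asym mem_not_refl by (metis linorder_neqE_nat)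
qed

lemma vn_inject[simp]: "vn m = vn n \<longleftrightarrow> m = n"
  by (metis vn_mem linorder_neqE_nat mem_not_refl)

definition rank_step where "rank_step x f = mk (UN y:el x. el (succ (app f y)))"
definition rank where "rank = recF rank_step"

lemma el_rank: "el (rank x) = (UN y:el x. insert (rank y) (el (rank y)))"
  unfolding rank_def by (subst recF) (simp add: rank_step_def TC_el)

lemma Ord_rank[simp]: "Ord (rank x)"
proof (induction x rule: el_induct)
  case (step x)
  have "rank x = mk (\<Union>(el ` (%y. succ (rank y)) ` el x))" by (rule ext_el) (simp add: el_rank[of x])
  moreover have "Ord (mk (\<Union>(el ` (%y. succ (rank y)) ` el x)))"
    using step by (intro Ord_UN) auto
  ultimately show ?case by simp
qed

lemma rank_mem: "y : el x ==> rank y : el (rank x)" by (subst el_rank) auto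

lemma rank_le: "Ord a ==> (!!y. y : el x ==> rank y : el a) ==> el (rank x) <= el a"
  by (subst el_rank) (auto intro: Ord_trans)

lemma rank_Ord: "Ord a ==> rank a = a"
proof (induction a rule: el_induct)
  case (step x)
  then have "rank y = y" if "y : el x" for y using that Ord_in by blast
  then show ?case using step(2) by (intro ext_el) (auto simp: el_rank[of x] intro: Ord_trans)
qed

lemma rank_TC: "y : TC x ==> rank y : el (rank x)"
  unfolding TC_def mem_Collect_eq
  by (induction rule: tranclp.induct) (auto intro: rank_mem Ord_trans[OF Ord_rank])

definition pr1 where "pr1 z = mk {a : TC z. EX x y. z = pair x y \<and> a : el x}"
definition pr2 where "pr2 z = mk {a : TC z. EX x y. z = pair x y \<and> a : el y}"
lemma pr1_pair[simp]: "pr1 (pair x y) = x" and sn_opr[simp]: "pr2 (pair x y) = y"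
proof -
  have c: "countable {a : TC z. Q a}" for z Q by (rule countable_subset[OF _ countable_TC[of z]]) auto
  show "pr1 (pair x y) = x" "pr2 (pair x y) = y"
    unfolding pr1_def pr2_def by (auto intro!: ext_el simp: el_mk[OF c] intro: TC_el_trans[OF pair_TC(1)] TC_el_trans[OF pair_TC(2)])
qed

lemma pr1_not_pair: "\<nexists>x y. z = pair x y ==> pr1 z = zero" "\<nexists>x y. z = pair x y ==> pr2 z = zero"
  unfolding pr1_def pr2_def zero_def by (rule arg_cong[of _ _ mk], blast)+

lemma (in carrier) dpred_fix:
  assumes "dpred A \<Phi>" "range e0 <= A" shows "dpred A (%e. \<Phi> (%k. if k < n then e k else e0 k))"
proof -
  obtain \<phi> w where a: "range w <= A"
    "!!e. range e <= A ==> \<Phi> e \<longleftrightarrow> sat A mem \<phi> (merge e w)"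
    using assms unfolding dpred_def by metis
  let ?f = "%k::nat. if even k \<and> k < 2*n then k else 2*k+1"
  have i: "inj ?f"
    by (rule injI) (auto split: if_splits)
  have m: "merge e (merge e0 w) \<circ> ?f = merge (%k. if k < n then e k else e0 k) w" for e
    by (auto simp: fun_eq_iff merge_def)
  show ?thesis unfolding dpred_def
  proof (intro exI conjI allI impI)
    show "range (merge e0 w) <= A" using a assms by (auto simp: merge_def)
    fix e :: "nat => hset" assume "range e <= A"
    then have "range (%k. if k < n then e k else e0 k) <= A" using assms by auto
    then show "\<Phi> (%k. if k < n then e k else e0 k) = sat A mem (rename ?f \<phi>) (merge e (merge e0 w))"
      using a by (simp only: sat_rename[OF i] m)
  qed
qed

lemma inj_skip1: "inj (%n::nat. if n = 0 then 0 else Suc n)"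
  by (rule injI) (auto split: if_splits)
lemma inj_swap01: "inj (%n::nat. if n = 0 then 1 else if n = 1 then 0 else n)"
  by (rule injI) (auto split: if_splits)

lemma (in carrier) dterm_ren:
  assumes "dterm A t" "inj f" shows "dterm A (%e. t (%n. e (f n)))"
proof -
  let ?f = "%n. case n of 0 => 0 | Suc m => Suc (f m)"
  have "inj ?f" by (rule injI) (auto split: nat.splits dest: injD[OF assms(2)])
  moreover have "dpred A (%e. e 0 = t (%n. e (Suc n)))" using assms(1) by (simp add: dterm_def)
  ultimately have "dpred A (%e. (e \<circ> ?f) 0 = t (%n. (e \<circ> ?f) (Suc n)))"
    by (rule dpred_ren[rotated])
  then show ?thesis using assms(1) by (auto simp: dterm_def image_subset_iff comp_def)
qed

locale zf = carrier A for A +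
  assumes Atrans: "x : A ==> y : el x ==> y : A"
    and cntA: "countable A"
    and upairA: "x : A ==> y : A ==> upair x y : A"
    and UniA: "x : A ==> Uni x : A"
    and powersetA: "x : A ==> mk {y : A. el y <= el x} : A"
    and omegaA: "omega : A"
    and sepA: "dpred A (%e. Q (e 0)) ==> x : A ==> mk {y : el x. Q y} : A"
    and replA: "dpred A (%e. R (e 0) (e 1)) ==> x : A ==> (!!a. a : el x ==> EX! b. b : A \<and> R a b) ==>
       EX y:A. ALL a:el x. EX b:el y. R a b"
begin

lemma countable_subset_A: "X <= A ==> countable X" using cntA countable_subset by blast

lemma el_mkA: "X <= A ==> el (mk X) = X" by (simp add: countable_subset_A)
lemma el_subA: "x : A ==> el x <= A" using Atrans by auto

lemma dterm_setI:
  assumes "!!e. range e <= A ==> t e : A" "dpred A (%e. e 0 : el (t (%n. e (Suc n))))" shows "dterm A t"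
proof -
  have "dpred A (%e. ALL z:A. z : el (e 0) \<longleftrightarrow> z : el (t (%n. e (Suc n))))"
  proof (intro dpred_all dpred_iff)
    show "dpred A (%e. e 0 : el (e (Suc 0)))" by (rule dpred_var_mem)
    show "dpred A (%e. e 0 : el (t (%n. e (Suc (Suc n)))))"
      using dpred_ren[OF assms(2) inj_skip1] by simp
  qed
  then have "dpred A (%e. e 0 = t (%n. e (Suc n)))"
  proof (rule dpred_cong)
    fix e :: "nat => hset" assume e: "range e <= A"
    then have "e 0 : A" "t (%n. e (Suc n)) : A" using assms(1)[of "%n. e (Suc n)"] by auto
    then show "(ALL z:A. (z : el (e 0)) = (z : el (t (%n. e (Suc n))))) = (e 0 = t (%n. e (Suc n)))"
      using Atrans by (auto intro!: ext_el)
  qed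
  then show ?thesis using assms(1) by (simp add: dterm_def)
qed

lemma dpred_ball[dintro]: "dterm A t ==> dpred A (%e. \<Phi> (%n. e (Suc n)) (e 0)) ==> dpred A (%e. ALL x:el (t e). \<Phi> e x)"
proof -
  assume a: "dterm A t" "dpred A (%e. \<Phi> (%n. e (Suc n)) (e 0))"
  have "dpred A (%e. ALL x:A. x : el (t e) --> \<Phi> e x)"
    by (intro dpred_all dpred_imp dpred_mem dterm_shift[OF a(1)] a(2) dterm_var)
  then show ?thesis by (rule dpred_cong) (use dterm_in[OF a(1)] Atrans in blast)
qed

lemma dpred_bex[dintro]: "dterm A t ==> dpred A (%e. \<Phi> (%n. e (Suc n)) (e 0)) ==> dpred A (%e. EX x:el (t e). \<Phi> e x)"
proof -
  assume a: "dterm A t" "dpred A (%e. \<Phi> (%n. e (Suc n)) (e 0))"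
  have "dpred A (%e. EX x:A. x : el (t e) \<and> \<Phi> e x)"
    by (intro dpred_ex dpred_conj dpred_mem dterm_shift[OF a(1)] a(2) dterm_var)
  then show ?thesis by (rule dpred_cong) (use dterm_in[OF a(1)] Atrans in blast)
qed

lemma dpred_sub_el[dintro]: assumes "dterm A s" "dterm A t" shows "dpred A (%e. el (s e) <= el (t e))"
  unfolding subset_iff Ball_def[symmetric] by (intro dpred_ball dpred_mem dterm_shift assms dterm_var)

lemma dpred_Suc_fix:
  assumes "dpred A (%e. \<Phi> (%n. e (Suc n)) (e 0))" "range e0 <= A" shows "dpred A (%e. \<Phi> e0 (e 0))"
proof -
  have "range (%n. case n of 0 => e0 0 | Suc n => e0 n) <= A"
    using assms(2) by (auto simp: image_subset_iff split: nat.splits)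
  from dpred_fix[OF assms(1) this, of 1] show ?thesis by simp
qed

lemma dterm_sep[dintro]: assumes "dterm A t" "dpred A (%e. \<Phi> (%n. e (Suc n)) (e 0))"
  shows "dterm A (%e. mk {x : el (t e). \<Phi> e x})"
proof (rule dterm_setI)
  fix e :: "nat => hset" assume e: "range e <= A"
  show "mk {x : el (t e). \<Phi> e x} : A"
    by (rule sepA[OF dpred_Suc_fix[OF assms(2) e] dterm_in[OF assms(1) e]])
next
  show "dpred A (%e. e 0 : el (mk {x : el (t (%n. e (Suc n))). \<Phi> (%n. e (Suc n)) x}))"
    using dpred_conj[OF dpred_mem[OF dterm_var dterm_shift[OF assms(1)], of 0] assms(2)] by simp
qed

lemma dterm_upair[dintro]: assumes "dterm A s" "dterm A t" shows "dterm A (%e. upair (s e) (t e))"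
proof (rule dterm_comp2[OF dterm_setI assms])
  show "dpred A (%e. e 0 : el (upair (e (Suc 0)) (e (Suc 1))))"
    by (simp, intro dintro)
qed (auto intro: upairA)

lemma dterm_pair[dintro]: "dterm A s ==> dterm A t ==> dterm A (%e. pair (s e) (t e))"
  unfolding pair_def by (intro dintro)

lemma pairA[simp]: "x : A ==> y : A ==> pair x y : A" unfolding pair_def by (intro upairA)
lemma pair_memD: assumes "pair x y : A" shows "x : A" "y : A"
proof -
  have "upair x y : A" using Atrans[OF assms, of "upair x y"] by (simp add: pair_def)
  then show "x : A" "y : A" using Atrans[of "upair x y"] by auto
qed
lemma pair_elA: assumes "z : A" "pair x y : el z" shows "x : A" "y : A"
  using pair_memD Atrans assms by blast+

lemma dterm_Uni[dintro]: assumes "dterm A t" shows "dterm A (%e. Uni (t e))"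
proof (rule dterm_comp1[OF dterm_setI assms])
  show "dpred A (%e. e 0 : el (Uni (e (Suc 0))))"
    by (simp, intro dintro)
qed (auto intro: UniA)

lemma repl_fun:
  assumes R: "dpred A (%e. R (e 0) (e 1))" and x: "x : A"
    and f: "!!a. a : el x ==> f a : A" "!!a b. a : el x ==> b : A ==> R a b \<longleftrightarrow> b = f a"
  shows "mk (f ` el x) : A" "lam x f : A"
proof -
  have g: "mk (f ` el x) : A" if R: "dpred A (%e. R (e 0) (e 1))"
    and f: "!!a. a : el x ==> f a : A" "!!a b. a : el x ==> b : A ==> R a b \<longleftrightarrow> b = f a" for R f
  proof -
    obtain y where y: "y : A" "ALL a:el x. EX b:el y. R a b" using replA[OF R x] f by metis
    have "f ` el x = {b : el y. EX a:el x. R a b}" using y f Atrans[OF y(1)] by blast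
    moreover have "mk {b : el y. EX a:el x. R a b} : A"
      by (rule sepA[OF _ y(1)], rule dpred_bex, rule dterm_const[OF x])
         (rule dpred_comp2[OF R dterm_var dterm_var])
    ultimately show ?thesis by simp
  qed
  show "mk (f ` el x) : A" by (rule g[OF R f])
  show "lam x f : A" unfolding lam_def
  proof (rule g)
    show "dpred A (%e. EX b:A. R (e 0) b \<and> e 1 = pair (e 0) b)"
      by (intro dintro dpred_comp2[OF R])
    show "pair a (f a) : A" if "a : el x" for a using that f x Atrans by auto
    show "(EX b:A. R a b \<and> c = pair a b) \<longleftrightarrow> c = pair a (f a)" if "a : el x" "c : A" for a c
      using f that by auto
  qed
qed

lemma dpred_Suc_fix2:
  assumes "dterm A (%e. f (%n. e (Suc n)) (e 0))" "range e0 <= A" shows "dpred A (%e. e 1 = f e0 (e 0))"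
proof -
  have "range (%n. case n of 0 => e0 0 | Suc 0 => e0 0 | Suc (Suc n) => e0 n) <= A"
    using assms(2) by (auto simp: image_subset_iff split: nat.splits)
  moreover have "dpred A (%e. e 0 = f (%n. e (Suc (Suc n))) (e 1))"
    using assms(1) by (simp add: dterm_def)
  ultimately have "dpred A (%e. e 0 = f e0 (e 1))"
    using dpred_fix[of _ _ 2] by fastforce
  from dpred_ren[OF this inj_swap01] show ?thesis by simp
qed

lemma dterm_image[dintro]: assumes "dterm A t" "dterm A (%e. f (%n. e (Suc n)) (e 0))"
  shows "dterm A (%e. mk ((%x. f e x) ` el (t e)))"
proof (rule dterm_setI)
  have fe: "f e a : A" if "range e <= A" "a : A" for e a
  proof -
    have "range (%n. case n of 0 => a | Suc m => e m) <= A"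
      using that by (auto simp: image_subset_iff split: nat.splits)
    from dterm_in[OF assms(2) this] show ?thesis by simp
  qed
  fix e :: "nat => hset" assume e: "range e <= A"
  show "mk ((%x. f e x) ` el (t e)) : A"
    by (rule repl_fun(1)[OF dpred_Suc_fix2[OF assms(2) e] dterm_in[OF assms(1) e]])
       (use fe e dterm_in[OF assms(1) e] Atrans in auto)
next
  have "dpred A (%e. EX x:el (t (%n. e (Suc n))). e 0 = f (%n. e (Suc n)) x)"
  proof (intro dintro dterm_shift assms)
    show "dterm A (%e. f (%n. e (Suc (Suc n))) (e 0))"
      using dterm_ren[OF assms(2) inj_skip1] by simp
  qed
  then show "dpred A (%e. e 0 : el (mk ((%x. f (%n. e (Suc n)) x) ` el (t (%n. e (Suc n))))))"
    by (simp add: image_iff)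
qed

lemma dterm_UN: assumes "dterm A t" "dterm A (%e. f (%n. e (Suc n)) (e 0))"
  shows "dterm A (%e. mk (UN x:el (t e). el (f e x)))"
proof -
  have "mk (UN x:el y. el (g x)) = Uni (mk (g ` el y))" for g y by (simp add: Uni_def)
  then show ?thesis using dterm_Uni[OF dterm_image[OF assms]] by simp
qed

lemma dterm_succ[dintro]: assumes "dterm A t" shows "dterm A (%e. succ (t e))"
proof -
  have "succ x = Uni (upair x (upair x x))" for x by (rule ext_el) auto
  then show ?thesis using assms by (simp, intro dintro)
qed

lemma zeroA[simp]: "zero : A"
proof -
  have "mk {y : el omega. False} : A" by (rule sepA[OF _ omegaA]) (rule dpred_const)
  then show ?thesis by (simp add: zero_def)
qed
lemma succA[simp]: "x : A ==> succ x : A"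
  by (rule dterm_constD[OF dterm_succ[OF dterm_const]])
lemma oneA[simp]: "one : A" by (simp add: one_def)
declare omegaA[simp] upairA[simp]

lemma dterm_lam[dintro]: assumes "dterm A t" "dterm A (%e. f (%n. e (Suc n)) (e 0))"
  shows "dterm A (%e. lam (t e) (%x. f e x))"
  unfolding lam_def by (intro dintro assms)

lemma dpred_pex[dintro]: assumes "dterm A t" "dpred A (%e. \<Phi> (%n. e (Suc (Suc n))) (e 1) (e 0))"
  shows "dpred A (%e. EX x y. pair x y : el (t e) \<and> \<Phi> e x y)"
proof -
  have "dpred A (%e. EX x:A. EX y:A. pair x y : el (t e) \<and> \<Phi> e x y)"
    by (intro dintro dterm_shift[OF dterm_shift[OF assms(1)]]) (use assms(2) in simp)
  then show ?thesis by (rule dpred_cong) (use pair_elA[OF dterm_in[OF assms(1)]] in blast)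
qed

lemma dpred_pall[dintro]: assumes "dterm A t" "dpred A (%e. \<Phi> (%n. e (Suc (Suc n))) (e 1) (e 0))"
  shows "dpred A (%e. ALL x y. pair x y : el (t e) --> \<Phi> e x y)"
proof -
  have "dpred A (%e. ALL x:A. ALL y:A. pair x y : el (t e) --> \<Phi> e x y)"
    by (intro dintro dterm_shift[OF dterm_shift[OF assms(1)]]) (use assms(2) in simp)
  then show ?thesis by (rule dpred_cong) (use pair_elA[OF dterm_in[OF assms(1)]] in blast)
qed

lemma dpred_pex1[dintro]: assumes "dterm A t" "dterm A s" "dpred A (%e. \<Phi> (%n. e (Suc n)) (e 0))"
  shows "dpred A (%e. EX y. pair (s e) y : el (t e) \<and> \<Phi> e y)"
proof -
  have "dpred A (%e. EX y:A. pair (s e) y : el (t e) \<and> \<Phi> e y)"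
    by (intro dintro dterm_shift[OF assms(1)] dterm_shift[OF assms(2)]) (use assms(3) in simp)
  then show ?thesis by (rule dpred_cong) (use pair_elA[OF dterm_in[OF assms(1)]] in blast)
qed

lemma dpred_peq[dintro]: assumes "dterm A t" "dpred A (%e. \<Phi> (%n. e (Suc (Suc n))) (e 1) (e 0))"
  shows "dpred A (%e. EX x y. t e = pair x y \<and> \<Phi> e x y)"
proof -
  have "dpred A (%e. EX x:A. EX y:A. t e = pair x y \<and> \<Phi> e x y)"
    by (intro dintro dterm_shift[OF dterm_shift[OF assms(1)]]) (use assms(2) in simp)
  then show ?thesis by (rule dpred_cong) (metis pair_memD dterm_in[OF assms(1)])
qed

lemma app_Uni: "app g x = mk {z : el (Uni (Uni (Uni g))). EX y. pair x y : el g \<and> z : el y}"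
proof (rule ext_el, unfold el_app el_Collect, rule Collect_cong)
  fix z
  have "z : el (Uni (Uni (Uni g)))" if "pair x y : el g" "z : el y" for y
  proof -
    have "upair x y : el (pair x y)" by (simp add: pair_def)
    then have "upair x y : el (Uni g)" using that(1) by (simp only: el_Uni) blast
    moreover have "y : el (upair x y)" by simp
    ultimately have "y : el (Uni (Uni g))" by (simp only: el_Uni[of "Uni g"]) blast
    then show ?thesis using that(2) by (simp only: el_Uni[of "Uni (Uni g)"]) blast
  qed
  then show "(EX y. pair x y : el g \<and> z : el y) =
     (z : el (Uni (Uni (Uni g))) \<and> (EX y. pair x y : el g \<and> z : el y))" by blast
qed

lemma dterm_app[dintro]: "dterm A s ==> dterm A t ==> dterm A (%e. app (s e) (t e))"
  by (rule dterm_comp2) (simp_all only: app_Uni, intro dintro)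

lemma pr1_Uni: "pr1 z = mk {a : el (Uni (Uni z)). EX x y. z = pair x y \<and> a : el x}"
  and pr2_Uni: "pr2 z = mk {a : el (Uni (Uni z)). EX x y. z = pair x y \<and> a : el y}"
proof -
  have U: "el (Uni (Uni (pair x y))) = el x Un el y" for x y by (auto simp: pair_def)
  have a: "{a : el (Uni (Uni (pair x y))). EX x' y'. pair x y = pair x' y' \<and> a : el x'} = el x"
    "{a : el (Uni (Uni (pair x y))). EX x' y'. pair x y = pair x' y' \<and> a : el y'} = el y" for x y
    unfolding U by (simp_all only: pair_inject) blast+
  have b: "pr1 z = mk {a : el (Uni (Uni z)). EX x y. z = pair x y \<and> a : el x} \<and>
    pr2 z = mk {a : el (Uni (Uni z)). EX x y. z = pair x y \<and> a : el y}"
  proof (cases "EX x y. z = pair x y")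
    case True
    then obtain x y where z: "z = pair x y" by blast
    show ?thesis unfolding z a by simp
  next
    case False
    then have "{a : el (Uni (Uni z)). EX x y. z = pair x y \<and> a : el x} = {}"
      "{a : el (Uni (Uni z)). EX x y. z = pair x y \<and> a : el y} = {}" by blast+
    then show ?thesis using pr1_not_pair[OF False] by (simp only: zero_def)
  qed
  from b show "pr1 z = mk {a : el (Uni (Uni z)). EX x y. z = pair x y \<and> a : el x}" ..
  from b show "pr2 z = mk {a : el (Uni (Uni z)). EX x y. z = pair x y \<and> a : el y}" ..
qed

lemma dterm_pr1[dintro]: "dterm A t ==> dterm A (%e. pr1 (t e))"
  by (rule dterm_comp1) (simp_all only: pr1_Uni, intro dintro)
lemma dterm_pr2[dintro]: "dterm A t ==> dterm A (%e. pr2 (t e))"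
  by (rule dterm_comp1) (simp_all only: pr2_Uni, intro dintro)

lemma dpred_Ord[dintro]: "dterm A t ==> dpred A (%e. Ord (t e))"
  by (rule dpred_comp1) (simp_all only: Ord_def, intro dintro)

abbreviation isTC where "isTC x t \<equiv> (ALL y:el t. el y <= el t) \<and> el x <= el t \<and>
  (ALL t':A. (ALL y:el t'. el y <= el t') \<and> el x <= el t' --> el t <= el t')"

lemma TC_least: assumes "ALL y:t. el y <= t" "el x <= t" shows "TC x <= t"
proof
  fix y assume "y : TC x"
  then have "mem\<^sup>+\<^sup>+ y x" by (simp add: TC_def)
  then show "y : t" using assms(2)
    by (induction rule: converse_tranclp_induct) (use assms(1) in blast)+
qed

lemma isTC: "tc x : A ==> isTC x t \<longleftrightarrow> t = tc x"
proof
  assume x: "tc x : A" and t: "isTC x t"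
  have "el t <= TC x" using t x TC_el TC_el_trans by (metis (no_types, lifting) el_tc subsetI)
  moreover have "TC x <= el t" using t by (intro TC_least) auto
  ultimately show "t = tc x" by (intro ext_el) simp
next
  assume "t = tc x"
  then show "isTC x t" using TC_el TC_el_trans TC_least by auto
qed

lemma dpred_isTC: "dpred A (%e. isTC (e 0) (e 1))"
  by (intro dintro)

lemma tcA: "x : A ==> tc x : A"
proof (induction x rule: el_induct)
  case (step x)
  then have i: "tc y : A" if "y : el x" for y using that Atrans by blast
  have "mk (tc ` el x) : A"
    by (rule repl_fun(1)[OF dpred_isTC step(2)]) (use i isTC in auto)
  then have "Uni (upair x (Uni (mk (tc ` el x)))) : A" using step by (intro UniA upairA)
  moreover have "Uni (upair x (Uni (mk (tc ` el x)))) = tc x"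
    by (rule ext_el) (auto simp: TC_unfold[of x])
  ultimately show ?case by simp
qed

lemma dterm_tc[dintro]: "dterm A t ==> dterm A (%e. tc (t e))"
proof (rule dterm_comp1[where f=tc], simp add: dterm_def, intro conjI allI impI)
  show "tc (e 0) : A" if "range e <= A" for e :: "nat => hset" using that by (auto intro: tcA)
  have "dpred A (%e. isTC (e 1) (e 0))" by (intro dintro)
  then show "dpred A (%e. e 0 = tc (e (Suc 0)))"
    by (rule dpred_cong) (simp add: isTC tcA image_subset_iff)
qed

lemma dpred_attempt:
  assumes H: "dterm A (%e. H (e 0) (e 1) (e 2))" and "dterm A s" "dterm A t" "dterm A u"
  shows "dpred A (%e. attempt (H (s e)) (t e) (u e))"
  by (rule dpred_comp3[OF _ assms(2-4)]) (unfold attempt_def, intro dintro dterm_comp3[OF H])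

lemma lam_recFA:
  assumes H: "dterm A (%e. H (e 0) (e 1) (e 2))" and p: "p : A"
  shows "x : A ==> lam (tc x) (recF (H p)) : A"
proof (induction x rule: TC_induct)
  case (step x)
  have TA: "TC x <= A" using el_subA[OF tcA[OF step(2)]] by simp
  have IH: "lam (tc y) (recF (H p)) : A" if "y : TC x" for y using step(1) that TA by blast
  show ?case
  proof (rule repl_fun(2)[where R="%y v. EX f:A. attempt (H p) y f \<and> v = H p y f"])
    show "dpred A (%e. EX f:A. attempt (H p) (e 0) f \<and> e 1 = H p (e 0) f)"
      by (intro dintro dpred_attempt[OF H] dterm_comp3[OF H] p)
    show "tc x : A" using step(2) by (rule tcA)
    show "recF (H p) y : A" if "y : el (tc x)" for y
      using that TA IH p by (subst recF) (auto intro!: dterm_closed3[OF H])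
    show "(EX f:A. attempt (H p) y f \<and> v = H p y f) = (v = recF (H p) y)" if "y : el (tc x)" for y v
      unfolding attempt_iff recF[of "H p" y] using IH[of y] that by auto
  qed
qed

theorem dterm_recF_vars:
  assumes H: "dterm A (%e. H (e 0) (e 1) (e 2))"
  shows "dterm A (%e. recF (H (e 0)) (e 1))"
proof -
  have "dpred A (%e. EX f:A. attempt (H (e 1)) (e 2) f \<and> e 0 = H (e 1) (e 2) f)"
    by (intro dintro dpred_attempt[OF H] dterm_comp3[OF H])
  then have "dpred A (%e. e 0 = recF (H (e 1)) (e 2))"
  proof (rule dpred_cong)
    fix e :: "nat => hset" assume "range e <= A"
    then have "lam (tc (e 2)) (recF (H (e 1))) : A" by (intro lam_recFA H) auto
    then show "(EX f:A. attempt (H (e 1)) (e 2) f \<and> e 0 = H (e 1) (e 2) f) = (e 0 = recF (H (e 1)) (e 2))"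
      unfolding attempt_iff recF[of "H (e 1)" "e 2"] by blast
  qed
  moreover have "recF (H p) x : A" if "p : A" "x : A" for p x
    using that lam_recFA[OF H that] by (subst recF) (auto intro!: dterm_closed3[OF H])
  ultimately show ?thesis by (auto simp: dterm_def numeral_2_eq_2 image_subset_iff)
qed

lemma dterm_recF: "dterm A (%e. H (e 0) (e 1) (e 2)) ==> dterm A s ==> dterm A t ==> dterm A (%e. recF (H (s e)) (t e))"
  by (rule dterm_comp2[OF dterm_recF_vars])

lemma dterm_rank[dintro]: "dterm A t ==> dterm A (%e. rank (t e))"
  unfolding rank_def
  by (rule dterm_recF[where H="%p. rank_step" and s=t]) (simp only: rank_step_def, intro dintro dterm_UN)

lemma rankA[simp]: "x : A ==> rank x : A"
  by (rule dterm_constD[OF dterm_rank[OF dterm_const]])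

definition Vset where "Vset a = mk {x : A. rank x : el a}"

lemma el_Vset[simp]: "el (Vset a) = {x : A. rank x : el a}" unfolding Vset_def by (rule el_mkA) auto

definition pow where "pow x = mk {y : A. el y <= el x}"
lemma el_pow[simp]: "el (pow x) = {y : A. el y <= el x}" unfolding pow_def by (rule el_mkA) auto
lemma dterm_pow[dintro]: "dterm A t ==> dterm A (%e. pow (t e))"
proof (rule dterm_comp1[where f=pow], rule dterm_setI)
  show "pow (e 0) : A" if "range e <= A" for e :: "nat => hset" using that powersetA by (auto simp: pow_def)
  have "dpred A (%e. el (e 0) <= el (e (Suc 0)))" by (intro dintro)
  then show "dpred A (%e. e 0 : el (pow (e (Suc 0))))" by (rule dpred_cong) auto
qed

lemma el_Vset_UN: assumes a: "Ord a" "a : A" shows "el (Vset a) = (UN b:el a. el (pow (Vset b)))"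
proof (intro set_eqI iffI)
  fix x assume "x : el (Vset a)"
  then show "x : (UN b:el a. el (pow (Vset b)))" using rank_mem[of _ x] Atrans[of x] by auto
next
  fix x assume "x : (UN b:el a. el (pow (Vset b)))"
  then obtain b where b: "b : el a" "x : A" "ALL y:el x. rank y : el b" by auto
  then have "Ord b" using Ord_in[OF a(1)] by blast
  moreover have "el (rank x) <= el b" using calculation b by (intro rank_le) auto
  ultimately have "rank x : el a" using Ord_subset[of "rank x" b] b Ord_trans[OF a(1)] by auto
  then show "x : el (Vset a)" using b by simp
qed

lemma VsetA: "Ord a ==> a : A ==> Vset a : A"
proof (induction a rule: el_induct)
  case (step a)
  have IH: "Vset b : A" if "b : el a" for b using step that Ord_in Atrans by blast
  have "mk (Vset ` el a) : A"
  proof (rule repl_fun(1)[where R="%b t. ALL x:A. x : el t \<longleftrightarrow> rank x : el b"])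
    show "dpred A (%e. ALL x:A. x : el (e 1) \<longleftrightarrow> rank x : el (e 0))" by (intro dintro)
    fix b t assume b: "b : el a" and t: "t : A"
    have "(ALL x:A. x : el t \<longleftrightarrow> rank x : el b) \<longleftrightarrow> el t = el (Vset b)"
      unfolding el_Vset using Atrans[OF t] by blast
    then show "(ALL x:A. x : el t \<longleftrightarrow> rank x : el b) \<longleftrightarrow> t = Vset b" using ext_el by blast
  qed (use IH step in blast)+
  then have "Uni (mk (pow ` el (mk (Vset ` el a)))) : A" by (intro dterm_constD) (intro dintro)
  moreover have "Uni (mk (pow ` el (mk (Vset ` el a)))) = Vset a"
    by (rule ext_el) (simp add: el_Vset_UN[OF step(2,3)] del: el_Vset el_pow)
  ultimately show ?case by simp
qed

lemma dpred_Vset: "dterm A s ==> dterm A t ==> dpred A (%e. s e : el (Vset (t e)))"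
proof -
  assume a: "dterm A s" "dterm A t"
  have "dpred A (%e. rank (s e) : el (t e))" by (intro dintro a)
  then show ?thesis by (rule dpred_cong) (use dterm_in[OF a(1)] in auto)
qed

lemma Ord_bound: "X : A ==> EX a:A. Ord a \<and> (ALL x:el X. rank x : el a)"
  by (rule bexI[of _ "rank X"]) (auto intro: rank_mem)

lemma collection:
  assumes \<Phi>: "dpred A (%e. \<Phi> (e 0) (e 1))" and X: "X : A" and ex: "!!x. x : el X ==> EX y:A. \<Phi> x y"
  shows "EX Y:A. ALL x:el X. EX y:el Y. \<Phi> x y"
proof -
  let ?Q = "%x a. Ord a \<and> (EX y:A. rank y = a \<and> \<Phi> x y)"
  let ?R = "%x a. ?Q x a \<and> (ALL b:el a. \<not> ?Q x b)"
  have d: "dpred A (%e. ?R (e 0) (e 1))" by (intro dintro dpred_comp2[OF \<Phi>])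
  have "EX! a. a : A \<and> ?R x a" if x: "x : el X" for x
  proof -
    obtain y where y: "y : A" "\<Phi> x y" using ex x by auto
    obtain a where a: "Ord a" "?Q x a" "ALL b:el a. \<not> ?Q x b"
      using Ord_least[of "?Q x" "rank y"] y by auto
    then have "a : A" by auto
    then show ?thesis using a Ord_linear by blast
  qed
  from replA[OF d X this] obtain Y where Y: "Y : A" "ALL x:el X. EX a:el Y. ?R x a" by blast
  obtain c where c: "c : A" "Ord c" "ALL a:el Y. rank a : el c" using Ord_bound[OF Y(1)] by auto
  have "EX y:el (Vset c). \<Phi> x y" if x: "x : el X" for x
  proof -
    obtain a y where "a : el Y" "y : A" "rank y = a" "\<Phi> x y" "Ord a" using Y x by blast
    then show ?thesis using c rank_Ord[of a] by (intro bexI[of _ y]) auto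
  qed
  then show ?thesis using VsetA[OF c(2,1)] by blast
qed

lemma Ord_UniA: "Y : A ==> (!!x. x : el Y ==> Ord x) ==> Ord (Uni Y)"
  unfolding Uni_def by (rule Ord_UN) auto

end

section \<open>The constructible hierarchy\<close>

definition prd where "prd x y = mk (UN a:el x. el (mk ((%b. pair a b) ` el y)))"
lemma el_prd: "el (prd x y) = {pair a b |a b. a : el x \<and> b : el y}"
  unfolding prd_def by auto

definition upd where "upd s i a = Uni (upair (mk {z : el s. pr1 z ~= i}) (upair (pair i a) (pair i a)))"
lemma el_upd: "el (upd s i a) = insert (pair i a) {z : el s. pr1 z ~= i}"
proof -
  have "countable {z : el s. pr1 z ~= i}" by (rule countable_subset[OF _ countable_el[of s]]) auto
  then show ?thesis unfolding upd_def by auto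
qed

definition asg :: "nat set => (nat => hset) => hset" where
  "asg F f = mk ((%i. pair (vn i) (f i)) ` F)"
definition asgs :: "hset => hset set" where
  "asgs X = {asg F f |F f. finite F \<and> f ` F <= el X}"
definition env :: "hset => nat => hset" where "env s i = app s (vn i)"

lemma el_asg: "el (asg F f) = (%i. pair (vn i) (f i)) ` F"
  unfolding asg_def by simp

lemma asg_upd: "upd (asg F f) (vn i) a = asg (insert i F) (f(i := a))"
  by (rule ext_el) (auto simp: el_upd el_asg)

lemma env_asg: "env (asg F f) i = (if i : F then f i else zero)"
proof (cases "i : F")
  case True
  then show ?thesis unfolding env_def by (simp, intro app_unique) (auto simp: el_asg)
next
  case False
  then have "el (app (asg F f) (vn i)) = {}" by (auto simp: el_app el_asg)
  then show ?thesis unfolding env_def using False by (intro ext_el) simp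
qed

lemma asgs_upd: "s : asgs X ==> a : el X ==> upd s (vn i) a : asgs X"
proof -
  assume s: "s : asgs X" and a: "a : el X"
  then obtain F f where "s = asg F f" "finite F" "f ` F <= el X" unfolding asgs_def by blast
  moreover have "(f(i := a)) ` insert i F <= el X" using calculation a by auto
  ultimately show ?thesis unfolding asgs_def using asg_upd by blast
qed

lemma env_upd: "env (upd s (vn i) a) = (env s)(i := a)"
proof
  fix j
  show "env (upd s (vn i) a) j = ((env s)(i := a)) j"
  proof (cases "j = i")
    case True
    then show ?thesis unfolding env_def by (simp, intro app_unique) (auto simp: el_upd)
  next
    case False
    then have "el (app (upd s (vn i) a) (vn j)) = el (app s (vn j))" by (auto simp: el_app el_upd)
    then show ?thesis unfolding env_def using False ext_el by auto
  qed
qed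

lemma env_asgs: "s : asgs X ==> env s i : insert zero (el X)"
  unfolding asgs_def by (auto simp: env_asg image_subset_iff)

primrec code :: "fm => hset" where
  "code (Mem i j) = pair (vn 0) (pair (vn i) (vn j))"
| "code (Eq i j) = pair (vn 1) (pair (vn i) (vn j))"
| "code (Neg \<phi>) = pair (vn 2) (code \<phi>)"
| "code (Conj \<phi> \<psi>) = pair (vn 3) (pair (code \<phi>) (code \<psi>))"
| "code (Forall i \<phi>) = pair (vn 4) (pair (vn i) (code \<phi>))"

definition Sat_step where "Sat_step p c f = mk {s : el (pr2 p).
   (EX i:el omega. EX j:el omega. c = pair (vn 0) (pair i j) \<and> app s i : el (app s j)) \<or>
   (EX i:el omega. EX j:el omega. c = pair (vn 1) (pair i j) \<and> app s i = app s j) \<or>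
   (EX d:el (tc c). c = pair (vn 2) d \<and> s ~: el (app f d)) \<or>
   (EX d:el (tc c). EX d':el (tc c). c = pair (vn 3) (pair d d') \<and> s : el (app f d) \<and> s : el (app f d')) \<or>
   (EX i:el omega. EX d:el (tc c). c = pair (vn 4) (pair i d) \<and> (ALL a:el (pr1 p). upd s i a : el (app f d)))}"
definition Sat where "Sat p = recF (Sat_step p)"

lemma el_Sat: "el (Sat p c) = {s : el (pr2 p).
   (EX i:el omega. EX j:el omega. c = pair (vn 0) (pair i j) \<and> app s i : el (app s j)) \<or>
   (EX i:el omega. EX j:el omega. c = pair (vn 1) (pair i j) \<and> app s i = app s j) \<or>
   (EX d. c = pair (vn 2) d \<and> s ~: el (Sat p d)) \<or>
   (EX d d'. c = pair (vn 3) (pair d d') \<and> s : el (Sat p d) \<and> s : el (Sat p d')) \<or>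
   (EX i:el omega. EX d. c = pair (vn 4) (pair i d) \<and> (ALL a:el (pr1 p). upd s i a : el (Sat p d)))}"
proof -
  have t: "d : TC (pair i d)" "d : TC (pair k (pair i d))" "i : TC (pair k (pair i d))" for i d k
    using pair_TC TC_trans by blast+
  show ?thesis unfolding Sat_def
    by (subst recF, unfold Sat_step_def el_Collect el_tc, rule Collect_cong, rule conj_cong[OF refl])
       (intro disj_cong refl bex_cong iffI; (elim bexE exE conjE, simp add: t; fail)?; 
        (elim bexE exE conjE, (rule exI bexI)+, use t in \<open>auto\<close>; fail)?)
qed

definition with_asgs where "with_asgs X = pair X (mk (asgs X))"

context
  fixes X assumes cF: "countable (asgs X)"
begin

lemma Sat_Mem: "el (Sat (with_asgs X) (pair (vn 0) (pair (vn i) (vn j)))) = {s : asgs X. sat (el X) mem (Mem i j) (env s)}"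
  by (subst el_Sat) (auto simp: with_asgs_def cF env_def simp del: vn.simps)
lemma Sat_Eq: "el (Sat (with_asgs X) (pair (vn 1) (pair (vn i) (vn j)))) = {s : asgs X. sat (el X) mem (Eq i j) (env s)}"
  by (subst el_Sat) (auto simp: with_asgs_def cF env_def simp del: vn.simps)
lemma Sat_Neg: assumes "el (Sat (with_asgs X) c) = {s : asgs X. sat (el X) mem \<phi> (env s)}"
  shows "el (Sat (with_asgs X) (pair (vn 2) c)) = {s : asgs X. sat (el X) mem (Neg \<phi>) (env s)}"
  by (subst el_Sat) (auto simp: assms simp del: vn.simps, auto simp: with_asgs_def cF simp del: vn.simps)
lemma Sat_Conj: assumes "el (Sat (with_asgs X) c) = {s : asgs X. sat (el X) mem \<phi> (env s)}"
   "el (Sat (with_asgs X) d) = {s : asgs X. sat (el X) mem \<psi> (env s)}"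
  shows "el (Sat (with_asgs X) (pair (vn 3) (pair c d))) = {s : asgs X. sat (el X) mem (Conj \<phi> \<psi>) (env s)}"
  by (subst el_Sat) (auto simp: assms simp del: vn.simps, auto simp: with_asgs_def cF simp del: vn.simps)
lemma Sat_Forall: assumes "el (Sat (with_asgs X) c) = {s : asgs X. sat (el X) mem \<phi> (env s)}"
  shows "el (Sat (with_asgs X) (pair (vn 4) (pair (vn i) c))) = {s : asgs X. sat (el X) mem (Forall i \<phi>) (env s)}"
proof -
  have "el (Sat (with_asgs X) (pair (vn 4) (pair (vn i) c))) =
    {s : asgs X. ALL a:el X. upd s (vn i) a : el (Sat (with_asgs X) c)}"
    by (subst el_Sat) (auto simp: with_asgs_def cF simp del: vn.simps)
  also have "... = {s : asgs X. sat (el X) mem (Forall i \<phi>) (env s)}"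
    unfolding assms by (rule Collect_cong) (auto simp: env_upd asgs_upd)
  finally show ?thesis .
qed

lemma Sat_code: "el (Sat (with_asgs X) (code \<phi>)) = {s : asgs X. sat (el X) mem \<phi> (env s)}"
  by (induction \<phi>) (simp_all only: code.simps Sat_Mem Sat_Eq Sat_Neg Sat_Conj Sat_Forall)

lemma Sat_cases:
  obtains (Mem) i j where "c = pair (vn 0) (pair (vn i) (vn j))"
    | (Eq) i j where "c = pair (vn 1) (pair (vn i) (vn j))"
    | (Neg) d where "c = pair (vn 2) d"
    | (Conj) d d' where "c = pair (vn 3) (pair d d')"
    | (Forall) i d where "c = pair (vn 4) (pair (vn i) d)"
    | (empty) "el (Sat (with_asgs X) c) = {}"
proof (cases "el (Sat (with_asgs X) c) = {}")
  case False
  then obtain s where "s : el (Sat (with_asgs X) c)" by blast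
  from this[unfolded el_Sat[of "with_asgs X" c] el_omega, THEN CollectD, THEN conjunct2] show ?thesis
    by (elim disjE bexE exE conjE rangeE) (use Mem Eq Neg Conj Forall in metis)+
qed

lemma Sat_any: "EX \<phi>. el (Sat (with_asgs X) c) = {s : asgs X. sat (el X) mem \<phi> (env s)}"
proof (induction c rule: TC_induct)
  case (step c)
  note TC = pair_TC TC_trans[OF pair_TC(2) pair_TC(1)] TC_trans[OF pair_TC(2) pair_TC(2)]
  show ?case
  proof (cases c rule: Sat_cases)
    case (Mem i j) then show ?thesis using Sat_Mem by blast
  next
    case (Eq i j) then show ?thesis using Sat_Eq by blast
  next
    case (Neg d)
    then obtain \<phi> where "el (Sat (with_asgs X) d) = {s : asgs X. sat (el X) mem \<phi> (env s)}" using step[of d] TC by blast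
    from Sat_Neg[OF this] show ?thesis using Neg by blast
  next
    case (Conj d d')
    then obtain \<phi> \<psi> where "el (Sat (with_asgs X) d) = {s : asgs X. sat (el X) mem \<phi> (env s)}"
      "el (Sat (with_asgs X) d') = {s : asgs X. sat (el X) mem \<psi> (env s)}" using step[of d] step[of d'] TC by blast
    from Sat_Conj[OF this] show ?thesis using Conj by blast
  next
    case (Forall i d)
    then obtain \<phi> where "el (Sat (with_asgs X) d) = {s : asgs X. sat (el X) mem \<phi> (env s)}" using step[of d] TC by blast
    from Sat_Forall[OF this] show ?thesis using Forall by blast
  next
    case empty
    then have "el (Sat (with_asgs X) c) = {s : asgs X. sat (el X) mem (Neg (Eq 0 0)) (env s)}" by simp
    then show ?thesis by blast
  qed
qed

end

definition defset where "defset X c s = mk {a : el X. upd s zero a : el (Sat (with_asgs X) c)}"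
definition Defpow where "Defpow X = mk {defset X c s |c s. s : asgs X}"

definition Lh_step where "Lh_step x f = mk (UN b:el x. el (Defpow (app f b)))"
definition Lh where "Lh = recF Lh_step"

lemma asgs_cong_sat:
  assumes "X ~= {} --> zero : X" "s : asgs Y" "X = el Y"
  shows "definable X mem {a : X. sat X mem \<phi> (env (upd s zero a))}"
proof (cases "X = {}")
  case True then show ?thesis unfolding definable_def by (intro exI[of _ "Eq 0 0"] exI) auto
next
  case False
  then have "env s i : X" for i using env_asgs[OF assms(2), of i] assms by auto
  then have "env s ` (fv \<phi> - {0}) <= X" by auto
  moreover have "env (upd s zero a) = (env s)(0 := a)" for a using env_upd[of s 0 a] by simp
  ultimately show ?thesis unfolding definable_def by (intro exI[of _ \<phi>] exI[of _ "env s"]) simp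
qed

context zf
begin

lemma dterm_cong: "dterm A t ==> (!!e. range e <= A ==> t e = u e) ==> dterm A u"
  unfolding dterm_def by (auto intro: dpred_cong simp: image_subset_iff)

lemma vnA[simp]: "vn n : A" by (induction n) auto

lemma dterm_prd[dintro]: "dterm A s ==> dterm A t ==> dterm A (%e. prd (s e) (t e))"
  by (rule dterm_comp2[where f=prd]) (simp_all only: prd_def, intro dintro dterm_UN)
lemma prdA[simp]: "x : A ==> y : A ==> prd x y : A"
  by (rule dterm_constD[OF dterm_prd[OF dterm_const dterm_const]])
lemma dterm_upd[dintro]: "dterm A s ==> dterm A t ==> dterm A u ==> dterm A (%e. upd (s e) (t e) (u e))"
  by (rule dterm_comp3[where f=upd]) (simp_all only: upd_def, intro dintro)
lemma updA[simp]: "s : A ==> i : A ==> a : A ==> upd s i a : A"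
  by (rule dterm_constD[OF dterm_upd[OF dterm_const dterm_const dterm_const]])

lemma asgA: "finite F ==> f ` F <= A ==> asg F f : A"
proof (induction F rule: finite_induct)
  case empty then show ?case by (simp add: asg_def zero_def[symmetric])
next
  case (insert i F)
  have "asg (insert i F) f = upd (asg F f) (vn i) (f i)" by (simp add: asg_upd)
  then show ?case using insert by simp
qed

lemma asgs_char: assumes "X : A"
  shows "asgs X = {s : el (pow (prd omega X)). (ALL i x. pair i x : el s --> (ALL j y. pair j y : el s --> i = j --> x = y)) \<and>
     (EX n:el omega. ALL i x. pair i x : el s --> i : el n)}" (is "_ = ?R")
proof (intro set_eqI iffI)
  fix s assume "s : asgs X"
  then obtain F f where s: "s = asg F f" "finite F" "f ` F <= el X" unfolding asgs_def by blast
  obtain n where n: "ALL i:F. i < n" using s(2) by (meson finite_nat_set_iff_bounded)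
  have "s : A" using s el_subA[OF assms] by (auto intro!: asgA)
  moreover have "el s <= el (prd omega X)" using s by (auto simp: el_asg el_prd image_subset_iff)
  moreover have "vn i : el (vn n)" if "i : F" for i using n that by (simp add: vn_mem)
  then have "EX n:el omega. ALL i x. pair i x : el s --> i : el n"
    by (intro bexI[of _ "vn n"]) (auto simp: s(1) el_asg)
  moreover have "ALL i x. pair i x : el s --> (ALL j y. pair j y : el s --> i = j --> x = y)"
    by (auto simp: s(1) el_asg)
  ultimately show "s : ?R" by simp
next
  fix s assume s: "s : ?R"
  then obtain n where n: "!!i x. pair i x : el s ==> i : el (vn n)" unfolding el_omega by blast
  have sub: "el s <= {pair a b |a b. a : range vn \<and> b : el X}" using s by (simp add: el_prd)
  have fn: "!!i x y. pair i x : el s ==> pair i y : el s ==> x = y" using s by blast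
  let ?F = "{i. EX x. pair (vn i) x : el s}"
  have "?F <= {..<n}" using n vn_mem by blast
  then have F: "finite ?F" by (rule finite_subset) simp
  have ap: "app s (vn i) = x" if "pair (vn i) x : el s" for i x using that fn by (intro app_unique) blast+
  have "el s = el (asg ?F (%i. app s (vn i)))"
  proof (intro set_eqI iffI)
    fix z assume z: "z : el s"
    then obtain i x where "z = pair (vn i) x" using sub by blast
    then show "z : el (asg ?F (%i. app s (vn i)))" using z ap by (auto simp: el_asg)
  next
    fix z assume "z : el (asg ?F (%i. app s (vn i)))"
    then show "z : el s" using ap by (auto simp: el_asg)
  qed
  then have "s = asg ?F (%i. app s (vn i))" by (rule ext_el)
  moreover have "(%i. app s (vn i)) ` ?F <= el X" using ap sub by fastforce
  ultimately show "s : asgs X" unfolding asgs_def using F by blast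
qed

lemma asgs_sub: "X : A ==> asgs X <= A" by (auto simp: asgs_char)
lemma countable_asgs: "X : A ==> countable (asgs X)" using asgs_sub countable_subset_A by blast

lemma dterm_asgs[dintro]: "dterm A t ==> dterm A (%e. mk (asgs (t e)))"
proof (rule dterm_comp1[where f="%x. mk (asgs x)"])
  have "dterm A (%e. mk {s : el (pow (prd omega (e 0))). (ALL i x. pair i x : el s --> (ALL j y. pair j y : el s --> i = j --> x = y)) \<and>
     (EX n:el omega. ALL i x. pair i x : el s --> i : el n)})" by (intro dintro omegaA)
  then show "dterm A (%e. mk (asgs (e 0)))"
    by (rule dterm_cong, subst asgs_char) auto
qed

lemma dterm_with_asgs[dintro]: "dterm A t ==> dterm A (%e. with_asgs (t e))"
  by (rule dterm_comp1[where f=with_asgs]) (simp_all only: with_asgs_def, intro dintro)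

lemma dterm_Sat[dintro]: "dterm A s ==> dterm A t ==> dterm A (%e. Sat (s e) (t e))"
  unfolding Sat_def
  by (rule dterm_recF[where H=Sat_step]) (simp_all only: Sat_step_def, intro dintro omegaA vnA)

lemma dterm_defset[dintro]: "dterm A s ==> dterm A t ==> dterm A u ==> dterm A (%e. defset (s e) (t e) (u e))"
  by (rule dterm_comp3[where f=defset]) (simp_all only: defset_def, intro dintro zeroA)

lemma defsetA: "X : A ==> c : A ==> s : A ==> defset X c s : A"
  by (rule dterm_constD[OF dterm_defset[OF dterm_const dterm_const dterm_const]])

lemma codeA[simp]: "code \<phi> : A" by (induction \<phi>) auto

lemma el_defset[simp]: "el (defset X c s) = {a : el X. upd s zero a : el (Sat (with_asgs X) c)}"
  unfolding defset_def by simp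

lemma Defpow_code: assumes "X : A" shows "{defset X c s |c s. s : asgs X} = {defset X (code \<phi>) s |\<phi> s. s : asgs X}"
proof -
  have "EX \<phi>. defset X c s = defset X (code \<phi>) s" for c s
    using Sat_any[OF countable_asgs[OF assms], of c] Sat_code[OF countable_asgs[OF assms]] by (metis defset_def)
  then show ?thesis by blast
qed

lemma Defpow_char: assumes "X : A"
  shows "{defset X c s |c s. s : asgs X} = {y : el (pow X). EX c:A. EX s:el (mk (asgs X)). y = defset X c s}"
proof -
  have "{defset X c s |c s. s : asgs X} <= {y : el (pow X). EX c:A. EX s:el (mk (asgs X)). y = defset X c s}"
    unfolding Defpow_code[OF assms] using defsetA[OF assms codeA] asgs_sub[OF assms]
    by (auto simp: countable_asgs[OF assms])
  then show ?thesis by (auto simp: countable_asgs[OF assms])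
qed

lemma el_Defpow: "X : A ==> el (Defpow X) = {defset X c s |c s. s : asgs X}"
  by (simp only: Defpow_def Defpow_char el_Collect)

lemma dterm_Defpow[dintro]: "dterm A t ==> dterm A (%e. Defpow (t e))"
proof (rule dterm_comp1[where f=Defpow])
  have "dterm A (%e. mk {y : el (pow (e 0)). EX c:A. EX s:el (mk (asgs (e 0))). y = defset (e 0) c s})" by (intro dintro)
  then show "dterm A (%e. Defpow (e 0))"
    by (rule dterm_cong, unfold Defpow_def, subst Defpow_char) auto
qed

lemma dterm_Lh[dintro]: "dterm A t ==> dterm A (%e. Lh (t e))"
  unfolding Lh_def
  by (rule dterm_recF[where H="%p. Lh_step" and s=t]) (simp only: Lh_step_def, intro dintro dterm_UN)

lemma LhA[simp]: "x : A ==> Lh x : A"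
  by (rule dterm_constD[OF dterm_Lh[OF dterm_const]])
lemma DefpowA[simp]: "x : A ==> Defpow x : A"
  by (rule dterm_constD[OF dterm_Defpow[OF dterm_const]])

lemma el_Lh: "x : A ==> el (Lh x) = (UN b:el x. el (Defpow (Lh b)))"
  unfolding Lh_def by (subst recF) (simp add: Lh_step_def TC_el)

lemma Defpow_definable:
  assumes X: "X : A" and z: "el X ~= {} --> zero : el X"
  shows "y : el (Defpow X) \<longleftrightarrow> el y <= el X \<and> definable (el X) mem (el y)"
proof
  note c = countable_asgs[OF X]
  assume "y : el (Defpow X)"
  then obtain \<phi> s where s: "y = defset X (code \<phi>) s" "s : asgs X" unfolding el_Defpow[OF X] Defpow_code[OF X] by blast
  have "el y = {a : el X. sat (el X) mem \<phi> (env (upd s zero a))}"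
    unfolding s(1) el_defset Sat_code[OF c] using asgs_upd[OF s(2), of _ 0] by auto
  then show "el y <= el X \<and> definable (el X) mem (el y)" using asgs_cong_sat[OF z s(2) refl] by auto
next
  note c = countable_asgs[OF X]
  assume "el y <= el X \<and> definable (el X) mem (el y)"
  then obtain \<phi> v where v: "v ` (fv \<phi> - {0}) <= el X" "el y = {a : el X. sat (el X) mem \<phi> (v(0 := a))}"
    unfolding definable_def by blast
  let ?s = "asg (fv \<phi> - {0}) v"
  have s: "?s : asgs X" unfolding asgs_def using v(1) by (intro CollectI exI conjI) auto
  have "sat (el X) mem \<phi> (v(0 := a)) \<longleftrightarrow> sat (el X) mem \<phi> (env (upd ?s zero a))" for a
    unfolding env_upd[of _ 0, simplified] by (rule sat_cong_fv) (auto simp: env_asg)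
  then have "el y = el (defset X (code \<phi>) ?s)" unfolding v(2) el_defset Sat_code[OF c]
    using asgs_upd[OF s, of _ 0] by auto
  then show "y : el (Defpow X)" unfolding el_Defpow[OF X] using s ext_el by blast
qed

end

section \<open>Reflection and ZF in L\<close>

definition least_ord :: "(hset => bool) => hset" where
  "least_ord Q = (THE a. Ord a \<and> Q a \<and> (ALL c:el a. \<not> Q c))"

lemma least_ord_eq: "Ord a ==> Q a ==> ALL c:el a. \<not> Q c ==> least_ord Q = a"
  unfolding least_ord_def by (rule the_equality) (use Ord_linear in blast)+

lemma least_ord: assumes "Q a" "Ord a" shows "Ord (least_ord Q)" "Q (least_ord Q)" "c : el (least_ord Q) ==> \<not> Q c" "a ~: el (least_ord Q)"
proof -
  obtain b where b: "Ord b" "Q b" "ALL c:el b. \<not> Q c" using Ord_least[of Q a] assms by blast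
  then have "least_ord Q = b" by (intro least_ord_eq)
  then show "Ord (least_ord Q)" "Q (least_ord Q)" "c : el (least_ord Q) ==> \<not> Q c" "a ~: el (least_ord Q)" using b assms by auto
qed

definition is_trans where "is_trans X \<longleftrightarrow> (ALL y:el X. el y <= el X)"

lemma is_trans_zero: "is_trans X ==> el X ~= {} --> zero : el X"
proof
  assume t: "is_trans X" and "el X ~= {}"
  then obtain x where "x : el X" by auto
  then show "zero : el X"
  proof (induction x rule: el_induct)
    case (step x)
    show ?case
    proof (cases "el x = {}")
      case True
      then have "x = zero" by (intro ext_el) simp
      then show ?thesis using step by simp
    next
      case False
      then show ?thesis using step t unfolding is_trans_def by blast
    qed
  qed
qed

definition limit where "limit a \<longleftrightarrow> Ord a \<and> zero : el a \<and> (ALL b:el a. succ b : el a)"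

definition iterate where
  "iterate G b0 = recF (%x f. G (Uni (upair (succ b0) (mk (UN y:el x. el (succ (app f y)))))))"
definition iterate_arg where
  "iterate_arg G b0 x = Uni (upair (succ b0) (mk (UN y:el x. el (succ (iterate G b0 y)))))"

lemma iterate: "iterate G b0 x = G (iterate_arg G b0 x)"
proof -
  have "(UN y:el x. el (succ (app (lam (tc x) (iterate G b0)) y))) = (UN y:el x. el (succ (iterate G b0 y)))"
    by (simp add: TC_el)
  then show ?thesis unfolding iterate_arg_def by (subst iterate_def, subst recF) (simp add: iterate_def)
qed

lemma el_iterate_arg: "el (iterate_arg G b0 x) = insert b0 (el b0) Un (UN y:el x. insert (iterate G b0 y) (el (iterate G b0 y)))"
  unfolding iterate_arg_def by simp

context zf
begin

lemma dterm_least_ord: assumes Q: "dpred A (%e. Q (%n. e (Suc n)) (e 0))"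
  and ex: "!!e. range e <= A ==> EX a:A. Ord a \<and> Q e a"
  shows "dterm A (%e. least_ord (Q e))"
proof -
  have Q2: "dpred A (%e. Q (%n. e (Suc (Suc n))) (e 0))"
    using dpred_ren[OF Q inj_skip1] by simp
  have "dpred A (%e. Ord (e 0) \<and> Q (%n. e (Suc n)) (e 0) \<and> (ALL c:el (e 0). \<not> Q (%n. e (Suc n)) c))"
    by (intro dintro Q Q2)
  then have "dpred A (%e. e 0 = least_ord (Q (%n. e (Suc n))))"
  proof (rule dpred_cong)
    fix e :: "nat => hset" assume "range e <= A"
    then obtain a where "Ord a" "Q (%n. e (Suc n)) a" using ex[of "%n. e (Suc n)"] by auto
    from least_ord[of "Q (%n. e (Suc n))", OF this(2,1)] least_ord_eq[of "e 0" "Q (%n. e (Suc n))"]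
    show "(Ord (e 0) \<and> Q (%n. e (Suc n)) (e 0) \<and> (ALL c:el (e 0). \<not> Q (%n. e (Suc n)) c)) =
       (e 0 = least_ord (Q (%n. e (Suc n))))" by metis
  qed
  moreover have "least_ord (Q e) : A" if e: "range e <= A" for e
  proof -
    obtain a where a: "a : A" "Ord a" "Q e a" using ex[OF e] by auto
    from least_ord[of "Q e", OF a(3,2)] have "least_ord (Q e) = a \<or> least_ord (Q e) : el a"
      using Ord_linear[OF _ a(2), of "least_ord (Q e)"] by blast
    then show ?thesis using a Atrans by blast
  qed
  ultimately show ?thesis by (simp add: dterm_def)
qed

lemma DefpowI: assumes X: "X : A" "is_trans X" "el X ~= {}" and Q: "dpred (el X) (%e. Q (e 0))"
  shows "mk {a : el X. Q a} : el (Defpow X)"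
proof -
  interpret X: carrier "el X" by unfold_locales fact
  have "dpred (el X) (%e. e 0 : {a : el X. Q a})" using Q by (rule X.dpred_cong) auto
  then have "definable (el X) mem {a : el X. Q a}" by (subst X.definable_iff_dpred) auto
  then show ?thesis using Defpow_definable[OF X(1) is_trans_zero[OF X(2)]] by auto
qed

lemma Defpow_sup: assumes X: "X : A" "is_trans X" shows "el X <= el (Defpow X)"
proof
  fix x assume x: "x : el X"
  then interpret X: carrier "el X" by unfold_locales auto
  have "mk {a : el X. a : el x} : el (Defpow X)"
    by (rule DefpowI[OF X]) (use x in \<open>auto intro!: dintro\<close>)
  moreover have "{a : el X. a : el x} = el x" using X x unfolding is_trans_def by blast
  ultimately show "x : el (Defpow X)" by simp
qed

lemma Defpow_self: assumes X: "X : A" "is_trans X" shows "X : el (Defpow X)"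
proof -
  have "definable (el X) mem (el X)" unfolding definable_def
    by (rule exI[of _ "Eq 0 0"]) auto
  then show ?thesis using Defpow_definable[OF X(1) is_trans_zero[OF X(2)]] by auto
qed

lemma Defpow_Pow: "X : A ==> y : el (Defpow X) ==> el y <= el X"
  by (auto simp: el_Defpow)

lemma is_trans_Lh: "a : A ==> is_trans (Lh a)"
proof (induction a rule: el_induct)
  case (step a)
  show ?case unfolding is_trans_def
  proof
    fix y assume "y : el (Lh a)"
    then obtain b where b: "b : el a" "y : el (Defpow (Lh b))" using step(2) el_Lh by blast
    then have bA: "b : A" using step Atrans by blast
    have "el y <= el (Lh b)" using b Defpow_Pow bA by auto
    also have "... <= el (Defpow (Lh b))" using step b bA by (intro Defpow_sup) auto
    also have "... <= el (Lh a)" using b step(2) el_Lh by blast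
    finally show "el y <= el (Lh a)" .
  qed
qed

lemma Lh_mono: "a : A ==> b : el a ==> el (Lh b) <= el (Lh a)"
  using Defpow_sup[OF LhA is_trans_Lh, of b] el_Lh[of a] Atrans by blast
lemma Lh_succ: "a : A ==> el (Lh (succ a)) = el (Defpow (Lh a))"
  using Defpow_sup[OF LhA is_trans_Lh, of a] el_Lh[of a] el_Lh[of "succ a"] by auto
lemma Lh_le: "a : A ==> b : A ==> Ord a ==> Ord b ==> el b <= el a ==> el (Lh b) <= el (Lh a)"
  using Lh_mono[of a b] Ord_subset[of b a] by auto

lemma rank_Lh: "a : A ==> Ord a ==> x : el (Lh a) ==> rank x : el a"
proof (induction a arbitrary: x rule: el_induct)
  case (step a)
  then obtain b where b: "b : el a" "x : el (Defpow (Lh b))" using el_Lh by blast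
  then have bA: "b : A" "Ord b" using step Atrans Ord_in by blast+
  then have "el x <= el (Lh b)" using b Defpow_Pow by auto
  then have "rank y : el b" if "y : el x" for y using step(1)[OF b(1) bA] that by blast
  then have "el (rank x) <= el b" using bA by (intro rank_le) auto
  then have "rank x = b \<or> rank x : el b" using Ord_subset[of "rank x" b] bA by simp
  then show ?case using b step Ord_trans by blast
qed

lemma Ord_Defpow: "a : A ==> Ord a ==> a : el (Defpow (Lh a))"
proof (induction a rule: el_induct)
  case (step a)
  have eq: "el a = {x : el (Lh a). Ord x}"
  proof (intro set_eqI iffI)
    fix x assume x: "x : el a"
    then have "x : A" "Ord x" using step Atrans Ord_in by blast+
    then show "x : {x : el (Lh a). Ord x}" using step x el_Lh[of a] by blast
  next
    fix x assume "x : {x : el (Lh a). Ord x}"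
    then show "x : el a" using rank_Lh[of a x] rank_Ord[of x] step by auto
  qed
  show ?case
  proof (cases "el (Lh a) = {}")
    case True
    then have "Lh a = a" using eq by (intro ext_el) auto
    then show ?thesis using Defpow_self[of "Lh a"] is_trans_Lh[of a] step by auto
  next
    case False
    then interpret X: carrier "el (Lh a)" by unfold_locales
    have t: "!!x y. x : el (Lh a) ==> y : el x ==> y : el (Lh a)" using is_trans_Lh[of a] step unfolding is_trans_def by blast
    have "dpred (el (Lh a)) (%e. (ALL y:el (Lh a). y : el (e 0) --> (ALL z:el (Lh a). z : el y --> z : el (e 0))) \<and>
      (ALL y:el (Lh a). y : el (e 0) --> (ALL z:el (Lh a). z : el y --> (ALL w:el (Lh a). w : el z --> w : el y))))"
      by (intro dintro)
    then have "dpred (el (Lh a)) (%e. Ord (e 0))"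
    proof (rule X.dpred_cong)
      fix e :: "nat => hset" assume "range e <= el (Lh a)"
      then have "e 0 : el (Lh a)" by auto
      then show "((ALL y:el (Lh a). y : el (e 0) --> (ALL z:el (Lh a). z : el y --> z : el (e 0))) \<and>
      (ALL y:el (Lh a). y : el (e 0) --> (ALL z:el (Lh a). z : el y --> (ALL w:el (Lh a). w : el z --> w : el y)))) = Ord (e 0)"
        unfolding Ord_def subset_iff using t by meson
    qed
    then have "mk {x : el (Lh a). Ord x} : el (Defpow (Lh a))"
      using False is_trans_Lh[of a] step by (intro DefpowI) auto
    then show ?thesis using eq by (metis mk_el)
  qed
qed

definition Lcls where "Lcls = {x : A. EX a:A. Ord a \<and> x : el (Lh a)}"

lemma Lcls_I: "a : A ==> Ord a ==> x : el (Lh a) ==> x : Lcls"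
  unfolding Lcls_def using LhA Atrans by blast
lemma Lcls_Ex: "x : Lcls ==> EX a:A. Ord a \<and> x : el (Lh a)" unfolding Lcls_def by blast
lemma Lcls_sub: "Lcls <= A" unfolding Lcls_def by blast
lemma dpred_Lcls[dintro]: "dterm A t ==> dpred A (%e. t e : Lcls)"
proof (rule dpred_comp1[where Q="%x. x : Lcls"])
  have "dpred A (%e. EX a:A. Ord a \<and> e 0 : el (Lh a))" by (intro dintro)
  then show "dpred A (%e. e 0 : Lcls)" by (rule dpred_cong) (auto simp: Lcls_def)
qed

lemma Lcls_trans: "x : Lcls ==> y : el x ==> y : Lcls"
  using Lcls_Ex is_trans_Lh Lcls_I unfolding is_trans_def by blast
lemma Lcls_Def: "a : A ==> Ord a ==> x : el (Defpow (Lh a)) ==> x : Lcls"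
  using Lcls_I[of "succ a" x] Lh_succ[of a] by simp
lemma Ord_Lcls: "a : A ==> Ord a ==> a : Lcls" using Lcls_Def Ord_Defpow by blast
lemma Lh_Lcls: "a : A ==> Ord a ==> Lh a : Lcls" using Lcls_Def Defpow_self[OF LhA is_trans_Lh] by blast

lemma dpred_Lcls_all: assumes "dpred A (%e. \<Phi> (%n. e (Suc n)) (e 0))" shows "dpred A (%e. ALL x:Lcls. \<Phi> e x)"
proof -
  have "dpred A (%e. ALL x:A. x : Lcls --> \<Phi> e x)" by (intro dintro assms)
  then show ?thesis by (rule dpred_cong) (use Lcls_sub in blast)
qed

lemma dpred_satK: "dpred A (%e. sat Lcls mem \<phi> (env (e 0)))"
proof (induction \<phi>)
  case (Forall i \<phi>)
  have "dpred A (%e. ALL a:Lcls. sat Lcls mem \<phi> (env (upd (e 0) (vn i) a)))"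
    by (intro dpred_Lcls_all dpred_comp1[OF Forall] dintro vnA)
  then show ?case by (simp add: env_upd)
qed (auto simp: env_def intro!: dintro vnA)

definition reflects where "reflects \<phi> a \<longleftrightarrow> (ALL v. range v <= el (Lh a) --> (sat Lcls mem \<phi> v \<longleftrightarrow> sat (el (Lh a)) mem \<phi> v))"

definition bounding where "bounding C \<longleftrightarrow> dpred A (%e. C (e 0) (e 1)) \<and> (ALL b:A. Ord b --> (EX c:A. Ord c \<and> C b c)) \<and>
   (ALL b:A. ALL b':A. ALL c:A. ALL c':A. Ord b --> Ord b' --> Ord c --> Ord c' -->
      C b c --> el b' <= el b --> el c <= el c' --> C b' c')"

definition closed_under where "closed_under C a \<longleftrightarrow> a : A \<and> limit a \<and> (ALL b:el a. EX c:el a. C b c)"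

lemma Ord_max: "b : A ==> c : A ==> Ord b ==> Ord c ==> EX d:A. Ord d \<and> el b <= el d \<and> el c <= el d"
  using Ord_linear[of b c] Ord_subset[of b c] Ord_subset[of c b] by blast

lemma bounding_mono: assumes "bounding C" "C b c" "b : A" "b' : A" "c : A" "c' : A" "Ord b" "Ord b'" "Ord c" "Ord c'"
    "el b' <= el b" "el c <= el c'" shows "C b' c'"
  using assms(1)[unfolded bounding_def, THEN conjunct2, THEN conjunct2, rule_format, of b b' c c'] assms(2-) by simp

lemma bounding_conj: assumes "bounding C" "bounding D" shows "bounding (%b c. C b c \<and> D b c)"
  unfolding bounding_def
proof (intro conjI ballI impI)
  show "dpred A (%e. C (e 0) (e 1) \<and> D (e 0) (e 1))" using assms by (intro dpred_conj) (simp_all add: bounding_def)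
  fix b assume b: "b : A" "Ord b"
  then obtain c d where c: "c : A" "Ord c" "C b c" "d : A" "Ord d" "D b d" using assms unfolding bounding_def by blast
  obtain m where m: "m : A" "Ord m" "el c <= el m" "el d <= el m" using Ord_max[of c d] c by blast
  have "C b m" "D b m" using bounding_mono[OF assms(1) c(3)] bounding_mono[OF assms(2) c(6)] b c m by blast+
  then show "EX c:A. Ord c \<and> C b c \<and> D b c" using m by blast
next
  fix b b' c c' assume a: "b : A" "b' : A" "c : A" "c' : A" "Ord b" "Ord b'" "Ord c" "Ord c'"
    "C b c \<and> D b c" "el b' <= el b" "el c <= el c'"
  then show "C b' c'" using bounding_mono[OF assms(1)] by blast
  show "D b' c'" using a bounding_mono[OF assms(2)] by blast
qed

lemma closed_under_conj: "bounding C ==> bounding D ==> closed_under (%b c. C b c \<and> D b c) a ==> closed_under C a \<and> closed_under D a"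
  unfolding closed_under_def by blast

lemma Lh_limit: "limit a ==> a : A ==> el (Lh a) = (UN b:el a. el (Lh b))"
proof
  assume a: "limit a" "a : A"
  show "el (Lh a) <= (UN b:el a. el (Lh b))"
  proof
    fix x assume "x : el (Lh a)"
    then obtain b where b: "b : el a" "x : el (Defpow (Lh b))" using el_Lh a by blast
    then have "x : el (Lh (succ b))" using Lh_succ[of b] Atrans a by blast
    then show "x : (UN b:el a. el (Lh b))" using a b unfolding limit_def by blast
  qed
qed (use Lh_mono in blast)

lemma Lh_limit_finite:
  assumes a: "limit a" "a : A" and F: "finite F" "F <= el (Lh a)" shows "EX b:el a. F <= el (Lh b)"
  using F
proof (induction F rule: finite_induct)
  case empty then show ?case using a unfolding limit_def by auto
next
  case (insert x F)
  then obtain b where b: "b : el a" "F <= el (Lh b)" by auto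
  obtain c where c: "c : el a" "x : el (Lh c)" using insert Lh_limit[OF a] by auto
  have "Ord b" "Ord c" "b : A" "c : A" using a b c Ord_in Atrans unfolding limit_def by blast+
  then have "el (Lh b) <= el (Lh c) \<or> el (Lh c) <= el (Lh b)" using Ord_linear[of b c] Lh_mono by blast
  then show ?case using b c by blast
qed

lemma Ord_collection:
  assumes Q: "dpred A (%e. Q (e 0) (e 1))" and X: "X : A"
    and ex: "!!x. x : el X ==> EX c:A. Ord c \<and> Q x c"
    and mono: "!!x c d. x : el X ==> c : A ==> d : A ==> Ord c ==> Ord d ==> el c <= el d ==> Q x c ==> Q x d"
  shows "EX c:A. Ord c \<and> (ALL x:el X. Q x c)"
proof -
  have "dpred A (%e. Ord (e 1) \<and> Q (e 0) (e 1))" by (intro dintro Q)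
  from collection[OF this X ex] obtain Y where Y: "Y : A" "ALL x:el X. EX c:el Y. Ord c \<and> Q x c" by blast
  let ?Z = "mk {c : el Y. Ord c}"
  have Z: "?Z : A" by (rule sepA[OF _ Y(1)]) (intro dintro)
  have U: "Uni ?Z : A" "Ord (Uni ?Z)" using Z UniA Ord_UniA[OF Z] by auto
  have "Q x (Uni ?Z)" if x: "x : el X" for x
  proof -
    obtain c where c: "c : el Y" "Ord c" "Q x c" using Y(2) x by blast
    have "c : A" using c(1) Y(1) Atrans by blast
    then show ?thesis by (rule mono[OF x _ U(1) c(2) U(2) _ c(3)]) (use c in auto)
  qed
  then show ?thesis using U by blast
qed

definition counterexample where "counterexample \<phi> i s x \<longleftrightarrow> \<not> sat Lcls mem \<phi> (env (upd s (vn i) x))"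
definition counterexample_bound where "counterexample_bound \<phi> i b c \<longleftrightarrow>
  (ALL s:el (mk (asgs (Lh b))). (EX x:Lcls. counterexample \<phi> i s x) --> (EX x:el (Lh c). counterexample \<phi> i s x))"

lemma dpred_counterexample: "dterm A s ==> dterm A t ==> dpred A (%e. counterexample \<phi> i (s e) (t e))"
  unfolding counterexample_def by (intro dintro dpred_comp1[OF dpred_satK] vnA)

lemma dpred_ex_counterexample: "dpred A (%e. EX x:Lcls. counterexample \<phi> i (e k) x)"
proof -
  have "dpred A (%e. \<not> (ALL x:Lcls. \<not> counterexample \<phi> i (e k) x))" by (intro dintro dpred_Lcls_all dpred_counterexample)
  then show ?thesis by (rule dpred_cong) blast
qed

lemma bounding_counterexample_bound: "bounding (counterexample_bound \<phi> i)"
  unfolding bounding_def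
proof (intro conjI ballI impI)
  show "dpred A (%e. counterexample_bound \<phi> i (e 0) (e 1))"
    unfolding counterexample_bound_def by (intro dintro dpred_ex_counterexample dpred_counterexample)
  fix b assume b: "b : A" "Ord b"
  show "EX c:A. Ord c \<and> counterexample_bound \<phi> i b c" unfolding counterexample_bound_def
  proof (rule Ord_collection)
    show "dpred A (%e. (EX x:Lcls. counterexample \<phi> i (e 0) x) --> (EX x:el (Lh (e 1)). counterexample \<phi> i (e 0) x))"
      by (intro dintro dpred_ex_counterexample dpred_counterexample)
    show "mk (asgs (Lh b)) : A" by (rule dterm_constD) (intro dintro b)
    show "EX c:A. Ord c \<and> ((EX x:Lcls. counterexample \<phi> i s x) --> (EX x:el (Lh c). counterexample \<phi> i s x))" for s
      using Lcls_Ex Ord_zero zeroA by blast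
  qed (use Lh_le in blast)
next
  fix b b' c c' assume a: "b : A" "b' : A" "c : A" "c' : A" "Ord b" "Ord b'" "Ord c" "Ord c'"
    "counterexample_bound \<phi> i b c" "el b' <= el b" "el c <= el c'"
  have "el (Lh b') <= el (Lh b)" and le: "el (Lh c) <= el (Lh c')" using a Lh_le[of b b'] Lh_le[of c' c] by simp_all
  then have "asgs (Lh b') <= asgs (Lh b)" unfolding asgs_def by blast
  then show "counterexample_bound \<phi> i b' c'"
    using le a(9) countable_asgs[OF LhA] a(1,2) unfolding counterexample_bound_def by (simp add: subset_iff) blast
qed

lemma reflects_Forall:
  assumes \<phi>: "reflects \<phi> a" and cl: "closed_under (counterexample_bound \<phi> i) a" shows "reflects (Forall i \<phi>) a"
  unfolding reflects_def
proof (intro allI impI)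
  fix v :: "nat => hset" assume v: "range v <= el (Lh a)"
  have a: "a : A" "limit a" "Ord a" using cl unfolding closed_under_def limit_def by auto
  have sub: "el (Lh a) <= Lcls" using Lcls_I a by blast
  have vi: "sat Lcls mem \<phi> (v(i := x)) = sat (el (Lh a)) mem \<phi> (v(i := x))" if "x : el (Lh a)" for x
  proof -
    have "range (v(i := x)) <= el (Lh a)" using v that by (auto simp: image_subset_iff)
    then show ?thesis using \<phi> unfolding reflects_def by blast
  qed
  have "sat Lcls mem \<phi> (v(i := x))" if s: "ALL y:el (Lh a). sat (el (Lh a)) mem \<phi> (v(i := y))" and x: "x : Lcls" for x
  proof (rule ccontr)
    assume n: "\<not> sat Lcls mem \<phi> (v(i := x))"
    have "finite (v ` fv \<phi>)" "v ` fv \<phi> <= el (Lh a)" using v by auto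
    then obtain b where b: "b : el a" "v ` fv \<phi> <= el (Lh b)" using Lh_limit_finite[OF a(2,1)] by blast
    let ?s = "asg (fv \<phi>) v"
    have "?s : asgs (Lh b)" unfolding asgs_def using b by (intro CollectI exI conjI) auto
    then have sF: "?s : el (mk (asgs (Lh b)))" using countable_asgs[OF LhA] b a Atrans by simp
    have N: "counterexample \<phi> i ?s y \<longleftrightarrow> \<not> sat Lcls mem \<phi> (v(i := y))" for y
      unfolding counterexample_def env_upd not_not by (rule arg_cong[of _ _ Not], rule sat_cong_fv) (auto simp: env_asg)
    obtain c where c: "c : el a" "counterexample_bound \<phi> i b c" using cl b(1) unfolding closed_under_def by blast
    then obtain y where y: "y : el (Lh c)" "counterexample \<phi> i ?s y"
      using sF x n N unfolding counterexample_bound_def by blast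
    then have "y : el (Lh a)" using c Lh_mono a by blast
    then show False using y N s vi by blast
  qed
  then show "sat Lcls mem (Forall i \<phi>) v = sat (el (Lh a)) mem (Forall i \<phi>) v" using vi sub by auto
qed

lemma reflect: "EX C. bounding C \<and> (ALL a. closed_under C a --> reflects \<phi> a)"
proof (induction \<phi>)
  case (Mem i j)
  show ?case by (rule exI[of _ "%b c. True"]) (auto simp: bounding_def reflects_def intro!: dpred_const bexI[of _ zero])
next
  case (Eq i j)
  show ?case by (rule exI[of _ "%b c. True"]) (auto simp: bounding_def reflects_def intro!: dpred_const bexI[of _ zero])
next
  case (Neg \<phi>)
  then show ?case unfolding reflects_def by auto
next
  case (Conj \<phi> \<psi>)
  then obtain C D where C: "bounding C" "ALL a. closed_under C a --> reflects \<phi> a" and D: "bounding D" "ALL a. closed_under D a --> reflects \<psi> a" by blast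
  have "reflects (Conj \<phi> \<psi>) a" if "closed_under (%b c. C b c \<and> D b c) a" for a
  proof -
    have "reflects \<phi> a" "reflects \<psi> a" using closed_under_conj[OF C(1) D(1) that] C(2) D(2) by blast+
    then show ?thesis unfolding reflects_def by simp
  qed
  then show ?case using bounding_conj[OF C(1) D(1)] by blast
next
  case (Forall i \<phi>)
  then obtain C where C: "bounding C" "ALL a. closed_under C a --> reflects \<phi> a" by blast
  let ?D = "counterexample_bound \<phi> i"
  have "reflects (Forall i \<phi>) a" if "closed_under (%b c. C b c \<and> ?D b c) a" for a
    using closed_under_conj[OF C(1) bounding_counterexample_bound that] C(2) reflects_Forall by blast
  then show ?case using bounding_conj[OF C(1) bounding_counterexample_bound] by blast
qed

context
  fixes G b0
  assumes dft_G: "dterm A (%e. G (e 0))" and G: "!!b. b : A ==> Ord b ==> Ord (G b) \<and> b : el (G b)"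
    and b0: "b0 : A" "Ord b0"
begin

lemma dterm_iterate: "dterm A t ==> dterm A (%e. iterate G b0 (t e))"
  unfolding iterate_def
  by (rule dterm_recF[where H="%p x f. G (Uni (upair (succ b0) (mk (UN y:el x. el (succ (app f y))))))" and s=t])
    (intro dintro dterm_UN dterm_comp1[OF dft_G] b0 succA)+

lemma iterate_argA: "x : A ==> iterate_arg G b0 x : A"
  unfolding iterate_arg_def by (rule dterm_constD) (intro dintro dterm_UN dterm_iterate b0 succA)

lemma Ord_iterate: "x : A ==> Ord (iterate_arg G b0 x) \<and> Ord (iterate G b0 x)"
proof (induction x rule: el_induct)
  case (step x)
  let ?S = "insert (succ b0) ((%y. succ (iterate G b0 y)) ` el x)"
  have "Ord (mk (\<Union>(el ` ?S)))" using step Atrans b0 by (intro Ord_UN) auto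
  moreover have "iterate_arg G b0 x = mk (\<Union>(el ` ?S))" by (rule ext_el) (simp add: el_iterate_arg)
  ultimately show ?case using G iterate_argA[OF step(2)] iterate[of G b0 x] by simp
qed

lemma iterate_sup: "EX a:A. limit a \<and> b0 : el a \<and> (ALL d:el a. EX b:A. Ord b \<and> el d <= el b \<and> G b : el a)"
proof -
  let ?b = "iterate_arg G b0" and ?I = "iterate G b0"
  let ?i = "%n. ?I (vn n)" and ?c = "%n. ?b (vn n)"
  have i: "?i n = G (?c n)" "?c n : A" "Ord (?c n)" "Ord (?i n)" "?c n : el (?i n)" for n
    using iterate[of G b0 "vn n"] iterate_argA[OF vnA] Ord_iterate[OF vnA] G by auto
  have ic: "?i n : el (?c (Suc n))" for n unfolding el_iterate_arg by simp
  then have ii: "?i n : el (?i (Suc n))" for n using i(5)[of "Suc n"] Ord_trans[OF i(4)] by blast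
  define a where "a = mk (UN n:el omega. el (?I n))"
  have a: "el a = (\<Union>n. el (?i n))" unfolding a_def by simp
  have "a : A" unfolding a_def by (rule dterm_constD) (intro dintro dterm_UN dterm_iterate omegaA)
  have "a = mk (\<Union>(el ` range ?i))" by (rule ext_el) (simp add: a)
  moreover have "Ord (mk (\<Union>(el ` range ?i)))" using i(4) by (intro Ord_UN) auto
  ultimately have "Ord a" by simp
  have ia: "?i n : el a" for n using ii[of n] unfolding a by blast
  have step: "succ d : el a \<and> (EX b:A. Ord b \<and> el d <= el b \<and> G b : el a)" if "d : el a" for d
  proof -
    obtain n where n: "d : el (?i n)" using \<open>d : el a\<close> a by auto
    then have "succ d = ?i n \<or> succ d : el (?i n)" using Ord_succ_le[OF i(4)] by blast
    then have "succ d : el a" using ia[of n] Ord_trans[OF \<open>Ord a\<close> ia] by metis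
    moreover have "el d <= el (?c (Suc n))" using n ic[of n] i(3) Ord_trans by blast
    ultimately show ?thesis using i(1,2,3)[of "Suc n"] ia[of "Suc n"] by metis
  qed
  have "b0 : el (?c 0)" unfolding el_iterate_arg by simp
  then have b0a: "b0 : el a" using Ord_trans[OF i(4) i(5)] unfolding a by blast
  then have "zero : el a" using is_trans_zero[of a] \<open>Ord a\<close> unfolding is_trans_def Ord_def by blast
  then have "limit a" using step \<open>Ord a\<close> unfolding limit_def by blast
  then show ?thesis using \<open>a : A\<close> b0a step by blast
qed

end

lemma closed_under_ex: assumes C: "bounding C" and b0: "b0 : A" "Ord b0" shows "EX a. closed_under C a \<and> b0 : el a"
proof -
  define Q where "Q b c \<longleftrightarrow> Ord b --> C b c \<and> b : el c" for b c
  have exQ: "EX c:A. Ord c \<and> Q b c" if b: "b : A" for b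
  proof (cases "Ord b")
    case True
    then obtain c where c: "c : A" "Ord c" "C b c" using C b unfolding bounding_def by blast
    obtain m where m: "m : A" "Ord m" "el c <= el m" "el (succ b) <= el m"
      using Ord_max[of c "succ b"] c b True by auto
    have "C b m" using bounding_mono[OF C c(3)] b c m True by blast
    then show ?thesis unfolding Q_def using m by auto
  next
    case False then show ?thesis unfolding Q_def using zeroA Ord_zero by blast
  qed
  let ?G = "%b. least_ord (Q b)"
  have dG: "dterm A (%e. ?G (e 0))"
  proof (rule dterm_least_ord)
    have dC: "dpred A (%e. C (e 0) (e 1))" using C by (simp add: bounding_def)
    show "dpred A (%e. Q (e (Suc 0)) (e 0))" unfolding Q_def by (intro dintro dpred_comp2[OF dC])
  qed (use exQ in auto)
  have G: "Ord (?G b)" "C b (?G b)" "b : el (?G b)" if b: "b : A" "Ord b" for b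
  proof -
    obtain c where c: "c : A" "Ord c" "Q b c" using exQ b by blast
    show "Ord (?G b)" "C b (?G b)" "b : el (?G b)" using least_ord[of "Q b", OF c(3,2)] b Q_def by auto
  qed
  obtain a where a: "a : A" "limit a" "b0 : el a" "ALL d:el a. EX b:A. Ord b \<and> el d <= el b \<and> ?G b : el a"
    using iterate_sup[OF dG _ b0] G by blast
  have "EX c:el a. C d c" if d: "d : el a" for d
  proof -
    obtain b where b: "b : A" "Ord b" "el d <= el b" "?G b : el a" using a(4) d by blast
    have "d : A" "Ord d" "?G b : A" using d b(4) a(1,2) Atrans Ord_in unfolding limit_def by blast+
    then show ?thesis using bounding_mono[OF C G(2)[OF b(1,2)]] b G(1) by blast
  qed
  then show ?thesis using a unfolding closed_under_def by blast
qed

lemma reflect_ex: assumes "b0 : A" "Ord b0" shows "EX a:A. limit a \<and> b0 : el a \<and> reflects \<phi> a"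
  using reflect[of \<phi>] closed_under_ex assms unfolding closed_under_def by metis

lemma Lcls_bound: assumes "finite F" "F <= Lcls" shows "EX b:A. Ord b \<and> F <= el (Lh b)"
  using assms
proof (induction F rule: finite_induct)
  case empty then show ?case using Ord_zero zeroA by blast
next
  case (insert x F)
  then obtain b c where b: "b : A" "Ord b" "F <= el (Lh b)" "c : A" "Ord c" "x : el (Lh c)" using Lcls_Ex by (metis insert_subset)
  obtain m where "m : A" "Ord m" "el b <= el m" "el c <= el m" using Ord_max[of b c] b by blast
  then show ?case using b Lh_le[of m b] Lh_le[of m c] by blast
qed

lemma Lcls_carrier: "carrier Lcls"
  by unfold_locales (use Ord_Lcls[OF zeroA Ord_zero] in auto)

lemma dpred_rel_Lcls: assumes "dpred Lcls (%e. R (e 0) (e 1))"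
  shows "EX R'. dpred A (%e. R' (e 0) (e 1)) \<and> (ALL x:Lcls. ALL y:Lcls. R x y \<longleftrightarrow> R' x y)"
proof -
  obtain \<phi> w where w: "range w <= Lcls" "!!e. range e <= Lcls ==> R (e 0) (e 1) \<longleftrightarrow> sat Lcls mem \<phi> (merge e w)"
    using assms unfolding dpred_def by blast
  let ?F = "fv \<phi> - {0, 2}"
  define s where "s = asg ?F (merge (%_. zero) w)"
  have zK: "zero : Lcls" using Ord_Lcls[OF zeroA Ord_zero] .
  have sA: "s : A" unfolding s_def using w(1) zK Lcls_sub by (intro asgA) (auto simp: merge_def)
  let ?R = "%x y. sat Lcls mem \<phi> (env (upd (upd s (vn 0) x) (vn 2) y))"
  have "dpred A (%e. ?R (e 0) (e 1))" by (intro dintro dpred_comp1[OF dpred_satK] sA vnA)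
  moreover have "R x y \<longleftrightarrow> ?R x y" if "x : Lcls" "y : Lcls" for x y
  proof -
    let ?e = "(%_. zero)(0 := x, 1 := y)"
    have "range ?e <= Lcls" using that zK by auto
    from w(2)[OF this] have "R x y \<longleftrightarrow> sat Lcls mem \<phi> (merge ?e w)" by simp
    also have "... \<longleftrightarrow> ?R x y" unfolding env_upd
      by (rule sat_cong_fv) (auto simp: s_def env_asg merge_def elim!: evenE oddE)
    finally show ?thesis .
  qed
  ultimately show ?thesis by (intro exI[of _ ?R]) simp
qed

lemma Lcls_sep: assumes Q: "dpred Lcls (%e. Q (e 0))" and x: "x : Lcls" shows "mk {y : el x. Q y} : Lcls"
proof -
  obtain \<phi> w where w: "range w <= Lcls" "!!e. range e <= Lcls ==> Q (e 0) \<longleftrightarrow> sat Lcls mem \<phi> (merge e w)"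
    using Q unfolding dpred_def by blast
  have zero: "zero : Lcls" using Ord_Lcls[OF zeroA Ord_zero] .
  define v where "v i = (if i : fv \<phi> then merge (%_. zero) w i else zero)" for i
  have "finite (insert x (insert zero (v ` fv \<phi>)))" "insert x (insert zero (v ` fv \<phi>)) <= Lcls"
    using x w(1) zero by (auto simp: v_def merge_def)
  from Lcls_bound[OF this] obtain b where b: "b : A" "Ord b" "x : el (Lh b)" "zero : el (Lh b)" "v ` fv \<phi> <= el (Lh b)" by auto
  obtain a where a: "a : A" "limit a" "b : el a" "reflects \<phi> a" using reflect_ex b by blast
  let ?X = "el (Lh a)"
  have sub: "el (Lh b) <= ?X" using Lh_mono a by blast
  have XK: "?X <= Lcls" using Lcls_I a unfolding limit_def by blast
  interpret X: carrier ?X using sub b by unfold_locales blast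
  have Qy: "Q y \<longleftrightarrow> sat ?X mem \<phi> (v(0 := y))" if y: "y : ?X" for y
  proof -
    have "range ((%_. zero)(0 := y)) <= Lcls" using y XK zero by auto
    from w(2)[OF this] have "Q y \<longleftrightarrow> sat Lcls mem \<phi> (merge ((%_. zero)(0 := y)) w)" by simp
    also have "... \<longleftrightarrow> sat Lcls mem \<phi> (v(0 := y))" by (rule sat_cong_fv) (auto simp: v_def merge_def elim!: evenE)
    also have "range (v(0 := y)) <= ?X" using b sub y by (auto simp: v_def)
    then have "sat Lcls mem \<phi> (v(0 := y)) \<longleftrightarrow> sat ?X mem \<phi> (v(0 := y))" using a(4) unfolding reflects_def by blast
    finally show ?thesis .
  qed
  have "definable ?X mem {y : ?X. Q y}" unfolding definable_def
    by (intro exI[of _ \<phi>] exI[of _ v] conjI) (use b sub Qy in \<open>auto simp: image_subset_iff\<close>)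
  then have "dpred ?X (%e. e 0 : {y : ?X. Q y})" by (subst (asm) X.definable_iff_dpred) auto
  then have "dpred ?X (%e. e 0 : el x \<and> e 0 : {y : ?X. Q y})"
    using b(3) sub by (intro dintro) auto
  then have "mk {y : ?X. y : el x \<and> y : {y : ?X. Q y}} : el (Defpow (Lh a))"
    using a X.nonempty is_trans_Lh by (intro DefpowI) auto
  moreover have "el x <= ?X" using b sub is_trans_Lh[OF a(1)] unfolding is_trans_def by blast
  then have "{y : ?X. y : el x \<and> y : {y : ?X. Q y}} = {y : el x. Q y}" by blast
  ultimately have "mk {y : el x. Q y} : el (Defpow (Lh a))" by (simp only:)
  then show ?thesis using Lcls_Def a unfolding limit_def by blast
qed

lemma Lcls_Lh_bound: assumes "X : A" shows "EX b:A. Ord b \<and> (ALL x:el X. x : Lcls --> x : el (Lh b))"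
proof (rule Ord_collection[OF _ assms])
  show "dpred A (%e. e 0 : Lcls --> e 0 : el (Lh (e 1)))" by (intro dintro)
qed (use Lcls_Ex Ord_zero zeroA Lh_le in blast)+

lemma Lcls_upair: assumes "x : Lcls" "y : Lcls" shows "upair x y : Lcls"
proof -
  interpret K: carrier Lcls by (rule Lcls_carrier)
  obtain b where b: "b : A" "Ord b" "{x,y} <= el (Lh b)" using Lcls_bound[of "{x,y}"] assms by auto
  have "mk {z : el (Lh b). z = x \<or> z = y} : Lcls" by (rule Lcls_sep) (use assms b Lh_Lcls in \<open>auto intro!: dintro\<close>)
  moreover have "{z : el (Lh b). z = x \<or> z = y} = {x, y}" using b by auto
  ultimately show ?thesis by (simp add: upair_def)
qed

lemma Lcls_Uni: assumes x: "x : Lcls" shows "Uni x : Lcls"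
proof -
  interpret K: carrier Lcls by (rule Lcls_carrier)
  obtain b where b: "b : A" "Ord b" "x : el (Lh b)" using Lcls_Ex x by auto
  have "mk {z : el (Lh b). EX y:Lcls. y : el x \<and> z : el y} : Lcls" by (rule Lcls_sep) (use x b Lh_Lcls in \<open>auto intro!: dintro\<close>)
  moreover have "{z : el (Lh b). EX y:Lcls. y : el x \<and> z : el y} = \<Union>(el ` el x)"
    using b is_trans_Lh[OF b(1)] Lcls_trans[OF x] unfolding is_trans_def by blast
  ultimately show ?thesis by (simp add: Uni_def)
qed

lemma Lcls_Pow: assumes x: "x : Lcls" shows "mk {y : Lcls. el y <= el x} : Lcls"
proof -
  interpret K: carrier Lcls by (rule Lcls_carrier)
  have "pow x : A" using powersetA x Lcls_sub by (auto simp: pow_def)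
  from Lcls_Lh_bound[OF this] obtain b where b: "b : A" "Ord b" "ALL y:el (pow x). y : Lcls --> y : el (Lh b)" by blast
  have "mk {y : el (Lh b). ALL z:Lcls. z : el y --> z : el x} : Lcls"
    by (rule Lcls_sep) (use x b Lh_Lcls in \<open>auto intro!: dintro\<close>)
  moreover have "y : el (Lh b) \<and> (ALL z:Lcls. z : el y --> z : el x) \<longleftrightarrow> y : Lcls \<and> el y <= el x" for y
    using Lcls_I[OF b(1,2)] Lcls_trans[of y] Lcls_sub b(3) by auto
  ultimately show ?thesis by simp
qed

lemma Lcls_replacement:
  assumes R: "dpred Lcls (%e. R (e 0) (e 1))" and x: "x : Lcls" and u: "!!a. a : el x ==> EX! b. b : Lcls \<and> R a b"
  shows "EX y:Lcls. ALL a:el x. EX b:el y. R a b"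
proof -
  obtain R' where R': "dpred A (%e. R' (e 0) (e 1))" "ALL x:Lcls. ALL y:Lcls. R x y \<longleftrightarrow> R' x y" using dpred_rel_Lcls[OF R] by blast
  have "dpred A (%e. e 1 : Lcls \<and> R' (e 0) (e 1))" by (intro dintro R')
  moreover have "EX b:A. b : Lcls \<and> R' a b" if "a : el x" for a using u[OF that] R' Lcls_sub Lcls_trans[OF x that] by blast
  ultimately have "EX Y:A. ALL a:el x. EX b:el Y. b : Lcls \<and> R' a b" using x Lcls_sub by (intro collection) auto
  then obtain Y where Y: "Y : A" "ALL a:el x. EX b:el Y. b : Lcls \<and> R' a b" by blast
  from Lcls_Lh_bound[OF Y(1)] obtain b where b: "b : A" "Ord b" "ALL y:el Y. y : Lcls --> y : el (Lh b)" by blast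
  then show ?thesis using Y(2) Lh_Lcls R'(2) Lcls_trans[OF x] by (intro bexI[of _ "Lh b"]) blast+
qed

theorem Lcls_zf: "zf Lcls"
proof -
  interpret K: carrier Lcls by (rule Lcls_carrier)
  show ?thesis
  proof unfold_locales
    show "omega : Lcls" by (rule Ord_Lcls) auto
    show "countable Lcls" using Lcls_sub countable_subset_A by blast
  qed (fact Lcls_trans Lcls_upair Lcls_Uni Lcls_Pow Lcls_sep Lcls_replacement)+
qed

end

section \<open>The definable well-order of L\<close>

definition max_diff :: "('a => 'a => bool) => 'a set => 'a set => bool" where
  "max_diff r s t \<longleftrightarrow> (EX z:t. z ~: s \<and> (ALL w:s. r z w --> w : t) \<and> (ALL w:t. r z w --> w : s))"

lemma wfp_on_ex_minimal: "wfp_on Y r ==> Q <= Y ==> Q ~= {} ==> EX m:Q. ALL y:Q. \<not> r y m"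
  unfolding wfp_on_iff_ex_minimal by meson

lemma wfp_onI_minimal: "(!!Q. Q <= Y ==> Q ~= {} ==> EX m:Q. ALL y:Q. \<not> r y m) ==> wfp_on Y r"
  unfolding wfp_on_iff_ex_minimal by meson

lemma wfp_on_iff_wf: "wfp_on Y r \<longleftrightarrow> wf {(x, y). x : Y \<and> y : Y \<and> r x y}"
  by (subst wfp_on_iff_wfp, unfold wfp_def, rule arg_cong[of _ _ wf]) auto

lemma wfp_on_max_diff: assumes "totalp_on Y r" "wfp_on Y r" shows "wfp_on {s. finite s \<and> s <= Y} (max_diff r)"
proof -
  let ?R = "{(x, y). x : Y \<and> y : Y \<and> r x y}"
  have "wf (inv_image (mult ?R) mset_set)" using assms(2) unfolding wfp_on_iff_wf by (intro wf_inv_image wf_mult)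
  moreover have "{(s, t). s : {s. finite s \<and> s <= Y} \<and> t : {s. finite s \<and> s <= Y} \<and> max_diff r s t} <= inv_image (mult ?R) mset_set"
  proof clarify
    fix s t assume st: "finite s" "s <= Y" "finite t" "t <= Y" "max_diff r s t"
    then obtain z where z: "z : t" "z ~: s" "!!w. w : s ==> r z w ==> w : t" unfolding max_diff_def by blast
    have "(mset_set (s Int t) + mset_set (s - t), mset_set (s Int t) + mset_set (t - s)) : mult ?R"
    proof (rule one_step_implies_mult)
      show "mset_set (t - s) ~= {#}" using z st by (auto simp: mset_set_empty_iff)
      show "ALL k:set_mset (mset_set (s - t)). EX j:set_mset (mset_set (t - s)). (k, j) : ?R"
      proof
        fix k assume "k : set_mset (mset_set (s - t))"
        then have k: "k : s" "k ~: t" using st by auto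
        then have "r k z" using z assms(1) st unfolding totalp_on_def by (metis subsetD)
        then show "EX j:set_mset (mset_set (t - s)). (k, j) : ?R" using z st k by auto
      qed
    qed
    moreover have "mset_set (s Int t) + mset_set (s - t) = mset_set s"
      using st by (subst mset_set_Union[symmetric]) (auto intro!: arg_cong[of _ _ mset_set])
    moreover have "mset_set (s Int t) + mset_set (t - s) = mset_set t"
      using st by (subst mset_set_Union[symmetric]) (auto intro!: arg_cong[of _ _ mset_set])
    ultimately show "(s, t) : inv_image (mult ?R) mset_set" by simp
  qed
  ultimately show ?thesis unfolding wfp_on_iff_wf by (rule wf_subset)
qed

lemma totalp_on_max_diff: assumes "totalp_on Y r" "wfp_on Y r" shows "totalp_on {s. finite s \<and> s <= Y} (max_diff r)"
  unfolding totalp_on_def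
proof (intro ballI impI)
  fix s t assume st: "s : {s. finite s \<and> s <= Y}" "t : {s. finite s \<and> s <= Y}" "s ~= t"
  let ?D = "(s - t) Un (t - s)"
  let ?R = "{(x, y). x : ?D \<and> y : ?D \<and> r x y}"
  have "finite ?R" by (rule finite_subset[of _ "?D \<times> ?D"]) (use st in auto)
  moreover have "acyclic ?R" by (rule wf_acyclic, rule wf_subset[OF assms(2)[unfolded wfp_on_iff_wf]]) (use st in auto)
  ultimately have "wf (?R\<inverse>)" by (rule finite_acyclic_wf_converse)
  moreover obtain d where "d : ?D" using st by blast
  ultimately obtain z where z: "z : ?D" "!!y. (y, z) : ?R\<inverse> ==> y ~: ?D" using wfE_min[of "?R\<inverse>" d ?D] by blast
  have z2: "\<not> r z w" if "w : ?D" for w using z(1) z(2)[of w] that by auto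
  show "max_diff r s t \<or> max_diff r t s"
  proof (cases "z : t")
    case True
    then have "max_diff r s t" unfolding max_diff_def using z z2 by blast
    then show ?thesis ..
  next
    case False
    then have "max_diff r t s" unfolding max_diff_def using z z2 by blast
    then show ?thesis ..
  qed
qed

lemma wfp_on_lex: assumes "wfp_on Y r" "wfp_on Z q" shows "wfp_on (Y \<times> Z) (%a b. r (fst a) (fst b) \<or> fst a = fst b \<and> q (snd a) (snd b))"
proof -
  have "wf ({(x, y). x : Y \<and> y : Y \<and> r x y} <*lex*> {(x, y). x : Z \<and> y : Z \<and> q x y})"
    using assms unfolding wfp_on_iff_wf by (rule wf_lex_prod)
  then show ?thesis unfolding wfp_on_iff_wf by (rule wf_subset) auto
qed

lemma least_key_wellorder:
  assumes total: "totalp_on K l" and wf: "wfp_on K l"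
    and keyset: "!!x. x : X ==> keyset x <= K \<and> keyset x ~= {}" "!!x y k. k : keyset x ==> k : keyset y ==> x = y"
    and q: "!!x y. x : X ==> y : X ==> q x y \<longleftrightarrow> (EX k:keyset x. ALL k':keyset y. l k k')"
  shows "totalp_on X q \<and> wfp_on X q"
proof
  show "totalp_on X q"
  proof (rule totalp_onI)
    fix x y assume xy: "x : X" "y : X" "x ~= y"
    have less: "q x y" if xy: "x : X" "y : X" "x ~= y" and k: "k : keyset x" "ALL k':keyset x Un keyset y. \<not> l k' k" for x y k
    proof -
      have "l k k'" if "k' : keyset y" for k'
        using totalp_onD[OF total, of k k'] keyset xy k that by blast
      then show ?thesis unfolding q[OF xy(1,2)] using k(1) by blast
    qed
    have "keyset x Un keyset y <= K" "keyset x Un keyset y ~= {}" using keyset(1) xy by blast+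
    from wfp_on_ex_minimal[OF wf this] obtain k where "k : keyset x Un keyset y" "ALL k':keyset x Un keyset y. \<not> l k' k" by blast
    then show "q x y \<or> q y x" using less[OF xy, of k] less[of y x k] xy by blast
  qed
  show "wfp_on X q"
  proof (rule wfp_onI_minimal)
    fix Q assume Q: "Q <= X" "Q ~= {}"
    have sub: "\<Union>(keyset ` Q) <= K" using keyset(1) Q(1) by (intro UN_least) blast
    obtain y where "y : Q" using Q(2) by blast
    then have "keyset y ~= {}" using keyset(1) Q(1) by blast
    then have "\<Union>(keyset ` Q) ~= {}" using \<open>y : Q\<close> by blast
    from wfp_on_ex_minimal[OF wf sub this] obtain k where "k : \<Union>(keyset ` Q)" "ALL k':\<Union>(keyset ` Q). \<not> l k' k" by blast
    then obtain x where x: "x : Q" "k : keyset x" and min: "ALL y:Q. ALL k':keyset y. \<not> l k' k" by blast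
    have "\<not> q y x" if "y : Q" for y using min x that Q(1) q by blast
    then show "EX m:Q. ALL y:Q. \<not> q y m" using x(1) by blast
  qed
qed

abbreviation max_diff_el where "max_diff_el r s t \<equiv> max_diff r (el s) (el t)"

locale L_model = zf +
  assumes VL: "x : A ==> EX a:A. Ord a \<and> x : el (Lh a)"
begin

definition Lrank where "Lrank x = least_ord (%a. x : el (Defpow (Lh a)))"

lemma Lrank_ex: "x : A ==> EX a:A. Ord a \<and> x : el (Defpow (Lh a))"
  using VL[of x] el_Lh Ord_in Atrans by blast

lemma Lrank: assumes "x : A" shows "Ord (Lrank x)" "x : el (Defpow (Lh (Lrank x)))" "Lrank x : A"
  "!!a. a : A ==> Ord a ==> x : el (Defpow (Lh a)) ==> Lrank x = a \<or> Lrank x : el a"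
proof -
  obtain b where b: "b : A" "Ord b" "x : el (Defpow (Lh b))" using Lrank_ex[OF assms] by blast
  note o = least_ord[of "%a. x : el (Defpow (Lh a))", OF b(3,2), folded Lrank_def]
  show ord: "Ord (Lrank x)" "x : el (Defpow (Lh (Lrank x)))" using o by auto
  show least: "Lrank x = a \<or> Lrank x : el a" if "a : A" "Ord a" "x : el (Defpow (Lh a))" for a
    using o(3)[of a] that Ord_linear[OF ord(1) that(2)] by blast
  show "Lrank x : A" using least[OF b] b Atrans by blast
qed

lemma dterm_Lrank[dintro]: "dterm A t ==> dterm A (%e. Lrank (t e))"
  by (rule dterm_comp1[where f=Lrank], unfold Lrank_def, rule dterm_least_ord) (intro dintro, use Lrank_ex in auto)

lemma Lrank_Lh: "a : A ==> Ord a ==> x : el (Lh a) ==> x : A \<and> Lrank x : el a"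
proof -
  assume a: "a : A" "Ord a" "x : el (Lh a)"
  then obtain b where b: "b : el a" "x : el (Defpow (Lh b))" using el_Lh by blast
  then have "b : A" "Ord b" "x : A" using a Atrans Ord_in LhA by blast+
  then show ?thesis using Lrank(4)[of x b] b a Ord_trans by blast
qed

definition less_via where "less_via f x y \<longleftrightarrow> Lrank x : el (Lrank y) \<or> Lrank x = Lrank y \<and> pair x y : el (app f (Lrank x))"
definition pair_less where "pair_less r u v \<longleftrightarrow> r (pr2 u) (pr2 v) \<or> pr2 u = pr2 v \<and> pr1 u : el (pr1 v)"
definition def_less where "def_less r c s c' s' \<longleftrightarrow> r c c' \<or> c = c' \<and> max_diff_el (pair_less r) s s'"
definition key_less where "key_less r X x y \<longleftrightarrow> (EX c:el X. EX s:el (mk (asgs X)). x = defset X c s \<and>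
   (ALL c':el X. ALL s':el (mk (asgs X)). y = defset X c' s' --> def_less r c s c' s'))"
definition stage_less where "stage_less r a x y \<longleftrightarrow> Lrank x = a \<and> Lrank y = a \<and>
   (a : el omega \<and> max_diff_el r x y \<or> a ~: el omega \<and> key_less r (Lh a) x y)"
definition less_step where "less_step a f = mk {z : el (prd (Defpow (Lh a)) (Defpow (Lh a))). stage_less (less_via f) a (pr1 z) (pr2 z)}"
definition less_rec where "less_rec = recF less_step"
definition less_L where "less_L x y \<longleftrightarrow> Lrank x : el (Lrank y) \<or> Lrank x = Lrank y \<and> pair x y : el (less_rec (Lrank x))"

lemma dterm_less_rec[dintro]: "dterm A t ==> dterm A (%e. less_rec (t e))"
  unfolding less_rec_def
  by (rule dterm_recF[where H="%p. less_step" and s=t],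
      unfold less_step_def stage_less_def key_less_def def_less_def max_diff_def pair_less_def less_via_def) (intro dintro omegaA)+

lemma dpred_less_L[dintro]: "dterm A s ==> dterm A t ==> dpred A (%e. less_L (s e) (t e))"
  by (rule dpred_comp2[where Q=less_L], unfold less_L_def) (intro dintro)+

lemma less_via_less_rec: "Lrank x : el a ==> less_via (lam (tc a) less_rec) x y \<longleftrightarrow> less_L x y"
  unfolding less_via_def less_L_def by (simp add: TC_el)

lemma less_L_stage: "x : A ==> y : A ==> less_L x y \<longleftrightarrow> Lrank x : el (Lrank y) \<or> stage_less (less_via (lam (tc (Lrank x)) less_rec)) (Lrank x) x y"
proof -
  assume xy: "x : A" "y : A"
  have "el (less_rec a) = {z : el (prd (Defpow (Lh a)) (Defpow (Lh a))). stage_less (less_via (lam (tc a) less_rec)) a (pr1 z) (pr2 z)}" for a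
    unfolding less_rec_def by (subst recF) (simp only: less_step_def el_Collect)
  then have "pair x y : el (less_rec (Lrank x)) \<longleftrightarrow> stage_less (less_via (lam (tc (Lrank x)) less_rec)) (Lrank x) x y" if "Lrank x = Lrank y"
    using Lrank(2)[OF xy(1)] Lrank(2)[OF xy(2)] that by (simp add: el_prd)
  moreover have "stage_less r (Lrank x) x y ==> Lrank x = Lrank y" for r unfolding stage_less_def by simp
  ultimately show ?thesis unfolding less_L_def by blast
qed

lemma upair_Lh: assumes "b : A" "x : el (Lh b)" "y : el (Lh b)" shows "upair x y : el (Lh (succ b))"
proof -
  interpret X: carrier "el (Lh b)" using assms by unfold_locales blast
  have "mk {z : el (Lh b). z = x \<or> z = y} : el (Defpow (Lh b))"
    using assms is_trans_Lh by (intro DefpowI dintro) auto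
  moreover have "{z : el (Lh b). z = x \<or> z = y} = {x, y}" using assms by auto
  ultimately show ?thesis using Lh_succ[OF assms(1)] by (simp add: upair_def)
qed

lemma limit_omega: "limit omega" unfolding limit_def by (auto intro: range_eqI[of _ _ 0] range_eqI[of _ _ "Suc _"])

lemma pair_limit: assumes a: "limit a" "a : A" "x : el (Lh a)" "y : el (Lh a)" shows "pair x y : el (Lh a)"
proof -
  have u: "upair x y : el (Lh a)" if xy: "x : el (Lh a)" "y : el (Lh a)" for x y
  proof -
    obtain b where b: "b : el a" "{x, y} <= el (Lh b)" using Lh_limit_finite[OF a(1,2), of "{x,y}"] xy by auto
    then have "upair x y : el (Lh (succ b))" using upair_Lh[of b x y] a Atrans by auto
    then show ?thesis using Lh_mono[of a "succ b"] a b unfolding limit_def by blast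
  qed
  show ?thesis unfolding pair_def using u a by blast
qed

lemma code_Lh: "code \<phi> : el (Lh omega)"
proof -
  have "vn n : el (Lh omega)" for n
  proof -
    have "vn n : el (Lh (vn (Suc n)))" using Ord_Defpow[of "vn n"] Lh_succ[of "vn n"] by simp
    moreover have "vn (Suc n) : el omega" by (simp del: vn.simps)
    ultimately show ?thesis using Lh_mono[OF omegaA] by blast
  qed
  then show ?thesis by (induction \<phi>) (auto intro!: pair_limit limit_omega simp del: vn.simps)
qed

lemma finite_Lh: "finite (el (Lh (vn n)))"
proof (induction n)
  case 0 then show ?case by (simp add: el_Lh)
next
  case (Suc n)
  have "el ` el (Defpow (Lh (vn n))) <= Pow (el (Lh (vn n)))" using Defpow_Pow[OF LhA[OF vnA]] by blast
  then have "finite (el ` el (Defpow (Lh (vn n))))" using Suc finite_subset by blast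
  then have "finite (el (Defpow (Lh (vn n))))" by (rule finite_imageD) (auto intro: inj_onI ext_el)
  then show ?case using Lh_succ[of "vn n"] by simp
qed

context
  fixes a r
  assumes a: "a : A" "Ord a" and total: "totalp_on (el (Lh a)) r" and wf: "wfp_on (el (Lh a)) r"
begin

lemma stage_wellorder_finite: assumes "a : el omega"
  shows "totalp_on {x : A. Lrank x = a} (stage_less r a) \<and> wfp_on {x : A. Lrank x = a} (stage_less r a)"
proof
  let ?F = "{s. finite s \<and> s <= el (Lh a)}"
  obtain n where n: "a = vn n" using assms by auto
  have sub: "el x : ?F" if "x : A" "Lrank x = a" for x
  proof -
    have "el x <= el (Lh a)" using Defpow_Pow[OF LhA[OF a(1)]] Lrank(2)[OF that(1)] that(2) by simp
    then show ?thesis using finite_subset[OF _ finite_Lh[of n]] n by simp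
  qed
  have st: "stage_less r a x y \<longleftrightarrow> max_diff_el r x y" if "Lrank x = a" "Lrank y = a" for x y unfolding stage_less_def using assms that by blast
  show "totalp_on {x : A. Lrank x = a} (stage_less r a)"
  proof (rule totalp_onI)
    fix x y assume xy: "x : {x : A. Lrank x = a}" "y : {x : A. Lrank x = a}" "x ~= y"
    then have "el x ~= el y" using ext_el by blast
    then have "max_diff_el r x y \<or> max_diff_el r y x" using totalp_onD[OF totalp_on_max_diff[OF total wf] sub sub] xy by blast
    then show "stage_less r a x y \<or> stage_less r a y x" using st xy by blast
  qed
  show "wfp_on {x : A. Lrank x = a} (stage_less r a)"
    by (rule wfp_on_mono_stronger[OF wfp_on_max_diff[OF total wf], of el]) (use sub st in blast)+
qed

lemma pair_less_wellorder:
  shows "totalp_on {pair (vn i) b |i b. b : el (Lh a)} (pair_less r)" "wfp_on {pair (vn i) b |i b. b : el (Lh a)} (pair_less r)"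
proof -
  show "totalp_on {pair (vn i) b |i b. b : el (Lh a)} (pair_less r)"
  proof (rule totalp_onI)
    fix u v assume "u : {pair (vn i) b |i b. b : el (Lh a)}" "v : {pair (vn i) b |i b. b : el (Lh a)}" "u ~= v"
    then obtain i b j c where "u = pair (vn i) b" "v = pair (vn j) c" "b : el (Lh a)" "c : el (Lh a)" "i ~= j \<or> b ~= c" by auto
    then show "pair_less r u v \<or> pair_less r v u" using total unfolding totalp_on_def pair_less_def by (auto simp: vn_mem)
  qed
  have "wfp_on UNIV (%x y. x : el y)" unfolding wfp_on_iff_wf using wf_mem by simp
  from wfp_on_lex[OF wf this] show "wfp_on {pair (vn i) b |i b. b : el (Lh a)} (pair_less r)"
    by (rule wfp_on_mono_stronger[of _ _ "%u. (pr2 u, pr1 u)"]) (auto simp: pair_less_def)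
qed

lemma el_asgs_finite: "s : asgs (Lh a) ==> el s : {s. finite s \<and> s <= {pair (vn i) b |i b. b : el (Lh a)}}"
  unfolding asgs_def by (auto simp: el_asg image_subset_iff)

lemma def_less_wellorder:
  fixes K l defines "K \<equiv> el (Lh a) \<times> asgs (Lh a)" and "l \<equiv> %k k'. def_less r (fst k) (snd k) (fst k') (snd k')"
  shows "totalp_on K l" "wfp_on K l"
proof -
  show "totalp_on K l"
  proof (rule totalp_onI)
    fix k k' assume k: "k : K" "k' : K" "k ~= k'"
    show "l k k' \<or> l k' k"
    proof (cases "fst k = fst k'")
      case True
      then have "el (snd k) ~= el (snd k')" using k ext_el prod_eqI by blast
      then have "max_diff_el (pair_less r) (snd k) (snd k') \<or> max_diff_el (pair_less r) (snd k') (snd k)"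
        using totalp_onD[OF totalp_on_max_diff[OF pair_less_wellorder] el_asgs_finite el_asgs_finite] k by (auto simp: K_def mem_Times_iff)
      then show ?thesis using True unfolding l_def def_less_def by metis
    next
      case False
      then show ?thesis using totalp_onD[OF total, of "fst k" "fst k'"] k by (auto simp: K_def l_def def_less_def mem_Times_iff)
    qed
  qed
  show "wfp_on K l"
    by (rule wfp_on_mono_stronger[OF wfp_on_lex[OF wf wfp_on_max_diff[OF pair_less_wellorder]], of "%k. (fst k, el (snd k))"])
       (rule image_subsetI, unfold K_def mem_Times_iff fst_conv snd_conv, use el_asgs_finite in blast, simp add: l_def def_less_def)
qed

lemma stage_wellorder_infinite: assumes "a ~: el omega"
  shows "totalp_on {x : A. Lrank x = a} (stage_less r a) \<and> wfp_on {x : A. Lrank x = a} (stage_less r a)"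
proof -
  have XA: "Lh a : A" using a by simp
  have el_asgs: "el (mk (asgs (Lh a))) = asgs (Lh a)" using countable_asgs[OF XA] by simp
  let ?K = "el (Lh a) \<times> asgs (Lh a)"
  define keyset where "keyset x = {k : ?K. x = defset (Lh a) (fst k) (snd k)}" for x
  show ?thesis
  proof (rule least_key_wellorder[OF def_less_wellorder])
    fix x assume x: "x : {x : A. Lrank x = a}"
    then have "x : el (Defpow (Lh a))" using Lrank(2) by blast
    then obtain \<phi> s where s: "x = defset (Lh a) (code \<phi>) s" "s : asgs (Lh a)" unfolding el_Defpow[OF XA] Defpow_code[OF XA] by blast
    have "el (Lh omega) <= el (Lh a)" using Ord_linear[of a omega] a assms Lh_mono[of a omega] by auto
    then have "(code \<phi>, s) : keyset x" unfolding keyset_def using s code_Lh by auto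
    then show "keyset x <= ?K \<and> keyset x ~= {}" unfolding keyset_def by blast
    fix y assume "y : {x : A. Lrank x = a}"
    then show "stage_less r a x y \<longleftrightarrow> (EX k:keyset x. ALL k':keyset y. def_less r (fst k) (snd k) (fst k') (snd k'))"
      unfolding stage_less_def key_less_def keyset_def el_asgs using assms x by fastforce
  qed (auto simp: keyset_def)
qed

end

lemma less_L_glue: assumes "Y <= A" "!!b. b : Lrank ` Y ==> totalp_on {x : A. Lrank x = b} less_L \<and> wfp_on {x : A. Lrank x = b} less_L"
  shows "totalp_on Y less_L \<and> wfp_on Y less_L"
proof
  show "totalp_on Y less_L" unfolding totalp_on_def
  proof (intro ballI impI)
    fix x y assume xy: "x : Y" "y : Y" "x ~= y"
    show "less_L x y \<or> less_L y x"
    proof (cases "Lrank x = Lrank y")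
      case True
      have "totalp_on {z : A. Lrank z = Lrank x} less_L" using assms(2)[of "Lrank x"] xy by simp
      moreover have "x : {z : A. Lrank z = Lrank x}" "y : {z : A. Lrank z = Lrank x}" using True xy assms(1) by auto
      ultimately show ?thesis using xy(3) unfolding totalp_on_def by blast
    next
      case False then show ?thesis using Ord_linear[of "Lrank x" "Lrank y"] Lrank(1) assms(1) xy unfolding less_L_def by blast
    qed
  qed
  show "wfp_on Y less_L"
  proof (rule wfp_onI_minimal)
    fix Q assume Q: "Q <= Y" "Q ~= {}"
    then obtain x0 where "x0 : Q" by blast
    then obtain b where b: "b : Lrank ` Q" "!!c. c : el b ==> c ~: Lrank ` Q"
      using wfE_min[OF wf_mem, of "Lrank x0" "Lrank ` Q"] by auto
    have "{x : Q. Lrank x = b} <= {x : A. Lrank x = b}" "{x : Q. Lrank x = b} ~= {}" using Q assms b by auto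
    moreover have "wfp_on {x : A. Lrank x = b} less_L" using assms Q b by blast
    ultimately obtain m where m: "m : Q" "Lrank m = b" "ALL y:{x : Q. Lrank x = b}. \<not> less_L y m"
      using wfp_on_ex_minimal[of "{x : A. Lrank x = b}" less_L "{x : Q. Lrank x = b}"] by blast
    have "\<not> less_L y m" if y: "y : Q" for y
    proof
      assume "less_L y m"
      then have "Lrank y : el b \<or> Lrank y = b" unfolding less_L_def using m by auto
      then show False using b(2) m(3) y \<open>less_L y m\<close> by blast
    qed
    then show "EX m:Q. ALL y:Q. \<not> less_L y m" using m by blast
  qed
qed

lemma less_L_stages: "a : A ==> Ord a ==> totalp_on {x : A. Lrank x = a} less_L \<and> wfp_on {x : A. Lrank x = a} less_L"
proof (induction a rule: el_induct)
  case (step a)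
  have LA: "x : A \<and> Lrank x : el a" if "x : el (Lh a)" for x using Lrank_Lh step that by blast
  have "totalp_on (el (Lh a)) less_L \<and> wfp_on (el (Lh a)) less_L"
    by (rule less_L_glue) (use LA step Ord_in Atrans in blast)+
  then have "totalp_on (el (Lh a)) (less_via (lam (tc a) less_rec))" "wfp_on (el (Lh a)) (less_via (lam (tc a) less_rec))"
    using less_via_less_rec LA by (auto elim!: totalp_on_mono_strong wfp_on_mono_strong)
  then have "totalp_on {x : A. Lrank x = a} (stage_less (less_via (lam (tc a) less_rec)) a) \<and> wfp_on {x : A. Lrank x = a} (stage_less (less_via (lam (tc a) less_rec)) a)"
    using stage_wellorder_finite[OF step(2,3)] stage_wellorder_infinite[OF step(2,3)] by blast
  moreover have "stage_less (less_via (lam (tc a) less_rec)) a x y \<longleftrightarrow> less_L x y" if "x : A" "y : A" "Lrank x = a" "Lrank y = a" for x y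
    using less_L_stage that by auto
  ultimately show ?case by (auto elim!: totalp_on_mono_strong wfp_on_mono_strong)
qed

theorem less_L_wellorder: "totalp_on A less_L" "wfp_on A less_L"
proof -
  have "totalp_on A less_L \<and> wfp_on A less_L" by (rule less_L_glue) (use less_L_stages Lrank in auto)
  then show "totalp_on A less_L" "wfp_on A less_L" by auto
qed

definition least_L where "least_L Q = (THE x. x : A \<and> Q x \<and> (ALL y:A. Q y --> \<not> less_L y x))"

lemma least_L_ex1: assumes "x : A" "Q x" shows "EX! x. x : A \<and> Q x \<and> (ALL y:A. Q y --> \<not> less_L y x)"
proof -
  obtain m where "m : {x : A. Q x}" "ALL y:{x : A. Q x}. \<not> less_L y m"
    using wfp_on_ex_minimal[OF less_L_wellorder(2), of "{x : A. Q x}"] assms by blast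
  then show ?thesis using less_L_wellorder(1) unfolding totalp_on_def by blast
qed

lemma least_L: assumes "x : A" "Q x" shows "least_L Q : A" "Q (least_L Q)" "y : A ==> Q y ==> \<not> less_L y (least_L Q)"
  using theI'[OF least_L_ex1[of x Q, OF assms]] unfolding least_L_def by blast+

lemma least_L_eq: assumes "x : A" "Q x" "!!y. y : A ==> Q y ==> \<not> less_L y x" shows "least_L Q = x"
  unfolding least_L_def using least_L_ex1[of x Q, OF assms(1,2)] by (rule the1_equality) (use assms in blast)

lemma dterm_least_L: assumes Q: "dpred A (%e. Q (%n. e (Suc n)) (e 0))" and ex: "!!e. range e <= A ==> EX x:A. Q e x"
  shows "dterm A (%e. least_L (Q e))"
proof -
  have Q2: "dpred A (%e. Q (%n. e (Suc (Suc n))) (e 0))"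
    using dpred_ren[OF Q inj_skip1] by simp
  have "dpred A (%e. Q (%n. e (Suc n)) (e 0) \<and> (ALL y:A. Q (%n. e (Suc n)) y --> \<not> less_L y (e 0)))"
    by (intro dintro Q Q2)
  then have "dpred A (%e. e 0 = least_L (Q (%n. e (Suc n))))"
  proof (rule dpred_cong)
    fix e :: "nat => hset" assume e: "range e <= A"
    then obtain x where "x : A" "Q (%n. e (Suc n)) x" using ex[of "%n. e (Suc n)"] by auto
    from least_L_eq[of "e 0" "Q (%n. e (Suc n))"] least_L[of x "Q (%n. e (Suc n))", OF this]
    show "(Q (%n. e (Suc n)) (e 0) \<and> (ALL y:A. Q (%n. e (Suc n)) y --> \<not> less_L y (e 0))) =
       (e 0 = least_L (Q (%n. e (Suc n))))" using e by (metis range_subsetD)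
  qed
  moreover have "least_L (Q e) : A" if e: "range e <= A" for e using ex[OF e] least_L(1) by blast
  ultimately show ?thesis by (simp add: dterm_def)
qed

end

lemma (in zf) Lcls_L_model: "L_model Lcls"
proof -
  interpret K: zf Lcls by (rule Lcls_zf)
  show ?thesis by unfold_locales (use Lcls_Ex Ord_Lcls in blast)
qed

section \<open>Set forcing\<close>

definition val_step where "val_step G x f = mk ((%z. app f (pr1 z)) ` {z : el x. (EX s p. z = pair s p \<and> p : G)})"
definition val :: "hset set => hset => hset" where "val G = recF (val_step G)"

lemma countable_val: "countable {val G s |s p. p : G \<and> pair s p : el x}"
  by (rule countable_subset[of _ "(%z. val G (pr1 z)) ` el x"]) force+

lemma el_val: "el (val G x) = {val G s |s p. p : G \<and> pair s p : el x}"
proof -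
  have "(%z. app (lam (tc x) (recF (val_step G))) (pr1 z)) ` {z : el x. (EX s p. z = pair s p \<and> p : G)} =
     {val G s |s p. p : G \<and> pair s p : el x}" (is "?L = ?R")
  proof (intro set_eqI iffI)
    fix y assume "y : ?L"
    then obtain s p where "pair s p : el x" "p : G" "y = app (lam (tc x) (recF (val_step G))) s" by auto
    moreover have "s : TC x" using calculation pair_el_TC by blast
    ultimately show "y : ?R" by (auto simp: val_def)
  next
    fix y assume "y : ?R"
    then obtain s p where s: "pair s p : el x" "p : G" "y = val G s" by auto
    moreover have "s : TC x" using calculation pair_el_TC by blast
    ultimately have "y = app (lam (tc x) (recF (val_step G))) (pr1 (pair s p))" by (simp add: val_def)
    then show "y : ?L" using s by blast
  qed
  moreover have "val G x = mk ?L" unfolding val_def by (subst recF) (simp only: val_step_def)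
  ultimately show ?thesis using countable_val[of G x] by simp
qed

definition chk where "chk o1 = recF (%x f. mk ((%y. pair (app f y) o1) ` el x))"

lemma el_chk: "el (chk o1 x) = (%y. pair (chk o1 y) o1) ` el x"
  unfolding chk_def by (subst recF) (auto simp: TC_el)

lemma val_chk: "o1 : G ==> val G (chk o1 x) = x"
proof (induction x rule: el_induct)
  case (step x)
  have "el (val G (chk o1 x)) = {val G (chk o1 y) |y. y : el x}" using step(2) by (auto simp: el_val el_chk)
  also have "... = el x"
  proof -
    have "val G (chk o1 y) = y" if "y : el x" for y using step that by blast
    then have "(%y. val G (chk o1 y)) ` el x = el x" by simp
    moreover have "{val G (chk o1 y) |y. y : el x} = (%y. val G (chk o1 y)) ` el x" by blast
    ultimately show ?thesis by (simp only:)
  qed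
  finally show ?case by (rule ext_el)
qed

lemma rank_val: "el (rank (val G x)) <= el (rank x)"
proof (induction x rule: TC_induct)
  case (step x)
  show ?case
  proof (rule rank_le)
    fix y assume "y : el (val G x)"
    then obtain s p where s: "pair s p : el x" "y = val G s" by (auto simp: el_val)
    then have "s : TC x" using pair_el_TC by blast
    then have "el (rank y) <= el (rank s)" "rank s : el (rank x)" using step rank_TC s by auto
    then show "rank y : el (rank x)" using Ord_subset[of "rank y" "rank s"] Ord_trans[OF Ord_rank, of "rank s" x "rank y"] by auto
  qed simp
qed

text \<open>\<open>eq_table (pair (pair c r) t) x\<close> maps each \<open>y\<close> in the transitive set \<open>t\<close> to the conditions forcing \<open>x = y\<close>;
  the recursion is on \<open>x\<close> only.\<close>

definition eq_table_step where "eq_table_step P x f = lam (pr2 P) (%y. mk {p : el (pr1 (pr1 P)).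
   (ALL s a. pair s a : el x --> (ALL q:el (pr1 (pr1 P)). pair q p : el (pr2 (pr1 P)) --> pair q a : el (pr2 (pr1 P)) -->
      (EX q':el (pr1 (pr1 P)). pair q' q : el (pr2 (pr1 P)) \<and>
         (EX t b. pair t b : el y \<and> (pair q' b : el (pr2 (pr1 P)) \<and> q' : el (app (app f s) t)))))) \<and>
   (ALL t b. pair t b : el y --> (ALL q:el (pr1 (pr1 P)). pair q p : el (pr2 (pr1 P)) --> pair q b : el (pr2 (pr1 P)) -->
      (EX q':el (pr1 (pr1 P)). pair q' q : el (pr2 (pr1 P)) \<and>
         (EX s a. pair s a : el x \<and> (pair q' a : el (pr2 (pr1 P)) \<and> q' : el (app (app f s) t))))))})"
definition eq_table where "eq_table P = recF (eq_table_step P)"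

context zf
begin

lemma dterm_val[dintro]: "dterm A s ==> dterm A t ==> dterm A (%e. val (el (s e)) (t e))"
  unfolding val_def by (rule dterm_recF[where H="%g. val_step (el g)"], unfold val_step_def)
    ((rule dterm_image[where t="%e. mk {z : el (t e). Q e z}" for t Q, simplified el_Collect], intro dintro, intro dintro), assumption+)

lemma dterm_chk[dintro]: "dterm A s ==> dterm A t ==> dterm A (%e. chk (s e) (t e))"
  unfolding chk_def by (rule dterm_recF[where H="%o1 x f. mk ((%y. pair (app f y) o1) ` el x)"]) (intro dintro)

lemma chkA[simp]: "o1 : A ==> x : A ==> chk o1 x : A"
  by (rule dterm_constD[OF dterm_chk[OF dterm_const dterm_const]])
lemma valA: "g : A ==> x : A ==> val (el g) x : A"
  by (rule dterm_constD[OF dterm_val[OF dterm_const dterm_const]])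

lemma dterm_eq_table[dintro]: "dterm A s ==> dterm A t ==> dterm A (%e. eq_table (s e) (t e))"
  unfolding eq_table_def by (rule dterm_recF[where H=eq_table_step], unfold eq_table_step_def) (intro dintro)+

end

definition le where "le r p q \<longleftrightarrow> pair p q : el r"

locale poset_in = zf +
  fixes c r assumes cA: "c : A" and rA: "r : A"
    and le_refl: "p : el c ==> le r p p"
    and le_trans: "p : el c ==> q : el c ==> s : el c ==> le r p q ==> le r q s ==> le r p s"
    and le_c: "le r p q ==> p : el c \<and> q : el c"
begin

definition forces_eq where "forces_eq t p x y \<longleftrightarrow> p : el (app (eq_table (pair (pair c r) t) x) y)"

definition forces_mem where "forces_mem t p s y \<longleftrightarrow> (EX u b. pair u b : el y \<and> le r p b \<and> forces_eq t p s u)"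
definition forces_has where "forces_has t p x u \<longleftrightarrow> (EX s a. pair s a : el x \<and> le r p a \<and> forces_eq t p s u)"

lemma forces_eq: assumes "y : el t" shows "forces_eq t p x y \<longleftrightarrow> p : el c \<and>
  (ALL s a. pair s a : el x --> (ALL q. le r q p --> le r q a --> (EX q'. le r q' q \<and> forces_mem t q' s y))) \<and>
  (ALL u b. pair u b : el y --> (ALL q. le r q p --> le r q b --> (EX q'. le r q' q \<and> forces_has t q' x u)))"
proof -
  let ?P = "pair (pair c r) t" and ?f = "lam (tc x) (eq_table (pair (pair c r) t))"
  have "app (eq_table ?P x) y = mk {p : el c.
   (ALL s a. pair s a : el x --> (ALL q:el c. pair q p : el r --> pair q a : el r -->
      (EX q':el c. pair q' q : el r \<and> (EX t b. pair t b : el y \<and> (pair q' b : el r \<and> q' : el (app (app ?f s) t)))))) \<and>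
   (ALL t b. pair t b : el y --> (ALL q:el c. pair q p : el r --> pair q b : el r -->
      (EX q':el c. pair q' q : el r \<and> (EX s a. pair s a : el x \<and> (pair q' a : el r \<and> q' : el (app (app ?f s) t))))))}"
    (is "_ = mk ?D") unfolding eq_table_def by (subst recF, unfold eq_table_step_def sn_opr pr1_pair, subst app_lam) (use assms in simp_all)
  then have el_FE: "el (app (eq_table ?P x) y) = ?D" by (simp only: el_Collect)
  have app_f: "app ?f s = eq_table ?P s" if "pair s a : el x" for s a
    using pair_el_TC(1)[OF that] by simp
  have ball: "(ALL q:el c. pair q p : el r --> Q q) \<longleftrightarrow> (ALL q. le r q p --> Q q)" for p Q using le_c unfolding le_def by blast
  have bex: "(EX q:el c. pair q p : el r \<and> Q q) \<longleftrightarrow> (EX q. le r q p \<and> Q q)" for p Q using le_c unfolding le_def by blast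
  show ?thesis unfolding forces_mem_def forces_has_def forces_eq_def el_FE mem_Collect_eq ball bex unfolding le_def
    by (intro conj_cong iff_allI imp_cong iff_exI HOL.refl) (simp_all only: app_f)
qed

definition forces_no_mem where
  "forces_no_mem t p x y \<longleftrightarrow> (EX s a. pair s a : el x \<and> (le r p a \<and> (ALL q:el c. le r q p --> \<not> forces_mem t q s y)))"
definition forces_no_has where
  "forces_no_has t p x y \<longleftrightarrow> (EX u b. pair u b : el y \<and> (le r p b \<and> (ALL q:el c. le r q p --> \<not> forces_has t q x u)))"

lemma forces_eq_alternatives: assumes y: "y : el t" and p: "p : el c"
  shows "EX d. le r d p \<and> (forces_eq t d x y \<or> forces_no_mem t d x y \<or> forces_no_has t d x y)"
proof (cases "forces_eq t p x y")
  case True then show ?thesis using p le_refl by blast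
next
  case False
  then consider
      s a q where "pair s a : el x" "le r q p" "le r q a" "!!q'. le r q' q ==> \<not> forces_mem t q' s y"
    | u b q where "pair u b : el y" "le r q p" "le r q b" "!!q'. le r q' q ==> \<not> forces_has t q' x u"
    unfolding forces_eq[OF y] using p by blast
  then show ?thesis unfolding forces_no_mem_def forces_no_has_def by cases blast+
qed

lemma forces_eq_mono: assumes "y : el t" "forces_eq t p x y" "le r q p" shows "forces_eq t q x y"
proof -
  have "le r w p" if "le r w q" for w using le_trans assms(3) that le_c by blast
  then show ?thesis using assms le_c[OF assms(3)] unfolding forces_eq[OF assms(1), of p] forces_eq[OF assms(1), of q] by blast
qed

lemma forces_eq_dense: assumes y: "y : el t" and p: "p : el c" and dense: "!!q. le r q p ==> EX q'. le r q' q \<and> forces_eq t q' x y"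
  shows "forces_eq t p x y"
proof -
  have below: "EX d. le r d q \<and> le r d a \<and> forces_eq t d x y" if "le r q p" "le r q a" for q a
    using dense[OF that(1)] that le_trans le_c by blast
  show ?thesis unfolding forces_eq[OF y, of p]
  proof (intro conjI allI impI)
    show "p : el c" by fact
    fix q assume q: "le r q p"
    show "EX q'. le r q' q \<and> forces_mem t q' s y" if s: "pair s a : el x" and a: "le r q a" for s a
    proof -
      obtain d where "le r d q" "le r d a" "forces_eq t d x y" using below[OF q a] by blast
      then show ?thesis using s le_refl le_trans le_c unfolding forces_eq[OF y] by meson
    qed
    show "EX q'. le r q' q \<and> forces_has t q' x u" if u: "pair u b : el y" and b: "le r q b" for u b
    proof -
      obtain d where "le r d q" "le r d b" "forces_eq t d x y" using below[OF q b] by blast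
      then show ?thesis using u le_refl le_trans le_c unfolding forces_eq[OF y] by meson
    qed
  qed
qed

lemma dpred_forces_eq: "dterm A t ==> dterm A p ==> dterm A x ==> dterm A y ==> dpred A (%e. forces_eq (t e) (p e) (x e) (y e))"
  unfolding forces_eq_def by (intro dintro cA rA)

lemma dpred_forces_mem: assumes "t : A" "y : A" shows "dterm A p ==> dterm A s ==> dpred A (%e. forces_mem t (p e) (s e) y)"
  by (rule dpred_comp2[where Q="%p s. forces_mem t p s y"], unfold forces_mem_def le_def) (intro dintro dpred_forces_eq rA assms)+

lemma dpred_forces_has: assumes "t : A" "x : A" shows "dterm A p ==> dterm A u ==> dpred A (%e. forces_has t (p e) x (u e))"
  by (rule dpred_comp2[where Q="%p u. forces_has t p x u"], unfold forces_has_def le_def) (intro dintro dpred_forces_eq rA assms)+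

end

locale generic_in = poset_in +
  fixes G assumes Gc: "G <= el c" and Gne: "G ~= {}"
    and Gup: "p : G ==> le r p q ==> q : G"
    and Gdir: "p : G ==> q : G ==> EX s:G. le r s p \<and> le r s q"
    and Ggen: "D : A ==> el D <= el c ==> (!!p. p : el c ==> EX d:el D. le r d p) ==> G Int el D ~= {}"
begin

lemma Ggen_pred: assumes Q: "dpred A (%e. Q (e 0))" and d: "!!p. p : el c ==> EX d. le r d p \<and> Q d"
  shows "EX p:G. Q p"
proof -
  let ?D = "mk {p : el c. Q p}"
  have "?D : A" by (rule sepA[OF Q cA])
  then have "G Int el ?D ~= {}" using d le_c by (intro Ggen) (auto, blast)
  then show ?thesis by auto
qed

lemma dpred_le[dintro]: "dterm A s ==> dterm A t ==> dpred A (%e. le r (s e) (t e))"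
  unfolding le_def by (intro dintro rA)

lemma Ggen_below: assumes Q: "dpred A (%e. Q (e 0))" and p: "p : G"
  and d: "!!q. le r q p ==> EX d. le r d q \<and> Q d"
  shows "EX q:G. le r q p \<and> Q q"
proof -
  have pA: "p : A" using p Gc el_subA[OF cA] by auto
  let ?R = "%q. (le r q p \<and> Q q) \<or> (ALL s:el c. le r s q --> \<not> le r s p)"
  have "EX q:G. ?R q"
  proof (rule Ggen_pred)
    show "dpred A (%e. ?R (e 0))" by (intro dintro dpred_comp1[OF Q] pA cA)
    fix q assume q: "q : el c"
    show "EX d. le r d q \<and> ?R d"
    proof (cases "EX s. le r s q \<and> le r s p")
      case True
      then obtain s where s: "le r s q" "le r s p" by blast
      then obtain d where "le r d s" "Q d" using d by blast
      then show ?thesis using s le_trans le_c by blast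
    next
      case False then show ?thesis using q le_refl by blast
    qed
  qed
  then obtain q where q: "q : G" "?R q" by blast
  obtain s where "s : G" "le r s q" "le r s p" using Gdir q p by blast
  then have "le r q p \<and> Q q" using q(2) le_c by blast
  then show ?thesis using q by blast
qed

lemma val_subset: assumes p: "p : G"
  and Q: "!!s a. pair s a : el x ==> dpred A (%e. Q s (e 0))"
  and dense: "!!s a q. pair s a : el x ==> le r q p ==> le r q a ==> EX d. le r d q \<and> Q s d"
  and sound: "!!s a q. pair s a : el x ==> q : G ==> Q s q ==> val G s : el (val G y)"
  shows "el (val G x) <= el (val G y)"
proof
  fix z assume "z : el (val G x)"
  then obtain s a where s: "pair s a : el x" "a : G" "z = val G s" by (auto simp: el_val)
  obtain q where q: "q : G" "le r q p" "le r q a" using Gdir p s by blast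
  have "EX d:G. le r d q \<and> Q s d"
  proof (rule Ggen_below[OF Q[OF s(1)] q(1)])
    fix d assume "le r d q"
    then have "le r d p" "le r d a" using q le_trans le_c by blast+
    then show "EX e. le r e d \<and> Q s e" by (rule dense[OF s(1)])
  qed
  then show "z : el (val G y)" using sound[OF s(1)] s(3) by blast
qed

lemma val_mem_forced: assumes z: "z : el (val G y)" and p: "p : G"
  and complete: "!!u b. pair u b : el y ==> z = val G u ==> EX q:G. Q q u"
  and mono: "!!u b q d. pair u b : el y ==> Q q u ==> le r d q ==> Q d u"
  shows "EX q. le r q p \<and> (EX u b. pair u b : el y \<and> le r q b \<and> Q q u)"
proof -
  obtain u b where u: "pair u b : el y" "b : G" "z = val G u" using z by (auto simp: el_val)
  obtain p' where p': "p' : G" "Q p' u" using complete[OF u(1,3)] by blast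
  obtain d where d: "d : G" "le r d p'" "le r d b" using Gdir p' u by blast
  obtain q where q: "le r q d" "le r q p" using Gdir d p by blast
  then have "le r q b" "le r q p'" using d le_trans le_c by blast+
  then show ?thesis using u(1) q(2) mono[OF u(1) p'(2)] by blast
qed

lemma forces_eq_imp_val_eq: assumes x: "x : A" and t: "t : A" and y: "y : el t" and p: "p : G" "forces_eq t p x y"
  and IH: "!!s a u b q. pair s a : el x ==> pair u b : el y ==> q : G ==> forces_eq t q s u ==> val G s = val G u"
  shows "val G x = val G y"
proof (rule ext_el, rule equalityI)
  have yA: "y : A" using y t Atrans by blast
  note F = p(2)[unfolded forces_eq[OF y, of p]]
  show "el (val G x) <= el (val G y)"
  proof (rule val_subset[OF p(1)])
    fix s a assume s: "pair s a : el x"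
    then have "s : A" using x pair_elA by blast
    then show "dpred A (%e. forces_mem t (e 0) s y)" by (intro dintro dpred_forces_mem t yA)
    show "EX d. le r d q \<and> forces_mem t d s y" if "le r q p" "le r q a" for q using F s that by blast
    show "val G s : el (val G y)" if q: "q : G" "forces_mem t q s y" for q
    proof -
      obtain u b where u: "pair u b : el y" "le r q b" "forces_eq t q s u" using q(2) unfolding forces_mem_def by blast
      then show ?thesis using IH[OF s u(1) q(1) u(3)] Gup[OF q(1) u(2)] by (auto simp: el_val)
    qed
  qed
  show "el (val G y) <= el (val G x)"
  proof (rule val_subset[OF p(1)])
    fix u b assume u: "pair u b : el y"
    then have "u : A" using yA pair_elA by blast
    then show "dpred A (%e. forces_has t (e 0) x u)" by (intro dintro dpred_forces_has t x)
    show "EX d. le r d q \<and> forces_has t d x u" if "le r q p" "le r q b" for q using F u that by blast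
    show "val G u : el (val G x)" if q: "q : G" "forces_has t q x u" for q
    proof -
      obtain s a where s: "pair s a : el x" "le r q a" "forces_eq t q s u" using q(2) unfolding forces_has_def by blast
      then show ?thesis using IH[OF s(1) u q(1) s(3), symmetric] Gup[OF q(1) s(2)] unfolding el_val by blast
    qed
  qed
qed

lemma val_eq_imp_forces_eq: assumes x: "x : A" and t: "t : A" and y: "y : el t" and eq: "val G x = val G y"
  and tu: "!!u b. pair u b : el y ==> u : el t"
  and IH: "!!s a u b. pair s a : el x ==> pair u b : el y ==> val G s = val G u ==> EX q:G. forces_eq t q s u"
  shows "EX p:G. forces_eq t p x y"
proof -
  have yA: "y : A" using y t Atrans by blast
  have "EX p:G. forces_eq t p x y \<or> forces_no_mem t p x y \<or> forces_no_has t p x y"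
  proof (rule Ggen_pred)
    show "dpred A (%e. forces_eq t (e 0) x y \<or> forces_no_mem t (e 0) x y \<or> forces_no_has t (e 0) x y)"
      unfolding forces_no_mem_def forces_no_has_def by (intro dintro dpred_forces_mem dpred_forces_has dpred_forces_eq x yA t cA)
  qed (rule forces_eq_alternatives[OF y])
  then obtain p where p: "p : G" "forces_eq t p x y \<or> forces_no_mem t p x y \<or> forces_no_has t p x y" by blast
  have "\<not> forces_no_mem t p x y"
  proof
    assume "forces_no_mem t p x y"
    then obtain s a where s: "pair s a : el x" "le r p a" "!!q. le r q p ==> \<not> forces_mem t q s y"
      unfolding forces_no_mem_def using le_c by blast
    then have "val G s : el (val G y)" using p(1) Gup unfolding eq[symmetric] el_val by blast
    then have "EX q. le r q p \<and> forces_mem t q s y" unfolding forces_mem_def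
      by (rule val_mem_forced[OF _ p(1)]) (use IH[OF s(1)] forces_eq_mono tu in blast)+
    then show False using s(3) by blast
  qed
  moreover have "\<not> forces_no_has t p x y"
  proof
    assume "forces_no_has t p x y"
    then obtain u b where u: "pair u b : el y" "le r p b" "!!q. le r q p ==> \<not> forces_has t q x u"
      unfolding forces_no_has_def using le_c by blast
    then have "val G u : el (val G x)" using p(1) Gup unfolding eq el_val by blast
    then have "EX q. le r q p \<and> forces_has t q x u" unfolding forces_has_def
      by (rule val_mem_forced[OF _ p(1)]) (use IH[OF _ u(1)] forces_eq_mono[OF tu[OF u(1)]] in \<open>metis\<close>)+
    then show False using u(3) by blast
  qed
  ultimately show ?thesis using p by blast
qed

lemma truth: assumes tA: "t : A" and t: "is_trans t"
  shows "x : A ==> y : el t ==> val G x = val G y \<longleftrightarrow> (EX p:G. forces_eq t p x y)"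
proof (induction x arbitrary: y rule: TC_induct)
  case (step x)
  have "TC y <= el t" using t step.prems(2) unfolding is_trans_def by (intro TC_least) auto
  then have tu: "u : el t" if "pair u b : el y" for u b using pair_el_TC that by blast
  have IH: "val G s = val G u \<longleftrightarrow> (EX p:G. forces_eq t p s u)" if "pair s a : el x" "pair u b : el y" for s a u b
  proof -
    have "s : TC x" "s : A" using that pair_el_TC pair_elA step.prems(1) by blast+
    then show ?thesis using step.IH tu[OF that(2)] by blast
  qed
  show ?case
  proof
    assume eq: "val G x = val G y"
    show "EX p:G. forces_eq t p x y" by (rule val_eq_imp_forces_eq[OF step.prems(1) tA step.prems(2) eq tu]) (simp_all add: IH)
  next
    assume "EX p:G. forces_eq t p x y"
    then obtain p where p: "p : G" "forces_eq t p x y" by blast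
    show "val G x = val G y" by (rule forces_eq_imp_val_eq[OF step.prems(1) tA step.prems(2) p]) (simp only: IH, blast)
  qed
qed

lemma is_trans_tc: "is_trans (tc x)" unfolding is_trans_def using TC_el_trans by auto

lemma ex_subset_name: assumes x: "x : A" and w: "w : A" and o1: "o1 : G"
  shows "EX rho:A. el (val G x) Int el w = {y : el w. EX q:G. pair y q : el rho}"
proof -
  let ?t = "tc x"
  have oA: "o1 : A" using o1 Gc el_subA[OF cA] by auto
  let ?Q = "%y q. EX u b. pair u b : el x \<and> (le r q b \<and> forces_eq ?t q (chk o1 y) u)"
  let ?rho = "mk {z : el (prd w c). ?Q (pr1 z) (pr2 z)}"
  have dQ: "dpred A (%e. ?Q (pr1 (e 0)) (pr2 (e 0)))" by (intro dintro dpred_forces_eq x oA tcA)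
  have er: "el ?rho = {z : el (prd w c). ?Q (pr1 z) (pr2 z)}" by (simp only: el_Collect)
  have "?rho : A" by (rule sepA[OF dQ]) (use w cA in simp)
  moreover have "el (val G x) Int el w = {y : el w. EX q:G. pair y q : el ?rho}"
  proof (intro set_eqI iffI)
    fix y assume "y : el (val G x) Int el w"
    then obtain u b where u: "pair u b : el x" "b : G" "y = val G u" and y: "y : el w" by (auto simp: el_val)
    have "val G (chk o1 y) = val G u" using u val_chk[OF o1] by simp
    moreover have "chk o1 y : A" using y w Atrans oA by auto
    moreover have "u : el ?t" using u pair_el_TC by simp
    ultimately obtain p where p: "p : G" "forces_eq ?t p (chk o1 y) u" using truth[OF tcA[OF x] is_trans_tc] by blast
    obtain q where q: "q : G" "le r q p" "le r q b" using Gdir p u by blast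
    then have "forces_eq ?t q (chk o1 y) u" using forces_eq_mono[OF \<open>u : el ?t\<close> p(2)] by blast
    then have "pair y q : el ?rho" unfolding er using u q y Gc by (auto simp: el_prd)
    then show "y : {y : el w. EX q:G. pair y q : el ?rho}" using q y by blast
  next
    fix y assume "y : {y : el w. EX q:G. pair y q : el ?rho}"
    then obtain q u b where u: "y : el w" "q : G" "pair u b : el x" "le r q b" "forces_eq ?t q (chk o1 y) u" unfolding er by auto
    moreover have "chk o1 y : A" using u(1) w Atrans oA by auto
    moreover have "u : el ?t" using u pair_el_TC by simp
    ultimately have "val G (chk o1 y) = val G u" using truth[OF tcA[OF x] is_trans_tc] by blast
    then have "y = val G u" using val_chk[OF o1] by simp
    moreover have "b : G" using u Gup by blast
    ultimately show "y : el (val G x) Int el w" using u by (auto simp: el_val)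
  qed
  ultimately show ?thesis by blast
qed

end

section \<open>The class of conditions\<close>

definition cup where "cup x y = Uni (upair x y)"
lemma el_cup[simp]: "el (cup x y) = el x Un el y" by (auto simp: cup_def)
definition lower where "lower b p = mk {z : el p. rank z : el b}"
definition upper where "upper b p = mk {z : el p. rank z ~: el b}"
lemma el_lower[simp]: "el (lower b p) = {z : el p. rank z : el b}" unfolding lower_def by simp
lemma el_upper[simp]: "el (upper b p) = {z : el p. rank z ~: el b}" unfolding upper_def by simp

definition fiber where "fiber i w = mk {x : el (Uni (Uni w)). pair i x : el w}"
lemma el_fiber: "el (fiber i w) = {x. pair i x : el w}"
proof -
  have "x : el (Uni (Uni w))" if "pair i x : el w" for x
  proof -
    have "upair i x : el (pair i x)" by (simp add: pair_def)
    then have "upair i x : el (Uni w)" using that unfolding el_Uni by blast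
    moreover have "x : el (upair i x)" by simp
    ultimately show ?thesis unfolding el_Uni[of "Uni w"] by blast
  qed
  then show ?thesis unfolding fiber_def el_Collect by blast
qed

lemma rank_in_limit: assumes b: "limit b" and x: "!!y. y : el x ==> rank y : el c" "c : el b" shows "rank x : el b"
proof -
  have o: "Ord b" "Ord c" using b x(2) Ord_in unfolding limit_def by blast+
  have "el (rank x) <= el c" using x(1) o by (intro rank_le)
  then have "rank x = c \<or> rank x : el c" using Ord_subset[of "rank x" c] o by simp
  then show ?thesis using x(2) o Ord_trans by blast
qed

lemma limit_max: assumes b: "limit b" "c : el b" "d : el b" shows "EX m:el b. c : el m \<and> d : el m"
proof -
  have o: "Ord b" "Ord c" "Ord d" "succ c : el b" "succ d : el b" using b Ord_in unfolding limit_def by blast+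
  have "c : el d \<or> c = d \<or> d : el c" using o Ord_linear by blast
  then show ?thesis
  proof (elim disjE)
    assume "c : el d" then show ?thesis using o by (intro bexI[of _ "succ d"]) auto
  next
    assume "c = d" then show ?thesis using o by (intro bexI[of _ "succ d"]) auto
  next
    assume "d : el c" then show ?thesis using o by (intro bexI[of _ "succ c"]) auto
  qed
qed

lemma rank_upair: assumes b: "limit b" shows "rank (upair x y) : el b \<longleftrightarrow> rank x : el b \<and> rank y : el b"
proof
  assume u: "rank (upair x y) : el b"
  have "rank x : el (rank (upair x y))" "rank y : el (rank (upair x y))" by (auto intro: rank_mem)
  then show "rank x : el b \<and> rank y : el b" using u b Ord_trans unfolding limit_def by blast
next
  assume "rank x : el b \<and> rank y : el b"
  then obtain m where "m : el b" "rank x : el m" "rank y : el m" using limit_max[OF b] by blast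
  then show "rank (upair x y) : el b" by (intro rank_in_limit[OF b, of _ m]) auto
qed

lemma rank_pair: "limit b ==> rank (pair x y) : el b \<longleftrightarrow> rank x : el b \<and> rank y : el b"
  unfolding pair_def by (auto simp: rank_upair)

lemma rank_zero: "rank zero = zero" by (rule rank_Ord) simp
lemma rank_one: "rank one = one" by (rule rank_Ord) (simp add: one_def)
lemma limit_rank_01: "limit b ==> rank zero : el b \<and> rank one : el b"
  by (simp only: rank_zero rank_one) (auto simp: limit_def one_def)

context zf
begin

lemma dterm_cup[dintro]: "dterm A s ==> dterm A t ==> dterm A (%e. cup (s e) (t e))" unfolding cup_def by (intro dintro)
lemma cupA[simp]: "x : A ==> y : A ==> cup x y : A" unfolding cup_def by (intro UniA upairA)
lemma dterm_lower[dintro]: "dterm A s ==> dterm A t ==> dterm A (%e. lower (s e) (t e))"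
  by (rule dterm_comp2[where f=lower], unfold lower_def) (intro dintro)+
lemma dterm_upper[dintro]: "dterm A s ==> dterm A t ==> dterm A (%e. upper (s e) (t e))"
  by (rule dterm_comp2[where f=upper], unfold upper_def) (intro dintro)+
lemma lowerA[simp]: "x : A ==> y : A ==> lower x y : A"
  by (rule dterm_constD[OF dterm_lower[OF dterm_const dterm_const]])
lemma upperA[simp]: "x : A ==> y : A ==> upper x y : A"
  by (rule dterm_constD[OF dterm_upper[OF dterm_const dterm_const]])
lemma dterm_fiber[dintro]: "dterm A s ==> dterm A t ==> dterm A (%e. fiber (s e) (t e))"
  by (rule dterm_comp2[where f=fiber], unfold fiber_def) (intro dintro)+
lemma dpred_limit[dintro]: "dterm A t ==> dpred A (%e. limit (t e))"
  by (rule dpred_comp1[where Q=limit], unfold limit_def) (intro dintro zeroA)+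

lemma limit_ex: "b : A ==> Ord b ==> EX c:A. limit c \<and> b : el c"
proof -
  assume b: "b : A" "Ord b"
  have "bounding (%b c. True)" unfolding bounding_def by (auto intro: dpred_const bexI[of _ zero])
  from closed_under_ex[OF this b] show ?thesis unfolding closed_under_def by blast
qed

definition nextlim where "nextlim b = least_ord (%c. limit c \<and> rank b : el c)"
lemma nextlim: assumes "b : A" shows "nextlim b : A" "limit (nextlim b)" "rank b : el (nextlim b)"
  "!!c. limit c ==> rank b : el c ==> el (nextlim b) <= el c"
proof -
  obtain c where c: "c : A" "limit c" "rank b : el c" using limit_ex[of "rank b"] assms by auto
  have oc: "Ord c" using c unfolding limit_def by simp
  note o = least_ord[of "%c. limit c \<and> rank b : el c" c, folded nextlim_def, OF conjI[OF c(2,3)] oc]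
  show "limit (nextlim b)" "rank b : el (nextlim b)" using o(2) by auto
  show le: "el (nextlim b) <= el c" if "limit c" "rank b : el c" for c
  proof -
    have "Ord c" using that unfolding limit_def by simp
    then show ?thesis using o(3)[of c] that Ord_linear[OF o(1), of c] Ord_subset[OF o(1), of c] by blast
  qed
  show "nextlim b : A" using le[OF c(2,3)] Ord_subset[OF o(1) oc] c(1) Atrans by blast
qed
lemma dterm_nextlim[dintro]: "dterm A t ==> dterm A (%e. nextlim (t e))"
proof (rule dterm_comp1[where f=nextlim], unfold nextlim_def, rule dterm_least_ord)
  show "dpred A (%e. limit (e 0) \<and> rank (e (Suc 0)) : el (e 0))" by (intro dintro)
  show "EX a:A. Ord a \<and> limit a \<and> rank (e 0) : el a" if "range e <= A" for e :: "nat => hset"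
  proof -
    have "e 0 : A" using that by blast
    then obtain c where "c : A" "limit c" "rank (e 0) : el c" using limit_ex[of "rank (e 0)"] by auto
    then show ?thesis unfolding limit_def by blast
  qed
qed

lemma dterm_Vset[dintro]: "dterm A t ==> dterm A (%e. Vset (rank (t e)))"
proof (rule dterm_comp1[where f="%x. Vset (rank x)"], rule dterm_setI)
  show "Vset (rank (e 0)) : A" if "range e <= A" for e :: "nat => hset"
    using VsetA[OF Ord_rank rankA, of "e 0"] that by blast
  show "dpred A (%e. e 0 : el (Vset (rank (e (Suc 0)))))" by (intro dpred_Vset dintro)
qed

context
  fixes x g
  assumes x: "x : A" and g: "g : A" and choice: "!!y. y : A ==> el y <= el x ==> el y ~= {} ==> app g y : el y"
begin

definition enum_step where "enum_step P z h = app (pr1 P) (mk {w : el (pr2 P). \<not> (EX k:el z. app h k = w)})"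
definition enum where "enum = recF (enum_step (pair g x))"
definition unlisted where "unlisted z = mk {w : el x. \<not> (EX k:el z. enum k = w)}"

lemma dterm_enum: "dterm A t ==> dterm A (%e. enum (t e))"
  unfolding enum_def by (rule dterm_recF[where H=enum_step and s="%_. pair g x"], unfold enum_step_def) (intro dintro pairA x g)+

lemma dterm_unlisted: "dterm A t ==> dterm A (%e. unlisted (t e))"
  by (rule dterm_comp1[where f=unlisted], unfold unlisted_def) (intro dintro dterm_enum x)+

lemma el_unlisted: "el (unlisted z) = {w : el x. \<not> (EX k:el z. enum k = w)}" unfolding unlisted_def by simp

lemma enum_eq: "enum z = app g (unlisted z)"
proof -
  have "{w : el x. \<not> (EX k:el z. app (lam (tc z) enum) k = w)} = {w : el x. \<not> (EX k:el z. enum k = w)}"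
    using TC_el by auto
  then show ?thesis unfolding unlisted_def by (subst enum_def, subst recF) (simp add: enum_step_def enum_def)
qed

lemma enum_mem: assumes "z : A" "el (unlisted z) ~= {}" shows "enum z : el (unlisted z)"
  unfolding enum_eq using assms dterm_constD[OF dterm_unlisted[OF dterm_const]] by (intro choice) (auto simp: el_unlisted)

lemma enum_inj: assumes "k : A" "l : A" "Ord k" "Ord l" "el (unlisted k) ~= {}" "el (unlisted l) ~= {}" "enum k = enum l"
  shows "k = l"
proof -
  have "enum m ~= enum z" if "z : A" "el (unlisted z) ~= {}" "m : el z" for m z
    using enum_mem[OF that(1,2)] that(3) el_unlisted by auto
  then show ?thesis using assms Ord_linear[of k l] by metis
qed

text \<open>Otherwise \<open>enum\<close> would inject the ordinals of \<open>A\<close> into \<open>x\<close>, against Collection.\<close>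

lemma enum_exhausts: "EX l:A. Ord l \<and> el (unlisted l) = {}"
proof (rule ccontr)
  assume "\<not> ?thesis"
  then have ne: "el (unlisted k) ~= {}" if "k : A" "Ord k" for k using that by blast
  have "dpred A (%e. e 0 : el x --> (EX k:A. Ord k \<and> enum k = e 0) --> Ord (e 1) \<and> enum (e 1) = e 0)"
    by (intro dintro dterm_enum x)
  from collection[where \<Phi>="%w k. w : el x --> (EX k:A. Ord k \<and> enum k = w) --> Ord k \<and> enum k = w", OF this x]
  obtain Y where Y: "Y : A" "ALL w:el x. EX k:el Y. w : el x --> (EX k:A. Ord k \<and> enum k = w) --> Ord k \<and> enum k = w"
    using x by blast
  have "k : el Y" if k: "k : A" "Ord k" for k
  proof -
    have "enum k : el x" using enum_mem[OF k(1) ne[OF k]] el_unlisted by auto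
    then obtain k' where k': "k' : el Y" "Ord k' \<and> enum k' = enum k" using Y k by blast
    moreover have "k' : A" using k'(1) Y(1) Atrans by blast
    ultimately show ?thesis using enum_inj[of k' k] ne k by metis
  qed
  then have "rank Y : el Y" using Y by simp
  then show False using rank_mem[of "rank Y" Y] rank_Ord[of "rank Y"] by simp
qed

lemma ex_enumeration: "EX l:A. EX f:A. Ord l \<and> app f ` el l = el x \<and> inj_on (app f) (el l)"
proof -
  obtain l0 where l0: "l0 : A" "Ord l0" "el (unlisted l0) = {}" using enum_exhausts by blast
  then obtain l where l: "Ord l" "el (unlisted l) = {}" "ALL k:el l. el (unlisted k) ~= {}"
    using Ord_least[of "%l. el (unlisted l) = {}" l0] by blast
  have "l = l0 \<or> l : el l0" using Ord_linear[OF l(1) l0(2)] l l0 by blast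
  then have lA: "l : A" using l0 Atrans by blast
  have k: "k : A" "Ord k" "el (unlisted k) ~= {}" if "k : el l" for k using that l lA Atrans Ord_in by blast+
  have fA: "lam l enum : A" by (rule dterm_constD) (intro dintro dterm_enum lA)
  have "enum ` el l = el x"
  proof
    show "enum ` el l <= el x" using enum_mem k unfolding el_unlisted by blast
    show "el x <= enum ` el l" using l(2) unfolding el_unlisted by blast
  qed
  then have "app (lam l enum) ` el l = el x" by (simp cong: image_cong_simp)
  moreover have "inj_on (app (lam l enum)) (el l)" using enum_inj k by (auto simp: inj_on_def)
  ultimately show ?thesis using lA fA l(1) by blast
qed

end

text \<open>\<open>Vset (rank (succ b))\<close> is \<open>V_(b+1)\<close>; the \<open>rank\<close> makes it a total term.\<close>

definition small where "small b X \<longleftrightarrow> (EX f:A. ALL z:el X. EX u:el (Vset (rank (succ b))). app f u = z)"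
lemma dpred_small[dintro]: "dterm A s ==> dterm A t ==> dpred A (%e. small (s e) (t e))"
  by (rule dpred_comp2[where Q=small], unfold small_def) (intro dintro)+

lemma small_sub: "small b X ==> el Y <= el X ==> small b Y" unfolding small_def by blast
lemma Vset_succ: "Ord b ==> el (Vset (rank (succ b))) = {x : A. rank x = b \<or> rank x : el b}" by (auto simp: rank_Ord)

lemma small_subset_Vset: assumes "b : A" "Ord b" "el X <= el (Vset (rank (succ b)))" shows "small b X"
proof -
  let ?V = "Vset (rank (succ b))"
  have VA: "?V : A" using assms by (intro VsetA) auto
  have "lam ?V (%u. u) : A" by (rule dterm_constD) (intro dintro VA)
  moreover have "app (lam ?V (%u. u)) z = z" if "z : el X" for z using assms that by (intro app_lam) blast
  ultimately show ?thesis unfolding small_def using assms(3) by (intro bexI[of _ "lam ?V (%u. u)"]) blast+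
qed

lemma small_mono: assumes "small b X" "b : el c" "c : A" "Ord c" shows "small c X"
proof -
  have "Ord b" using assms Ord_in by blast
  then have "el (Vset (rank (succ b))) <= el (Vset (rank (succ c)))" unfolding Vset_succ[OF \<open>Ord b\<close>] Vset_succ[OF assms(4)]
    using assms Ord_trans by blast
  then show ?thesis using assms(1) unfolding small_def by blast
qed

lemma ex_pair_code: assumes b: "limit b" "b : A" and u: "u : el (Vset (rank (succ b)))" "v : el (Vset (rank (succ b)))"
  shows "EX w:el (Vset (rank (succ b))). fiber zero w = u \<and> fiber one w = v"
proof -
  have o: "Ord b" using b unfolding limit_def by simp
  let ?w = "cup (mk ((%x. pair zero x) ` el u)) (mk ((%x. pair one x) ` el v))"
  have uv: "u : A" "v : A" "!!x. x : el u ==> rank x : el b" "!!x. x : el v ==> rank x : el b"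
  proof -
    show "u : A" "v : A" using u by auto
    have ranks: "rank x : el b" if "x : el w" "rank w = b \<or> rank w : el b" for x w
      using rank_mem[OF that(1)] Ord_trans[OF o, of "rank w" "rank x"] that(2) by auto
    show "!!x. x : el u ==> rank x : el b" "!!x. x : el v ==> rank x : el b"
      using ranks u unfolding Vset_succ[OF o] by simp_all
  qed
  have wA: "?w : A" by (rule dterm_constD) (intro dintro zeroA oneA uv)
  have "rank z : el b" if "z : el ?w" for z using that uv limit_rank_01[OF b(1)] by (auto simp: rank_pair[OF b(1)])
  then have "el (rank ?w) <= el b" by (intro rank_le o)
  then have "rank ?w = b \<or> rank ?w : el b" using Ord_subset[of "rank ?w" b] o by simp
  then have "?w : el (Vset (rank (succ b)))" unfolding Vset_succ[OF o] using wA by simp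
  moreover have "fiber zero ?w = u" "fiber one ?w = v" by (rule ext_el, auto simp: el_fiber)+
  ultimately show ?thesis by blast
qed

end

context L_model
begin

lemma small_UN: assumes b: "limit b" "b : A" and X: "dterm A (%e. X (e 0))" and I: "I : A" "small b I"
  and s: "!!i. i : el I ==> small b (X i)"
  shows "small b (mk (UN i:el I. el (X i)))"
proof -
  let ?V = "Vset (rank (succ b))"
  have VA: "?V : A" using b by (intro VsetA) auto
  define Q where "Q i f \<longleftrightarrow> (i : el I --> (ALL z:el (X i). EX u:el ?V. app f u = z))" for i f
  have dX: "dterm A t ==> dterm A (%e. X (t e))" for t by (rule dterm_comp1[OF X])
  have dQ: "dpred A (%e. Q (e (Suc 0)) (e 0))" unfolding Q_def by (intro dintro dX I VA)
  have exQ: "EX f:A. Q i f" for i using s[of i] zeroA unfolding Q_def small_def by blast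
  have dF: "dterm A t ==> dterm A (%e. least_L (Q (t e)))" for t
    by (rule dterm_comp1[where f="%i. least_L (Q i)"], rule dterm_least_L[OF dQ]) (use exQ in auto)
  have F: "Q i (least_L (Q i))" for i using exQ least_L(2) by blast
  obtain g where g: "g : A" "ALL i:el I. EX u:el ?V. app g u = i" using I unfolding small_def by blast
  let ?h = "lam ?V (%w. app (least_L (Q (app g (fiber zero w)))) (fiber one w))"
  have hA: "?h : A" by (rule dterm_constD) (intro dintro dF VA g zeroA oneA)
  have "EX w:el ?V. app ?h w = z" if z: "i : el I" "z : el (X i)" for i z
  proof -
    obtain u where u: "u : el ?V" "app g u = i" using g z by blast
    obtain v where v: "v : el ?V" "app (least_L (Q i)) v = z" using F[of i] z unfolding Q_def by blast
    obtain w where w: "w : el ?V" "fiber zero w = u" "fiber one w = v" using ex_pair_code[OF b u(1) v(1)] by blast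
    have "app ?h w = z" using w u v by simp
    then show ?thesis using w by blast
  qed
  moreover have "el (mk (UN i:el I. el (X i))) = (UN i:el I. el (X i))" by (rule el_mk) auto
  ultimately show ?thesis unfolding small_def using hA by (intro bexI[of _ ?h]) (simp, blast)
qed

lemma small_upair: assumes b: "limit b" "b : A" "p : A" "q : A" shows "small b (upair p q)"
proof -
  have o: "Ord b" using b unfolding limit_def by simp
  let ?f = "upair (pair zero p) (pair one q)"
  have "?f : A" using b by simp
  moreover have "app ?f zero = p" "app ?f one = q" by (rule app_unique; auto)+
  moreover have "zero : el (Vset (rank (succ b)))" "one : el (Vset (rank (succ b)))"
    unfolding Vset_succ[OF o] using limit_rank_01[OF b(1)] by auto
  ultimately show ?thesis unfolding small_def el_upair by (intro bexI[of _ ?f]) blast+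
qed

lemma small_cup: assumes b: "limit b" "b : A" "p : A" "q : A" "small b p" "small b q" shows "small b (cup p q)"
proof -
  have "small b (mk (UN i:el (upair p q). el i))"
    by (rule small_UN[OF b(1,2) dterm_var]) (use b small_upair in auto)
  moreover have "mk (UN i:el (upair p q). el i) = cup p q" by (rule ext_el) simp
  ultimately show ?thesis by simp
qed

lemma small_image: assumes b: "b : A" and X: "small b X" and f: "dterm A (%e. f (e 0))" and Y: "el Y <= f ` el X" shows "small b Y"
proof -
  let ?V = "Vset (rank (succ b))"
  have VA: "?V : A" using b by (intro VsetA) auto
  obtain g where g: "g : A" "ALL i:el X. EX u:el ?V. app g u = i" using X unfolding small_def by blast
  have hA: "lam ?V (%u. f (app g u)) : A" by (rule dterm_constD) (intro dintro dterm_comp1[OF f] VA g)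
  have "EX u:el ?V. app (lam ?V (%u. f (app g u))) u = z" if z: "z : el Y" for z
  proof -
    obtain i where i: "i : el X" "z = f i" using Y z by blast
    then obtain u where "u : el ?V" "app g u = i" using g by blast
    then show ?thesis using i by (intro bexI[of _ u]) auto
  qed
  then show ?thesis unfolding small_def using hA by blast
qed

lemma small_prd: assumes b: "limit b" "b : A" "I : A" "J : A" "small b I" "small b J" shows "small b (prd I J)"
  unfolding prd_def
proof (rule small_UN[OF b(1,2)])
  show "dterm A (%e. mk ((%c. pair (e 0) c) ` el J))" by (intro dintro b)
  show "small b (mk ((%c. pair i c) ` el J))" if "i : el I" for i
    by (rule small_image[OF b(2,6), of "%c. pair i c"]) (use b Atrans that in \<open>auto intro!: dintro\<close>)
qed fact+

definition bit_fun where "bit_fun p \<longleftrightarrow> (ALL z:el p. EX x y. z = pair x y \<and> (y = zero \<or> y = one)) \<and>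
   (ALL x y. pair x y : el p --> (ALL x' y'. pair x' y' : el p --> x = x' --> y = y'))"
definition easton where "easton p \<longleftrightarrow> p : A \<and> bit_fun p \<and> (ALL b:A. limit b --> small b (lower (nextlim b) p))"
definition cond where "cond a p \<longleftrightarrow> easton p \<and> (ALL z:el p. rank z ~: el a)"

lemma dpred_easton[dintro]: "dterm A t ==> dpred A (%e. easton (t e))"
proof (rule dpred_comp1[where Q=easton])
  have "dpred A (%e. bit_fun (e 0) \<and> (ALL b:A. limit b --> small b (lower (nextlim b) (e 0))))" unfolding bit_fun_def by (intro dintro zeroA oneA)
  then show "dpred A (%e. easton (e 0))" by (rule dpred_cong) (auto simp: easton_def)
qed
lemma dpred_cond[dintro]: "dterm A s ==> dterm A t ==> dpred A (%e. cond (s e) (t e))"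
  by (rule dpred_comp2[where Q=cond], unfold cond_def) (intro dintro)+

lemma bit_fun_sub: assumes "bit_fun p" "el q <= el p" shows "bit_fun q"
  unfolding bit_fun_def
proof (intro conjI ballI allI impI)
  show "EX x y. z = pair x y \<and> (y = zero \<or> y = one)" if "z : el q" for z
    using assms(1)[unfolded bit_fun_def, THEN conjunct1] assms(2) that by blast
  fix x y x' y' assume "pair x y : el q" "pair x' y' : el q" "x = x'"
  then show "y = y'" using assms(1)[unfolded bit_fun_def, THEN conjunct2, rule_format, of x y x' y'] assms(2) by blast
qed

lemma easton_sub: assumes p: "easton p" and q: "q : A" "el q <= el p" shows "easton q"
  unfolding easton_def
proof (intro conjI ballI impI)
  show "q : A" by fact
  show "bit_fun q" using p q bit_fun_sub unfolding easton_def by blast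
  fix b assume b: "b : A" "limit b"
  have "small b (lower (nextlim b) p)" using p b unfolding easton_def by blast
  then show "small b (lower (nextlim b) q)" by (rule small_sub) (use q in auto)
qed

lemma cond_sub: "cond a p ==> q : A ==> el q <= el p ==> cond a q" unfolding cond_def using easton_sub by blast
lemma condA: "cond a p ==> p : A" unfolding cond_def easton_def by blast
lemma cond_zero: "cond a zero"
proof -
  have "small b (lower c zero)" for b c unfolding small_def by (rule bexI[of _ zero]) auto
  then show ?thesis unfolding cond_def easton_def bit_fun_def by auto
qed

lemma bit_funI: assumes "!!z z'. z : el p ==> z' : el p ==> EX x. bit_fun x \<and> z : el x \<and> z' : el x" shows "bit_fun p"
  unfolding bit_fun_def
proof (intro conjI ballI allI impI)
  fix z assume "z : el p"
  then obtain x where "bit_fun x" "z : el x" using assms by blast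
  then show "EX x y. z = pair x y \<and> (y = zero \<or> y = one)" unfolding bit_fun_def by blast
next
  fix x y x' y' assume "pair x y : el p" "pair x' y' : el p" and e: "x = x'"
  then obtain w where w: "bit_fun w" "pair x y : el w" "pair x' y' : el w" using assms by blast
  show "y = y'" using w(1)[unfolded bit_fun_def, THEN conjunct2, rule_format, OF w(2,3) e] .
qed

lemma easton_cup: assumes p: "easton p" "easton q" and f: "bit_fun (cup p q)" shows "easton (cup p q)"
  unfolding easton_def
proof (intro conjI ballI impI f)
  show "cup p q : A" using p unfolding easton_def by simp
  fix b assume b: "b : A" "limit b"
  have "small b (cup (lower (nextlim b) p) (lower (nextlim b) q))" using p b nextlim(1) unfolding easton_def by (intro small_cup) auto
  then show "small b (lower (nextlim b) (cup p q))" by (rule small_sub) auto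
qed

lemma cond_cup: "cond a p ==> cond a q ==> bit_fun (cup p q) ==> cond a (cup p q)" unfolding cond_def using easton_cup by auto
lemma cond_cup_sub: "cond a s ==> p : A ==> q : A ==> el p <= el s ==> el q <= el s ==> cond a (cup p q)"
  by (rule cond_sub) auto

lemma bit_fun_cup: assumes b: "limit b" and p: "bit_fun p" "bit_fun q" "!!z. z : el p ==> rank z : el b" "!!z. z : el q ==> rank z ~: el b"
  shows "bit_fun (cup p q)"
proof -
  have "rank (pair x y) : el b \<longleftrightarrow> rank x : el b" if "pair x y : el p Un el q" for x y
  proof -
    have "y = zero \<or> y = one" using that p unfolding bit_fun_def by (metis Un_iff pair_inject)
    then show ?thesis using rank_pair[OF b] limit_rank_01[OF b] by auto
  qed
  then have d: "\<not> (pair x y : el p \<and> pair x y' : el q)" for x y y' using p by (metis Un_iff)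
  show ?thesis unfolding bit_fun_def
  proof (intro conjI ballI allI impI)
    show "EX x y. z = pair x y \<and> (y = zero \<or> y = one)" if "z : el (cup p q)" for z using that p unfolding bit_fun_def by auto
    fix x y x' y' assume "pair x y : el (cup p q)" "pair x' y' : el (cup p q)" "x = x'"
    then show "y = y'" using d p unfolding bit_fun_def el_cup by (metis Un_iff)
  qed
qed

lemma cond_glue: assumes b: "limit b" "b : A" and u: "cond a u" "!!z. z : el u ==> rank z : el b" and p: "cond a p" "el (lower b p) <= el u"
  shows "cond a (cup u p)"
proof -
  have A: "u : A" "p : A" using u p condA by auto
  have "cond a (upper b p)" using p A b by (intro cond_sub[OF p(1)]) auto
  moreover have "bit_fun (cup u (upper b p))" using u p b calculation by (intro bit_fun_cup[OF b(1)]) (auto simp: cond_def easton_def)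
  ultimately have "cond a (cup u (upper b p))" using u by (intro cond_cup)
  moreover have "cup u (upper b p) = cup u p" using p(2) by (intro ext_el) auto
  ultimately show ?thesis by simp
qed

definition conds where "conds a b = mk {p : el (pow (Vset (rank b))). cond a p}"
lemma el_conds: "Ord b ==> el (conds a b) = {p. cond a p \<and> (ALL z:el p. rank z : el b)}"
proof -
  assume o: "Ord b"
  have "el (conds a b) = {p : el (pow (Vset (rank b))). cond a p}" unfolding conds_def by (rule el_Collect)
  then show ?thesis unfolding el_pow el_Vset rank_Ord[OF o] using condA Atrans by blast
qed
lemma dterm_conds[dintro]: "dterm A s ==> dterm A t ==> dterm A (%e. conds (s e) (t e))"
  by (rule dterm_comp2[where f=conds], unfold conds_def) (intro dintro)+
lemma condsA[simp]: "x : A ==> y : A ==> conds x y : A"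
  by (rule dterm_constD[OF dterm_conds[OF dterm_const dterm_const]])

lemma small_conds: assumes "b : A" "Ord b" shows "small b (conds a b)"
proof (rule small_subset_Vset[OF assms])
  show "el (conds a b) <= el (Vset (rank (succ b)))"
  proof
    fix p assume "p : el (conds a b)"
    then have p: "p : A" "!!z. z : el p ==> rank z : el b" unfolding el_conds[OF assms(2)] using condA by blast+
    have "el (rank p) <= el b" using p(2) assms(2) by (intro rank_le)
    then show "p : el (Vset (rank (succ b)))" unfolding Vset_succ[OF assms(2)] using p Ord_subset[of "rank p" b] assms by auto
  qed
qed

lemma ex_choice_function: assumes x: "x : A" shows "EX g:A. ALL y:A. el y <= el x --> el y ~= {} --> app g y : el y"
proof -
  define Q where "Q y z \<longleftrightarrow> ((EX w:el y. True) --> z : el y)" for y z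
  have dQ: "dpred A (%e. Q (e (Suc 0)) (e 0))" unfolding Q_def by (intro dintro)
  have ex: "EX z:A. Q y z" if "y : A" for y unfolding Q_def using that Atrans zeroA by blast
  have dW: "dterm A t ==> dterm A (%e. least_L (Q (t e)))" for t
    by (rule dterm_comp1[where f="%y. least_L (Q y)"], rule dterm_least_L[OF dQ]) (use ex in auto)
  have "lam (pow x) (%y. least_L (Q y)) : A" by (rule dterm_constD) (intro dintro dW x)
  moreover have "app (lam (pow x) (%y. least_L (Q y))) y : el y" if y: "y : A" "el y <= el x" "el y ~= {}" for y
  proof -
    obtain z where "z : A" "Q y z" using ex y by blast
    then have "Q y (least_L (Q y))" using least_L(2)[of z "Q y"] by blast
    then have "least_L (Q y) : el y" using y(3) unfolding Q_def[of y "least_L (Q y)"] by blast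
    moreover have "y : el (pow x)" using y by simp
    ultimately show ?thesis by (simp only: app_lam)
  qed
  ultimately show ?thesis by blast
qed

definition cond_above where "cond_above a b x \<longleftrightarrow> cond a x \<and> (ALL z:el x. rank z ~: el b)"

lemma cond_above_upper: "cond a p ==> b : A ==> cond_above a b (upper b p)"
  unfolding cond_above_def using cond_sub[of a p "upper b p"] condA by auto

lemma cond_above_cup: "limit b ==> b : A ==> u : el (conds a b) ==> cond_above a b t ==> cond a (cup u t)"
  using el_conds by (intro cond_glue) (auto simp: cond_above_def limit_def)

lemma cond_above_UN: assumes b: "limit b" "b : A" and k: "k : A" "Ord k" "small b k" and h: "cond_above a b h"
    and T: "dterm A (%e. T (e 0))" and TP: "!!m. m : el k ==> cond_above a b (T m)"
    and hT: "!!m. m : el k ==> el h <= el (T m)" and chain: "!!m n. m : el n ==> n : el k ==> el (T m) <= el (T n)"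
  shows "cond_above a b (cup h (mk (UN m:el k. el (T m))))" (is "cond_above a b ?t")
proof -
  have o: "Ord b" using b unfolding limit_def by simp
  have hA: "h : A" using h condA unfolding cond_above_def by blast
  have UNA: "mk (UN m:el k. el (S m)) : A" if "dterm A (%e. S (e 0))" for S
    by (rule dterm_constD) (intro dintro dterm_UN dterm_comp1[OF that] k(1))
  have elt: "z : el h \<or> (EX m:el k. z : el (T m))" if "z : el ?t" for z using that by auto
  have bit_fun: "bit_fun x" if "cond_above a b x" for x using that unfolding cond_above_def cond_def easton_def by blast
  have "bit_fun ?t"
  proof (rule bit_funI)
    have T2: "EX x. bit_fun x \<and> z : el x \<and> z' : el x" if m: "m : el k" "z : el (T m)" "n : el k" "z' : el (T n)" for z z' m n
    proof -
      have "m : el n \<or> m = n \<or> n : el m" using m k(2) Ord_in Ord_linear by blast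
      then show ?thesis using m chain bit_fun TP by blast
    qed
    fix z z' assume "z : el ?t" "z' : el ?t"
    then consider "z : el h" "z' : el h" | m n where "m : el k" "z : el (T m)" "n : el k" "z' : el (T n)"
      using elt[of z] elt[of z'] subsetD[OF hT] by blast
    then show "EX x. bit_fun x \<and> z : el x \<and> z' : el x" using T2 bit_fun[OF h] by cases blast+
  qed
  moreover have "small d (lower (nextlim d) ?t)" if d: "d : A" "limit d" for d
  proof (cases "d : el b")
    case True
    then have "el (nextlim d) <= el b" using nextlim(4)[OF d(1) b(1)] rank_Ord[of d] d(2) unfolding limit_def by simp
    then have "el (lower (nextlim d) ?t) = {}" using TP h elt unfolding el_lower cond_above_def by blast
    then show ?thesis unfolding small_def by (intro bexI[of _ zero]) auto
  next
    case False
    then have "d = b \<or> b : el d" using Ord_linear[of d b] d o unfolding limit_def by blast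
    then have smk: "small d k" using k small_mono d unfolding limit_def by blast
    have smP: "small d (lower (nextlim d) x)" if "cond_above a b x" for x using that d unfolding cond_above_def cond_def easton_def by blast
    have dl: "dterm A (%e. lower (nextlim d) (T (e 0)))" by (intro dintro T nextlim(1) d(1))
    have "small d (cup (lower (nextlim d) h) (mk (UN m:el k. el (lower (nextlim d) (T m)))))"
      by (rule small_cup[OF d(2,1) _ _ smP[OF h] small_UN[OF d(2,1) dl k(1) smk smP[OF TP]]]) (use UNA[OF dl] nextlim(1) d(1) hA in auto)
    then show ?thesis by (rule small_sub) auto
  qed
  moreover have "?t : A" using UNA[OF T] hA by simp
  moreover have "rank z ~: el a \<and> rank z ~: el b" if "z : el ?t" for z
    using elt[OF that] h TP unfolding cond_above_def cond_def by blast
  ultimately show ?thesis unfolding cond_above_def cond_def easton_def by blast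
qed

lemma small_injective_domain: assumes b: "b : A" and J: "small b J" and l: "l : A" "Ord l"
    and f: "f : A" "app f ` el l = el J" "inj_on (app f) (el l)"
  shows "small b l"
proof (rule small_image[OF b J])
  let ?Q = "%j k. (EX m:el l. app f m = j) --> k : el l \<and> app f k = j"
  show "dterm A (%e. least_ord (?Q (e 0)))"
  proof (rule dterm_least_ord)
    show "dpred A (%e. ?Q (e (Suc 0)) (e 0))" by (intro dintro l f)
    show "EX k:A. Ord k \<and> ?Q (e 0) k" for e :: "nat => hset"
    proof (cases "EX m:el l. app f m = e 0")
      case True
      then obtain m where m: "m : el l" "app f m = e 0" by blast
      then have "m : A" "Ord m" using Atrans[OF l(1)] Ord_in[OF l(2)] by blast+
      then show ?thesis using m by blast
    next
      case False then show ?thesis using zeroA Ord_zero by blast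
    qed
  qed
  show "el l <= (%j. least_ord (?Q j)) ` el J"
  proof
    fix k assume k: "k : el l"
    have least: "least_ord (?Q (app f k)) = k"
    proof (rule least_ord_eq)
      show "Ord k" using k l Ord_in by blast
      show "?Q (app f k) k" using k by blast
      show "ALL m:el k. \<not> ?Q (app f k) m"
      proof
        fix m assume "m : el k"
        then have "m ~= k" by auto
        then show "\<not> ?Q (app f k) m" using k f(3) unfolding inj_on_def by blast
      qed
    qed
    have "app f k : el J" using k f(2) by blast
    then show "k : (%j. least_ord (?Q j)) ` el J" by (rule image_eqI[rotated]) (rule least[symmetric])
  qed
qed

context
  fixes a b I D p
  assumes aA: "a : A" and b: "limit b" "b : A" and I: "I : A"
    and dD: "dpred A (%e. D (e 0) (e 1))"
    and dense: "!!i p. i : el I ==> cond a p ==> EX d. cond a d \<and> el p <= el d \<and> D i d"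
    and p: "cond a p"
begin

definition ext_ok where "ext_ok t j t' \<longleftrightarrow> cond_above a b t' \<and> el t <= el t' \<and>
  (EX u':el (conds a b). el (pr2 j) <= el u' \<and> D (pr1 j) (cup u' t'))"
definition ext_choice where "ext_choice t j t' \<longleftrightarrow> ((EX s:A. ext_ok t j s) --> ext_ok t j t') \<and> (\<not> (EX s:A. ext_ok t j s) --> t' = t)"
definition ext where "ext t j = least_L (ext_choice t j)"

lemma ex_ext_ok: assumes i: "i : el I" and u: "u : el (conds a b)" and t: "cond_above a b t"
  shows "EX t':A. ext_ok t (pair i u) t'"
proof -
  have elc: "el (conds a b) = {p. cond a p \<and> (ALL z:el p. rank z : el b)}" using b by (intro el_conds) (simp add: limit_def)
  obtain d where d: "cond a d" "el (cup u t) <= el d" "D i d" using dense[OF i cond_above_cup[OF b u t]] by blast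
  have dA: "d : A" using d condA by blast
  have "cond_above a b (upper b d)" by (rule cond_above_upper[OF d(1) b(2)])
  moreover have "el t <= el (upper b d)" using d(2) t unfolding cond_above_def by auto
  moreover have "lower b d : el (conds a b)" unfolding elc using cond_sub[OF d(1)] dA b by auto
  moreover have "el u <= el (lower b d)" using d(2) u unfolding elc by auto
  moreover have "cup (lower b d) (upper b d) = d" by (rule ext_el) auto
  ultimately have "ext_ok t (pair i u) (upper b d)" unfolding ext_ok_def using d(3)
    by (intro conjI bexI[of _ "lower b d"]) simp_all
  then show ?thesis using dA b by auto
qed

lemma dpred_ext_ok: "dterm A x ==> dterm A y ==> dterm A z ==> dpred A (%e. ext_ok (x e) (y e) (z e))"
  by (rule dpred_comp3[where Q=ext_ok], unfold ext_ok_def cond_above_def) (intro dintro dpred_comp2[OF dD] aA b condsA)+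

lemma dterm_ext: "dterm A x ==> dterm A y ==> dterm A (%e. ext (x e) (y e))"
proof (rule dterm_comp2[where f=ext], unfold ext_def, rule dterm_least_L)
  show "dpred A (%e. ext_choice (e (Suc 0)) (e (Suc 1)) (e 0))" unfolding ext_choice_def by (intro dintro dpred_ext_ok)
qed (auto simp: ext_choice_def)

lemma ext_ok_ext: assumes "t : A" "EX t':A. ext_ok t j t'" shows "ext_ok t j (ext t j)"
proof -
  have "EX t':A. ext_choice t j t'" using assms unfolding ext_choice_def by blast
  then have "ext_choice t j (ext t j)" unfolding ext_def using least_L(2) by blast
  then show ?thesis using assms(2) unfolding ext_choice_def by blast
qed

definition stage where "stage f = recF (%k h. ext (cup (upper b p) (mk (UN m:el k. el (app h m)))) (app f k))"
definition stage_below where "stage_below f k = cup (upper b p) (mk (UN m:el k. el (stage f m)))"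

lemma stage: "stage f k = ext (stage_below f k) (app f k)"
  unfolding stage_below_def by (subst stage_def, subst recF) (simp add: stage_def TC_el)

lemma el_stage_below: "el (stage_below f k) = el (upper b p) Un (UN m:el k. el (stage f m))"
  unfolding stage_below_def by simp

lemma dterm_stage: "f : A ==> dterm A x ==> dterm A (%e. stage f (x e))"
  unfolding stage_def by (rule dterm_recF[where H="%q k h. ext (cup (upper b p) (mk (UN m:el k. el (app h m)))) (app f k)" and s=x])
    (intro dintro dterm_UN dterm_ext upperA b(2) condA[OF p])+

lemma stage_belowA: "f : A ==> k : A ==> stage_below f k : A"
  unfolding stage_below_def by (rule dterm_constD) (intro dintro dterm_UN dterm_stage upperA b(2) condA[OF p])

lemma stage_ok: assumes f: "f : A" "app f ` el l <= el (prd I (conds a b))" and l: "l : A" "Ord l" "small b l"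
  shows "Ord k ==> el k <= el l ==> k : A ==> cond_above a b (stage_below f k) \<and> (k : el l --> ext_ok (stage_below f k) (app f k) (stage f k))"
proof (induction k rule: el_induct)
  case (step k)
  have IH: "cond_above a b (stage f m)" "el (stage_below f m) <= el (stage f m)" if m: "m : el k" for m
  proof -
    have "Ord m" "el m <= el l" "m : A" "m : el l" using m step.prems Ord_in Ord_trans[OF step.prems(1)] Atrans by blast+
    then have "ext_ok (stage_below f m) (app f m) (stage f m)" using step.IH m by blast
    then show "cond_above a b (stage f m)" "el (stage_below f m) <= el (stage f m)" unfolding ext_ok_def by auto
  qed
  have above: "cond_above a b (stage_below f k)" unfolding stage_below_def
  proof (rule cond_above_UN[OF b step.prems(3,1) small_sub[OF l(3) step.prems(2)] cond_above_upper[OF p b(2)]])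
    show "dterm A (%e. stage f (e 0))" by (intro dintro dterm_stage f)
    show "el (upper b p) <= el (stage f m)" if "m : el k" for m using IH(2)[OF that] unfolding el_stage_below by blast
    show "el (stage f m) <= el (stage f n)" if "m : el n" "n : el k" for m n
      using IH(2)[OF that(2)] that(1) unfolding el_stage_below by blast
  qed (rule IH)
  have "ext_ok (stage_below f k) (app f k) (stage f k)" if "k : el l"
  proof -
    have "app f k : el (prd I (conds a b))" using that f(2) by blast
    then obtain i u where "app f k = pair i u" "i : el I" "u : el (conds a b)" unfolding el_prd by blast
    then show ?thesis unfolding stage using ext_ok_ext[OF stage_belowA[OF f(1) step.prems(3)]] ex_ext_ok above by metis
  qed
  then show ?case using above by blast
qed

text \<open>The part of \<open>p\<close> above \<open>b\<close> is extended along an enumeration of the pairs \<open>(i, u)\<close>; at each stage a lower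
  extension \<open>u'\<close> of \<open>u\<close> is found together with the next upper part so that their union is in \<open>D i\<close>.\<close>

lemma ex_upper_extension:
  assumes smI: "small b I"
    and upward: "!!i p q. i : el I ==> cond a p ==> D i p ==> cond a q ==> el p <= el q ==> D i q"
  shows "EX q. cond a q \<and> el p <= el q \<and> lower b q = lower b p \<and>
     (ALL i:el I. ALL u:el (conds a b). el (lower b p) <= el u --> (EX u':el (conds a b). el u <= el u' \<and> D i (cup u' q)))"
proof -
  have o: "Ord b" using b unfolding limit_def by simp
  let ?J = "prd I (conds a b)"
  have J: "?J : A" "small b ?J" using I aA b smI small_conds[OF b(2) o] by (auto intro!: small_prd)
  obtain g where g: "g : A" "ALL y:A. el y <= el ?J --> el y ~= {} --> app g y : el y" using ex_choice_function[OF J(1)] by blast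
  obtain l f where l: "l : A" "Ord l" and f: "f : A" "app f ` el l = el ?J" "inj_on (app f) (el l)"
    using ex_enumeration[OF J(1) g(1)] g(2) by blast
  note ok = stage_ok[OF f(1) equalityD1[OF f(2)] l small_injective_domain[OF b(2) J(2) l f]]
  let ?t = "stage_below f l" let ?q = "cup (lower b p) ?t"
  have above: "cond_above a b ?t" using ok[OF l(2) subset_refl l(1)] by blast
  have "lower b p : el (conds a b)" unfolding el_conds[OF o] using cond_sub[OF p] condA[OF p] b by auto
  then have q: "cond a ?q" by (rule cond_above_cup[OF b _ above])
  have low_q: "lower b ?q = lower b p" by (rule ext_el) (use above in \<open>auto simp: cond_above_def\<close>)
  have "EX u':el (conds a b). el u <= el u' \<and> D i (cup u' ?q)" if i: "i : el I" and u: "u : el (conds a b)" "el (lower b p) <= el u" for i u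
  proof -
    have "pair i u : el ?J" unfolding el_prd using i u by blast
    then obtain k where k: "k : el l" "app f k = pair i u" using f(2) by (metis imageE)
    have "Ord k" "el k <= el l" "k : A" using k l Ord_in Ord_trans[OF l(2)] Atrans by blast+
    then have "ext_ok (stage_below f k) (pair i u) (stage f k)" using ok k by metis
    then obtain u' where u': "u' : el (conds a b)" "el u <= el u'" "D i (cup u' (stage f k))" "cond_above a b (stage f k)"
      unfolding ext_ok_def by auto
    have "cond a (cup u' ?q)" by (rule cond_glue[OF b _ _ q]) (use u u' low_q in \<open>auto simp: el_conds[OF o]\<close>)
    moreover have "el (cup u' (stage f k)) <= el (cup u' ?q)" using k by (auto simp: el_stage_below)
    ultimately have "D i (cup u' ?q)" using upward[OF i cond_above_cup[OF b u'(1,4)] u'(3)] by blast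
    then show ?thesis using u' by blast
  qed
  moreover have "el p <= el ?q" by (auto simp: el_stage_below)
  ultimately show ?thesis using q low_q by blast
qed

end

end

section \<open>Class forcing\<close>

lemma val_cong: assumes "!!p. p : TC x ==> p : G \<longleftrightarrow> p : H" shows "val G x = val H x"
  using assms
proof (induction x rule: TC_induct)
  case (step x)
  have s: "val G s = val H s" "p : G \<longleftrightarrow> p : H" if "pair s p : el x" for s p
  proof -
    have "s : TC x" "p : TC x" using pair_el_TC[OF that] by auto
    then show "val G s = val H s" "p : G \<longleftrightarrow> p : H" using step TC_trans by blast+
  qed
  show ?case by (rule ext_el, unfold el_val, rule Collect_cong) (metis s)
qed

definition AC where "AC A \<longleftrightarrow> (ALL x:A. (ALL y:el x. el y ~= {}) \<and>
   (ALL y:el x. ALL z:el x. y ~= z --> el y Int el z = {}) --> (EX c:A. ALL y:el x. EX! z. z : el c Int el y))"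

locale class_ext = L_model +
  fixes a G
  assumes aA: "a : A" and G_cond_in: "p : G ==> cond a p" and G0: "zero : G"
    and Gup: "p : G ==> cond a q ==> el q <= el p ==> q : G"
    and Gdir: "p : G ==> q : G ==> EX s:G. el p <= el s \<and> el q <= el s"
    and Ggen: "dpred A (%e. Q (e 0)) ==> (!!p. cond a p ==> EX d. cond a d \<and> el p <= el d \<and> Q d) ==> EX p:G. Q p"
begin

lemma G_mem: "p : G ==> p : A" using G_cond_in condA by blast

lemma Gcup: assumes "p : G" "q : G" shows "cup p q : G"
proof -
  obtain s where s: "s : G" "el p <= el s" "el q <= el s" using Gdir assms by blast
  have "cond a (cup p q)" using G_cond_in[OF s(1)] G_mem assms s by (intro cond_cup_sub) auto
  then show ?thesis using Gup[OF s(1)] s by auto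
qed

lemma Ggen_below: assumes Q: "dpred A (%e. Q (e 0))" and p: "p : G"
  and d: "!!q. cond a q ==> el p <= el q ==> EX d. cond a d \<and> el q <= el d \<and> Q d"
  shows "EX q:G. el p <= el q \<and> Q q"
proof -
  let ?R = "%q. (el p <= el q \<and> Q q) \<or> (ALL s:A. cond a s --> el q <= el s --> \<not> el p <= el s)"
  have "EX q:G. ?R q"
  proof (rule Ggen)
    show "dpred A (%e. ?R (e 0))" by (intro dintro dpred_comp1[OF Q] G_mem[OF p] aA)
    fix q assume q: "cond a q"
    show "EX d. cond a d \<and> el q <= el d \<and> ?R d"
    proof (cases "EX s. cond a s \<and> el q <= el s \<and> el p <= el s")
      case True
      then obtain s where s: "cond a s" "el q <= el s" "el p <= el s" by blast
      then obtain t where "cond a t" "el s <= el t" "Q t" using d by blast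
      then show ?thesis using s by blast
    next
      case False then show ?thesis using q by blast
    qed
  qed
  then obtain q where q: "q : G" "?R q" by blast
  obtain s where "s : G" "el q <= el s" "el p <= el s" using Gdir[OF q(1) p] by blast
  then have "\<not> (ALL s:A. cond a s --> el q <= el s --> \<not> el p <= el s)" using G_cond_in[of s] G_mem[of s] by blast
  then have "el p <= el q \<and> Q q" using q(2) by argo
  then show ?thesis using q(1) by blast
qed

definition conds_le where "conds_le b = mk {z : el (prd (conds a b) (conds a b)). el (pr2 z) <= el (pr1 z)}"
definition Glow where "Glow b = {p : G. ALL z:el p. rank z : el b}"

lemma dterm_conds_le[dintro]: "dterm A t ==> dterm A (%e. conds_le (t e))"
  by (rule dterm_comp1[where f=conds_le], unfold conds_le_def) (intro dintro aA)+
lemma conds_leA: "b : A ==> conds_le b : A" by (rule dterm_constD[OF dterm_conds_le[OF dterm_const]])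

lemma le_conds_le: "le (conds_le b) p q \<longleftrightarrow> p : el (conds a b) \<and> q : el (conds a b) \<and> el q <= el p"
proof -
  have "el (conds_le b) = {z : el (prd (conds a b) (conds a b)). el (pr2 z) <= el (pr1 z)}" unfolding conds_le_def by (rule el_Collect)
  then show ?thesis unfolding le_def el_prd by auto
qed

lemma poset_in_conds: "b : A ==> poset_in A (conds a b) (conds_le b)"
  by unfold_locales (use aA conds_leA le_conds_le in auto)

lemma lower_Glow: "b : A ==> p : G ==> lower b p : Glow b"
  unfolding Glow_def using Gup[of p "lower b p"] cond_sub[OF G_cond_in, of p "lower b p"] G_mem by auto

lemma Glow_conds: "Ord b ==> Glow b <= el (conds a b)" unfolding Glow_def using G_cond_in by (auto simp: el_conds)

lemma cond_lift: assumes b: "limit b" "b : A" and p: "cond a p" and u: "u : el (conds a b)" "el (lower b p) <= el u" shows "cond a (cup u p)"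
proof -
  have o: "Ord b" using b unfolding limit_def by simp
  show ?thesis by (rule cond_glue[OF b]) (use u p in \<open>auto simp: el_conds[OF o]\<close>)
qed

lemma generic_in_Glow: assumes b: "limit b" "b : A" shows "generic_in A (conds a b) (conds_le b) (Glow b)"
proof -
  have o: "Ord b" using b unfolding limit_def by simp
  interpret poset_in A "conds a b" "conds_le b" by (rule poset_in_conds[OF b(2)])
  show ?thesis
  proof unfold_locales
    show "Glow b <= el (conds a b)" by (rule Glow_conds[OF o])
    show "Glow b ~= {}" using lower_Glow[OF b(2) G0] by blast
    show "q : Glow b" if "p : Glow b" "le (conds_le b) p q" for p q
      using that Gup unfolding Glow_def le_conds_le el_conds[OF o] by blast
    show "EX s:Glow b. le (conds_le b) s p \<and> le (conds_le b) s q" if pq: "p : Glow b" "q : Glow b" for p q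
    proof (rule bexI[of _ "cup p q"])
      show c: "cup p q : Glow b" using pq Gcup unfolding Glow_def by auto
      show "le (conds_le b) (cup p q) p \<and> le (conds_le b) (cup p q) q" unfolding le_conds_le using c pq Glow_conds[OF o] by auto
    qed
    show "Glow b Int el D ~= {}" if D: "D : A" "el D <= el (conds a b)" "!!p. p : el (conds a b) ==> EX d:el D. le (conds_le b) d p" for D
    proof -
      have "EX p:G. EX d:el D. el d <= el p"
      proof (rule Ggen)
        show "dpred A (%e. EX d:el D. el d <= el (e 0))" by (intro dintro D)
        fix p assume p: "cond a p"
        have "lower b p : el (conds a b)" unfolding el_conds[OF o] using cond_sub[OF p, of "lower b p"] condA[OF p] b by auto
        then obtain d where d: "d : el D" "el (lower b p) <= el d" "d : el (conds a b)" using D(3) unfolding le_conds_le by blast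
        have "cond a (cup d p)" using cond_lift[OF b p d(3,2)] .
        then show "EX q. cond a q \<and> el p <= el q \<and> (EX d:el D. el d <= el q)" using d by (intro exI[of _ "cup d p"]) auto
      qed
      then obtain p d where d: "p : G" "d : el D" "el d <= el p" by blast
      have "cond a d" "ALL z:el d. rank z : el b" using d D(2) unfolding el_conds[OF o] by blast+
      then have "d : Glow b" using Gup d unfolding Glow_def by blast
      then show ?thesis using d by blast
    qed
  qed
qed

lemma val_Glow: assumes b: "limit b" and x: "rank x : el b" shows "val G x = val (Glow b) x"
proof (rule val_cong)
  fix p assume "p : TC x"
  then have "rank p : el b" using rank_TC x b Ord_trans unfolding limit_def by blast
  then have "ALL z:el p. rank z : el b" using rank_mem b Ord_trans unfolding limit_def by blast
  then show "p : G \<longleftrightarrow> p : Glow b" unfolding Glow_def by blast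
qed

definition cforces_eq where "cforces_eq p x y \<longleftrightarrow> lower (nextlim (upair x y)) p :
   el (app (eq_table (pair (pair (conds a (nextlim (upair x y))) (conds_le (nextlim (upair x y)))) (tc (upair x y))) x) y)"

lemma dpred_cforces_eq[dintro]: "dterm A p ==> dterm A x ==> dterm A y ==> dpred A (%e. cforces_eq (p e) (x e) (y e))"
  unfolding cforces_eq_def by (intro dintro aA)

lemma nextlim_upair: assumes "x : A" "y : A"
  shows "limit (nextlim (upair x y))" "nextlim (upair x y) : A" "rank x : el (nextlim (upair x y))" "rank y : el (nextlim (upair x y))"
  using nextlim[of "upair x y"] rank_upair[of "nextlim (upair x y)" x y] assms by auto

lemma cforces_eq_iff: "x : A ==> y : A ==>
  cforces_eq p x y \<longleftrightarrow> poset_in.forces_eq (conds a (nextlim (upair x y))) (conds_le (nextlim (upair x y))) (tc (upair x y)) (lower (nextlim (upair x y)) p) x y"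
  unfolding cforces_eq_def by (subst poset_in.forces_eq_def[OF poset_in_conds]) (use nextlim_upair in auto)

lemma lower_conds: "b : A ==> Ord b ==> cond a p ==> lower b p : el (conds a b)"
  using cond_sub[of a p "lower b p"] condA by (auto simp: el_conds)

lemma cforces_eq_truth: assumes "x : A" "y : A" shows "val G x = val G y \<longleftrightarrow> (EX p:G. cforces_eq p x y)"
proof -
  let ?b = "nextlim (upair x y)"
  note b = nextlim_upair[OF assms]
  interpret generic_in A "conds a ?b" "conds_le ?b" "Glow ?b" by (rule generic_in_Glow[OF b(1,2)])
  have "val G x = val G y \<longleftrightarrow> val (Glow ?b) x = val (Glow ?b) y" using val_Glow b by simp
  also have "... \<longleftrightarrow> (EX p:Glow ?b. forces_eq (tc (upair x y)) p x y)"
    using truth[of "tc (upair x y)" x y] is_trans_tc tcA assms TC_el[of y "upair x y"] by simp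
  also have "... \<longleftrightarrow> (EX p:G. cforces_eq p x y)"
  proof
    assume "EX p:Glow ?b. forces_eq (tc (upair x y)) p x y"
    then obtain p where p: "p : Glow ?b" "forces_eq (tc (upair x y)) p x y" by blast
    moreover have "lower ?b p = p" using p unfolding Glow_def by (intro ext_el) auto
    ultimately show "EX p:G. cforces_eq p x y" unfolding cforces_eq_iff[OF assms] Glow_def by (intro bexI[of _ p]) simp_all
  next
    assume "EX p:G. cforces_eq p x y"
    then show "EX p:Glow ?b. forces_eq (tc (upair x y)) p x y" unfolding cforces_eq_iff[OF assms] using lower_Glow[OF b(2)] by blast
  qed
  finally show ?thesis .
qed

lemma cforces_eq_mono: assumes "x : A" "y : A" "cforces_eq p x y" "cond a p" "cond a q" "el p <= el q" shows "cforces_eq q x y"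
proof -
  let ?b = "nextlim (upair x y)"
  note b = nextlim_upair[OF assms(1,2)]
  have o: "Ord ?b" using b unfolding limit_def by simp
  interpret poset_in A "conds a ?b" "conds_le ?b" by (rule poset_in_conds[OF b(2)])
  have "le (conds_le ?b) (lower ?b q) (lower ?b p)" unfolding le_conds_le using lower_conds[OF b(2) o] assms by auto
  then show ?thesis using forces_eq_mono[of y "tc (upair x y)"] assms(3) TC_el[of y "upair x y"] unfolding cforces_eq_iff[OF assms(1,2)] by simp
qed

lemma cforces_eq_dense: assumes xy: "x : A" "y : A" and p: "cond a p" and d: "!!q. cond a q ==> el p <= el q ==> EX q'. cond a q' \<and> el q <= el q' \<and> cforces_eq q' x y"
  shows "cforces_eq p x y"
proof -
  let ?b = "nextlim (upair x y)"
  note b = nextlim_upair[OF xy]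
  have o: "Ord ?b" using b unfolding limit_def by simp
  interpret poset_in A "conds a ?b" "conds_le ?b" by (rule poset_in_conds[OF b(2)])
  show ?thesis unfolding cforces_eq_iff[OF xy]
  proof (rule forces_eq_dense)
    show "y : el (tc (upair x y))" using TC_el[of y "upair x y"] by simp
    show "lower ?b p : el (conds a ?b)" using lower_conds[OF b(2) o p] .
    fix u assume "le (conds_le ?b) u (lower ?b p)"
    then have u: "u : el (conds a ?b)" "el (lower ?b p) <= el u" unfolding le_conds_le by auto
    then have "cond a (cup u p)" using cond_lift[OF b(1,2) p] by blast
    then obtain q' where q': "cond a q'" "el (cup u p) <= el q'" "cforces_eq q' x y" using d[of "cup u p"] by auto
    have "el u <= el (lower ?b q')" using q'(2) u(1) unfolding el_conds[OF o] by auto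
    then have "le (conds_le ?b) (lower ?b q') u" unfolding le_conds_le using lower_conds[OF b(2) o q'(1)] u by blast
    then show "EX q'. le (conds_le ?b) q' u \<and> forces_eq (tc (upair x y)) q' x y" using q'(3) unfolding cforces_eq_iff[OF xy] by blast
  qed
qed

definition cforces_mem where "cforces_mem p x y \<longleftrightarrow> (EX u s. pair u s : el y \<and> (cond a s \<and> el s <= el p \<and> cforces_eq p x u))"
definition dense_below where "dense_below Q p \<longleftrightarrow> (ALL q:A. cond a q --> el p <= el q --> (EX q':A. cond a q' \<and> el q <= el q' \<and> Q q'))"

lemma dense_below_mono: "dense_below Q p ==> el p <= el q ==> dense_below Q q" unfolding dense_below_def by blast
lemma dense_below_dense: "(!!q. cond a q ==> el p <= el q ==> EX q'. cond a q' \<and> el q <= el q' \<and> dense_below Q q') ==> dense_below Q p"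
  unfolding dense_below_def using condA by (meson order_refl order_trans)

primrec forces :: "fm => hset => (nat => hset) => bool" where
  "forces (Mem i j) p v = dense_below (%q. cforces_mem q (v i) (v j)) p"
| "forces (Eq i j) p v = cforces_eq p (v i) (v j)"
| "forces (Neg \<phi>) p v = (ALL q:A. cond a q --> el p <= el q --> \<not> forces \<phi> q v)"
| "forces (Conj \<phi> \<psi>) p v = (forces \<phi> p v \<and> forces \<psi> p v)"
| "forces (Forall i \<phi>) p v = (ALL x:A. forces \<phi> p (v(i := x)))"

lemma dpred_forces: "dpred A (%e. forces \<phi> (e 0) (%n. e (Suc n)))"
proof (induction \<phi>)
  case (Mem i j) show ?case unfolding forces.simps dense_below_def cforces_mem_def by (intro dintro aA)
next
  case (Eq i j) show ?case unfolding forces.simps by (intro dintro)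
next
  case (Neg \<phi>)
  have "dpred A (%e. forces \<phi> (e 0) (%n. e (Suc (Suc n))))" using dpred_ren[OF Neg inj_skip1] by simp
  then show ?case unfolding forces.simps by (intro dintro aA)
next
  case (Conj \<phi> \<psi>) then show ?case unfolding forces.simps by (intro dintro)
next
  case (Forall i \<phi>)
  have "dpred A (%e. ALL x:A. forces \<phi> ((e(Suc i := x)) 0) (%n. (e(Suc i := x)) (Suc n)))" by (rule dpred_all_upd[OF Forall])
  moreover have "(%n. (e(Suc i := x)) (Suc n)) = (%n. e (Suc n))(i := x)" for e :: "nat => hset" and x by auto
  ultimately show ?case by simp
qed

lemma forces_mono: "range v <= A ==> forces \<phi> p v ==> cond a p ==> cond a q ==> el p <= el q ==> forces \<phi> q v"
proof (induction \<phi> arbitrary: v)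
  case (Mem i j) then show ?case using dense_below_mono by simp
next
  case (Eq i j)
  then have "v i : A" "v j : A" by auto
  then show ?case using Eq cforces_eq_mono by simp
next
  case (Neg \<phi>) show ?case using Neg.prems(2,5) unfolding forces.simps by blast
next
  case (Conj \<phi> \<psi>) then show ?case by simp
next
  case (Forall i \<phi>)
  have "range (v(i := x)) <= A" if "x : A" for x using Forall.prems(1) that by (auto simp: image_subset_iff)
  then have "forces \<phi> q (v(i := x))" if "x : A" for x
    using Forall.IH[of "v(i := x)"] Forall.prems(2-5) that unfolding forces.simps by blast
  then show ?case by simp
qed

lemma forces_dense: "range v <= A ==> cond a p ==> (!!q. cond a q ==> el p <= el q ==> EX q'. cond a q' \<and> el q <= el q' \<and> forces \<phi> q' v) ==> forces \<phi> p v"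
proof (induction \<phi> arbitrary: v)
  case (Mem i j) then show ?case using dense_below_dense[of p] by simp
next
  case (Eq i j)
  then have "v i : A" "v j : A" by auto
  then show ?case using Eq cforces_eq_dense[of "v i" "v j" p] by simp
next
  case (Neg \<phi>)
  show ?case unfolding forces.simps
  proof (intro ballI impI notI)
    fix q assume q: "q : A" "cond a q" "el p <= el q" "forces \<phi> q v"
    obtain q' where q': "cond a q'" "el q <= el q'" "forces (Neg \<phi>) q' v" using Neg.prems(3)[OF q(2,3)] by blast
    have "forces \<phi> q' v" using forces_mono[OF Neg.prems(1) q(4,2) q'(1,2)] .
    then show False using q' condA by auto
  qed
next
  case (Conj \<phi> \<psi>)
  have "forces \<phi> p v" by (rule Conj.IH(1)[OF Conj.prems(1,2)]) (use Conj.prems(3) in fastforce)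
  moreover have "forces \<psi> p v" by (rule Conj.IH(2)[OF Conj.prems(1,2)]) (use Conj.prems(3) in fastforce)
  ultimately show ?case by simp
next
  case (Forall i \<phi>)
  have "forces \<phi> p (v(i := x))" if x: "x : A" for x
  proof (rule Forall.IH)
    show "range (v(i := x)) <= A" using Forall.prems(1) x by (auto simp: image_subset_iff)
    show "EX q'. cond a q' \<and> el q <= el q' \<and> forces \<phi> q' (v(i := x))" if "cond a q" "el p <= el q" for q
      using Forall.prems(3)[OF that] x by auto
  qed (use Forall.prems in blast)
  then show ?case by simp
qed

definition N where "N = val G ` A"

lemma dpred_forces_const: assumes "range v <= A" shows "dpred A (%e. forces \<phi> (e 0) v)"
proof -
  have "range (%n. case n of 0 => v 0 | Suc n => v n) <= A" using assms by (auto simp: image_subset_iff split: nat.splits)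
  from dpred_fix[OF dpred_forces this, of \<phi> 1] show ?thesis by simp
qed

lemma forces_or_neg: assumes "range v <= A" "cond a p" shows "EX q. cond a q \<and> el p <= el q \<and> (forces \<phi> q v \<or> forces (Neg \<phi>) q v)"
proof (cases "forces (Neg \<phi>) p v")
  case True then show ?thesis using assms by blast
next
  case False
  then obtain q where "cond a q" "el p <= el q" "forces \<phi> q v" by auto
  then show ?thesis by blast
qed

lemma forces_contra: assumes v: "range v <= A" and "p : G" "q : G" "forces \<phi> p v" "forces (Neg \<phi>) q v" shows False
proof -
  obtain s where s: "s : G" "el p <= el s" "el q <= el s" using Gdir assms by blast
  have "forces \<phi> s v" using forces_mono[OF v assms(4)] G_cond_in s assms by blast
  then show False using assms(5) s G_cond_in G_mem by auto
qed

lemma truth_Mem: assumes x: "x : A" and y: "y : A"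
  shows "val G x : el (val G y) \<longleftrightarrow> (EX p:G. dense_below (%q. cforces_mem q x y) p)"
proof
  assume "val G x : el (val G y)"
  then obtain u s where u: "val G x = val G u" "s : G" "pair u s : el y" by (auto simp: el_val)
  have uA: "u : A" using u y pair_elA by blast
  obtain p where p: "p : G" "cforces_eq p x u" using u cforces_eq_truth[OF x uA] by blast
  have "dense_below (%q. cforces_mem q x y) (cup p s)" unfolding dense_below_def cforces_mem_def
  proof (intro ballI impI)
    fix r assume r: "r : A" "cond a r" "el (cup p s) <= el r"
    have "cforces_eq r x u" using cforces_eq_mono[OF x uA p(2) G_cond_in[OF p(1)] r(2)] r by auto
    then show "EX q':A. cond a q' \<and> el r <= el q' \<and> (EX u s. pair u s : el y \<and> cond a s \<and> el s <= el q' \<and> cforces_eq q' x u)"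
      using r u G_cond_in by (intro bexI[of _ r]) auto
  qed
  then show "EX p:G. dense_below (%q. cforces_mem q x y) p" using Gcup p u by blast
next
  assume "EX p:G. dense_below (%q. cforces_mem q x y) p"
  then obtain p where p: "p : G" "dense_below (%q. cforces_mem q x y) p" by blast
  have "EX q:G. el p <= el q \<and> cforces_mem q x y"
  proof (rule Ggen_below[OF _ p(1)])
    show "dpred A (%e. cforces_mem (e 0) x y)" unfolding cforces_mem_def by (intro dintro aA x y)
  qed (use p(2) condA in \<open>unfold dense_below_def, blast\<close>)
  then obtain q u s where q: "q : G" "pair u s : el y" "cond a s" "el s <= el q" "cforces_eq q x u" unfolding cforces_mem_def by blast
  have uA: "u : A" using q y pair_elA by blast
  have "val G x = val G u" using cforces_eq_truth[OF x uA] q by blast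
  moreover have "s : G" using Gup q by blast
  ultimately show "val G x : el (val G y)" using q(2) unfolding el_val by blast
qed

lemma forces_decided: assumes "range v <= A" shows "(EX p:G. forces (Neg \<phi>) p v) \<longleftrightarrow> \<not> (EX p:G. forces \<phi> p v)"
proof
  show "\<not> (EX p:G. forces \<phi> p v)" if "EX p:G. forces (Neg \<phi>) p v" using that forces_contra[OF assms] by blast
  have "EX p:G. forces \<phi> p v \<or> forces (Neg \<phi>) p v"
    by (rule Ggen) (intro dintro dpred_forces_const assms, rule forces_or_neg[OF assms])
  then show "EX p:G. forces (Neg \<phi>) p v" if "\<not> (EX p:G. forces \<phi> p v)" using that by blast
qed

lemma dpred_ex_forces: assumes v: "range v <= A" shows "dpred A (%e. EX x:A. forces \<phi> (e 0) (v(i := x)))"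
proof -
  from dpred_neg[OF dpred_all_upd[OF dpred_neg[OF dpred_forces[of \<phi>]], of "Suc i"]]
  have "dpred A (%e. EX x:A. forces \<phi> (e 0) ((%n. e (Suc n))(i := x)))"
  proof (rule dpred_cong)
    fix e :: "nat => hset"
    have "(%n. (e(Suc i := x)) (Suc n)) = (%n. e (Suc n))(i := x)" for x by auto
    then show "(\<not> (ALL x:A. \<not> forces \<phi> ((e(Suc i := x)) 0) (%n. (e(Suc i := x)) (Suc n)))) =
      (EX x:A. forces \<phi> (e 0) ((%n. e (Suc n))(i := x)))" by simp
  qed
  moreover have "range (%n. case n of 0 => v 0 | Suc n => v n) <= A"
    using v by (auto simp: image_subset_iff split: nat.splits)
  ultimately show ?thesis using dpred_fix[of _ _ 1] by fastforce
qed

lemma truth_Forall: assumes v: "range v <= A"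
  shows "(EX p:G. forces (Forall i \<phi>) p v) \<longleftrightarrow> (ALL x:A. EX p:G. forces \<phi> p (v(i := x)))"
proof
  show "ALL x:A. EX p:G. forces \<phi> p (v(i := x))" if "EX p:G. forces (Forall i \<phi>) p v" using that by auto
  assume all: "ALL x:A. EX p:G. forces \<phi> p (v(i := x))"
  have vx: "range (v(i := x)) <= A" if "x : A" for x using v that by (auto simp: image_subset_iff)
  have "EX p:G. forces (Forall i \<phi>) p v \<or> (EX x:A. forces (Neg \<phi>) p (v(i := x)))"
  proof (rule Ggen)
    show "dpred A (%e. forces (Forall i \<phi>) (e 0) v \<or> (EX x:A. forces (Neg \<phi>) (e 0) (v(i := x))))"
      by (intro dpred_disj dpred_forces_const dpred_ex_forces v)
    fix p assume p: "cond a p"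
    show "EX d. cond a d \<and> el p <= el d \<and> (forces (Forall i \<phi>) d v \<or> (EX x:A. forces (Neg \<phi>) d (v(i := x))))"
    proof (cases "forces (Forall i \<phi>) p v")
      case True then show ?thesis using p by blast
    next
      case False
      then obtain x where x: "x : A" "\<not> forces \<phi> p (v(i := x))" by auto
      then obtain q where q: "cond a q" "el p <= el q" "!!q'. cond a q' ==> el q <= el q' ==> \<not> forces \<phi> q' (v(i := x))"
        using forces_dense[OF vx[OF x(1)] p] by blast
      then have "forces (Neg \<phi>) q (v(i := x))" by simp
      then show ?thesis using q x by blast
    qed
  qed
  moreover have "\<not> (EX x:A. forces (Neg \<phi>) p (v(i := x)))" if "p : G" for p using all forces_decided[OF vx] that by blast
  ultimately show "EX p:G. forces (Forall i \<phi>) p v" by blast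
qed

theorem truth: "range v <= A ==> sat N mem \<phi> (%i. val G (v i)) \<longleftrightarrow> (EX p:G. forces \<phi> p v)"
proof (induction \<phi> arbitrary: v)
  case (Mem i j)
  then have "v i : A" "v j : A" by auto
  then show ?case using truth_Mem by simp
next
  case (Eq i j)
  then have "v i : A" "v j : A" by auto
  then show ?case using cforces_eq_truth by simp
next
  case (Neg \<phi>) show ?case unfolding forces_decided[OF Neg.prems] using Neg by simp
next
  case (Conj \<phi> \<psi>)
  show ?case
  proof
    assume "sat N mem (Conj \<phi> \<psi>) (%i. val G (v i))"
    then obtain p q where pq: "p : G" "q : G" "forces \<phi> p v" "forces \<psi> q v" using Conj by auto
    obtain s where s: "s : G" "el p <= el s" "el q <= el s" using Gdir pq by blast
    then have "forces \<phi> s v" "forces \<psi> s v" using forces_mono[OF Conj.prems] pq G_cond_in by blast+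
    then show "EX p:G. forces (Conj \<phi> \<psi>) p v" using s by auto
  next
    assume "EX p:G. forces (Conj \<phi> \<psi>) p v"
    then show "sat N mem (Conj \<phi> \<psi>) (%i. val G (v i))" using Conj by auto
  qed
next
  case (Forall i \<phi>)
  have vx: "range (v(i := x)) <= A" if "x : A" for x using Forall.prems that by (auto simp: image_subset_iff)
  have vv: "(%k. val G (v k))(i := val G x) = (%k. val G ((v(i := x)) k))" for x by auto
  have "sat N mem (Forall i \<phi>) (%i. val G (v i)) \<longleftrightarrow> (ALL x:A. sat N mem \<phi> ((%k. val G (v k))(i := val G x)))"
    unfolding N_def by simp
  also have "... \<longleftrightarrow> (ALL x:A. EX p:G. forces \<phi> p (v(i := x)))"
    by (intro ball_cong HOL.refl) (simp only: vv Forall.IH[OF vx])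
  finally show ?case unfolding truth_Forall[OF Forall.prems] .
qed

lemma ex_generic_upper: assumes b: "limit b" "b : A" and I: "I : A" "small b I"
    and dD: "dpred A (%e. D (e 0) (e 1))"
    and dense: "!!i p. i : el I ==> cond a p ==> EX d. cond a d \<and> el p <= el d \<and> D i d"
    and upward: "!!i p q. i : el I ==> cond a p ==> D i p ==> cond a q ==> el p <= el q ==> D i q"
  shows "EX q:G. ALL i:el I. EX u:Glow b. D i (cup u q)"
proof -
  let ?Q = "%q. ALL i:el I. ALL u:el (conds a b). el (lower b q) <= el u --> (EX u':el (conds a b). el u <= el u' \<and> D i (cup u' q))"
  have "EX q:G. ?Q q"
  proof (rule Ggen)
    show "dpred A (%e. ?Q (e 0))" by (intro dintro dpred_comp2[OF dD] I aA b condsA)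
    fix p assume p: "cond a p"
    have "EX q. cond a q \<and> el p <= el q \<and> lower b q = lower b p \<and>
      (ALL i:el I. ALL u:el (conds a b). el (lower b p) <= el u --> (EX u':el (conds a b). el u <= el u' \<and> D i (cup u' q)))"
      by (rule ex_upper_extension[OF aA b I(1) dD _ p I(2)]) (fact dense, fact upward)
    then obtain q where q: "cond a q" "el p <= el q" "lower b q = lower b p"
      "ALL i:el I. ALL u:el (conds a b). el (lower b p) <= el u --> (EX u':el (conds a b). el u <= el u' \<and> D i (cup u' q))"
      by (elim exE conjE) (rule that)
    then show "EX d. cond a d \<and> el p <= el d \<and> ?Q d" by (intro exI[of _ q]) simp
  qed
  then obtain q where q: "q : G" "?Q q" by blast
  interpret g: generic_in A "conds a b" "conds_le b" "Glow b" by (rule generic_in_Glow[OF b])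
  have "EX u:Glow b. D i (cup u q)" if i: "i : el I" for i
  proof -
    have iA: "i : A" using i I Atrans by blast
    have "EX u:Glow b. le (conds_le b) u (lower b q) \<and> D i (cup u q)"
    proof (rule g.Ggen_below)
      show "dpred A (%e. D i (cup (e 0) q))" by (intro dintro dpred_comp2[OF dD] iA G_mem[OF q(1)])
      show "lower b q : Glow b" using lower_Glow[OF b(2) q(1)] .
      show "EX d. le (conds_le b) d u \<and> D i (cup d q)" if "le (conds_le b) u (lower b q)" for u
        using q(2) i that unfolding le_conds_le by blast
    qed
    then show ?thesis by blast
  qed
  then show ?thesis using q(1) by blast
qed

end

section \<open>The class extension satisfies ZFC\<close>

context L_model
begin

lemma small_rank: assumes "b : A" "limit b" "rank I : el b" "I : A" shows "small b I"
proof -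
  have o: "Ord b" using assms unfolding limit_def by simp
  show ?thesis
  proof (rule small_subset_Vset[OF assms(1) o], unfold Vset_succ[OF o], rule subsetI)
    fix x assume x: "x : el I"
    then have "rank x : el b" using rank_mem assms(3) Ord_trans[OF o] by blast
    then show "x : {x : A. rank x = b \<or> rank x : el b}" using x assms(4) Atrans by blast
  qed
qed

end

definition upair_name where "upair_name s t = upair (pair s zero) (pair t zero)"
definition pair_name where "pair_name s t = upair_name (upair_name s s) (upair_name s t)"

lemma val_upair_name: "zero : G ==> val G (upair_name s t) = upair (val G s) (val G t)"
  by (rule ext_el) (auto simp: el_val upair_name_def)
lemma val_pair_name: "zero : G ==> val G (pair_name s t) = pair (val G s) (val G t)"
  unfolding pair_name_def by (simp add: val_upair_name pair_def)

definition set_name where "set_name X = mk ((%s. pair s zero) ` el X)"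
lemma val_set_name: "zero : G ==> el (val G (set_name X)) = val G ` el X"
  by (auto simp: el_val set_name_def)

context zf
begin
lemma dterm_pair_name[dintro]: "dterm A s ==> dterm A t ==> dterm A (%e. pair_name (s e) (t e))"
  by (rule dterm_comp2[where f=pair_name], unfold pair_name_def upair_name_def) (intro dintro zeroA)+
lemma dterm_set_name[dintro]: "dterm A t ==> dterm A (%e. set_name (t e))"
  by (rule dterm_comp1[where f=set_name], unfold set_name_def) (intro dintro zeroA)+
lemma set_nameA[simp]: "x : A ==> set_name x : A"
  by (rule dterm_constD[OF dterm_set_name[OF dterm_const]])
lemma powA[simp]: "x : A ==> pow x : A" using powersetA unfolding pow_def .
declare tcA[simp] UniA[simp]
end

context class_ext
begin

lemma N_I: "x : A ==> val G x : N" unfolding N_def by blast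
lemma A_N: "x : A ==> x : N" using val_chk[OF G0, of x] N_I[of "chk zero x"] chkA[OF zeroA] by simp
lemma N_trans: "x : N ==> y : el x ==> y : N"
proof -
  assume "x : N" "y : el x"
  then obtain x0 s p where "x0 : A" "y = val G s" "pair s p : el x0" unfolding N_def by (auto simp: el_val)
  then show ?thesis using pair_elA(1) N_I by blast
qed
lemma countable_N: "countable N" unfolding N_def using cntA by simp
lemma carrier_N: "carrier N" by unfold_locales (use A_N[OF zeroA] in auto)

lemma dpred_forces_upd: assumes v: "range v <= A" and s: "dterm A s" and t: "dterm A t" shows "dpred A (%e. forces \<phi> (s e) (v(0 := t e)))"
proof (rule dpred_comp2[where Q="%p x. forces \<phi> p (v(0 := x))", OF _ s t])
  have "range (%n. case n of 0 => v 0 | Suc n => v n) <= A" using v by (auto simp: image_subset_iff split: nat.splits)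
  from dpred_fix[OF dpred_forces this, of \<phi> 2]
  have "dpred A (%e. forces \<phi> (e 0) (%n. if n = 0 then e (Suc n) else v n))" by (simp add: less_Suc_eq numeral_2_eq_2 cong: if_cong)
  moreover have "(%n. if n = 0 then e (Suc n) else v n) = v(0 := e 1)" for e by auto
  ultimately show "dpred A (%e. forces \<phi> (e 0) (v(0 := e 1)))" by simp
qed

lemma dpred_forces_upd2: assumes v: "range v <= A" and s: "dterm A s" and t: "dterm A t" and u: "dterm A u"
  shows "dpred A (%e. forces \<phi> (s e) (v(0 := t e, 2 := u e)))"
proof (rule dpred_comp3[where Q="%p x y. forces \<phi> p (v(0 := x, 2 := y))", OF _ s t u])
  let ?swap = "%n::nat. if n = 2 then 3 else if n = 3 then 2 else n"
  let ?w = "%k. case k of 0 => v 0 | Suc n => (v(2 := v 1)) n"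
  have "inj ?swap" by (rule injI) (auto split: if_splits)
  from dpred_ren[OF dpred_forces this, of \<phi>] have "dpred A (%e. forces \<phi> (e 0) (%n. (e \<circ> ?swap) (Suc n)))" by simp
  moreover have "range ?w <= A" using v by (auto simp: image_subset_iff split: nat.splits)
  ultimately have "dpred A (%e. forces \<phi> (e 0) (%n. ((%k. if k < 3 then e k else ?w k) \<circ> ?swap) (Suc n)))"
    using dpred_fix[of "%e. forces \<phi> (e 0) (%n. (e \<circ> ?swap) (Suc n))" ?w 3] by simp
  moreover have "(%n. ((%k. if k < 3 then e k else ?w k) \<circ> ?swap) (Suc n)) = v(0 := e 1, 2 := e 2)" for e
    by (auto simp: fun_eq_iff)
  ultimately show "dpred A (%e. forces \<phi> (e 0) (v(0 := e 1, 2 := e 2)))" by simp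
qed

lemma truth_definable: assumes "dpred N Q"
  obtains v \<phi> where "range v <= A" "!!e. range e <= A ==> Q (%k. val G (e k)) \<longleftrightarrow> (EX p:G. forces \<phi> p (merge e v))"
proof -
  obtain \<phi> w where w: "range w <= N" "!!e. range e <= N ==> Q e \<longleftrightarrow> sat N mem \<phi> (merge e w)"
    using assms unfolding dpred_def by blast
  have "ALL k. EX x. x : A \<and> w k = val G x" using w(1) unfolding N_def by blast
  then obtain v where v: "!!k. v k : A" "!!k. w k = val G (v k)" by metis
  show ?thesis
  proof (rule that[of v \<phi>])
    show "range v <= A" using v by blast
    fix e :: "nat => hset" assume e: "range e <= A"
    have "range (%k. val G (e k)) <= N" using e N_I by blast
    then have "Q (%k. val G (e k)) \<longleftrightarrow> sat N mem \<phi> (merge (%k. val G (e k)) w)" by (rule w(2))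
    also have "merge (%k. val G (e k)) w = (%k. val G (merge e v k))" by (auto simp: merge_def v(2))
    also have "sat N mem \<phi> ... \<longleftrightarrow> (EX p:G. forces \<phi> p (merge e v))"
      by (rule truth) (use e v in \<open>auto simp: image_subset_iff merge_def\<close>)
    finally show "Q (%k. val G (e k)) \<longleftrightarrow> (EX p:G. forces \<phi> p (merge e v))" .
  qed
qed

lemma truth_definable1: assumes "dpred N (%e. Q (e 0))"
  obtains v \<phi> where "range v <= A" "!!i. i : A ==> Q (val G i) \<longleftrightarrow> (EX p:G. forces \<phi> p (v(0 := i)))"
proof -
  obtain v \<phi> where v: "range v <= A" "!!e. range e <= A ==> Q (val G (e 0)) \<longleftrightarrow> (EX p:G. forces \<phi> p (merge e v))"
    by (rule truth_definable[OF assms]) (rule that)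
  have "Q (val G i) \<longleftrightarrow> (EX p:G. forces \<phi> p ((merge (%_. zero) v)(0 := i)))" if "i : A" for i
  proof -
    have "merge ((%_. zero)(0 := i)) v = (merge (%_. zero) v)(0 := i)" by (auto simp: merge_def fun_eq_iff elim!: evenE)
    then show ?thesis using v(2)[of "(%_. zero)(0 := i)"] that zeroA by (simp add: image_subset_iff)
  qed
  moreover have "range (merge (%_. zero) v) <= A" using v(1) zeroA by (auto simp: merge_def)
  ultimately show ?thesis using that by blast
qed

lemma truth_definable2: assumes "dpred N (%e. R (e 0) (e 1))"
  obtains v \<phi> where "range v <= A" "!!i t. i : A ==> t : A ==> R (val G i) (val G t) \<longleftrightarrow> (EX p:G. forces \<phi> p (v(0 := i, 2 := t)))"
proof -
  obtain v \<phi> where v: "range v <= A" "!!e. range e <= A ==> R (val G (e 0)) (val G (e 1)) \<longleftrightarrow> (EX p:G. forces \<phi> p (merge e v))"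
    by (rule truth_definable[OF assms]) (rule that)
  have "R (val G i) (val G t) \<longleftrightarrow> (EX p:G. forces \<phi> p ((merge (%_. zero) v)(0 := i, 2 := t)))" if "i : A" "t : A" for i t
  proof -
    have "merge ((%_. zero)(0 := i, 1 := t)) v = (merge (%_. zero) v)(0 := i, 2 := t)" by (auto simp: merge_def fun_eq_iff elim!: evenE)
    then show ?thesis using v(2)[of "(%_. zero)(0 := i, 1 := t)"] that zeroA by (simp add: image_subset_iff)
  qed
  moreover have "range (merge (%_. zero) v) <= A" using v(1) zeroA by (auto simp: merge_def)
  ultimately show ?thesis using that by blast
qed

lemma Sep_name: assumes Q: "dpred N (%e. Q (e 0))" and b: "limit b" "b : A" and I: "I : A" "small b I"
  shows "EX f:A. el f <= el (prd I (conds a b)) \<and> (ALL i:el I. Q (val G i) \<longleftrightarrow> (EX u:G. pair i u : el f))"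
proof -
  obtain v \<phi> where v: "range v <= A" and Qi: "!!i. i : A ==> Q (val G i) \<longleftrightarrow> (EX p:G. forces \<phi> p (v(0 := i)))"
    by (rule truth_definable1[OF Q]) (rule that)
  have vi: "range (v(0 := i)) <= A" if "i : A" for i using v that by (auto simp: image_subset_iff)
  let ?D = "%i p. forces \<phi> p (v(0 := i)) \<or> forces (Neg \<phi>) p (v(0 := i))"
  have "EX q:G. ALL i:el I. EX u:Glow b. ?D i (cup u q)"
  proof (rule ex_generic_upper[OF b I])
    show "dpred A (%e. ?D (e 0) (e 1))" by (intro dpred_disj dpred_forces_upd v dintro)
    show "EX d. cond a d \<and> el p <= el d \<and> ?D i d" if "i : el I" "cond a p" for i p
      using forces_or_neg[OF vi] that I Atrans by blast
    show "?D i q" if "i : el I" "cond a p" "?D i p" "cond a q" "el p <= el q" for i p q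
      using forces_mono[OF vi] that I Atrans by blast
  qed
  then obtain q where q: "q : G" "ALL i:el I. EX u:Glow b. ?D i (cup u q)" by blast
  let ?f = "mk {z : el (prd I (conds a b)). forces \<phi> (cup (pr2 z) q) (v(0 := pr1 z))}"
  have fA: "?f : A" by (rule sepA) (intro dpred_forces_upd v dintro G_mem[OF q(1)], use I aA b in simp)
  have elf: "el ?f = {z : el (prd I (conds a b)). forces \<phi> (cup (pr2 z) q) (v(0 := pr1 z))}" by (rule el_Collect)
  have "Q (val G i) \<longleftrightarrow> (EX u:G. pair i u : el ?f)" if i: "i : el I" for i
  proof
    have iA: "i : A" using i I Atrans by blast
    assume "Q (val G i)"
    then obtain p where p: "p : G" "forces \<phi> p (v(0 := i))" using Qi[OF iA] by blast
    obtain u where u: "u : Glow b" "?D i (cup u q)" using q i by blast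
    have uG: "u : G" "cup u q : G" using u q Gcup unfolding Glow_def by auto
    have "forces \<phi> (cup u q) (v(0 := i))" using u(2) forces_contra[OF vi[OF iA] p(1) uG(2) p(2)] by blast
    then have "pair i u : el ?f" unfolding elf using i u Glow_conds b(1) by (auto simp: el_prd limit_def)
    then show "EX u:G. pair i u : el ?f" using uG by blast
  next
    have iA: "i : A" using i I Atrans by blast
    assume "EX u:G. pair i u : el ?f"
    then obtain u where "u : G" "forces \<phi> (cup u q) (v(0 := i))" unfolding elf by auto
    then show "Q (val G i)" using Qi[OF iA] Gcup q by blast
  qed
  moreover have "el ?f <= el (prd I (conds a b))" unfolding elf by blast
  ultimately show ?thesis using fA by blast
qed

lemma Sep_val: assumes Q: "dpred N (%e. Q (e 0))" and b: "limit b" "b : A" and I: "I : A" "small b I"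
  shows "EX f:A. el f <= el (prd I (conds a b)) \<and> el (val G f) = {val G i |i. i : el I \<and> Q (val G i)}"
proof -
  obtain f where f: "f : A" "el f <= el (prd I (conds a b))" "ALL i:el I. Q (val G i) \<longleftrightarrow> (EX u:G. pair i u : el f)"
    using Sep_name[OF assms] by blast
  have fI: "i : el I" if "pair i u : el f" for i u using subsetD[OF f(2) that] by (auto simp: el_prd)
  have "el (val G f) = {val G i |i. i : el I \<and> Q (val G i)}" unfolding el_val
  proof (intro set_eqI iffI)
    fix z assume "z : {val G s |s p. p : G \<and> pair s p : el f}"
    then obtain s p where "z = val G s" "p : G" "pair s p : el f" by blast
    then show "z : {val G i |i. i : el I \<and> Q (val G i)}" using f(3) fI by blast
  next
    fix z assume "z : {val G i |i. i : el I \<and> Q (val G i)}"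
    then show "z : {val G s |s p. p : G \<and> pair s p : el f}" using f(3) by blast
  qed
  then show ?thesis using f by blast
qed

definition dom_name where "dom_name x = mk (pr1 ` el x)"
lemma dom_nameA: "x : A ==> dom_name x : A" unfolding dom_name_def by (rule dterm_constD) (intro dintro)
lemma val_dom_name: "el (val G x) <= val G ` el (dom_name x)"
  unfolding dom_name_def by (auto simp: el_val image_iff) force

lemma small_nextlim: "I : A ==> limit (nextlim I) \<and> nextlim I : A \<and> small (nextlim I) I" using nextlim[of I] small_rank[of "nextlim I" I] by blast

lemma N_sep: assumes Q: "dpred N (%e. Q (e 0))" and x: "x : N" shows "mk {y : el x. Q y} : N"
proof -
  interpret N: carrier N by (rule carrier_N)
  obtain x0 where x0: "x0 : A" "x = val G x0" using x unfolding N_def by blast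
  let ?I = "dom_name x0"
  have I: "?I : A" using dom_nameA x0 by blast
  have "dpred N (%e. e 0 : el x \<and> Q (e 0))" by (intro N.dpred_conj N.dpred_mem N.dterm_var N.dterm_const x Q)
  from Sep_val[OF this, of "nextlim ?I" ?I] small_nextlim[OF I] I
  obtain f where f: "f : A" "el (val G f) = {val G i |i. i : el ?I \<and> (val G i : el x \<and> Q (val G i))}" by blast
  have "el (val G f) = {y : el x. Q y}" unfolding f(2) using val_dom_name[of x0] x0(2) by blast
  then have "mk {y : el x. Q y} = val G f" by (metis mk_el)
  then show ?thesis using N_I f by simp
qed

lemma N_upair: assumes "x : N" "y : N" shows "upair x y : N"
proof -
  obtain s t where "s : A" "t : A" "x = val G s" "y = val G t" using assms unfolding N_def by blast
  then show ?thesis using val_upair_name[OF G0, of s t] N_I[of "upair_name s t"] by (simp add: upair_name_def)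
qed

lemma N_Uni: assumes x: "x : N" shows "Uni x : N"
proof -
  interpret N: carrier N by (rule carrier_N)
  obtain x0 where x0: "x0 : A" "x = val G x0" using x unfolding N_def by blast
  let ?T = "val G (set_name (tc x0))"
  have T: "?T : N" using x0 by (intro N_I) simp
  have "mk {y : el ?T. EX w:N. w : el x \<and> y : el w} : N"
    by (rule N_sep[OF _ T]) (intro N.dpred_ex N.dpred_conj N.dpred_mem N.dterm_var N.dterm_const x)
  moreover have "{y : el ?T. EX w:N. w : el x \<and> y : el w} = \<Union>(el ` el x)"
  proof (intro set_eqI iffI)
    fix y assume "y : \<Union>(el ` el x)"
    then obtain w where w: "w : el x" "y : el w" by blast
    then obtain s p where s: "w = val G s" "pair s p : el x0" unfolding x0(2) el_val by blast
    then obtain t q where t: "y = val G t" "pair t q : el s" using w(2) unfolding s(1) el_val by blast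
    have "t : TC x0" using pair_el_TC(1)[OF s(2)] pair_el_TC(1)[OF t(2)] TC_trans by blast
    then have "y : el ?T" unfolding val_set_name[OF G0] t(1) by simp
    then show "y : {y : el ?T. EX w:N. w : el x \<and> y : el w}" using w N_trans[OF x] by blast
  qed blast
  ultimately show ?thesis by (simp add: Uni_def)
qed

text \<open>A subset of \<open>val G x\<close> has a name among the subsets of \<open>prd (dom_name x) (conds a b)\<close>.\<close>

lemma N_Pow: assumes x: "x : N" shows "mk {y : N. el y <= el x} : N"
proof -
  interpret N: carrier N by (rule carrier_N)
  obtain x0 where x0: "x0 : A" "x = val G x0" using x unfolding N_def by blast
  let ?I = "dom_name x0"
  have I: "?I : A" using dom_nameA x0 by blast
  let ?T = "set_name (pow (prd ?I (conds a (nextlim ?I))))"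
  have T: "val G ?T : N" using I aA small_nextlim[OF I] by (intro N_I) simp
  have "mk {y : el (val G ?T). ALL w:N. w : el y --> w : el x} : N"
    by (rule N_sep[OF _ T]) (intro N.dpred_all N.dpred_imp N.dpred_mem N.dterm_var N.dterm_const x)
  moreover have "{y : el (val G ?T). ALL w:N. w : el y --> w : el x} = {y : N. el y <= el x}"
  proof (intro set_eqI iffI)
    fix y assume y: "y : {y : el (val G ?T). ALL w:N. w : el y --> w : el x}"
    then have "y : N" using N_trans[OF T] by blast
    then show "y : {y : N. el y <= el x}" using y N_trans by blast
  next
    fix y assume y: "y : {y : N. el y <= el x}"
    have "dpred N (%e. e 0 : el y)" using y by (intro N.dpred_mem N.dterm_var N.dterm_const) simp
    from Sep_val[OF this, of "nextlim ?I" ?I] small_nextlim[OF I] I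
    obtain f where f: "f : A" "el f <= el (prd ?I (conds a (nextlim ?I)))" "el (val G f) = {val G i |i. i : el ?I \<and> val G i : el y}" by blast
    have "el (val G f) = el y" unfolding f(3) using val_dom_name[of x0] x0(2) y by blast
    then have "y = val G f" by (rule ext_el[symmetric])
    moreover have "f : el (pow (prd ?I (conds a (nextlim ?I))))" using f by simp
    ultimately have "y : el (val G ?T)" unfolding val_set_name[OF G0] by blast
    then show "y : {y : el (val G ?T). ALL w:N. w : el y --> w : el x}" using y by blast
  qed
  ultimately show ?thesis by simp
qed

lemma ex_deciding: assumes v: "range v <= A" and I: "I : A" and b: "limit b" "b : A" "small b I"
  shows "EX q:G. ALL i:el I. EX u:Glow b. (EX t:A. forces \<phi> (cup u q) (v(0 := i, 2 := t))) \<or>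
    (ALL t:A. forces (Neg \<phi>) (cup u q) (v(0 := i, 2 := t)))"
proof (rule ex_generic_upper[OF b(1,2) I b(3)])
  let ?D = "%i p. (EX t:A. forces \<phi> p (v(0 := i, 2 := t))) \<or> (ALL t:A. forces (Neg \<phi>) p (v(0 := i, 2 := t)))"
  show "dpred A (%e. ?D (e 0) (e 1))" by (intro dpred_disj dpred_ex dpred_all dpred_forces_upd2 v dterm_var)
  fix i p assume i: "i : el I" and p: "cond a p"
  have vi: "range (v(0 := i, 2 := t)) <= A" if "t : A" for t
    using v that i I Atrans by (auto simp: image_subset_iff)
  show "EX d. cond a d \<and> el p <= el d \<and> ?D i d"
  proof (cases "ALL t:A. forces (Neg \<phi>) p (v(0 := i, 2 := t))")
    case True then show ?thesis using p by blast
  next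
    case False
    then obtain t q where "t : A" "q : A" "cond a q" "el p <= el q" "forces \<phi> q (v(0 := i, 2 := t))" by auto
    then show ?thesis by blast
  qed
  fix q assume "?D i p" "cond a q" "el p <= el q"
  then show "?D i q" using forces_mono[OF vi _ p] by blast
qed

lemma N_replacement: assumes R: "dpred N (%e. R (e 0) (e 1))" and x: "x : N"
    and ex: "!!c. c : el x ==> EX! d. d : N \<and> R c d"
  shows "EX y:N. ALL c:el x. EX d:el y. R c d"
proof -
  obtain v \<phi> where v: "range v <= A"
    and Ri: "!!i t. i : A ==> t : A ==> R (val G i) (val G t) \<longleftrightarrow> (EX p:G. forces \<phi> p (v(0 := i, 2 := t)))"
    by (rule truth_definable2[OF R]) (rule that)
  have vi: "range (v(0 := i, 2 := t)) <= A" if "i : A" "t : A" for i t using v that by (auto simp: image_subset_iff)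
  obtain x0 where x0: "x0 : A" "x = val G x0" using x unfolding N_def by blast
  let ?I = "dom_name x0" let ?b = "nextlim (dom_name x0)" let ?P = "prd (dom_name x0) (conds a (nextlim (dom_name x0)))"
  have I: "?I : A" using dom_nameA x0 by blast
  have b: "limit ?b" "?b : A" "small ?b ?I" using small_nextlim[OF I] by auto
  obtain q where q: "q : G" "ALL i:el ?I. EX u:Glow ?b. (EX t:A. forces \<phi> (cup u q) (v(0 := i, 2 := t))) \<or>
      (ALL t:A. forces (Neg \<phi>) (cup u q) (v(0 := i, 2 := t)))" using ex_deciding[OF v I b] by blast
  let ?F = "%z t. forces \<phi> (cup (pr2 z) q) (v(0 := pr1 z, 2 := t))"
  have "EX Y:A. ALL z:el ?P. EX t:el Y. (EX t:A. ?F z t) --> ?F z t"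
  proof (rule collection)
    show "dpred A (%e. (EX t:A. ?F (e 0) t) --> ?F (e 0) (e 1))" by (intro dpred_imp dpred_ex dpred_forces_upd2 v dintro G_mem[OF q(1)])
    show "?P : A" using I aA b by simp
    show "EX t:A. (EX t:A. ?F z t) --> ?F z t" for z using zeroA by blast
  qed
  then obtain Y where Y: "Y : A" "ALL z:el ?P. EX t:el Y. (EX t:A. ?F z t) --> ?F z t" by blast
  have "EX d:el (val G (set_name Y)). R c d" if c: "c : el x" for c
  proof -
    obtain i where i: "i : el ?I" "c = val G i" using c val_dom_name[of x0] x0 by blast
    have iA: "i : A" using i I Atrans by blast
    obtain d where "d : N" "R c d" using ex[OF c] by blast
    then obtain t0 where t0: "t0 : A" "R c (val G t0)" unfolding N_def by blast
    then obtain p where p: "p : G" "forces \<phi> p (v(0 := i, 2 := t0))" using Ri[OF iA] i by blast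
    obtain u where u: "u : Glow ?b" and decides: "(EX t:A. forces \<phi> (cup u q) (v(0 := i, 2 := t))) \<or>
      (ALL t:A. forces (Neg \<phi>) (cup u q) (v(0 := i, 2 := t)))" using q i by blast
    have uG: "cup u q : G" using u q Gcup unfolding Glow_def by auto
    have "EX t:A. ?F (pair i u) t" using decides forces_contra[OF vi[OF iA t0(1)] p(1) uG p(2)] t0(1) by (auto simp del: forces.simps)
    moreover have "pair i u : el ?P" using i u Glow_conds b(1) by (auto simp: el_prd limit_def)
    ultimately obtain t where t: "t : el Y" "?F (pair i u) t" using Y(2) by blast
    have "t : A" using t Y Atrans by blast
    then have "R c (val G t)" using Ri[OF iA] t(2) uG i(2) by auto
    then show ?thesis unfolding val_set_name[OF G0] using t by blast
  qed
  moreover have "val G (set_name Y) : N" using Y by (intro N_I) simp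
  ultimately show ?thesis by blast
qed

theorem N_zf: "zf N"
proof -
  interpret N: carrier N by (rule carrier_N)
  show ?thesis
  proof unfold_locales
    show "y : N" if "x : N" "y : el x" for x y using N_trans that by blast
    show "omega : N" using A_N omegaA by blast
    show "EX y:N. ALL c:el x. EX d:el y. R c d" if "dpred N (%e. R (e 0) (e 1))" "x : N"
      "!!c. c : el x ==> EX! d. d : N \<and> R c d" for R x using N_replacement that by blast
  qed (fact countable_N N_upair N_sep N_Uni N_Pow)+
qed

lemma val_graph_N: assumes I: "I : A" shows "lam I (val G) : N"
proof -
  let ?T = "set_name (mk ((%s. pair_name (chk zero s) s) ` el I))"
  have "?T : A" by (rule dterm_constD) (intro dintro zeroA I)
  moreover have "val G ?T = lam I (val G)"
  proof (rule ext_el)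
    have "el (val G ?T) = val G ` (%s. pair_name (chk zero s) s) ` el I" unfolding val_set_name[OF G0] by simp
    also have "... = (%s. pair s (val G s)) ` el I" by (simp add: image_image val_pair_name[OF G0] val_chk[OF G0])
    finally show "el (val G ?T) = el (lam I (val G))" by simp
  qed
  ultimately show ?thesis using N_I by metis
qed

text \<open>The choice set consists of the values of the \<open>less_L\<close>-least names.\<close>

theorem N_AC: "AC N"
  unfolding AC_def
proof (intro ballI impI, elim conjE)
  interpret N: zf N by (rule N_zf)
  fix x assume x: "x : N" and ne: "ALL y:el x. el y ~= {}" and dj: "ALL y:el x. ALL z:el x. y ~= z --> el y Int el z = {}"
  obtain x0 where x0: "x0 : A" "x = val G x0" using x unfolding N_def by blast
  let ?I = "tc x0" let ?F = "lam ?I (val G)" let ?w = "mk {z : el (prd ?I ?I). less_L (pr1 z) (pr2 z)}"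
  have "?w : A" by (rule sepA) (intro dintro, use x0 in simp)
  then have params: "?F : N" "?I : N" "?w : N" using val_graph_N A_N x0 by auto
  have elw: "pair s t : el ?w \<longleftrightarrow> s : TC x0 \<and> t : TC x0 \<and> less_L s t" for s t
    unfolding el_Collect by (auto simp: el_prd)
  have elF: "pair s d : el ?F \<longleftrightarrow> s : TC x0 \<and> d = val G s" for s d by auto
  let ?Q = "%y s. s : TC x0 \<and> val G s : el y"
  have least: "EX! s. s : A \<and> ?Q y s \<and> (ALL t:A. ?Q y t --> \<not> less_L t s)" if y: "y : el x" for y
  proof -
    obtain d where d: "d : el y" using ne y by blast
    obtain s p where s: "y = val G s" "pair s p : el x0" using y unfolding x0(2) el_val by blast
    then obtain t q where t: "d = val G t" "pair t q : el s" using d unfolding s(1) el_val by blast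
    have "t : TC x0" using pair_el_TC(1)[OF s(2)] pair_el_TC(1)[OF t(2)] TC_trans by blast
    moreover have "TC x0 <= A" using el_subA[OF tcA[OF x0(1)]] by simp
    ultimately show ?thesis using d t(1) by (intro least_L_ex1[of t]) auto
  qed
  let ?L = "%y d. EX s:el ?I. pair s d : el ?F \<and> (ALL t:el ?I. ALL d':el y. pair t d' : el ?F --> pair t s ~: el ?w)"
  let ?c = "mk {d : el (Uni x). EX y:el x. d : el y \<and> ?L y d}"
  have cN: "?c : N" by (rule N.sepA) (intro dintro x params, use x in simp)
  have elc: "el ?c = {d : el (Uni x). EX y:el x. d : el y \<and> ?L y d}" by (rule el_Collect)
  have TA: "TC x0 <= A" using el_subA[OF tcA[OF x0(1)]] by simp
  have L: "d : el y \<and> ?L y d \<longleftrightarrow> (EX s. (s : A \<and> ?Q y s \<and> (ALL t:A. ?Q y t --> \<not> less_L t s)) \<and> d = val G s)" for y d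
    unfolding elF elw el_tc using TA by blast
  have "EX! z. z : el ?c Int el y" if y: "y : el x" for y
  proof -
    have "y' = y" if "y' : el x" "z : el y'" "z : el y" for y' z using dj y that by blast
    then have "z : {d : el (Uni x). EX y:el x. d : el y \<and> L y d} Int el y \<longleftrightarrow> z : el y \<and> L y z" for L z
      unfolding el_Uni using y by blast
    then have "z : el ?c Int el y \<longleftrightarrow> z : el y \<and> ?L y z" for z unfolding elc .
    note trans[OF this L]
    then show ?thesis using least[OF y] by (elim ex1E) (intro ex1I, blast+)
  qed
  then show "EX c:N. ALL y:el x. EX! z. z : el c Int el y" using cN by blast
qed

end

section \<open>Transitive models of ZFC\<close>

lemma elts_el: "ALL x:A. el x <= A ==> x : A ==> elts A mem x = el x"
  unfolding elts_def by auto

context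
  fixes A
  assumes cnt: "countable A" and t: "ALL x:A. el x <= A"
begin

lemma elts_el_el: "x : A ==> y : el x ==> elts A mem y = el y" using elts_el[OF t] t by blast

lemma ex_elts_iff: "X <= A ==> (EX z:A. elts A mem z = X) \<longleftrightarrow> mk X : A"
  using elts_el[OF t] mk_el el_mk[OF countable_subset[OF _ cnt]] by metis

lemma foundation_transitive: "ALL x:A. elts A mem x ~= {} --> (EX y:elts A mem x. elts A mem y Int elts A mem x = {})"
proof (intro ballI impI)
  fix x assume x: "x : A" "elts A mem x ~= {}"
  then obtain y0 where "y0 : el x" using elts_el[OF t] by auto
  then obtain y where "y : el x" "!!z. z : el y ==> z ~: el x" using wfE_min[OF wf_mem, of y0 "el x"] by auto
  then show "EX y:elts A mem x. elts A mem y Int elts A mem x = {}" using elts_el[OF t x(1)] elts_el_el[OF x(1)] by auto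
qed

lemma union_transitive_iff: assumes x: "x : A" shows "(EX u:A. elts A mem u = (UN y:elts A mem x. elts A mem y)) \<longleftrightarrow> Uni x : A"
proof -
  have "(UN y:elts A mem x. elts A mem y) = \<Union>(el ` el x)" using elts_el[OF t x] elts_el_el[OF x] by simp
  moreover have "\<Union>(el ` el x) <= A" using t x by blast
  ultimately show ?thesis using ex_elts_iff unfolding Uni_def by simp
qed

lemma infinity_transitive_iff: assumes w: "w : A"
  shows "(EX x:elts A mem w. elts A mem x = {}) \<and> (ALL x:elts A mem w. EX s:elts A mem w. elts A mem s = insert x (elts A mem x)) \<longleftrightarrow>
    zero : el w \<and> (ALL x:el w. succ x : el w)"
proof -
  have "elts A mem x = {} \<longleftrightarrow> x = zero" if "x : el w" for x using elts_el_el[OF w that] ext_el[of x zero] by auto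
  moreover have "elts A mem s = insert x (elts A mem x) \<longleftrightarrow> s = succ x" if "x : el w" "s : el w" for x s
    using elts_el_el[OF w] that ext_el[of s "succ x"] by auto
  ultimately show ?thesis using elts_el[OF t w] by auto
qed

lemma separation_transitive_iff: assumes x: "x : A"
  shows "(EX y:A. elts A mem y = elts A mem x Int X) \<longleftrightarrow> mk (el x Int X) : A"
  using ex_elts_iff[of "el x Int X"] elts_el[OF t x] t x by auto

lemma ZFC_transitive_iff: "ZFC A mem \<longleftrightarrow>
     (ALL x:A. ALL y:A. upair x y : A) \<and> (ALL x:A. Uni x : A) \<and> (ALL x:A. mk {y : A. el y <= el x} : A) \<and>
     (EX w:A. zero : el w \<and> (ALL x:el w. succ x : el w)) \<and>
     (ALL X. definable A mem X --> (ALL x:A. mk (el x Int X) : A)) \<and>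
     (ALL R. definable_rel A mem R --> (ALL x:A. (ALL a:el x. EX! b. (a, b) : R) --> (EX y:A. ALL a:el x. EX b:el y. (a, b) : R))) \<and>
     AC A"
proof -
  note e = elts_el[OF t]
  have extensionality: "extensional_model A mem" unfolding extensional_model_def using e ext_el by auto
  have pairing: "(ALL x:A. ALL y:A. EX z:A. elts A mem z = {x, y}) \<longleftrightarrow> (ALL x:A. ALL y:A. upair x y : A)"
    unfolding upair_def using ex_elts_iff by simp
  have power: "(ALL x:A. EX p:A. elts A mem p = {y : A. elts A mem y <= elts A mem x}) \<longleftrightarrow> (ALL x:A. mk {y : A. el y <= el x} : A)"
    using e ex_elts_iff by (simp cong: conj_cong)
  have replacement: "(ALL R. definable_rel A mem R --> (ALL x:A. (ALL a:elts A mem x. EX! b. (a, b) : R) -->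
      (EX y:A. ALL a:elts A mem x. EX b:elts A mem y. (a, b) : R))) \<longleftrightarrow>
    (ALL R. definable_rel A mem R --> (ALL x:A. (ALL a:el x. EX! b. (a, b) : R) --> (EX y:A. ALL a:el x. EX b:el y. (a, b) : R)))"
    using e by simp
  have choice: "(ALL x:A. (ALL y:elts A mem x. elts A mem y ~= {}) \<and>
      (ALL y:elts A mem x. ALL z:elts A mem x. y ~= z --> elts A mem y Int elts A mem z = {}) -->
      (EX c:A. ALL y:elts A mem x. EX! z. z : elts A mem c Int elts A mem y)) \<longleftrightarrow> AC A"
    unfolding AC_def by (rule ball_cong[OF HOL.refl]) (simp add: e elts_el_el)
  show ?thesis unfolding ZFC_def pairing power replacement choice eqTrueI[OF extensionality] eqTrueI[OF foundation_transitive]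
    by (simp only: simp_thms union_transitive_iff infinity_transitive_iff separation_transitive_iff cong: ball_cong bex_cong)
qed

end

definition zero_or_succ where
  "zero_or_succ A m \<longleftrightarrow> (ALL z:A. z ~: el m) \<or> (EX k:A. k : el m \<and> (ALL z:A. z : el m \<longleftrightarrow> z = k \<or> z : el k))"

lemma zero_or_succ_iff: assumes t: "ALL x:A. el x <= A" and m: "m : A"
  shows "zero_or_succ A m \<longleftrightarrow> m = zero \<or> (EX k:A. m = succ k)"
proof -
  have "(ALL z:A. z ~: el m) \<longleftrightarrow> m = zero"
    using t m ext_el[of m zero] by auto
  moreover have "k : el m \<and> (ALL z:A. z : el m \<longleftrightarrow> z = k \<or> z : el k) \<longleftrightarrow> m = succ k" if "k : A" for k
    using t m that ext_el[of m "succ k"] by auto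
  ultimately show ?thesis unfolding zero_or_succ_def by simp
qed

lemma range_vn_iff: assumes t: "ALL x:A. el x <= A" and vn: "range vn <= A" and n: "n : A"
  shows "n : range vn \<longleftrightarrow> (ALL m:A. m : el n \<or> m = n --> zero_or_succ A m)"
proof
  assume "n : range vn"
  then obtain i where i: "n = vn i" by blast
  have "el (vn i) <= range vn" using Ord_omega unfolding Ord_def by simp
  moreover have "vn j = zero \<or> (EX k:A. vn j = succ k)" for j using vn by (cases j) auto
  ultimately show "ALL m:A. m : el n \<or> m = n --> zero_or_succ A m" unfolding i using zero_or_succ_iff[OF t] by blast
next
  assume "ALL m:A. m : el n \<or> m = n --> zero_or_succ A m"
  then show "n : range vn" using n
  proof (induction n rule: el_induct)
    case (step n)
    then have "n = zero \<or> (EX k:A. n = succ k)" using zero_or_succ_iff[OF t] by blast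
    then show ?case
    proof (elim disjE bexE)
      assume "n = zero"
      then have "n = vn 0" by simp
      then show ?thesis by (rule range_eqI)
    next
      fix k assume k: "k : A" "n = succ k"
      then obtain i where "k = vn i" using step.IH[of k] step.prems(1) by auto
      then have "n = vn (Suc i)" using k(2) by simp
      then show ?thesis by (rule range_eqI)
    qed
  qed
qed

lemma (in carrier) omega_mem: assumes t: "ALL x:A. el x <= A"
  and sep: "!!Q. dpred A (%e. Q (e 0)) ==> mk {y : el w. Q y} : A"
  and w: "w : A" "zero : el w" "ALL x:el w. succ x : el w"
  shows "omega : A"
proof -
  have vw: "vn n : el w" for n by (induction n) (use w in auto)
  then have vn: "range vn <= A" using t w(1) by blast
  let ?P = "%n. ALL m:A. m : el n \<or> m = n --> zero_or_succ A m"
  have "mk {n : el w. ?P n} : A" by (rule sep) (unfold zero_or_succ_def, intro dintro)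
  moreover have "n : el w \<and> ?P n \<longleftrightarrow> n : range vn" for n
    using range_vn_iff[OF t vn, of n] vw t w(1) by blast
  ultimately show ?thesis by (simp add: omega_def)
qed

lemma zf_if_ZFC: assumes cnt: "countable A" and t: "ALL x:A. el x <= A" and Z: "ZFC A mem" shows "zf A"
proof -
  note ax = Z[unfolded ZFC_transitive_iff[OF cnt t]]
  from ax obtain w where w: "w : A" "zero : el w" "ALL x:el w. succ x : el w" by (elim conjE bexE) (rule that)
  interpret carrier A by unfold_locales (use w in blast)
  have sep: "mk {y : el x. Q y} : A" if Q: "dpred A (%e. Q (e 0))" and x: "x : A" for Q x
  proof -
    have "dpred A (%e. e 0 : {y : A. Q y})" using Q by (rule dpred_cong) auto
    then have "definable A mem {y : A. Q y}" by (subst definable_iff_dpred) auto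
    moreover have "ALL X. definable A mem X --> (ALL x:A. mk (el x Int X) : A)" using ax by (elim conjE)
    ultimately have "mk (el x Int {y : A. Q y}) : A" using x by blast
    moreover have "el x Int {y : A. Q y} = {y : el x. Q y}" using t x by blast
    ultimately show ?thesis by simp
  qed
  have repl: "EX y:A. ALL a:el x. EX b:el y. (a, b) : R"
    if "definable_rel A mem R" "x : A" "!!a. a : el x ==> EX! b. (a, b) : R" for R x
  proof -
    have "ALL R. definable_rel A mem R --> (ALL x:A. (ALL a:el x. EX! b. (a, b) : R) -->
      (EX y:A. ALL a:el x. EX b:el y. (a, b) : R))" using ax by (elim conjE)
    then show ?thesis using that by simp
  qed
  show ?thesis
  proof unfold_locales
    show "y : A" if "x : A" "y : el x" for x y using t that by blast
    show "omega : A" by (rule omega_mem[OF t sep[OF _ w(1)] w])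
    show "mk {y : el x. Q y} : A" if "dpred A (%e. Q (e 0))" "x : A" for Q x using sep that .
    show "mk {y : A. el y <= el x} : A" if "x : A" for x using ax that by (elim conjE) (rule bspec)
    fix R x assume R: "dpred A (%e. R (e 0) (e 1))" and x: "x : A" and u: "!!a. a : el x ==> EX! b. b : A \<and> R a b"
    let ?R = "{(a, b). a : A \<and> b : A \<and> R a b}"
    have "dpred A (%e. (e 0, e 1) : ?R)" using R by (rule dpred_cong) auto
    then have "definable_rel A mem ?R" by (subst definable_rel_iff_dpred) auto
    moreover have "EX! b. (a, b) : ?R" if a: "a : el x" for a
    proof -
      have "a : A" using a t x by blast
      then show ?thesis using u[OF a] by simp
    qed
    ultimately have "EX y:A. ALL a:el x. EX b:el y. (a, b) : ?R" using repl x by blast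
    then show "EX y:A. ALL a:el x. EX b:el y. R a b" by blast
  qed (use cnt ax in auto)
qed

lemma (in zf) ZFC_if_AC: assumes AC: "AC A" shows "ZFC A mem"
proof -
  have t: "ALL x:A. el x <= A" using el_subA by blast
  have sep: "mk (el x Int X) : A" if X: "definable A mem X" and x: "x : A" for X x
  proof -
    have "X <= A" using X unfolding definable_def by blast
    then have "dpred A (%e. e 0 : X)" using X definable_iff_dpred by blast
    from sepA[OF this x] show ?thesis by (simp add: Int_def)
  qed
  have repl: "EX y:A. ALL a:el x. EX b:el y. (a, b) : R"
    if R: "definable_rel A mem R" and x: "x : A" and u: "ALL a:el x. EX! b. (a, b) : R" for R x
  proof (rule replA[OF _ x])
    have RA: "R <= A \<times> A" using R unfolding definable_rel_def by blast
    then show "dpred A (%e. (e 0, e 1) : R)" using R definable_rel_iff_dpred by blast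
    show "EX! b. b : A \<and> (a, b) : R" if "a : el x" for a using u RA that by blast
  qed
  have inf: "EX w:A. zero : el w \<and> (ALL x:el w. succ x : el w)"
  proof (rule bexI[OF _ omegaA])
    have "zero = vn 0" "!!n. succ (vn n) = vn (Suc n)" by simp_all
    then show "zero : el omega \<and> (ALL x:el omega. succ x : el omega)" unfolding el_omega by blast
  qed
  show ?thesis unfolding ZFC_transitive_iff[OF cntA t]
    using AC by (intro conjI ballI allI impI upairA UniA powersetA inf sep repl) blast+
qed

theorem ZFC_iff_zf: assumes "countable A" "ALL x:A. el x <= A" shows "ZFC A mem \<longleftrightarrow> zf A \<and> AC A"
  using zf_if_ZFC[OF assms] ZFC_transitive_iff[OF assms] zf.ZFC_if_AC by blast

lemma AC_transversal: "AC A ==> x : A ==> (!!y. y : el x ==> el y ~= {}) ==>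
  (!!y z. y : el x ==> z : el x ==> y ~= z ==> el y Int el z = {}) ==> EX c:A. ALL y:el x. EX! z. z : el c Int el y"
  unfolding AC_def by simp

lemma (in zf) AC_selector: assumes AC: "AC A" and B: "B : A" and ne: "!!y. y : el B ==> el y ~= {}"
  shows "EX c:A. ALL y:el B. EX! v. v : el y \<and> pair y v : el c"
proof -
  let ?F = "mk ((%y. prd (upair y y) y) ` el B)"
  have FA: "?F : A" by (rule dterm_constD) (intro dintro B)
  have elF: "el ?F = (%y. prd (upair y y) y) ` el B" by simp
  have mem: "z : el (prd (upair y y) y) \<longleftrightarrow> (EX v. z = pair y v \<and> v : el y)" for z y by (auto simp: el_prd)
  obtain c where c: "c : A" "ALL y:el ?F. EX! z. z : el c Int el y"
  proof (rule bexE[OF AC_transversal[OF AC FA]])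
    show "el y ~= {}" if "y : el ?F" for y using that ne mem unfolding elF by fast
    show "el y Int el z = {}" if "y : el ?F" "z : el ?F" "y ~= z" for y z using that mem unfolding elF by auto
  qed
  have "EX! v. v : el y \<and> pair y v : el c" if "y : el B" for y
  proof -
    have "prd (upair y y) y : el ?F" unfolding elF using that by blast
    then have "EX! z. z : el c Int el (prd (upair y y) y)" using c(2) by blast
    then show ?thesis unfolding Int_iff mem by (metis pair_inject)
  qed
  then show ?thesis using c(1) by blast
qed

lemma (in zf) AC_choice_function: assumes "AC A" and x: "x : A"
  shows "EX g:A. ALL y:A. el y <= el x --> el y ~= {} --> app g y : el y"
proof -
  let ?B = "mk {y : el (pow x). EX z:el y. True}"
  have BA: "?B : A" by (rule sepA) (intro dintro, use x in simp)
  have elB: "el ?B = {y : A. el y <= el x \<and> el y ~= {}}" unfolding el_Collect unfolding el_pow by blast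
  obtain c where c: "c : A" "ALL y:el ?B. EX! v. v : el y \<and> pair y v : el c"
    using AC_selector[OF assms(1) BA] unfolding elB by blast
  let ?g = "mk {z : el c. pr2 z : el (pr1 z)}"
  have elg: "pair y v : el ?g \<longleftrightarrow> pair y v : el c \<and> v : el y" for y v by (simp add: el_Collect)
  have "?g : A" by (rule sepA[OF _ c(1)]) (intro dintro)
  moreover have "app ?g y : el y" if "y : A" "el y <= el x" "el y ~= {}" for y
  proof -
    have "EX! v. v : el y \<and> pair y v : el c" using c(2) that unfolding elB by blast
    then obtain v where v: "v : el y" "pair y v : el c" "!!v'. v' : el y ==> pair y v' : el c ==> v' = v" by blast
    then have "app ?g y = v" using elg by (intro app_unique) blast+
    then show ?thesis by (simp only: v(1))
  qed
  ultimately show ?thesis by blast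
qed

lemma (in zf) ex_wellorder: assumes "AC A" and x: "x : A"
  shows "EX l:A. EX f:A. Ord l \<and> app f ` el l = el x \<and> inj_on (app f) (el l)"
  using AC_choice_function[OF assms] ex_enumeration[OF x] by blast

section \<open>Small subsets and approximation\<close>

definition prune where "prune Q = recF (%x f. mk ((%z. pair (app f (pr1 z)) (pr2 z)) ` el (mk {z : el x. EX s p. z = pair s p \<and> Q p})))"

lemma el_prune: "el (prune Q x) = {pair (prune Q s) p |s p. pair s p : el x \<and> Q p}"
proof -
  have "el (prune Q x) = (%z. pair (app (lam (tc x) (prune Q)) (pr1 z)) (pr2 z)) ` {z : el x. EX s p. z = pair s p \<and> Q p}"
    unfolding prune_def by (subst recF) (simp only: el_Collect, simp)
  also have "... = {pair (prune Q s) p |s p. pair s p : el x \<and> Q p}"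
  proof (intro set_eqI iffI)
    fix y assume "y : (%z. pair (app (lam (tc x) (prune Q)) (pr1 z)) (pr2 z)) ` {z : el x. EX s p. z = pair s p \<and> Q p}"
    then obtain s p where s: "pair s p : el x" "Q p" "y = pair (app (lam (tc x) (prune Q)) s) p" by auto
    then show "y : {pair (prune Q s) p |s p. pair s p : el x \<and> Q p}" using pair_el_TC(1)[OF s(1)] by auto
  next
    fix y assume "y : {pair (prune Q s) p |s p. pair s p : el x \<and> Q p}"
    then obtain s p where s: "pair s p : el x" "Q p" "y = pair (prune Q s) p" by blast
    then have "y = pair (app (lam (tc x) (prune Q)) (pr1 (pair s p))) (pr2 (pair s p))" using pair_el_TC(1)[OF s(1)] by simp
    then show "y : (%z. pair (app (lam (tc x) (prune Q)) (pr1 z)) (pr2 z)) ` {z : el x. EX s p. z = pair s p \<and> Q p}" using s by blast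
  qed
  finally show ?thesis .
qed

lemma val_prune: "val G (prune Q x) = val (G Int {p. Q p}) x"
proof (induction x rule: TC_induct)
  case (step x)
  have s: "val G (prune Q s) = val (G Int {p. Q p}) s" if "pair s p : el x" for s p using step pair_el_TC(1)[OF that] by blast
  show ?case
  proof (rule ext_el, intro set_eqI iffI)
    fix y assume "y : el (val G (prune Q x))"
    then obtain s p where "y = val G (prune Q s)" "p : G" "pair s p : el x" "Q p" unfolding el_val el_prune by auto
    then show "y : el (val (G Int {p. Q p}) x)" using s unfolding el_val by blast
  next
    fix y assume "y : el (val (G Int {p. Q p}) x)"
    then obtain s p where y: "y = val (G Int {p. Q p}) s" "p : G" "Q p" "pair s p : el x" unfolding el_val by blast
    then have "y = val G (prune Q s)" "pair (prune Q s) p : el (prune Q x)" using s unfolding el_prune by auto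
    then show "y : el (val G (prune Q x))" using y(2) unfolding el_val by blast
  qed
qed

lemma (in zf) dterm_prune: assumes Q: "dpred A (%e. Q (e 0))" and t: "dterm A t" shows "dterm A (%e. prune Q (t e))"
proof -
  have Qd: "dterm A u ==> dpred A (%e. Q (u e))" for u by (rule dpred_comp1[where Q=Q, OF Q])
  show ?thesis unfolding prune_def
    by (rule dterm_recF[where H="%q x f. mk ((%z. pair (app f (pr1 z)) (pr2 z)) ` el (mk {z : el x. EX s p. z = pair s p \<and> Q p}))" and s=t, OF _ t t])
       (intro dintro Qd)
qed

lemma (in zf) pruneA: "dpred A (%e. Q (e 0)) ==> x : A ==> prune Q x : A"
  by (rule dterm_constD[OF dterm_prune[OF _ dterm_const]])

context class_ext
begin

lemma G_restrict_N: "c : A ==> mk (G Int el c) : N"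
proof -
  assume c: "c : A"
  have "mk ((%p. pair (chk zero p) p) ` el c) : A" by (rule dterm_constD) (intro dintro zeroA c)
  moreover have "el (val G (mk ((%p. pair (chk zero p) p) ` el c))) = G Int el c"
  proof (intro set_eqI iffI)
    fix x assume "x : G Int el c"
    then show "x : el (val G (mk ((%p. pair (chk zero p) p) ` el c)))" unfolding el_val
      by (intro CollectI exI[of _ "chk zero x"] exI[of _ x]) (simp add: val_chk[OF G0])
  qed (auto simp: el_val val_chk[OF G0])
  ultimately show ?thesis using N_I by (metis mk_el)
qed

lemma conds_self: assumes "Ord a" shows "el (conds a a) = {zero}"
proof -
  have "p = zero" if "cond a p" "ALL z:el p. rank z : el a" for p
    using that unfolding cond_def by (intro ext_el) auto
  then show ?thesis unfolding el_conds[OF assms] using cond_zero by auto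
qed

lemma Sep_name_check: assumes Z: "Z : N" and w: "w : A" and b: "limit b" "b : A" "small b w"
  shows "EX f:A. el f <= el (prd (mk ((%x. chk zero x) ` el w)) (conds a b)) \<and>
    (ALL x:el w. x : el Z \<longleftrightarrow> (EX u:G. pair (chk zero x) u : el f))"
proof -
  interpret N: carrier N by (rule carrier_N)
  let ?I = "mk ((%x. chk zero x) ` el w)"
  have I: "?I : A" by (rule dterm_constD) (intro dintro zeroA w)
  have sI: "small b ?I" by (rule small_image[OF b(2,3), of "%x. chk zero x"]) (intro dintro zeroA, simp)
  have "dpred N (%e. e 0 : el Z)" by (intro N.dpred_mem N.dterm_var N.dterm_const Z)
  from Sep_name[OF this b(1,2) I sI] obtain f where f: "f : A" "el f <= el (prd ?I (conds a b))"
    "ALL i:el ?I. val G i : el Z \<longleftrightarrow> (EX u:G. pair i u : el f)" by blast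
  have "x : el Z \<longleftrightarrow> (EX u:G. pair (chk zero x) u : el f)" if "x : el w" for x
    using bspec[OF f(3), of "chk zero x"] val_chk[OF G0, of x] that by simp
  then show ?thesis using f by blast
qed

lemma small_subset_mem: assumes a: "limit a" and Z: "Z : N" "el Z <= el w" and w: "w : A" "small a w" shows "Z : A"
proof -
  obtain f where f: "f : A" "el f <= el (prd (mk ((%x. chk zero x) ` el w)) (conds a a))"
    "ALL x:el w. x : el Z \<longleftrightarrow> (EX u:G. pair (chk zero x) u : el f)" using Sep_name_check[OF Z(1) w(1) a aA w(2)] by blast
  have "u = zero" if "pair i u : el f" for i u
    using subsetD[OF f(2) that] conds_self a unfolding el_prd limit_def by auto
  then have "el Z = {x : el w. pair (chk zero x) zero : el f}" using f(3) Z(2) G0 by blast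
  moreover have "mk {x : el w. pair (chk zero x) zero : el f} : A" by (rule sepA[OF _ w(1)]) (intro dintro zeroA f)
  ultimately show ?thesis by (metis mk_el)
qed

text \<open>For \<open>b = a\<close> the lower part in \<open>ex_generic_upper\<close> is trivial.\<close>

lemma ex_generic_deciding: assumes a: "limit a" and I: "I : A" "small a I"
    and dD: "dpred A (%e. D (e 0) (e 1))"
    and dense: "!!i p. i : el I ==> cond a p ==> EX d. cond a d \<and> el p <= el d \<and> D i d"
    and upward: "!!i p q. i : el I ==> cond a p ==> D i p ==> cond a q ==> el p <= el q ==> D i q"
  shows "EX q:G. ALL i:el I. D i q"
proof -
  have o: "Ord a" using a unfolding limit_def by simp
  have "EX q:G. ALL i:el I. EX u:Glow a. D i (cup u q)" by (rule ex_generic_upper[OF a aA I dD]) (fact dense, fact upward)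
  moreover have "cup u q = q" if "u : Glow a" for u q
    using that Glow_conds[OF o] conds_self[OF o] by (intro ext_el) auto
  ultimately show ?thesis by metis
qed

lemma ex_deciding_mem: assumes a: "limit a" and I: "I : A" "small a I" and w: "w : A" and v: "range v <= A"
  shows "EX q:G. ALL i:el I. (EX y:el w. forces \<phi> q (v(0 := chk zero (pair i y)))) \<or> (ALL y:el w. forces (Neg \<phi>) q (v(0 := chk zero (pair i y))))"
proof (rule ex_generic_deciding[OF a I])
  let ?F = "%\<phi> p i y. forces \<phi> p (v(0 := chk zero (pair i y)))"
  show "dpred A (%e. (EX y:el w. ?F \<phi> (e 1) (e 0) y) \<or> (ALL y:el w. ?F (Neg \<phi>) (e 1) (e 0) y))"
    by (intro dpred_disj dpred_bex dpred_ball dpred_forces_upd v dintro zeroA w)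
  fix i p assume i: "i : el I" and p: "cond a p"
  have vA: "range (v(0 := chk zero (pair i y))) <= A" if "y : el w" for y
    using i that I w Atrans v by (auto simp: image_subset_iff zeroA)
  show "EX d. cond a d \<and> el p <= el d \<and> ((EX y:el w. ?F \<phi> d i y) \<or> (ALL y:el w. ?F (Neg \<phi>) d i y))"
  proof (cases "ALL y:el w. ?F (Neg \<phi>) p i y")
    case True then show ?thesis using p by blast
  next
    case False
    then obtain y q where "y : el w" "cond a q" "el p <= el q" "?F \<phi> q i y" unfolding forces.simps(3) by blast
    then show ?thesis by blast
  qed
  fix q assume "(EX y:el w. ?F \<phi> p i y) \<or> (ALL y:el w. ?F (Neg \<phi>) p i y)" "cond a q" "el p <= el q"
  then show "(EX y:el w. ?F \<phi> q i y) \<or> (ALL y:el w. ?F (Neg \<phi>) q i y)" using forces_mono[OF vA _ p] by blast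
qed

lemma function_mem: assumes a: "limit a" and h: "h : N" "el h <= el (prd I w)" and I: "I : A" "small a I" and w: "w : A"
    and fn: "!!i y y'. pair i y : el h ==> pair i y' : el h ==> y = y'"
  shows "h : A"
proof -
  obtain h0 where h0: "h0 : A" "h = val G h0" using h(1) unfolding N_def by blast
  have v: "range (%_. h0) <= A" using h0 by auto
  let ?F = "%\<phi> p i y. forces \<phi> p ((%_. h0)(0 := chk zero (pair i y)))"
  have vA: "range ((%_. h0)(0 := chk zero (pair i y))) <= A" if "i : A" "y : A" for i y using that h0 by auto
  have mem_iff: "pair i y : el h \<longleftrightarrow> (EX p:G. ?F (Mem 0 1) p i y)" if "i : A" "y : A" for i y
    using truth[OF vA[OF that], of "Mem 0 1"] val_chk[OF G0] h0(2) by simp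
  obtain q where q: "q : G" and decides: "!!i. i : el I ==> (EX y:el w. ?F (Mem 0 1) q i y) \<or> (ALL y:el w. ?F (Neg (Mem 0 1)) q i y)"
    using ex_deciding_mem[OF a I w v] by blast
  have "?F (Mem 0 1) q i y \<longleftrightarrow> pair i y : el h" if i: "i : el I" and y: "y : el w" for i y
  proof
    have iA: "i : A" "y' : A" if "y' : el w" for y' using i that I w Atrans by blast+
    show "pair i y : el h" if "?F (Mem 0 1) q i y" using mem_iff[OF iA[OF y]] that q by blast
    assume m: "pair i y : el h"
    have "\<not> ?F (Neg (Mem 0 1)) q i y" using mem_iff[OF iA[OF y]] m forces_contra[OF vA[OF iA[OF y]] _ q] by blast
    then obtain y' where y': "y' : el w" "?F (Mem 0 1) q i y'" using decides[OF i] y by blast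
    then have "pair i y' : el h" using mem_iff[OF iA[OF y'(1)]] q by blast
    then have "y' = y" using fn m by blast
    then show "?F (Mem 0 1) q i y" using y' by blast
  qed
  then have "{z : el (prd I w). ?F (Mem 0 1) q (pr1 z) (pr2 z)} = {z : el (prd I w). z : el h}" by (auto simp: el_prd)
  also have "... = el h" using h(2) by blast
  finally have "{z : el (prd I w). ?F (Mem 0 1) q (pr1 z) (pr2 z)} = el h" .
  moreover have "mk {z : el (prd I w). ?F (Mem 0 1) q (pr1 z) (pr2 z)} : A"
    by (rule sepA) (intro dpred_forces_upd v dintro zeroA G_mem[OF q], use I w in simp)
  ultimately show ?thesis by (simp only: mk_el)
qed

end

context generic_in
begin

context
  fixes w W R rho Z
  assumes w: "w : A" and W: "W : A" "!!s t. pair s t : el W \<longleftrightarrow> s : el w \<and> t : el w \<and> R s t" "totalp_on (el w) R" "wfp_on (el w) R"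
    and rho: "rho : A" and Z: "Z = {x : el w. EX q:G. pair x q : el rho}"
begin

definition forces_notin where
  "forces_notin q x \<longleftrightarrow> (ALL q1:el c. le r q1 q --> \<not> (EX q3. pair x q3 : el rho \<and> le r q1 q3))"
definition forces_in where "forces_in q x \<longleftrightarrow> (ALL q1:el c. le r q1 q --> \<not> forces_notin q1 x)"
definition undecided where "undecided q x \<longleftrightarrow> \<not> forces_in q x \<and> \<not> forces_notin q x"

lemma dpred_forces_notin: "dterm A s ==> dterm A t ==> dpred A (%e. forces_notin (s e) (t e))"
  by (rule dpred_comp2[where Q=forces_notin], unfold forces_notin_def) (intro dintro cA rho)+

lemma dpred_forces_in: "dterm A s ==> dterm A t ==> dpred A (%e. forces_in (s e) (t e))"
  by (rule dpred_comp2[where Q=forces_in], unfold forces_in_def) (intro dintro cA dpred_forces_notin)+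

lemma dpred_undecided: "dterm A s ==> dterm A t ==> dpred A (%e. undecided (s e) (t e))"
  unfolding undecided_def by (intro dintro dpred_forces_in dpred_forces_notin)

lemma forces_notinD: assumes q: "q : G" "forces_notin q x" shows "x ~: Z"
proof
  assume "x : Z"
  then obtain q3 where q3: "q3 : G" "pair x q3 : el rho" unfolding Z by blast
  obtain s where "s : G" "le r s q" "le r s q3" using Gdir[OF q(1) q3(1)] by blast
  then show False using q(2) q3(2) Gc unfolding forces_notin_def by blast
qed

lemma forces_inD: assumes q: "q : G" "forces_in q x" and x: "x : el w" shows "x : Z"
proof -
  have xA: "x : A" using x w Atrans by blast
  have "EX q':G. le r q' q \<and> (EX q3. pair x q3 : el rho \<and> le r q' q3)"
  proof (rule Ggen_below[OF _ q(1)])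
    show "dpred A (%e. EX q3. pair x q3 : el rho \<and> le r (e 0) q3)" by (intro dintro rho xA)
    fix q' assume "le r q' q"
    then have "\<not> forces_notin q' x" using q(2) le_c unfolding forces_in_def by blast
    then show "EX d. le r d q' \<and> (EX q3. pair x q3 : el rho \<and> le r d q3)" unfolding forces_notin_def by blast
  qed
  then obtain q' q3 where "q' : G" "pair x q3 : el rho" "le r q' q3" by blast
  then show ?thesis unfolding Z using x Gup by blast
qed

lemma undecided_refutable: assumes p: "p : el c"
  shows "\<not> forces_in p x ==> EX d. le r d p \<and> forces_notin d x" "\<not> forces_notin p x ==> EX d. le r d p \<and> forces_in d x"
proof -
  show "EX d. le r d p \<and> forces_notin d x" if "\<not> forces_in p x" using that unfolding forces_in_def by blast
  assume "\<not> forces_notin p x"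
  then obtain d q where d: "le r d p" "pair x q : el rho" "le r d q" unfolding forces_notin_def by blast
  have "\<not> forces_notin q2 x" if "le r q2 d" for q2
  proof -
    have "le r q2 q" using le_trans[OF _ _ _ that d(3)] le_c[OF that] le_c[OF d(3)] by blast
    then show ?thesis unfolding forces_notin_def using le_refl le_c[OF that] d(2) by blast
  qed
  then show "EX d. le r d p \<and> forces_in d x" using d(1) unfolding forces_in_def by blast
qed

lemma ex_undecided: assumes nA: "mk Z ~: A" and q: "q : G" shows "EX x:el w. undecided q x"
proof (rule ccontr)
  assume n: "\<not> ?thesis"
  have "q : A" using q Gc el_subA[OF cA] by blast
  then have "mk {x : el w. forces_in q x} : A" by (intro sepA[OF _ w] dintro dpred_forces_in)
  moreover have "x : Z \<longleftrightarrow> x : el w \<and> forces_in q x" for x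
    using n forces_notinD[OF q, of x] forces_inD[OF q, of x] Z unfolding undecided_def by blast
  then have "{x : el w. forces_in q x} = Z" by blast
  ultimately show False using nA by simp
qed

lemma ex_least_undecided: assumes nA: "mk Z ~: A"
  shows "EX s:A. ALL q:G. app s q : el w \<and> undecided q (app s q)"
proof -
  let ?s = "mk {z : el (prd c w). undecided (pr1 z) (pr2 z) \<and> (ALL y:el w. undecided (pr1 z) y --> pair y (pr2 z) ~: el W)}"
  have els: "pair q x : el ?s \<longleftrightarrow> q : el c \<and> x : el w \<and> undecided q x \<and> (ALL y:el w. undecided q y --> \<not> R y x)" for q x
    unfolding el_Collect using W(2) by (auto simp: el_prd)
  have "app ?s q : el w \<and> undecided q (app ?s q)" if q: "q : G" for q
  proof -
    have "{x : el w. undecided q x} <= el w" "{x : el w. undecided q x} ~= {}" using ex_undecided[OF nA q] by auto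
    from wfp_on_ex_minimal[OF W(4) this]
    obtain m where m: "m : el w" "undecided q m" "ALL y:el w. undecided q y --> \<not> R y m" by blast
    have "app ?s q = m"
    proof (rule app_unique)
      show "pair q m : el ?s" unfolding els using m q Gc by blast
      fix z assume "pair q z : el ?s"
      then have "z : el w" "undecided q z" "ALL y:el w. undecided q y --> \<not> R y z" unfolding els by auto
      then show "z = m" using m W(3) unfolding totalp_on_def by blast
    qed
    then show ?thesis using m by simp
  qed
  moreover have "?s : A" by (rule sepA) (intro dintro dpred_undecided w W, use cA w in simp)
  ultimately show ?thesis by blast
qed

lemma ex_deciding_approximation: assumes s: "s : A" and y: "y : A" "el y = Z Int app s ` el c"
  shows "EX q:G. ALL p:el c. app s p : el w --> \<not> undecided q (app s p)"
proof -
  let ?a = "%x. EX q:el c. x = app s q"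
  let ?good = "%q. ALL x:el w. ?a x --> (x : el y --> forces_in q x) \<and> (x ~: el y --> forces_notin q x)"
  let ?bad = "%q. EX x:el w. ?a x \<and> ((x : el y \<and> forces_notin q x) \<or> (x ~: el y \<and> forces_in q x))"
  have "EX q:G. ?good q \<or> ?bad q"
  proof (rule Ggen_pred)
    show "dpred A (%e. ?good (e 0) \<or> ?bad (e 0))" by (intro dintro dpred_forces_in dpred_forces_notin w cA s y)
    fix p assume p: "p : el c"
    show "EX d. le r d p \<and> (?good d \<or> ?bad d)"
    proof (cases "?good p")
      case True then show ?thesis using le_refl[OF p] by blast
    next
      case False
      then obtain x where "x : el w" "?a x" "(x : el y \<and> \<not> forces_in p x) \<or> (x ~: el y \<and> \<not> forces_notin p x)" by blast
      moreover from this(3) have "EX d. le r d p \<and> ((x : el y \<and> forces_notin d x) \<or> (x ~: el y \<and> forces_in d x))"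
        using undecided_refutable[OF p, of x] by blast
      ultimately show ?thesis by blast
    qed
  qed
  then obtain q where q: "q : G" "?good q \<or> ?bad q" by blast
  have "x : el y \<longleftrightarrow> x : Z" if "?a x" for x using that y(2) by blast
  then have "\<not> ?bad q" using forces_notinD[OF q(1)] forces_inD[OF q(1)] by blast
  then have "?good q" using q(2) by blast
  then show ?thesis using q(1) unfolding undecided_def by blast
qed

text \<open>Otherwise let \<open>s\<close> pick, for every condition, the least undecided element; the condition deciding the
  approximation of \<open>Z\<close> on the range of \<open>s\<close> leaves its own pick undecided.\<close>

lemma approximation_property: assumes ap: "!!s. s : A ==> mk (Z Int app s ` el c) : A" shows "mk Z : A"
proof (rule ccontr)
  assume nA: "mk Z ~: A"
  obtain s where s: "s : A" "ALL q:G. app s q : el w \<and> undecided q (app s q)" using ex_least_undecided[OF nA] by blast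
  have "Z Int app s ` el c <= A" using el_subA[OF w] unfolding Z by blast
  then obtain q where "q : G" "ALL p:el c. app s p : el w --> \<not> undecided q (app s p)"
    using ex_deciding_approximation[OF s(1) ap[OF s(1)] el_mkA] by blast
  then show False using s(2) Gc by blast
qed

end

end

section \<open>The tower of inner models\<close>

definition coded_names_step where "coded_names_step P x f = lam (pr2 P) (%i. mk ((%z. pair (app (app f (pr2 (pr1 z))) (pr1 (pr1 (pr1 z)))) (pr2 z)) `
   el (mk {z : el (pr1 P). pr2 (pr1 z) : el x \<and> pr1 (pr1 (pr1 z)) : el (pr2 P) \<and>
     z = pair (pair (pair (pr1 (pr1 (pr1 z))) i) (pr2 (pr1 z))) (pr2 z)})))"
definition coded_names where "coded_names P = recF (coded_names_step P)"

text \<open>\<open>coded_name \<rho> l k i\<close> is a name for a set of rank \<open>k\<close>: if \<open>\<rho>\<close> names the membership relation of the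
  sets enumerated along the ordinal \<open>l\<close> (tagged with the ranks of the elements), then it is a
  name for the \<open>i\<close>-th of them.\<close>

definition coded_name where "coded_name rho l k i = app (coded_names (pair rho l) k) i"

lemma el_coded_name: assumes i: "i : el l"
  shows "el (coded_name rho l k i) = {pair (coded_name rho l n j) r |n j r. n : el k \<and> j : el l \<and> pair (pair (pair j i) n) r : el rho}"
proof -
  let ?S = "{z : el rho. pr2 (pr1 z) : el k \<and> pr1 (pr1 (pr1 z)) : el l \<and> z = pair (pair (pair (pr1 (pr1 (pr1 z))) i) (pr2 (pr1 z))) (pr2 z)}"
  have "el (coded_name rho l k i) = (%z. pair (app (app (lam (tc k) (coded_names (pair rho l))) (pr2 (pr1 z))) (pr1 (pr1 (pr1 z)))) (pr2 z)) ` ?S"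
    unfolding coded_name_def coded_names_def recF[of _ k] by (subst coded_names_step_def) (simp only: sn_opr pr1_pair app_lam[OF i] el_Collect, simp)
  also have "... = {pair (coded_name rho l n j) r |n j r. n : el k \<and> j : el l \<and> pair (pair (pair j i) n) r : el rho}"
  proof (intro set_eqI iffI)
    fix y assume "y : (%z. pair (app (app (lam (tc k) (coded_names (pair rho l))) (pr2 (pr1 z))) (pr1 (pr1 (pr1 z)))) (pr2 z)) ` ?S"
    then obtain z where z: "z : ?S" "y = pair (app (app (lam (tc k) (coded_names (pair rho l))) (pr2 (pr1 z))) (pr1 (pr1 (pr1 z)))) (pr2 z)" by blast
    define n where "n = pr2 (pr1 z)" define j where "j = pr1 (pr1 (pr1 z))" define r where "r = pr2 z"
    have a: "n : el k" "j : el l" "pair (pair (pair j i) n) r : el rho" "y = pair (app (app (lam (tc k) (coded_names (pair rho l))) n) j) r"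
      using z unfolding n_def j_def r_def by auto
    then have "y = pair (coded_name rho l n j) r" unfolding coded_name_def by (simp add: TC_el)
    then show "y : {pair (coded_name rho l n j) r |n j r. n : el k \<and> j : el l \<and> pair (pair (pair j i) n) r : el rho}" using a by blast
  next
    fix y assume "y : {pair (coded_name rho l n j) r |n j r. n : el k \<and> j : el l \<and> pair (pair (pair j i) n) r : el rho}"
    then obtain n j r where a: "y = pair (coded_name rho l n j) r" "n : el k" "j : el l" "pair (pair (pair j i) n) r : el rho" by blast
    show "y : (%z. pair (app (app (lam (tc k) (coded_names (pair rho l))) (pr2 (pr1 z))) (pr1 (pr1 (pr1 z)))) (pr2 z)) ` ?S"
    proof (rule image_eqI)
      show "pair (pair (pair j i) n) r : ?S" using a by simp
      show "y = pair (app (app (lam (tc k) (coded_names (pair rho l))) (pr2 (pr1 (pair (pair (pair j i) n) r)))) (pr1 (pr1 (pr1 (pair (pair (pair j i) n) r))))) (pr2 (pair (pair (pair j i) n) r))"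
        using a unfolding coded_name_def by (simp add: TC_el)
    qed
  qed
  finally show ?thesis .
qed

lemma (in zf) dterm_coded_name[dintro]: assumes "dterm A s" "dterm A t" "dterm A u" "dterm A v" shows "dterm A (%e. coded_name (s e) (t e) (u e) (v e))"
proof -
  have "dterm A (%e. coded_names (e 0) (e 1))" unfolding coded_names_def
    by (rule dterm_recF[where H=coded_names_step, OF _ dterm_var dterm_var]) (unfold coded_names_step_def, intro dintro)
  from dterm_comp2[where f=coded_names, OF this] have T: "dterm A s ==> dterm A t ==> dterm A (%e. coded_names (s e) (t e))" for s t .
  show ?thesis unfolding coded_name_def by (intro dintro T assms)
qed

lemma (in zf) coded_nameA: "s : A ==> t : A ==> u : A ==> v : A ==> coded_name s t u v : A"
  by (rule dterm_constD[OF dterm_coded_name[OF dterm_const dterm_const dterm_const dterm_const]])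

lemma val_coded_name: assumes h: "!!i j n. i : el l ==> j : el l ==> n : el k ==>
      (EX r:H. pair (pair (pair j i) n) r : el rho) \<longleftrightarrow> f j : el (f i) \<and> n = rank (f j)"
    and t: "!!i y. i : el l ==> y : el (f i) ==> EX j:el l. f j = y"
    and k: "!!i. i : el l ==> el (rank (f i)) <= el k"
    and i: "i : el l"
  shows "val H (coded_name rho l (rank (f i)) i) = f i"
proof -
  have "ALL i. i : el l --> x = f i --> val H (coded_name rho l (rank (f i)) i) = f i" for x
  proof (induction x rule: el_induct)
    case (step x)
    show ?case
    proof (intro allI impI ext_el set_eqI iffI)
      fix i y assume i: "i : el l" "x = f i" and "y : el (val H (coded_name rho l (rank (f i)) i))"
      then obtain n j r where a: "y = val H (coded_name rho l n j)" "r : H" "n : el (rank (f i))" "j : el l" "pair (pair (pair j i) n) r : el rho"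
        unfolding el_val el_coded_name[OF i(1)] by auto
      have "n : el k" using a(3) k[OF i(1)] by blast
      then have b: "f j : el (f i)" "n = rank (f j)" using h[OF i(1) a(4)] a by blast+
      then have "y = f j" using step[of "f j"] i a by blast
      then show "y : el (f i)" using b by simp
    next
      fix i y assume i: "i : el l" "x = f i" and y: "y : el (f i)"
      then obtain j where j: "j : el l" "f j = y" using t by blast
      have n: "rank y : el (rank (f i))" using y rank_mem by blast
      then have "rank y : el k" using k[OF i(1)] by blast
      then obtain r where r: "r : H" "pair (pair (pair j i) (rank y)) r : el rho" using h[OF i(1) j(1)] j y by blast
      have "val H (coded_name rho l (rank y) j) = y" using step[of y] i y j by blast
      moreover have "pair (coded_name rho l (rank y) j) r : el (coded_name rho l (rank (f i)) i)" unfolding el_coded_name[OF i(1)] using r n j by blast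
      ultimately show "y : el (val H (coded_name rho l (rank (f i)) i))" unfolding el_val using r(1)
        by (intro CollectI exI[of _ "coded_name rho l (rank y) j"] exI[of _ r]) simp
    qed
  qed
  then show ?thesis using i by blast
qed

lemma (in zf) ex_set_code: assumes AC: "AC A" and x: "x : A"
  shows "EX e:A. EX l:A. EX k:A. EX i:el l. Ord l \<and> Ord k \<and> el e <= el (prd (prd l l) k) \<and>
    (ALL H rho. el e = {z : el (prd (prd l l) k). EX r:H. pair z r : el rho} --> val H (coded_name rho l k i) = x)"
proof -
  have TCx: "TC (upair x x) = insert x (TC x)" by (subst TC_unfold) simp
  have "tc (upair x x) : A" using x by (simp add: upairA)
  from ex_wellorder[OF AC this] obtain l f where l: "l : A" "f : A" "Ord l" "app f ` el l = TC (upair x x)" by auto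
  have "x : app f ` el l" unfolding l TCx by simp
  then obtain i where i: "i : el l" "app f i = x" by blast
  define e where "e = mk {z : el (prd (prd l l) (rank x)). app f (pr1 (pr1 z)) : el (app f (pr2 (pr1 z))) \<and> pr2 z = rank (app f (pr1 (pr1 z)))}"
  have eA: "e : A" unfolding e_def by (rule sepA) (intro dintro l, use l x in simp)
  have ele: "pair (pair j i) n : el e \<longleftrightarrow> j : el l \<and> i : el l \<and> n : el (rank x) \<and> app f j : el (app f i) \<and> n = rank (app f j)" for i j n
    unfolding e_def el_Collect by (auto simp: el_prd)
  have "val H (coded_name rho l (rank x) i) = x" if H: "el e = {z : el (prd (prd l l) (rank x)). EX r:H. pair z r : el rho}" for H rho
  proof -
    have "val H (coded_name rho l (rank (app f i)) i) = app f i"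
    proof (rule val_coded_name[where k="rank x"])
      fix i' j n assume a: "i' : el l" "j : el l" "n : el (rank x)"
      have "pair (pair j i') n : el (prd (prd l l) (rank x))" using a by (simp add: el_prd)
      then have "(EX r:H. pair (pair (pair j i') n) r : el rho) \<longleftrightarrow> pair (pair j i') n : el e" unfolding H by blast
      then show "(EX r:H. pair (pair (pair j i') n) r : el rho) \<longleftrightarrow> app f j : el (app f i') \<and> n = rank (app f j)"
        unfolding ele using a by simp
    next
      fix i' y assume a: "i' : el l" "y : el (app f i')"
      have "app f i' : insert x (TC x)" using l(4) a(1) unfolding TCx by blast
      then have "y : insert x (TC x)" using a(2) TC_el TC_el_trans by blast
      then show "EX j:el l. app f j = y" using l(4) unfolding TCx by (metis imageE)
    next
      fix i' assume "i' : el l"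
      then have "app f i' : insert x (TC x)" using l(4) unfolding TCx by blast
      then show "el (rank (app f i')) <= el (rank x)" using rank_TC Ord_trans[OF Ord_rank] by blast
    qed (rule i)
    then show ?thesis unfolding i .
  qed
  moreover have "el e <= el (prd (prd l l) (rank x))" unfolding e_def el_Collect by blast
  ultimately show ?thesis using eA l i x by (intro bexI[of _ e] bexI[of _ l] bexI[of _ "rank x"] bexI[of _ i]) auto
qed

lemma zf_subset: assumes B: "zf B" and C: "zf C" "AC C" and o: "!!a. a : C ==> Ord a ==> a : B"
    and s: "!!e l k. e : C ==> l : C ==> k : C ==> Ord l ==> Ord k ==> el e <= el (prd (prd l l) k) ==> e : B"
  shows "C <= B"
proof
  interpret B: zf B by fact
  interpret C: zf C by fact
  fix x assume "x : C"
  from C.ex_set_code[OF C(2) this] obtain e l k i where a: "e : C" "l : C" "k : C" "i : el l" "Ord l" "Ord k" "el e <= el (prd (prd l l) k)"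
    and x: "ALL H rho. el e = {z : el (prd (prd l l) k). EX r:H. pair z r : el rho} --> val H (coded_name rho l k i) = x" by blast
  have b: "e : B" "l : B" "k : B" "i : B" using s[OF a(1-3) a(5-7)] o a B.Atrans by blast+
  have "el e = {z : el (prd (prd l l) k). EX r:el one. pair z r : el (prd e one)}" using a(7) by (auto simp: el_prd)
  then have "val (el one) (coded_name (prd e one) l k i) = x" using x by blast
  moreover have "val (el one) (coded_name (prd e one) l k i) : B" by (intro B.valA B.coded_nameA B.oneA B.prdA b)
  ultimately show "x : B" by simp
qed

lemma (in L_model) cond_singleton: assumes y: "y : A" and i: "i = zero \<or> i = one" and r: "rank (pair y i) ~: el a"
  shows "cond a (upair (pair y i) (pair y i))"
proof -
  let ?z = "pair y i" let ?s = "upair ?z ?z"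
  have zA: "?z : A" using y i by auto
  have "bit_fun ?s" unfolding bit_fun_def using i by auto
  moreover have "small c (lower (nextlim c) ?s)" if "c : A" "limit c" for c
    by (rule small_sub[OF small_upair[OF that(2,1) zA zA]]) auto
  ultimately show ?thesis unfolding cond_def easton_def using zA upairA r by auto
qed

locale easton_ext = class_ext A zero G for A G
begin

definition Ghigh where "Ghigh a = {p : G. cond a p}"
definition M where "M a = val (Ghigh a) ` A"

lemma cond_weaken: "cond a p ==> cond zero p" unfolding cond_def by simp

lemma cond_upper: "a : A ==> cond zero p ==> cond a (upper a p)"
  unfolding cond_def using easton_sub[of p "upper a p"] upperA easton_def by auto

lemma class_ext_Ghigh: assumes a: "limit a" "a : A" shows "class_ext A a (Ghigh a)"
proof unfold_locales
  show "a : A" by fact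
  show "zero : Ghigh a" unfolding Ghigh_def using G0 cond_zero by blast
  fix p assume p: "p : Ghigh a"
  show "cond a p" using p unfolding Ghigh_def by blast
  { fix q assume "cond a q" "el q <= el p" then show "q : Ghigh a" using p Gup cond_weaken unfolding Ghigh_def by blast }
  fix q assume q: "q : Ghigh a"
  have "cup p q : G" using p q Gcup unfolding Ghigh_def by blast
  moreover from this have "cond a (cup p q)" using p q G_cond_in unfolding Ghigh_def cond_def by auto
  ultimately have "cup p q : Ghigh a" unfolding Ghigh_def by blast
  then show "EX s:Ghigh a. el p <= el s \<and> el q <= el s" by (rule bexI[rotated]) auto
next
  fix Q assume Q: "dpred A (%e. Q (e 0))" and d: "!!p. cond a p ==> EX d. cond a d \<and> el p <= el d \<and> Q d"
  have "EX p:G. Q (upper a p)"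
  proof (rule Ggen[where Q="%p. Q (upper a p)"])
    show "dpred A (%e. Q (upper a (e 0)))" by (rule dpred_comp1[where Q=Q, OF Q]) (intro dintro a)
    fix p assume p: "cond zero p"
    obtain d where dd: "cond a d" "el (upper a p) <= el d" "Q d" using d[OF cond_upper[OF a(2) p]] by blast
    have dr: "rank z ~: el a" if "z : el d" for z using dd(1) that unfolding cond_def by blast
    have "cond zero (cup (lower a p) d)"
    proof (rule cond_glue[OF a _ _ cond_weaken[OF dd(1)]])
      show "cond zero (lower a p)" by (rule cond_sub[OF p]) (use a condA[OF p] in auto)
    qed (use dr in auto)
    moreover have "upper a (cup (lower a p) d) = d" by (rule ext_el) (use dr in auto)
    moreover have "el p <= el (cup (lower a p) d)" using dd(2) by auto
    ultimately show "EX d. cond zero d \<and> el p <= el d \<and> Q (upper a d)" using dd(3) by metis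
  qed
  then obtain p where p: "p : G" "Q (upper a p)" by blast
  have "cond a (upper a p)" using cond_upper[OF a(2) G_cond_in[OF p(1)]] .
  then have "upper a p : Ghigh a" unfolding Ghigh_def using Gup[OF p(1) cond_weaken] by auto
  then show "EX p:Ghigh a. Q p" using p by blast
qed

lemma class_N_eq_M: assumes "limit a" "a : A" shows "class_ext.N A (Ghigh a) = M a"
  unfolding class_ext.N_def[OF class_ext_Ghigh[OF assms]] M_def ..

lemma M_zf: assumes a: "limit a" "a : A" shows "zf (M a)" "AC (M a)" "x : A ==> x : M a" "M a <= N"
proof -
  interpret a: class_ext A a "Ghigh a" by (rule class_ext_Ghigh[OF a])
  show "zf (M a)" "AC (M a)" "x : A ==> x : M a" using a.N_zf a.N_AC a.A_N unfolding class_N_eq_M[OF a] by auto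
  have "val (Ghigh a) x : N" if x: "x : A" for x
  proof -
    have "prune (cond a) x : A" by (rule pruneA[OF _ x]) (intro dintro a)
    moreover have "Ghigh a = G Int {p. cond a p}" unfolding Ghigh_def by blast
    ultimately show ?thesis using val_prune[of G "cond a" x] N_I by metis
  qed
  then show "M a <= N" unfolding M_def by blast
qed

lemma Ord_N: "x : N ==> Ord x ==> x : A"
proof -
  assume x: "x : N" "Ord x"
  then obtain y where y: "y : A" "x = val G y" unfolding N_def by blast
  have "el x <= el (rank y)" using rank_val[of G y] rank_Ord[OF x(2)] y by simp
  then have "x = rank y \<or> x : el (rank y)" using Ord_subset x Ord_rank by blast
  then show "x : A" using rankA[OF y(1)] Atrans by blast
qed

definition Gslice where "Gslice a b = mk (Ghigh a Int el (conds a b))"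

lemma el_Gslice: "el (Gslice a b) = Ghigh a Int el (conds a b)"
  unfolding Gslice_def by (rule el_mk) (rule countable_subset[OF _ countable_el[of "conds a b"]], blast)

lemma Gslice_M: assumes a: "limit a" "a : A" and b: "b : A" shows "Gslice a b : M a"
proof -
  interpret a: class_ext A a "Ghigh a" by (rule class_ext_Ghigh[OF a])
  show ?thesis using a.G_restrict_N[of "conds a b"] a b unfolding Gslice_def class_N_eq_M[OF a] by simp
qed

lemma G_lower_upper: assumes a: "limit a" "a : A" and b: "Ord b" and u: "u : el (conds zero b)"
  shows "u : G \<longleftrightarrow> lower a u : Glow a \<and> upper a u : el (Gslice a b)"
proof
  assume uG: "u : G"
  have h: "cond a (upper a u)" using cond_upper[OF a(2) G_cond_in[OF uG]] .
  then have "upper a u : Ghigh a" unfolding Ghigh_def using Gup[OF uG cond_weaken] by auto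
  moreover have "upper a u : el (conds a b)" using h u unfolding el_conds[OF b] by auto
  ultimately show "lower a u : Glow a \<and> upper a u : el (Gslice a b)" unfolding el_Gslice using lower_Glow[OF a(2) uG] by blast
next
  assume "lower a u : Glow a \<and> upper a u : el (Gslice a b)"
  then have "lower a u : G" "upper a u : G" unfolding el_Gslice Ghigh_def Glow_def by auto
  moreover have "cup (lower a u) (upper a u) = u" by (rule ext_el) auto
  ultimately show "u : G" using Gcup by metis
qed

lemma ex_subset_name_M: assumes a: "limit a" "a : A" and Z: "Z : N" "el Z <= el w" and w: "w : A"
  shows "EX rho:M a. el Z = {x : el w. EX u:Glow a. pair x u : el rho}"
proof -
  interpret Ma: zf "M a" by (rule M_zf[OF a])
  obtain b where b: "limit b" "b : A" "small b w" using small_nextlim[OF w] by blast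
  obtain f where f: "f : A" "el f <= el (prd (mk ((%x. chk zero x) ` el w)) (conds zero b))"
    and Zf: "!!x. x : el w ==> x : el Z \<longleftrightarrow> (EX u:G. pair (chk zero x) u : el f)"
    using Sep_name_check[OF Z(1) w b] by blast
  have conds: "u : el (conds zero b)" if "pair i u : el f" for i u using subsetD[OF f(2) that] by (auto simp: el_prd)
  have G: "u : G \<longleftrightarrow> lower a u : Glow a \<and> upper a u : el (Gslice a b)" if "u : el (conds zero b)" for u
    using G_lower_upper[OF a _ that] b(1) unfolding limit_def by blast
  let ?rho = "mk {z : el (prd w (conds zero a)). EX u:el (conds zero b). pair (chk zero (pr1 z)) u : el f \<and> lower a u = pr2 z \<and> upper a u : el (Gslice a b)}"
  have "?rho : M a"
    by (rule Ma.sepA) (intro Ma.dpred_bex Ma.dpred_conj Ma.dpred_mem Ma.dpred_eq Ma.dterm_const Ma.dterm_pair Ma.dterm_chk Ma.dterm_pr1 Ma.dterm_pr2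
      Ma.dterm_lower Ma.dterm_upper Ma.dterm_var Ma.zeroA Gslice_M[OF a] M_zf(3)[OF a] f condsA zeroA b a prdA w)+
  moreover have "x : el Z \<longleftrightarrow> (EX v:Glow a. pair x v : el ?rho)" if x: "x : el w" for x
  proof -
    have rho: "pair x v : el ?rho \<longleftrightarrow> v : el (conds zero a) \<and>
      (EX u:el (conds zero b). pair (chk zero x) u : el f \<and> lower a u = v \<and> upper a u : el (Gslice a b))" for v
      unfolding el_Collect using x by (simp add: el_prd)
    show ?thesis unfolding Zf[OF x]
    proof
      assume "EX u:G. pair (chk zero x) u : el f"
      then obtain u where u: "u : G" "pair (chk zero x) u : el f" by blast
      then have "lower a u : Glow a" "upper a u : el (Gslice a b)" using G conds by blast+
      moreover have "Glow a <= el (conds zero a)" using Glow_conds a(1) unfolding limit_def by blast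
      ultimately show "EX v:Glow a. pair x v : el ?rho" unfolding rho using u conds by blast
    next
      assume "EX v:Glow a. pair x v : el ?rho"
      then obtain u where "u : el (conds zero b)" "pair (chk zero x) u : el f" "lower a u : Glow a" "upper a u : el (Gslice a b)" unfolding rho by blast
      then show "EX u:G. pair (chk zero x) u : el f" using G by blast
    qed
  qed
  ultimately show ?thesis using Z(2) by (intro bexI[of _ ?rho]) blast+
qed

lemma M_generic: assumes a: "limit a" "a : A" shows "generic_in (M a) (conds zero a) (conds_le a) (Glow a)"
proof -
  interpret a: class_ext A a "Ghigh a" by (rule class_ext_Ghigh[OF a])
  interpret Ma: zf "M a" by (rule M_zf[OF a])
  interpret g: generic_in A "conds zero a" "conds_le a" "Glow a" by (rule generic_in_Glow[OF a])
  have oa: "Ord a" using a unfolding limit_def by simp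
  show ?thesis
  proof unfold_locales
    show "conds zero a : M a" "conds_le a : M a" using M_zf(3)[OF a] g.cA g.rA by auto
    fix D assume D: "D : M a" "el D <= el (conds zero a)" "!!p. p : el (conds zero a) ==> EX d:el D. le (conds_le a) d p"
    have "D : A" by (rule a.small_subset_mem[OF a(1) _ D(2) g.cA small_conds[OF a(2) oa]]) (use D in \<open>simp add: class_N_eq_M[OF a]\<close>)
    then show "Glow a Int el D ~= {}" using g.Ggen D by blast
  qed (fact g.le_refl g.le_trans g.le_c g.Gc g.Gne g.Gup g.Gdir)+
qed

lemma Uni_Gslice_function: "\<not> (pair y zero : el (Uni (Gslice a b)) \<and> pair y one : el (Uni (Gslice a b)))"
proof
  assume "pair y zero : el (Uni (Gslice a b)) \<and> pair y one : el (Uni (Gslice a b))"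
  then obtain p q where pq: "p : G" "q : G" "pair y zero : el p" "pair y one : el q" unfolding el_Uni el_Gslice Ghigh_def by blast
  have "bit_fun (cup p q)" using G_cond_in[OF Gcup[OF pq(1,2)]] unfolding cond_def easton_def by blast
  moreover have "pair y zero : el (cup p q)" "pair y one : el (cup p q)" using pq by auto
  ultimately show False unfolding bit_fun_def using one_neq_zero by blast
qed

text \<open>A diagonal argument: \<open>p\<close> has at most as many elements of rank below \<open>nextlim a\<close> as \<open>V_(a+1)\<close>
  has elements, but \<open>V_(a+1)\<close> has more subsets.\<close>

lemma ex_outside_domain: assumes a: "limit a" "a : A" and p: "cond a p"
  shows "EX y:A. ALL i. rank i : el (nextlim a) --> rank (pair y i) : el (nextlim a) \<and> rank (pair y i) ~: el a \<and> pair y i ~: el p"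
proof -
  let ?b = "nextlim a" let ?V = "Vset (rank (succ a))"
  have oa: "Ord a" using a unfolding limit_def by simp
  have b: "limit ?b" "a : el ?b" "succ a : el ?b" using nextlim[OF a(2)] rank_Ord[OF oa] unfolding limit_def by auto
  have "small a (lower ?b p)" using p a unfolding cond_def easton_def by blast
  then obtain f where f: "f : A" "ALL z:el (lower ?b p). EX u:el ?V. app f u = z" unfolding small_def by blast
  let ?x = "mk {u : el ?V. u ~: el (pr1 (pr1 (app f u)))}"
  have "?V : A" by (rule VsetA) (use a oa in simp_all)
  then have yA: "pair ?x a : A" by (intro pairA sepA dintro f a)
  have elx: "u : el ?x \<longleftrightarrow> u : el ?V \<and> u ~: el (pr1 (pr1 (app f u)))" for u
    by (simp only: el_Collect mem_Collect_eq)
  have "rank ?x : el ?b" by (rule rank_in_limit[OF b(1) _ b(3)]) (use elx Vset_succ[OF oa] in auto)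
  then have rank_y: "rank (pair (pair ?x a) i) : el ?b" if "rank i : el ?b" for i
    unfolding rank_pair[OF b(1)] using that b(2) rank_Ord[OF oa] by simp
  have "rank (pair (pair ?x a) i) ~: el a" for i unfolding rank_pair[OF a(1)] using rank_Ord[OF oa] by simp
  moreover have "pair (pair ?x a) i ~: el p" if i: "rank i : el ?b" for i
  proof
    assume "pair (pair ?x a) i : el p"
    then have "pair (pair ?x a) i : el (lower ?b p)" using rank_y[OF i] by simp
    then obtain u where u: "u : el ?V" "app f u = pair (pair ?x a) i" using f(2) by blast
    have "u : el ?x \<longleftrightarrow> u ~: el ?x" using elx[of u] u by (simp only: pr1_pair simp_thms)
    then show False by blast
  qed
  ultimately show ?thesis using yA rank_y by blast
qed

lemma cond_insert: assumes p: "cond a p" and y: "y : A" "rank (pair y i) ~: el a" "pair y zero ~: el p" "pair y one ~: el p" and i: "i = zero \<or> i = one"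
  shows "cond a (cup p (upair (pair y i) (pair y i)))" (is "cond a (cup p ?s)")
proof (rule cond_cup[OF p cond_singleton[OF y(1) i y(2)]])
  have fp: "bit_fun p" using p unfolding cond_def easton_def by blast
  have k: "k = zero \<or> k = one" if "pair x k : el p" for x k using fp that unfolding bit_fun_def by fastforce
  have ny: "pair y k ~: el p" for k using y k by blast
  have unique: "k = k'" if "pair x k : el p" "pair x k' : el p" for x k k' using fp that unfolding bit_fun_def by blast
  show "bit_fun (cup p ?s)" unfolding bit_fun_def
  proof (intro conjI ballI allI impI)
    fix z assume "z : el (cup p ?s)" then show "EX x k. z = pair x k \<and> (k = zero \<or> k = one)"
      using fp i unfolding bit_fun_def by auto
  next
    fix x k x' k' assume "pair x k : el (cup p ?s)" "pair x' k' : el (cup p ?s)" "x = x'"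
    then show "k = k'" using unique ny by auto
  qed
qed

lemma Uni_Gslice_not_ground: assumes a: "limit a" "a : A" shows "Uni (Gslice a (nextlim a)) ~: A"
proof
  let ?b = "nextlim a" let ?U = "Uni (Gslice a (nextlim a))"
  assume UA: "?U : A"
  have b: "?b : A" "limit ?b" using nextlim[OF a(2)] by auto
  interpret a: class_ext A a "Ghigh a" by (rule class_ext_Ghigh[OF a])
  have "EX p:Ghigh a. EX z:el p. rank z : el ?b \<and> z ~: el ?U"
  proof (rule a.Ggen)
    show "dpred A (%e. EX z:el (e 0). rank z : el ?b \<and> z ~: el ?U)" by (intro dintro b UA)
    fix p assume p: "cond a p"
    obtain y where y: "y : A" "!!i. rank i : el ?b ==> rank (pair y i) : el ?b \<and> rank (pair y i) ~: el a \<and> pair y i ~: el p"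
      using ex_outside_domain[OF a p] by blast
    obtain i where i: "i = zero \<or> i = one" "pair y i ~: el ?U" using Uni_Gslice_function by blast
    let ?p = "cup p (upair (pair y i) (pair y i))"
    have ri: "rank i : el ?b" using limit_rank_01[OF b(2)] i by auto
    have "cond a ?p" by (rule cond_insert[OF p y(1) _ _ _ i(1)]) (use y(2) ri limit_rank_01[OF b(2)] in auto)
    moreover have "EX z:el ?p. rank z : el ?b \<and> z ~: el ?U" using y(2)[OF ri] i by (intro bexI[of _ "pair y i"]) auto
    ultimately show "EX d. cond a d \<and> el p <= el d \<and> (EX z:el d. rank z : el ?b \<and> z ~: el ?U)"
      by (intro exI[of _ ?p]) auto
  qed
  then obtain p z where pz: "p : Ghigh a" "z : el p" "rank z : el ?b" "z ~: el ?U" by blast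
  have "lower ?b p : Ghigh a" by (rule a.Gup[OF pz(1)]) (use a.G_cond_in[OF pz(1)] b a.G_mem[OF pz(1)] in \<open>auto intro!: cond_sub[of a p]\<close>)
  moreover from this have "lower ?b p : el (conds a ?b)" using a.G_cond_in b(2) el_conds unfolding limit_def by auto
  ultimately have "z : el ?U" unfolding el_Uni el_Gslice using pz(2,3) by (intro UN_I[of "lower ?b p"]) auto
  then show False using pz by blast
qed

lemma M_proper: assumes a: "limit a" "a : A" shows "EX U. U : M a \<and> U ~: M (nextlim a)"
proof -
  let ?b = "nextlim a" let ?U = "Uni (Gslice a (nextlim a))"
  have b: "?b : A" "limit ?b" "Ord ?b" using nextlim[OF a(2)] unfolding limit_def by auto
  interpret Ma: zf "M a" by (rule M_zf[OF a])
  interpret b: class_ext A ?b "Ghigh ?b" by (rule class_ext_Ghigh[OF b(2,1)])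
  have VA: "Vset (rank (succ ?b)) : A" by (rule VsetA) (use b in simp_all)
  have "el ?U <= el (Vset (rank (succ ?b)))"
  proof
    fix z assume "z : el ?U"
    then obtain p where p: "p : el (conds a ?b)" "z : el p" unfolding el_Uni el_Gslice by blast
    then have "cond a p" "rank z : el ?b" unfolding el_conds[OF b(3)] by auto
    then show "z : el (Vset (rank (succ ?b)))" using condA p(2) Atrans unfolding Vset_succ[OF b(3)] by blast
  qed
  then have "?U ~: M ?b"
    using b.small_subset_mem[OF b(2) _ _ VA small_subset_Vset[OF b(1,3) subset_refl]] Uni_Gslice_not_ground[OF a] unfolding class_N_eq_M[OF b(2,1)] by blast
  moreover have "?U : M a" using Ma.UniA Gslice_M[OF a b(1)] by simp
  ultimately show ?thesis by blast
qed

end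

section \<open>Grounds of the extension\<close>

context L_model
begin

definition less_L_graph where "less_L_graph w0 = mk {z : el (prd w0 w0). less_L (pr1 z) (pr2 z)}"

lemma less_L_graph: assumes w0: "w0 : A" shows "less_L_graph w0 : A" "!!s t. pair s t : el (less_L_graph w0) \<longleftrightarrow> s : el w0 \<and> t : el w0 \<and> less_L s t"
  "totalp_on (el w0) less_L" "wfp_on (el w0) less_L"
proof -
  show "less_L_graph w0 : A" unfolding less_L_graph_def by (rule sepA) (intro dintro, use w0 in simp)
  show "!!s t. pair s t : el (less_L_graph w0) \<longleftrightarrow> s : el w0 \<and> t : el w0 \<and> less_L s t" unfolding less_L_graph_def el_Collect by (auto simp: el_prd)
  show "totalp_on (el w0) less_L" using less_L_wellorder(1) el_subA[OF w0] by (rule totalp_on_subset)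
  show "wfp_on (el w0) less_L" using less_L_wellorder(2) el_subA[OF w0] by (rule wfp_on_subset)
qed

end

context easton_ext
begin

text \<open>\<open>g (i, u)\<close> is the \<open>less_L\<close>-least value at \<open>i\<close> allowed by the condition \<open>u\<close>.\<close>

lemma ex_section: assumes a: "limit a" "a : A" and l: "l : A" "small a l" and w: "w : A" and rho: "rho : M a"
  shows "EX g:A. ALL i:el l. ALL u:el (conds zero a). ALL y:el w. pair (pair i y) u : el rho -->
    (ALL y':el w. pair (pair i y') u : el rho --> y' = y) --> app g (pair i u) = y"
proof -
  interpret a: class_ext A a "Ghigh a" by (rule class_ext_Ghigh[OF a])
  interpret Ma: zf "M a" by (rule M_zf[OF a])
  have oa: "Ord a" using a unfolding limit_def by simp
  let ?I = "prd l (conds zero a)"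
  have I: "?I : A" "small a ?I" using l a by (auto intro!: small_prd small_conds oa)
  let ?g = "mk {z : el (prd ?I w). pair (pair (pr1 (pr1 z)) (pr2 z)) (pr2 (pr1 z)) : el rho \<and>
    (ALL y:el w. pair (pair (pr1 (pr1 z)) y) (pr2 (pr1 z)) : el rho --> pair y (pr2 z) ~: el (less_L_graph w))}"
  have elg: "pair (pair i u) y : el ?g \<longleftrightarrow> i : el l \<and> u : el (conds zero a) \<and> y : el w \<and> pair (pair i y) u : el rho \<and>
    (ALL y':el w. pair (pair i y') u : el rho --> \<not> less_L y' y)" for i u y
    unfolding el_Collect using less_L_graph(2)[OF w] by (auto simp: el_prd)
  have fn: "y = y'" if "pair (pair i u) y : el ?g" "pair (pair i u) y' : el ?g" for i u y y'
    using that less_L_graph(3)[OF w] unfolding elg totalp_on_def by blast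
  have "?g : M a"
    by (rule Ma.sepA) (intro Ma.dpred_conj Ma.dpred_ball Ma.dpred_imp Ma.dpred_neg Ma.dpred_mem Ma.dterm_pair Ma.dterm_pr1 Ma.dterm_pr2
      Ma.dterm_var Ma.dterm_const rho M_zf(3)[OF a] w less_L_graph(1) prdA I)+
  then have gA: "?g : A" unfolding class_N_eq_M[OF a, symmetric]
  proof (rule a.function_mem[OF a(1) _ _ I w])
    show "el ?g <= el (prd ?I w)" unfolding el_Collect by blast
    fix i y y' assume iy: "pair i y : el ?g" "pair i y' : el ?g"
    then have "i : el ?I" unfolding el_Collect by (auto simp: el_prd)
    then obtain j u where "i = pair j u" unfolding el_prd by blast
    then show "y = y'" using fn iy by blast
  qed
  have "app ?g (pair i u) = y" if i: "i : el l" and u: "u : el (conds zero a)" and y: "y : el w" "pair (pair i y) u : el rho"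
    and only: "ALL y':el w. pair (pair i y') u : el rho --> y' = y" for i u y
  proof (rule app_unique)
    have "\<not> less_L y y" using less_L_graph(4)[OF w] y(1) unfolding wfp_on_iff_wf using wf_not_refl by fastforce
    then show "pair (pair i u) y : el ?g" unfolding elg using i u y only by blast
    then show "z = y" if "pair (pair i u) z : el ?g" for z using fn that by blast
  qed
  then show ?thesis using gA by blast
qed

lemma ex_small_cover: assumes a: "limit a" "a : A" and l: "l : A" "small a l" and w: "w : A"
    and t: "t : N" "el t <= el (prd l w)" and fn: "!!i y y'. pair i y : el t ==> pair i y' : el t ==> y = y'"
  shows "EX b:A. small a b \<and> (ALL i y. pair i y : el t --> y : el b)"
proof -
  have oa: "Ord a" using a unfolding limit_def by simp
  let ?I = "prd l (conds zero a)"
  have I: "?I : A" "small a ?I" using l a by (auto intro!: small_prd small_conds oa)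
  obtain rho where rho: "rho : M a" "el t = {x : el (prd l w). EX u:Glow a. pair x u : el rho}"
    using ex_subset_name_M[OF a t] l w by auto
  obtain g where g: "g : A" "ALL i:el l. ALL u:el (conds zero a). ALL y:el w. pair (pair i y) u : el rho -->
    (ALL y':el w. pair (pair i y') u : el rho --> y' = y) --> app g (pair i u) = y"
    using ex_section[OF a l w rho(1)] by blast
  let ?b = "mk (app g ` el ?I)"
  have "?b : A" by (rule dterm_constD) (intro dintro I g(1))
  moreover have "small a ?b" by (rule small_image[OF a(2) I(2), of "app g"]) (intro dintro g(1), simp)
  moreover have "y : el ?b" if ty: "pair i y : el t" for i y
  proof -
    have iy: "i : el l" "y : el w" using subsetD[OF t(2) ty] by (auto simp: el_prd)
    obtain u where u: "u : Glow a" "pair (pair i y) u : el rho" using ty unfolding rho(2) by blast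
    then have uc: "u : el (conds zero a)" using Glow_conds[OF oa] by blast
    have "y' = y" if "y' : el w" "pair (pair i y') u : el rho" for y'
    proof (rule fn)
      show "pair i y' : el t" unfolding rho(2) using that u(1) iy(1) by (auto simp: el_prd)
    qed (rule ty)
    then have "app g (pair i u) = y" using g(2) iy uc u(2) by blast
    moreover have "pair i u : el ?I" using iy(1) uc by (simp add: el_prd)
    ultimately show ?thesis by (auto intro: image_eqI[of _ "app g" "pair i u"])
  qed
  ultimately show ?thesis by blast
qed

end

locale ground_of = easton_ext A G for A G +
  fixes W c r h
  assumes gW: "generic_in W c r h" and WN: "val h ` W = N" and WAC: "AC W" and WO: "a : A ==> Ord a ==> a : W"
begin

interpretation w: generic_in W c r h by (rule gW)

lemma A_W: "x : A ==> x : W"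
proof -
  assume "x : A"
  then obtain a where "a : A" "Ord a" "x : el (Lh a)" using VL by blast
  then show "x : W" using WO w.LhA w.Atrans by blast
qed

lemma W_N: "x : W ==> x : N"
proof -
  assume x: "x : W"
  obtain o1 where o: "o1 : h" using w.Gne by blast
  then have "o1 : W" using w.Gc w.cA w.Atrans by blast
  then have "chk o1 x : W" using x by simp
  then show "x : N" using val_chk[OF o, of x] WN by (metis imageI)
qed

lemma Ord_W: "x : W ==> Ord x ==> x : A" using W_N Ord_N by blast

lemma dpred_mem_A: "dterm W t ==> dpred W (%e. t e : A)"
proof -
  have "w.Lcls = A"
  proof (intro set_eqI iffI)
    fix x assume "x : w.Lcls"
    then obtain a where "a : W" "Ord a" "x : el (Lh a)" using w.Lcls_Ex by blast
    then show "x : A" using Ord_W LhA Atrans by blast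
  next
    fix x assume "x : A"
    then show "x : w.Lcls" using VL WO w.Lcls_I by blast
  qed
  then show "dterm W t ==> dpred W (%e. t e : A)" using w.dpred_Lcls by simp
qed

lemma ex_enumeration_poset: "EX l:A. EX f:W. Ord l \<and> app f ` el l = el c"
  using w.ex_wellorder[OF WAC w.cA] Ord_W by blast

context
  fixes a
  assumes a: "limit a" "a : A"
begin

text \<open>Over \<open>M a\<close>, sequences of length \<open>\<kappa> < a\<close> in \<open>N\<close> are covered by small sets of \<open>A\<close>, and
  on those \<open>M a\<close> has no new subsets; so the approximation property of \<open>W\<close> applies.\<close>

lemma M_approximated_in_ground: assumes l: "l0 : el a" "f : W" "app f ` el l0 = el c" and e: "e : M a" "el e <= el w0" and w0: "w0 : A" and s: "s : W"
  shows "mk (el e Int app s ` el c) : W"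
proof -
  interpret a: class_ext A a "Ghigh a" by (rule class_ext_Ghigh[OF a])
  interpret Ma: zf "M a" by (rule M_zf[OF a])
  have l0: "l0 : A" "Ord l0" using l(1) a Atrans Ord_in unfolding limit_def by blast+
  have sl: "small a l0" by (rule small_rank[OF a(2,1)]) (use l0 l(1) rank_Ord in auto)
  let ?t = "mk {z : el (prd l0 w0). pr2 z = app s (app f (pr1 z))}"
  have "?t : W" by (rule w.sepA) (intro w.dpred_eq w.dterm_pr2 w.dterm_pr1 w.dterm_var w.dterm_app w.dterm_const s l w.prdA A_W l0 w0)+
  then have tN: "?t : N" by (rule W_N)
  have elt: "pair i y : el ?t \<longleftrightarrow> i : el l0 \<and> y : el w0 \<and> y = app s (app f i)" for i y unfolding el_Collect by (auto simp: el_prd)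
  have "el ?t <= el (prd l0 w0)" unfolding el_Collect by blast
  then have "EX b:A. small a b \<and> (ALL i y. pair i y : el ?t --> y : el b)"
    by (rule ex_small_cover[OF a l0(1) sl w0 tN]) (simp only: elt)
  then obtain b where b: "b : A" "small a b" "!!i y. pair i y : el ?t ==> y : el b" by blast
  let ?e = "mk {y : el b. y : el e}"
  have "?e : M a" by (rule Ma.sepA) (intro Ma.dpred_mem Ma.dterm_var Ma.dterm_const e M_zf(3)[OF a] b)+
  then have "?e : A" by (intro a.small_subset_mem[OF a(1) _ _ b(1,2)]) (auto simp: class_N_eq_M[OF a] el_Collect)
  then have "mk {y : el ?e. EX q:el c. y = app s q} : W"
    by (intro w.sepA w.dpred_bex w.dpred_eq w.dterm_var w.dterm_app w.dterm_const s w.cA A_W)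
  moreover have "app s q : el b" if q: "q : el c" "app s q : el e" for q
  proof -
    obtain i where "i : el l0" "q = app f i" using q(1) l(3) by blast
    then have "pair i (app s q) : el ?t" unfolding elt using q(2) e(2) by blast
    then show ?thesis by (rule b(3))
  qed
  then have "{y : el ?e. EX q:el c. y = app s q} = el e Int app s ` el c" unfolding el_Collect by blast
  ultimately show ?thesis by simp
qed

lemma M_subset_ground: assumes l: "l0 : el a" "f : W" "app f ` el l0 = el c" shows "M a <= W"
proof (rule zf_subset[OF w.zf_axioms M_zf(1,2)[OF a]])
  have MN: "x : N" if "x : M a" for x using that M_zf(4)[OF a] by blast
  show "x : W" if "x : M a" "Ord x" for x using that MN Ord_N WO by blast
  fix e l k assume e: "e : M a" and lk: "l : M a" "k : M a" "Ord l" "Ord k" and sub: "el e <= el (prd (prd l l) k)"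
  let ?w = "prd (prd l l) k"
  have "l : A" "k : A" using lk MN Ord_N by blast+
  then have w: "?w : A" by simp
  have "e : N" by (rule MN[OF e])
  then obtain x where x: "x : W" "e = val h x" using WN by blast
  obtain o1 where o: "o1 : h" using w.Gne by blast
  have "el (val h x) Int el ?w = el e" using sub unfolding x(2) by blast
  with w.ex_subset_name[OF x(1) A_W[OF w] o] obtain rho where rho: "rho : W" "el e = {y : el ?w. EX q:h. pair y q : el rho}" by auto
  have "mk (el e) : W"
    by (rule w.approximation_property[OF A_W[OF w] A_W[OF less_L_graph(1)[OF w]] less_L_graph(2-4)[OF w] rho]) (rule M_approximated_in_ground[OF l e sub w])
  then show "e : W" by simp
qed

lemma M_locally_ground: assumes e: "e : M a" and s: "s : A"
  shows "mk {y : el e. EX q:el (conds zero a). y = app s q} : A"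
proof -
  interpret a: class_ext A a "Ghigh a" by (rule class_ext_Ghigh[OF a])
  interpret Ma: zf "M a" by (rule M_zf[OF a])
  have c: "conds zero a : A" "small a (conds zero a)" using a small_conds unfolding limit_def by auto
  let ?b = "mk ((%q. app s q) ` el (conds zero a))"
  have bA: "?b : A" by (rule dterm_constD) (intro dintro s c)
  have sb: "small a ?b" by (rule small_image[OF a(2) c(2), of "app s"]) (intro dintro s, simp)
  show ?thesis
  proof (rule a.small_subset_mem[OF a(1) _ _ bA sb])
    show "mk {y : el e. EX q:el (conds zero a). y = app s q} : a.N" unfolding class_N_eq_M[OF a]
      by (intro Ma.sepA Ma.dpred_bex Ma.dpred_eq Ma.dterm_var Ma.dterm_app Ma.dterm_const M_zf(3)[OF a] s c e)
  qed (auto simp: el_Collect)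
qed

lemma M_if_locally_ground: assumes e: "e : W" "el e <= el w0" and w0: "w0 : A"
    and small: "!!s. s : A ==> mk {y : el e. EX q:el (conds zero a). y = app s q} : A"
  shows "e : M a"
proof -
  interpret a: class_ext A a "Ghigh a" by (rule class_ext_Ghigh[OF a])
  interpret Ma: generic_in "M a" "conds zero a" "conds_le a" "Glow a" by (rule M_generic[OF a])
  have c: "conds zero a : A" "small a (conds zero a)" using a small_conds unfolding limit_def by auto
  obtain rho where rho: "rho : M a" "el e = {y : el w0. EX q:Glow a. pair y q : el rho}"
    using ex_subset_name_M[OF a W_N[OF e(1)] e(2) w0] by blast
  have "mk (el e) : M a"
  proof (rule Ma.approximation_property[OF M_zf(3)[OF a w0] M_zf(3)[OF a less_L_graph(1)[OF w0]] less_L_graph(2-4)[OF w0] rho])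
    fix s assume s: "s : M a"
    let ?t = "mk {z : el (prd (conds zero a) w0). pr2 z = app s (pr1 z)}"
    have elt: "pair q y : el ?t \<longleftrightarrow> q : el (conds zero a) \<and> y : el w0 \<and> y = app s q" for q y unfolding el_Collect by (auto simp: el_prd)
    have "?t : M a"
      by (rule Ma.sepA) (intro Ma.dpred_eq Ma.dterm_var Ma.dterm_app Ma.dterm_const Ma.dterm_pr1 Ma.dterm_pr2 s M_zf(3)[OF a] prdA c w0)+
    then have tA: "?t : A" unfolding class_N_eq_M[OF a, symmetric]
    proof (rule a.function_mem[OF a(1) _ _ c w0])
      show "el ?t <= el (prd (conds zero a) w0)" unfolding el_Collect by blast
    qed (simp only: elt)
    let ?e = "mk {y : el e. EX q:el (conds zero a). y = app ?t q}"
    have "mk {y : el ?e. EX q:el (conds zero a). y = app s q} : M a"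
      by (intro Ma.sepA Ma.dpred_bex Ma.dpred_eq Ma.dterm_var Ma.dterm_app Ma.dterm_const M_zf(3)[OF a] s c small tA)
    moreover have "app s q = app ?t q" if "q : el (conds zero a)" "app s q : el e" for q
    proof (rule app_unique[symmetric])
      show "pair q (app s q) : el ?t" unfolding elt using that e(2) by blast
    qed (simp only: elt)
    then have "{y : el ?e. EX q:el (conds zero a). y = app s q} = el e Int app s ` el (conds zero a)"
      unfolding el_Collect by blast
    ultimately show "mk (el e Int app s ` el (conds zero a)) : M a" by simp
  qed
  then show ?thesis by simp
qed

lemma dpred_M: assumes l: "l0 : el a" "f : W" "app f ` el l0 = el c"
  shows "dpred W (%e. e 0 : M a)"
proof (rule w.dpred_cong)
  interpret Ma: zf "M a" by (rule M_zf[OF a])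
  let ?P = "%x. EX e:W. EX l:W. EX k:W. EX i:el l. Ord l \<and> Ord k \<and> el e <= el (prd (prd l l) k) \<and>
     (ALL s:W. s : A --> mk {y : el e. EX q:el (conds zero a). y = app s q} : A) \<and> x = val (el one) (coded_name (prd e one) l k i)"
  have cW: "conds zero a : W" using a A_W by simp
  show "dpred W (%e. ?P (e 0))"
    by (intro w.dpred_ex w.dpred_bex w.dpred_conj w.dpred_all w.dpred_imp w.dpred_eq w.dpred_Ord w.dpred_sub_el dpred_mem_A w.dterm_sep
        w.dterm_var w.dterm_const w.dterm_app w.dterm_prd w.dterm_val w.dterm_coded_name w.oneA cW)
  fix e :: "nat => hset" assume "range e <= W"
  define x where "x = e 0"
  have "?P x \<longleftrightarrow> x : M a"
  proof
    assume "?P x"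
    then obtain d l k i where d: "d : W" "l : W" "k : W" "i : el l" "Ord l" "Ord k" "el d <= el (prd (prd l l) k)"
      "ALL s:W. s : A --> mk {y : el d. EX q:el (conds zero a). y = app s q} : A" "x = val (el one) (coded_name (prd d one) l k i)" by blast
    have lk: "l : A" "k : A" using d Ord_W by blast+
    have "ALL s:A. mk {y : el d. EX q:el (conds zero a). y = app s q} : A" using d(8) A_W by blast
    then have dM: "d : M a" using M_if_locally_ground[OF d(1,7)] lk by simp
    have "i : A" using lk d(4) Atrans by blast
    then have "l : M a" "k : M a" "i : M a" using M_zf(3)[OF a] lk by blast+
    then show "x : M a" unfolding d(9) by (intro Ma.valA Ma.coded_nameA Ma.prdA Ma.oneA dM)
  next
    assume "x : M a"
    from Ma.ex_set_code[OF M_zf(2)[OF a] this] obtain d l k i where d: "d : M a" "l : M a" "k : M a" "i : el l" "Ord l" "Ord k"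
      "el d <= el (prd (prd l l) k)"
      "ALL H rho. el d = {z : el (prd (prd l l) k). EX r:H. pair z r : el rho} --> val H (coded_name rho l k i) = x" by blast
    have W: "d : W" "l : W" "k : W" using d M_subset_ground[OF l] by blast+
    have lk: "l : A" "k : A" using W d Ord_W by blast+
    have "el d = {z : el (prd (prd l l) k). EX r:el one. pair z r : el (prd d one)}" using d(7) by (auto simp: el_prd)
    then have x: "x = val (el one) (coded_name (prd d one) l k i)" using d(8)[rule_format, of "el one" "prd d one"] by simp
    have "ALL s:A. mk {y : el d. EX q:el (conds zero a). y = app s q} : A" using M_locally_ground[OF d(1)] by blast
    then have "ALL s:W. s : A --> mk {y : el d. EX q:el (conds zero a). y = app s q} : A" by simp
    then show "?P x" by (intro bexI[OF _ W(1)] bexI[OF _ W(2)] bexI[OF _ W(3)] bexI[OF _ d(4)] conjI d(5-7) x)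
  qed
  then show "?P (e 0) \<longleftrightarrow> e 0 : M a" unfolding x_def .
qed

end

end

section \<open>Intermediate models\<close>

definition bval_step where "bval_step P e f = mk {p : el (pr1 (pr1 P)). ALL q:el (pr1 (pr1 P)). pair q p : el (pr2 (pr1 P)) -->
   \<not> (EX u. pair (pr1 e) u : el (pr2 P) \<and> pair q u : el (pr2 (pr1 P))) \<and> (ALL s:el (pr2 e). q ~: el (app f s))}"

text \<open>\<open>bval\<close> evaluates infinitary propositional codes: \<open>pair z S\<close> stands for ``neither the atom \<open>z\<close> nor any
  member of \<open>S\<close> holds'', and its value is the regular open set of conditions forcing this.\<close>

definition bval where "bval P = recF (bval_step P)"

lemma el_bval: "el (bval (pair (pair c r) X_name) e) = {p : el c. ALL q:el c. le r q p -->
   \<not> (EX u. pair (pr1 e) u : el X_name \<and> le r q u) \<and> (ALL s:el (pr2 e). q ~: el (bval (pair (pair c r) X_name) s))}"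
proof -
  have "s : TC e" if "s : el (pr2 e)" for s
  proof (cases "EX x y. e = pair x y")
    case True then show ?thesis using that pair_TC TC_el_trans by (metis sn_opr)
  next
    case False then show ?thesis using that pr1_not_pair(2)[of e] by simp
  qed
  then have t: "app (lam (tc e) (bval P)) s = bval P s" if "s : el (pr2 e)" for s P using that by simp
  have "bval (pair (pair c r) X_name) e = bval_step (pair (pair c r) X_name) e (lam (tc e) (bval (pair (pair c r) X_name)))" unfolding bval_def by (rule recF)
  then show ?thesis unfolding bval_step_def by (simp only: pr1_pair sn_opr el_Collect le_def) (use t in auto)
qed

lemma (in zf) dterm_bval[dintro]: assumes "dterm A s" "dterm A t" shows "dterm A (%e. bval (s e) (t e))" unfolding bval_def
  by (rule dterm_recF[where H=bval_step, OF _ assms]) (unfold bval_step_def, intro dintro)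

lemma (in zf) bvalA: "x : A ==> y : A ==> bval x y : A" by (rule dterm_constD[OF dterm_bval[OF dterm_const dterm_const]])

locale intermediate = B: generic_in B c r g for B c r g +
  fixes K W th X X_name
  assumes Wzf: "zf W" and WAC: "AC W" and BAC: "AC B" and Kzf: "zf K" and KB: "K <= B" and BW: "B <= W" and BnW: "B ~= W"
    and Bdfb: "dpred W (%e. e 0 : B)" and OK: "a : W ==> Ord a ==> a : K"
    and subset_named: "e : W ==> w : K ==> el e <= el w ==> EX rho:B. el e = {x : el w. EX u:g. pair x u : el rho}"
    and th: "th : K" and X: "X : W"
    and rows: "Y : W ==> el Y <= el c ==> EX j:el th. el Y = {p : el c. pair j p : el X}"
    and X_name: "X_name : B" and X_name_iff: "z : el X \<longleftrightarrow> (EX u:g. pair z u : el X_name)" and X_name_zero: "pair zero u ~: el X_name"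
begin

interpretation w: zf W by (rule Wzf)
interpretation K: zf K by (rule Kzf)

abbreviation bv where "bv \<equiv> bval (pair (pair c r) X_name)"

lemmas el_bv = el_bval[of c r X_name]

lemma bvB: "e : B ==> bv e : B" by (intro B.bvalA B.pairA B.cA B.rA X_name)
lemma dterm_bv: "dterm B t ==> dterm B (%e. bv (t e))" by (intro B.dterm_bval B.dterm_const B.pairA B.cA B.rA X_name)
lemma bv_cond: "p : el (bv e) ==> p : el c" by (subst (asm) el_bv) blast
lemma G_cond: "p : g ==> p : el c" using B.Gc by blast

lemma bv_iff: "p : el (bv e) \<longleftrightarrow> p : el c \<and> (ALL q. le r q p -->
   \<not> (EX u. pair (pr1 e) u : el X_name \<and> le r q u) \<and> (ALL s:el (pr2 e). q ~: el (bv s)))"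
  by (subst el_bv) (use B.le_c in blast)

lemma bv_down: assumes "p : el (bv e)" "le r q p" shows "q : el (bv e)"
proof -
  have "le r q' p" if "le r q' q" for q' using B.le_trans[OF _ _ _ that assms(2)] B.le_c that assms(2) by blast
  then show ?thesis using assms(1) B.le_c[OF assms(2)] unfolding bv_iff[of p e] bv_iff[of q e] by blast
qed

lemma bv_regular: assumes p: "p : el c" and d: "!!q. le r q p ==> EX t. le r t q \<and> t : el (bv e)" shows "p : el (bv e)"
  unfolding bv_iff[of p e]
proof (intro conjI allI impI ballI notI p)
  fix q assume q: "le r q p"
  obtain t where t: "le r t q" "t : el (bv e)" using d[OF q] by blast
  have tt: "le r t t" using B.le_refl bv_cond t by blast
  { assume "EX u. pair (pr1 e) u : el X_name \<and> le r q u"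
    then obtain u where u: "pair (pr1 e) u : el X_name" "le r q u" by blast
    have "le r t u" using B.le_trans[OF _ _ _ t(1) u(2)] B.le_c t(1) u(2) by blast
    then show False using t(2) tt u(1) unfolding bv_iff[of t] by blast }
  fix s assume "s : el (pr2 e)" "q : el (bv s)"
  then show False using bv_down[OF _ t(1)] t(2) tt unfolding bv_iff[of t e] by blast
qed

abbreviation meets where "meets d \<equiv> g Int el d ~= {}"

lemma meets_bv: assumes e: "e : B" shows "meets (bv e) \<longleftrightarrow> pr1 e ~: el X \<and> (ALL s:el (pr2 e). \<not> meets (bv s))"
proof
  assume "meets (bv e)"
  then obtain p where p: "p : g" "p : el (bv e)" by blast
  show "pr1 e ~: el X \<and> (ALL s:el (pr2 e). \<not> meets (bv s))"
  proof (intro conjI ballI notI)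
    assume "pr1 e : el X"
    then obtain u where u: "u : g" "pair (pr1 e) u : el X_name" unfolding X_name_iff by blast
    obtain t where "t : g" "le r t p" "le r t u" using B.Gdir[OF p(1) u(1)] by blast
    then show False using p(2) u(2) unfolding bv_iff[of p] by blast
  next
    fix s assume s: "s : el (pr2 e)" "meets (bv s)"
    then obtain u where u: "u : g" "u : el (bv s)" by blast
    obtain t where "t : g" "le r t p" "le r t u" using B.Gdir[OF p(1) u(1)] by blast
    then show False using p(2) s(1) bv_down[OF u(2)] unfolding bv_iff[of p] by blast
  qed
next
  assume a: "pr1 e ~: el X \<and> (ALL s:el (pr2 e). \<not> meets (bv s))"
  let ?Q = "%p. p : el (bv e) \<or> (EX u. pair (pr1 e) u : el X_name \<and> le r p u) \<or> (EX s:el (pr2 e). p : el (bv s))"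
  have "EX p:g. ?Q p"
  proof (rule B.Ggen_pred)
    show "dpred B (%x. ?Q (x 0))" by (intro B.dpred_disj B.dpred_mem B.dterm_var B.dpred_pex1 B.dpred_le B.dpred_bex dterm_bv B.dterm_const B.dterm_pr1 B.dterm_pr2 e X_name)
    fix p assume p: "p : el c"
    show "EX d. le r d p \<and> ?Q d"
    proof (cases "p : el (bv e)")
      case True then show ?thesis using B.le_refl[OF p] by blast
    next
      case False then show ?thesis using p unfolding bv_iff[of p e] by blast
    qed
  qed
  then obtain p where p: "p : g" "?Q p" by blast
  have "\<not> (EX u. pair (pr1 e) u : el X_name \<and> le r p u)" using a B.Gup[OF p(1)] unfolding X_name_iff by blast
  then show "meets (bv e)" using p a by blast
qed

definition unit_poset where "unit_poset = pair (pair one (prd one one)) (prd X one)"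

text \<open>Over the trivial poset \<open>bval\<close> computes truth values, so \<open>X\<close> alone decides which values the
  generic filter meets.\<close>

lemma meets_unit_poset: "e : B ==> meets (bv e) \<longleftrightarrow> zero : el (bval unit_poset e)"
proof (induction e rule: TC_induct)
  case (step e)
  have t: "s : TC e \<and> s : B" if "s : el (pr2 e)" for s
  proof (cases "EX x y. e = pair x y")
    case True then show ?thesis using that pair_TC TC_el_trans step(2) B.pair_memD B.Atrans by (metis sn_opr)
  next
    case False then show ?thesis using that pr1_not_pair(2)[of e] by simp
  qed
  have "zero : el (bval unit_poset e) \<longleftrightarrow> pr1 e ~: el X \<and> (ALL s:el (pr2 e). zero ~: el (bval unit_poset s))"
    unfolding unit_poset_def by (subst el_bval) (auto simp: le_def el_prd)
  also have "... \<longleftrightarrow> pr1 e ~: el X \<and> (ALL s:el (pr2 e). \<not> meets (bv s))" using step(1) t by blast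
  finally show ?case using meets_bv[OF step(2)] by blast
qed

lemma zero_notin_X: "zero ~: el X" using X_name_iff X_name_zero by blast

definition neg_code where "neg_code e = pair zero (upair e e)"
definition conj_code where "conj_code e e' = pair zero (upair (neg_code e) (neg_code e'))"

lemma codesB: "e : B ==> neg_code e : B" "e : B ==> e' : B ==> conj_code e e' : B" unfolding neg_code_def conj_code_def by (simp_all add: B.upairA)
lemma dterm_neg_code: "dterm B t ==> dterm B (%e. neg_code (t e))" unfolding neg_code_def by (intro B.dterm_pair B.dterm_upair B.dterm_const B.zeroA)
lemma bv_neg_code: "p : el (bv (neg_code e)) \<longleftrightarrow> p : el c \<and> (ALL q. le r q p --> q ~: el (bv e))"
  unfolding bv_iff[of p] neg_code_def by (simp add: X_name_zero)
lemma bv_conj_code: "el (bv (conj_code e e')) = el (bv e) Int el (bv e')"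
proof -
  have n: "(ALL q. le r q p --> q ~: el (bv (neg_code e))) \<longleftrightarrow> p : el (bv e)" if p: "p : el c" for p e
  proof
    assume "p : el (bv e)" then show "ALL q. le r q p --> q ~: el (bv (neg_code e))" using bv_down B.le_refl B.le_c unfolding bv_neg_code by blast
  next
    assume "ALL q. le r q p --> q ~: el (bv (neg_code e))" then show "p : el (bv e)" using bv_regular[OF p] B.le_c unfolding bv_neg_code by blast
  qed
  show ?thesis
  proof (intro set_eqI)
    fix p
    have "p : el (bv (conj_code e e')) \<longleftrightarrow> p : el c \<and> (ALL q. le r q p --> q ~: el (bv (neg_code e)) \<and> q ~: el (bv (neg_code e')))"
      unfolding bv_iff[of p] conj_code_def by (simp add: X_name_zero)
    then show "p : el (bv (conj_code e e')) \<longleftrightarrow> p : el (bv e) Int el (bv e')" using n[of p e] n[of p e'] bv_cond by blast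
  qed
qed

lemma meets_conj_code: assumes "meets (bv e)" "meets (bv e')" shows "meets (bv (conj_code e e'))"
proof -
  obtain p q where p: "p : g" "p : el (bv e)" "q : g" "q : el (bv e')" using assms by blast
  obtain t where "t : g" "le r t p" "le r t q" using B.Gdir[OF p(1,3)] by blast
  then show ?thesis unfolding bv_conj_code using bv_down p by blast
qed

definition top_code where "top_code = pair zero zero"
lemma top_codeB: "top_code : B" unfolding top_code_def by simp
lemma bv_top_code: "el (bv top_code) = el c" by (subst el_bv) (simp add: X_name_zero top_code_def)
lemma meets_top_code: "meets (bv top_code)" unfolding bv_top_code using B.Gne G_cond by blast

definition vals where "vals e0 = mk {d : el (B.pow c). (EX e:B. d = bv e) \<and> el d ~= {} \<and> el d <= el (bv e0)}"

lemma vals: assumes "e0 : B" shows "vals e0 : B" "d : el (vals e0) \<longleftrightarrow> (EX e:B. d = bv e) \<and> el d ~= {} \<and> el d <= el (bv e0)"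
proof -
  have ne: "el d ~= {} \<longleftrightarrow> (EX x:el d. True)" for d by blast
  show "vals e0 : B" unfolding vals_def ne
    by (rule B.sepA) (intro B.dpred_conj B.dpred_ex B.dpred_eq B.dpred_bex B.dpred_const B.dpred_sub_el dterm_bv B.dterm_var B.dterm_const assms B.powA B.cA)+
  show "d : el (vals e0) \<longleftrightarrow> (EX e:B. d = bv e) \<and> el d ~= {} \<and> el d <= el (bv e0)"
    unfolding vals_def el_Collect using bvB bv_cond by auto
qed

lemma valsI: "e0 : B ==> e : B ==> meets (bv e) ==> meets (bv e0) ==> bv (conj_code e0 e) : el (vals e0) \<and> meets (bv (conj_code e0 e))"
  using meets_conj_code[of e0 e] codesB(2)[of e0 e] unfolding vals(2) bv_conj_code by blast

definition Hvals where "Hvals e0 = {d : el (vals e0). meets d}"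

lemma Hvals_W: assumes "e0 : B" shows "mk (Hvals e0) : W"
proof -
  let ?Q = "%d. EX e:W. e : B \<and> d = bv e \<and> zero : el (bval unit_poset e)"
  have BWi: "x : B ==> x : W" for x using BW by blast
  have BD: "dterm W t ==> dpred W (%e. t e : B)" for t by (rule w.dpred_comp1[where Q="%x. x : B", OF Bdfb])
  have P1W: "unit_poset : W" unfolding unit_poset_def using X by simp
  have "mk {d : el (vals e0). ?Q d} : W"
    by (rule w.sepA) (intro w.dpred_ex w.dpred_conj w.dpred_eq w.dpred_mem BD w.dterm_bval w.dterm_var w.dterm_const w.pairA w.zeroA P1W BWi B.cA B.rA X_name vals assms)+
  moreover have "{d : el (vals e0). ?Q d} = Hvals e0"
  proof -
    have "?Q d \<longleftrightarrow> meets d" if d: "d : el (vals e0)" for d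
    proof
      assume "?Q d" then show "meets d" using meets_unit_poset by blast
    next
      assume m: "meets d"
      obtain e where "e : B" "d = bv e" using d unfolding vals(2)[OF assms] by blast
      then show "?Q d" using m meets_unit_poset BWi by blast
    qed
    then show ?thesis unfolding Hvals_def by blast
  qed
  ultimately show ?thesis by simp
qed

lemma Hvals_generic: assumes e0: "e0 : B" "meets (bv e0)" and Q: "dpred B (%e. Q (e 0))"
    and d: "!!d. d : el (vals e0) ==> EX d':el (vals e0). el d' <= el d \<and> Q d'"
  shows "EX d:Hvals e0. Q d"
proof (rule ccontr)
  assume n: "\<not> ?thesis"
  have Qd: "dterm B t ==> dpred B (%e. Q (t e))" for t by (rule B.dpred_comp1[where Q=Q, OF Q])
  have RB: "vals e0 : B" by (rule vals[OF e0(1)])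
  have "EX Y:B. ALL d:el (vals e0). EX e:el Y. d = bv e"
  proof (rule B.collection[OF _ RB])
    show "dpred B (%e. e 0 = bv (e 1))" by (intro B.dpred_eq B.dterm_var dterm_bv)
  qed (use vals(2)[OF e0(1)] in blast)
  then obtain Y where Y: "Y : B" "ALL d:el (vals e0). EX e:el Y. d = bv e" by blast
  define S where "S = mk {e : el Y. bv e : el (vals e0) \<and> Q (bv e)}"
  have S: "S : B" unfolding S_def by (rule B.sepA[OF _ Y(1)]) (intro B.dpred_conj B.dpred_mem Qd dterm_bv B.dterm_var B.dterm_const RB)
  have elS: "e : el S \<longleftrightarrow> e : el Y \<and> bv e : el (vals e0) \<and> Q (bv e)" for e unfolding S_def by simp
  let ?n = "pair zero S"
  have nB: "?n : B" using S by simp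
  have "\<not> meets (bv s)" if "s : el S" for s using n that unfolding elS Hvals_def by blast
  then have "meets (bv ?n)" unfolding meets_bv[OF nB] using zero_notin_X by simp
  then have "bv (conj_code e0 ?n) : el (vals e0)" using valsI[OF e0(1) nB _ e0(2)] by blast
  then obtain d' where d': "d' : el (vals e0)" "el d' <= el (bv (conj_code e0 ?n))" "Q d'" using d by blast
  obtain s where s: "s : el Y" "d' = bv s" using bspec[OF Y(2) d'(1)] by blast
  then have sS: "s : el S" using d' elS by simp
  obtain p where p: "p : el d'" using d'(1) unfolding vals(2)[OF e0(1)] by blast
  then have "p : el (bv ?n)" using d'(2) unfolding bv_conj_code by blast
  then have "ALL q. le r q p --> (ALL s:el (pr2 ?n). q ~: el (bv s))" unfolding bv_iff[of p ?n] by blast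
  then have "ALL s:el S. p ~: el (bv s)" using B.le_refl[of p] p s(2) bv_cond unfolding sn_opr by blast
  then show False using sS p s(2) by blast
qed

definition holds where "holds j p = neg_code (pair (pair j p) zero)"

lemma holdsB: "j : B ==> p : B ==> holds j p : B" unfolding holds_def by (intro codesB B.pairA B.zeroA)

lemma dterm_holds: "j : B ==> dterm B t ==> dterm B (%e. holds j (t e))"
  unfolding holds_def by (intro dterm_neg_code B.dterm_pair B.dterm_const B.zeroA)

lemma meets_holds: assumes "j : B" "p : B" shows "meets (bv (holds j p)) \<longleftrightarrow> pair j p : el X"
proof -
  have o: "pair (pair j p) zero : B" using assms by simp
  have "meets (bv (holds j p)) \<longleftrightarrow> \<not> meets (bv (pair (pair j p) zero))" unfolding meets_bv[OF holdsB[OF assms]] using zero_notin_X by (simp add: holds_def neg_code_def)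
  also have "... \<longleftrightarrow> pair j p : el X" unfolding meets_bv[OF o] by simp
  finally show ?thesis .
qed

text \<open>The conditions \<open>p\<close> of the original forcing are replaced by the values of codes asserting that \<open>p\<close>
  forces only elements of \<open>e\<close>; the set of such \<open>p\<close> is a row of \<open>X\<close>.\<close>

lemma ex_subset_name_Hvals: assumes e0: "e0 : B" "meets (bv e0)" and e: "e : W" "el e <= el w0" and w0: "w0 : K"
  shows "EX ro:B. el e = {z : el w0. EX d:Hvals e0. pair z d : el ro}"
proof -
  have KBi: "x : K ==> x : B" and BWi: "x : B ==> x : W" for x using KB BW by blast+
  obtain rho where rho: "rho : B" "el e = {z : el w0. EX u:g. pair z u : el rho}" using subset_named[OF e(1) w0 e(2)] by blast
  let ?Y = "mk {p : el c. ALL z:el w0. pair z p : el rho --> z : el e}"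
  have elY: "p : el ?Y \<longleftrightarrow> p : el c \<and> (ALL z:el w0. pair z p : el rho --> z : el e)" for p unfolding el_Collect by blast
  have "?Y : W"
    by (rule w.sepA) (intro w.dpred_ball w.dpred_imp w.dpred_mem w.dterm_pair w.dterm_var w.dterm_const e BWi KBi w0 rho B.cA)+
  moreover have "el ?Y <= el c" using elY by blast
  ultimately obtain j where j: "j : el th" "el ?Y = {p : el c. pair j p : el X}" by (rule bexE[OF rows])
  have jB: "j : B" using j th K.Atrans KBi by blast
  have holds_Y: "meets (bv (holds j p)) \<longleftrightarrow> p : el ?Y" if "p : el c" for p
    using meets_holds[OF jB] that B.cA B.Atrans unfolding j(2) by blast
  let ?ro = "mk {z : el (prd w0 (vals e0)). EX p:el c. pair (pr1 z) p : el rho \<and> el (pr2 z) <= el (bv (holds j p))}"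
  have "prd w0 (vals e0) : B" using KBi[OF w0] vals(1)[OF e0(1)] by simp
  then have roB: "?ro : B"
    by (rule B.sepA[rotated]) (intro B.dpred_bex B.dpred_conj B.dpred_mem B.dpred_sub_el B.dterm_pair B.dterm_pr1 B.dterm_pr2 B.dterm_var B.dterm_const
      dterm_bv dterm_holds jB B.cA rho)
  have elro: "pair z d : el ?ro \<longleftrightarrow> z : el w0 \<and> d : el (vals e0) \<and> (EX p:el c. pair z p : el rho \<and> el d <= el (bv (holds j p)))" for z d
    unfolding el_Collect by (simp add: el_prd)
  have "el e = {z : el w0. EX d:Hvals e0. pair z d : el ?ro}"
  proof (intro set_eqI iffI)
    fix z assume z: "z : el e"
    then have zw: "z : el w0" unfolding rho(2) by blast
    obtain p where p: "p : g" "pair z p : el rho" using z unfolding rho(2) by blast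
    have pc: "p : el c" by (rule G_cond[OF p(1)])
    have "p : el ?Y" unfolding elY using pc p unfolding rho(2) by blast
    then have m: "meets (bv (holds j p))" using holds_Y[OF pc] by blast
    have "holds j p : B" using holdsB[OF jB] pc B.cA B.Atrans by blast
    from valsI[OF e0(1) this m e0(2)] have d: "bv (conj_code e0 (holds j p)) : Hvals e0" "bv (conj_code e0 (holds j p)) : el (vals e0)"
      unfolding Hvals_def by blast+
    have "pair z (bv (conj_code e0 (holds j p))) : el ?ro" unfolding elro using d(2) zw pc p(2) bv_conj_code by blast
    then show "z : {z : el w0. EX d:Hvals e0. pair z d : el ?ro}" using zw d(1) by blast
  next
    fix z assume "z : {z : el w0. EX d:Hvals e0. pair z d : el ?ro}"
    then obtain d p where dp: "z : el w0" "meets d" "p : el c" "pair z p : el rho" "el d <= el (bv (holds j p))" unfolding elro Hvals_def by blast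
    then have "p : el ?Y" using holds_Y by blast
    then show "z : el e" using dp unfolding elY by blast
  qed
  then show ?thesis using roB by blast
qed

lemma val_Hvals: assumes e0: "e0 : B" "meets (bv e0)" shows "val (Hvals e0) ` B = W"
proof (intro set_eqI iffI)
  fix y assume "y : val (Hvals e0) ` B"
  then obtain x where x: "x : B" "y = val (Hvals e0) x" by blast
  have "el (mk (Hvals e0)) = Hvals e0" unfolding Hvals_def by (rule el_Collect)
  then show "y : W" using w.valA[OF Hvals_W[OF e0(1)], of x] x BW by auto
next
  fix x assume "x : W"
  from w.ex_set_code[OF WAC this] obtain e l k i where d: "e : W" "l : W" "k : W" "i : el l" "Ord l" "Ord k"
    "el e <= el (prd (prd l l) k)"
    "ALL H rho. el e = {z : el (prd (prd l l) k). EX r:H. pair z r : el rho} --> val H (coded_name rho l k i) = x" by blast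
  have lk: "l : K" "k : K" using d OK by blast+
  have "prd (prd l l) k : K" using lk by simp
  then obtain ro where ro: "ro : B" "el e = {z : el (prd (prd l l) k). EX d:Hvals e0. pair z d : el ro}"
    using ex_subset_name_Hvals[OF e0 d(1,7)] by blast
  have "val (Hvals e0) (coded_name ro l k i) = x" using d(8) ro(2) by blast
  moreover have "coded_name ro l k i : B" using ro(1) lk d(4) K.Atrans KB by (intro B.coded_nameA) blast+
  ultimately show "x : val (Hvals e0) ` B" by blast
qed

definition atom where "atom d \<longleftrightarrow> d : el (vals top_code) \<and> (ALL d1:el (vals top_code). ALL d2:el (vals top_code). el d1 <= el d --> el d2 <= el d -->
   (EX d3:el (vals top_code). el d3 <= el d1 \<and> el d3 <= el d2))"

lemma vals_top: "e0 : B ==> d : el (vals e0) \<longleftrightarrow> d : el (vals top_code) \<and> el d <= el (bv e0)"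
  using vals(2)[OF top_codeB, of d] vals(2)[of e0 d] bv_top_code bv_cond by blast

lemma Hvals_below_atom: assumes a: "atom d" and d: "d : Hvals top_code"
  shows "Hvals top_code = {d' : el (vals top_code). EX d3:el (vals top_code). el d3 <= el d' \<and> el d3 <= el d}"
proof (intro set_eqI iffI)
  obtain e0 where e0: "e0 : B" "d = bv e0" "meets (bv e0)" using d unfolding Hvals_def vals(2)[OF top_codeB] by blast
  { fix d' assume h: "d' : Hvals top_code"
    then obtain e where e: "e : B" "d' = bv e" "meets (bv e)" unfolding Hvals_def vals(2)[OF top_codeB] by blast
    have "bv (conj_code e0 e) : el (vals top_code)" using valsI[OF e0(1) e(1,3) e0(3)] vals_top[OF e0(1)] by blast
    then show "d' : {d' : el (vals top_code). EX d3:el (vals top_code). el d3 <= el d' \<and> el d3 <= el d}"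
      using h bv_conj_code[of e0 e] unfolding Hvals_def e(2) e0(2) by blast }
  fix d' assume "d' : {d' : el (vals top_code). EX d3:el (vals top_code). el d3 <= el d' \<and> el d3 <= el d}"
  then obtain d3 where d3: "d' : el (vals top_code)" "d3 : el (vals top_code)" "el d3 <= el d'" "el d3 <= el d" by blast
  have d3B: "d3 : B" using d3(2) vals(1)[OF top_codeB] B.Atrans by blast
  have "EX x:Hvals e0. el x <= el d3"
  proof (rule Hvals_generic[OF e0(1,3)])
    show "dpred B (%e. el (e 0) <= el d3)" by (intro B.dpred_sub_el B.dterm_var B.dterm_const d3B)
    fix d1 assume "d1 : el (vals e0)"
    then have d1: "d1 : el (vals top_code)" "el d1 <= el d" using vals_top[OF e0(1)] e0(2) by blast+
    then obtain d4 where "d4 : el (vals top_code)" "el d4 <= el d1" "el d4 <= el d3" using a d3 unfolding atom_def by blast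
    then show "EX d':el (vals e0). el d' <= el d1 \<and> el d' <= el d3" using vals_top[OF e0(1), of d4] d1 e0(2) by blast
  qed
  then show "d' : Hvals top_code" using d3 unfolding Hvals_def by blast
qed

lemma not_atom_Hvals: assumes d: "d : Hvals top_code" shows "\<not> atom d"
proof
  assume a: "atom d"
  have "d : B" using d vals(1)[OF top_codeB] B.Atrans unfolding Hvals_def by blast
  then have "mk {d' : el (vals top_code). EX d3:el (vals top_code). el d3 <= el d' \<and> el d3 <= el d} : B"
    by (intro B.sepA[OF _ vals(1)[OF top_codeB]] B.dpred_bex B.dpred_conj B.dpred_sub_el B.dterm_const B.dterm_var vals(1)[OF top_codeB])
  then have HB: "mk (Hvals top_code) : B" using Hvals_below_atom[OF a d] by simp
  have "el (mk (Hvals top_code)) = Hvals top_code" unfolding Hvals_def by (rule el_Collect)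
  then have "val (Hvals top_code) x : B" if "x : B" for x using B.valA[OF HB that] by simp
  then have "W <= B" using val_Hvals[OF top_codeB meets_top_code] by blast
  then show False using BW BnW by blast
qed

lemma no_atoms: "EX e0:B. meets (bv e0) \<and> (ALL d:el (vals e0). \<not> atom d)"
proof -
  have RB: "vals top_code : B" by (rule vals[OF top_codeB])
  have da: "dterm B t ==> dpred B (%e. atom (t e))" for t
    by (rule B.dpred_comp1[where Q=atom]) (unfold atom_def, intro B.dpred_conj B.dpred_mem B.dpred_ball B.dpred_bex B.dpred_imp B.dpred_sub_el B.dterm_const B.dterm_var RB)
  have "EX d:Hvals top_code. atom d \<or> (ALL d':el (vals top_code). el d' <= el d --> \<not> atom d')"
  proof (rule Hvals_generic[OF top_codeB meets_top_code])
    show "dpred B (%e. atom (e 0) \<or> (ALL d':el (vals top_code). el d' <= el (e 0) --> \<not> atom d'))"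
      by (intro B.dpred_disj B.dpred_ball B.dpred_imp B.dpred_neg B.dpred_sub_el B.dterm_const B.dterm_var da RB)
  qed blast
  then obtain d where d: "d : Hvals top_code" "ALL d':el (vals top_code). el d' <= el d --> \<not> atom d'" using not_atom_Hvals by blast
  obtain e0 where e0: "e0 : B" "d = bv e0" "meets (bv e0)" using d(1) unfolding Hvals_def vals(2)[OF top_codeB] by blast
  have "\<not> atom d'" if "d' : el (vals e0)" for d' using d(2) that vals_top[OF e0(1)] e0(2) by blast
  then show ?thesis using e0 by blast
qed

end

section \<open>Failure of the Ground and Bedrock Axioms\<close>

context zf
begin

lemma elts_A: "x : A ==> elts A mem x = el x" using elts_el el_subA by blast

lemma is_opair_pair: assumes z: "z : A" shows "is_opair A mem z x y \<longleftrightarrow> z = pair x y"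
proof
  assume "is_opair A mem z x y"
  then obtain s t where st: "x : A" "y : A" "s : A" "t : A" "elts A mem s = {x}" "elts A mem t = {x, y}" "elts A mem z = {s, t}"
    unfolding is_opair_def by blast
  have "s = upair x x" "t = upair x y" using st elts_A by (auto intro!: ext_el)
  then show "z = pair x y" using st(7) elts_A[OF z] unfolding pair_def by (auto intro!: ext_el)
next
  assume e: "z = pair x y"
  then have xy: "x : A" "y : A" using pair_memD z by blast+
  then show "is_opair A mem z x y" unfolding is_opair_def e
    by (intro conjI bexI[of _ "upair x x"] bexI[of _ "upair x y"]) (simp_all add: elts_A upairA pair_def)
qed

lemma names_A: "n : names A mem P ==> n : A" by (induction rule: names.induct)

lemma names_el: "n : names A mem P ==> z : el n ==> EX s p. s : names A mem P \<and> p : P \<and> z = pair s p"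
proof (erule names.cases)
  fix n' assume "z : el n" "n = n'" "n' : A" and h: "ALL z:elts A mem n'. EX s p. s : names A mem P \<and> p : P \<and> is_opair A mem z s p"
  then have z: "z : el n'" "z : A" using Atrans by blast+
  then have "z : elts A mem n'" using elts_A[OF \<open>n' : A\<close>] by simp
  then show ?thesis using bspec[OF h] is_opair_pair[OF z(2)] by blast
qed

lemma names_values: assumes n: "n : names A mem P"
  shows "{f s |s p. s : names A mem P \<and> p : G \<and> (EX z:elts A mem n. is_opair A mem z s p)} = {f s |s p. p : G \<and> pair s p : el n}"
proof -
  have "(EX z:elts A mem n. is_opair A mem z s p) \<longleftrightarrow> pair s p : el n" for s p
    using elts_A[OF names_A[OF n]] is_opair_pair Atrans[OF names_A[OF n]] by auto
  moreover have "s : names A mem P" if "pair s p : el n" for s p using names_el[OF n that] by auto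
  ultimately show ?thesis by blast
qed

lemma prune_names: assumes Q: "dpred A (%e. Q (e 0))" and P: "P = {p : A. Q p}"
  shows "x : A --> prune Q x : names A mem P"
proof (induction x rule: TC_induct)
  case (step x)
  show ?case
  proof (intro impI names.intros ballI)
    assume x: "x : A"
    show pA: "prune Q x : A" by (rule pruneA[OF Q x])
    fix z assume "z : elts A mem (prune Q x)"
    then have zz: "z : el (prune Q x)" unfolding elts_A[OF pA] .
    then obtain s p where z: "z = pair (prune Q s) p" "pair s p : el x" "Q p" unfolding el_prune by blast
    have "s : A" "p : A" using pair_elA[OF x z(2)] by auto
    then show "EX s p. s : names A mem P \<and> p : P \<and> is_opair A mem z s p"
      using step[of s] pair_el_TC[OF z(2)] z P is_opair_pair[OF Atrans[OF pA zz]] by blast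
  qed
qed

lemma val_names: assumes Q: "dpred A (%e. Q (e 0))" and P: "P = {p : A. Q p}" and G: "G <= P"
  shows "val G ` names A mem P = val G ` A"
proof (intro set_eqI iffI)
  fix y assume "y : val G ` A"
  then obtain x where x: "x : A" "y = val G x" by blast
  have "G Int {p. Q p} = G" using G P by blast
  then have "y = val G (prune Q x)" using val_prune[of G Q x] x by simp
  then show "y : val G ` names A mem P" using prune_names[OF Q P] x by blast
qed (use names_A in blast)

lemma forcing_extensionI: assumes "dpred A (%e. Q (e 0))" "P = {p : A. Q p}" "G <= P" and B: "B = val G ` A" "!!x y. x : B ==> y : el x ==> y : B"
  shows "forcing_extension A mem P G B mem"
proof -
  have eB: "elts B mem x = el x" if "x : B" for x using B(2) that by (intro elts_el) auto
  have v: "val G ` names A mem P = B" using val_names[OF assms(1-3)] B(1) by simp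
  have "elts B mem (val G n) = {val G s |s p. s : names A mem P \<and> p : G \<and> (EX z:elts A mem n. is_opair A mem z s p)}"
    if n: "n : names A mem P" for n
  proof -
    have "val G n : B" using n v by blast
    then show ?thesis unfolding names_values[OF n] using eB el_val by metis
  qed
  moreover have "extensional_model B mem" unfolding extensional_model_def using eB ext_el by auto
  ultimately show ?thesis unfolding forcing_extension_def using v by blast
qed

lemma forcing_extensionD: assumes "dpred A (%e. Q (e 0))" "P = {p : A. Q p}" "G <= P" and B: "!!x y. x : B ==> y : el x ==> y : B"
    and F: "forcing_extension A mem P G B mem"
  shows "B = val G ` A"
proof -
  obtain v where v: "v ` names A mem P = B" "ALL n:names A mem P. elts B mem (v n) =
      {v s |s p. s : names A mem P \<and> p : G \<and> (EX z:elts A mem n. is_opair A mem z s p)}"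
    using F unfolding forcing_extension_def by blast
  have eB: "elts B mem x = el x" if "x : B" for x using B that by (intro elts_el) auto
  have "n : names A mem P --> v n = val G n" for n
  proof (induction n rule: TC_induct)
    case (step n)
    show ?case
    proof
      assume n: "n : names A mem P"
      have "v n : B" using v n by blast
      then have q: "el (v n) = {v s |s p. p : G \<and> pair s p : el n}" using bspec[OF v(2) n] eB unfolding names_values[OF n] by simp
      have "v s = val G s" if "pair s p : el n" for s p using step[of s] pair_el_TC[OF that] names_el[OF n that] by auto
      then have "(u = v s \<and> p : G \<and> pair s p : el n) = (u = val G s \<and> p : G \<and> pair s p : el n)" for u s p by metis
      then have "el (v n) = el (val G n)" unfolding q el_val by (simp only:)
      then show "v n = val G n" by (rule ext_el)
    qed
  qed
  then have "v ` names A mem P = val G ` names A mem P" by (intro image_cong) auto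
  then show ?thesis using v(1) val_names[OF assms(1-3)] by simp
qed

lemma ordinal_Ord: "ordinal A mem x \<longleftrightarrow> x : A \<and> Ord x"
proof (cases "x : A")
  case True
  have e1: "elts A mem x = el x" by (rule elts_A[OF True])
  have e2: "elts A mem y = el y" if "y : el x" for y using that True Atrans elts_A by blast
  have e3: "elts A mem z = el z" if "y : el x" "z : el y" for y z using that True Atrans elts_A by blast
  show ?thesis unfolding ordinal_def Ord_def e1 using True e2 e3 by simp
qed (simp add: ordinal_def)

end

lemma (in zf) ex_generic_in: assumes sf: "set_forcing A mem P rl" and sg: "set_generic A mem P rl h"
  shows "EX c r. generic_in A c r h \<and> P = el c"
proof -
  obtain c where c: "c : A" "P = el c" using sf elts_A unfolding set_forcing_def by blast
  obtain r where r: "r : A" "rl = {(p, q). EX z:elts A mem r. is_opair A mem z p q}" using sf unfolding set_forcing_def by blast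
  have rl: "(p, q) : rl \<longleftrightarrow> le r p q" for p q
    unfolding r(2) le_def elts_A[OF r(1)] using is_opair_pair[OF Atrans[OF r(1)]] by auto
  have po: "partial_order_on P rl" using sf unfolding set_forcing_def forcing_poset_def by blast
  have fi: "filter_on P rl h" using sg unfolding set_generic_def by blast
  have "generic_in A c r h"
  proof unfold_locales
    show "c : A" "r : A" by fact+
    show "le r p p" if "p : el c" for p using po that c(2) unfolding partial_order_on_def preorder_on_def refl_on_def rl[symmetric] by blast
    show "le r p s" if "le r p q" "le r q s" for p q s
      using po that unfolding partial_order_on_def preorder_on_def trans_def rl[symmetric] by blast
    show "p : el c \<and> q : el c" if "le r p q" for p q using po that c(2) unfolding partial_order_on_def preorder_on_def rl[symmetric] by blast
    then show "q : h" if "p : h" "le r p q" for p q using fi that c(2) unfolding filter_on_def rl[symmetric] by blast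
    show "h <= el c" "h ~= {}" using fi c(2) unfolding filter_on_def by blast+
    show "EX s:h. le r s p \<and> le r s q" if "p : h" "q : h" for p q using fi that unfolding filter_on_def rl by blast
    fix D assume D: "D : A" "el D <= el c" "!!p. p : el c ==> EX d:el D. le r d p"
    then have "dense_in P rl (elts A mem D)" unfolding dense_in_def elts_A[OF D(1)] c(2) rl by blast
    then show "h Int el D ~= {}" using sg D(1) elts_A[OF D(1)] unfolding set_generic_def by blast
  qed
  then show ?thesis using c(2) by blast
qed

context intermediate
begin

interpretation w: zf W by (rule Wzf)

lemma inner_model_B: "inner_model W mem B" unfolding inner_model_def
proof (intro conjI ballI BW)
  show "definable W mem B" using w.definable_iff_dpred[OF BW] Bdfb by blast
  show "elts W mem x <= B" if "x : B" for x using w.elts_A[of x] B.el_subA[OF that] that BW by auto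
  show "{a. ordinal W mem a} <= B" using w.ordinal_Ord OK KB by blast
  show "ZFC B mem" using ZFC_iff_zf[OF B.cntA] B.el_subA B.zf_axioms BAC by blast
qed

definition sub_rel where "sub_rel x = {(d, d'). d : el x \<and> d' : el x \<and> el d <= el d'}"

lemma sub_rel_set: assumes x: "x : B" shows "EX z:B. sub_rel x = {(p, q). EX y:elts B mem z. is_opair B mem y p q}"
proof -
  let ?z = "mk {z : el (prd x x). el (pr1 z) <= el (pr2 z)}"
  have zB: "?z : B" by (rule B.sepA[OF _ B.prdA[OF x x]]) (intro B.dpred_sub_el B.dterm_pr1 B.dterm_pr2 B.dterm_var)
  have "(EX y:elts B mem ?z. is_opair B mem y p q) \<longleftrightarrow> (p, q) : sub_rel x" for p q
  proof -
    have "(EX y:elts B mem ?z. is_opair B mem y p q) \<longleftrightarrow> pair p q : el ?z"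
      unfolding B.elts_A[OF zB] using B.is_opair_pair[OF B.Atrans[OF zB]] by auto
    also have "... \<longleftrightarrow> (p, q) : sub_rel x" unfolding el_Collect sub_rel_def by (auto simp: el_prd)
    finally show ?thesis .
  qed
  then show ?thesis using zB by (intro bexI[of _ ?z]) auto
qed

context
  fixes e0
  assumes e0: "e0 : B" "meets (bv e0)"
begin

lemma bv_vals: "bv e0 : el (vals e0)" unfolding vals(2)[OF e0(1)] using e0 by blast

lemma set_forcing_vals: "set_forcing B mem (el (vals e0)) (sub_rel (vals e0))" unfolding set_forcing_def
proof (intro conjI)
  have "partial_order_on (el (vals e0)) (sub_rel (vals e0))"
    unfolding partial_order_on_def preorder_on_def refl_on_def trans_def antisym_def sub_rel_def by (auto intro: ext_el)
  moreover have "ALL p:el (vals e0). (p, bv e0) : sub_rel (vals e0)" unfolding sub_rel_def using bv_vals vals(2)[OF e0(1)] by blast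
  ultimately show "forcing_poset (el (vals e0)) (sub_rel (vals e0))" unfolding forcing_poset_def using bv_vals by blast
  show "EX c:B. el (vals e0) = elts B mem c" using vals(1)[OF e0(1)] B.elts_A by blast
qed (rule sub_rel_set[OF vals(1)[OF e0(1)]])

lemma nontrivial_vals: assumes na: "ALL d:el (vals e0). \<not> atom d" shows "nontrivial_poset (el (vals e0)) (sub_rel (vals e0))"
  unfolding nontrivial_poset_def
proof
  fix p assume p: "p : el (vals e0)"
  then have pb: "\<not> atom p" "p : el (vals top_code)" "el p <= el (bv e0)" using na vals_top[OF e0(1), of p] by blast+
  then obtain d1 d2 where d: "d1 : el (vals top_code)" "d2 : el (vals top_code)" "el d1 <= el p" "el d2 <= el p"
    "\<not> (EX d3:el (vals top_code). el d3 <= el d1 \<and> el d3 <= el d2)" unfolding atom_def by blast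
  have dR: "d1 : el (vals e0)" "d2 : el (vals e0)" unfolding vals_top[OF e0(1)] using d pb by blast+
  have "\<not> compatible (el (vals e0)) (sub_rel (vals e0)) d1 d2"
    using d(5) unfolding compatible_def sub_rel_def vals_top[OF e0(1)] by blast
  then show "EX q:el (vals e0). EX q':el (vals e0). (q, p) : sub_rel (vals e0) \<and> (q', p) : sub_rel (vals e0) \<and>
      \<not> compatible (el (vals e0)) (sub_rel (vals e0)) q q'"
    using dR d(3,4) p by (intro bexI[OF _ dR(1)] bexI[OF _ dR(2)]) (simp add: sub_rel_def)
qed

lemma filter_on_Hvals: "filter_on (el (vals e0)) (sub_rel (vals e0)) (Hvals e0)" unfolding filter_on_def
proof (intro conjI ballI impI)
  show "Hvals e0 <= el (vals e0)" unfolding Hvals_def by blast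
  show "Hvals e0 ~= {}" using bv_vals e0(2) unfolding Hvals_def by blast
  fix p assume p: "p : Hvals e0"
  { fix q assume "q : el (vals e0)" "(p, q) : sub_rel (vals e0)"
    then show "q : Hvals e0" using p unfolding Hvals_def sub_rel_def by blast }
  fix q assume q: "q : Hvals e0"
  obtain e e' where e: "e : B" "p = bv e" "meets (bv e)" "e' : B" "q = bv e'" "meets (bv e')" "el p <= el (bv e0)"
    using p q unfolding Hvals_def vals(2)[OF e0(1)] by blast
  let ?s = "bv (conj_code e e')"
  have m: "meets ?s" by (rule meets_conj_code[OF e(3,6)])
  have s: "el ?s <= el p" "el ?s <= el q" unfolding bv_conj_code e by blast+
  have "?s : el (vals e0)" unfolding vals(2)[OF e0(1)] using codesB(2)[OF e(1,4)] m s e(7) by blast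
  then have "?s : Hvals e0" unfolding Hvals_def using m by blast
  then show "EX s:Hvals e0. (s, p) : sub_rel (vals e0) \<and> (s, q) : sub_rel (vals e0)" using s p q unfolding sub_rel_def Hvals_def by blast
qed

lemma set_generic_Hvals: "set_generic B mem (el (vals e0)) (sub_rel (vals e0)) (Hvals e0)" unfolding set_generic_def
proof (intro conjI ballI impI filter_on_Hvals)
  fix D assume D: "D : B" "dense_in (el (vals e0)) (sub_rel (vals e0)) (elts B mem D)"
  have "EX d:Hvals e0. d : el D"
  proof (rule Hvals_generic[OF e0])
    show "dpred B (%e. e 0 : el D)" by (intro B.dpred_mem B.dterm_var B.dterm_const D)
    fix d assume "d : el (vals e0)"
    then obtain d' where "d' : el D" "(d', d) : sub_rel (vals e0)" using D(2) unfolding dense_in_def B.elts_A[OF D(1)] by blast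
    then show "EX d':el (vals e0). el d' <= el d \<and> d' : el D" unfolding sub_rel_def by blast
  qed
  then show "Hvals e0 Int elts B mem D ~= {}" unfolding B.elts_A[OF D(1)] by blast
qed

lemma forcing_extension_Hvals: "forcing_extension B mem (el (vals e0)) (Hvals e0) W mem"
proof (rule B.forcing_extensionI[where Q="%p. p : el (vals e0)"])
  show "dpred B (%e. e 0 : el (vals e0))" by (intro B.dpred_mem B.dterm_var B.dterm_const vals(1)[OF e0(1)])
  show "el (vals e0) = {p : B. p : el (vals e0)}" using B.Atrans[OF vals(1)[OF e0(1)]] by blast
  show "W = val (Hvals e0) ` B" using val_Hvals[OF e0] by simp
  show "Hvals e0 <= el (vals e0)" unfolding Hvals_def by blast
qed (use w.Atrans in auto)

end

lemma not_GA: "\<not> GA W mem"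
proof -
  obtain e0 where "e0 : B" "meets (bv e0)" "ALL d:el (vals e0). \<not> atom d" using no_atoms by blast
  then show ?thesis unfolding GA_def
    using inner_model_B set_forcing_vals nontrivial_vals set_generic_Hvals forcing_extension_Hvals by blast
qed

end

lemma pair_ne_zero: "pair x y ~= zero" using el_zero unfolding pair_def by (metis el_upair insert_not_empty)

lemma (in zf) ex_power_table: assumes AC: "AC A" and c: "c : A"
  shows "EX th:A. EX X:A. Ord th \<and> el X <= el (prd th c) \<and>
    (ALL Y:A. el Y <= el c --> (EX j:el th. el Y = {p : el c. pair j p : el X}))"
proof -
  obtain th f where t: "th : A" "f : A" "Ord th" "app f ` el th = el (pow c)"
    using ex_wellorder[OF AC powA[OF c]] by blast
  let ?X = "mk {z : el (prd th c). pr2 z : el (app f (pr1 z))}"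
  have "?X : A" by (rule sepA) (intro dintro t, use t c in simp)
  moreover have "el ?X <= el (prd th c)" unfolding el_Collect by blast
  moreover have "EX j:el th. el Y = {p : el c. pair j p : el ?X}" if Y: "Y : A" "el Y <= el c" for Y
  proof -
    have "Y : app f ` el th" unfolding t(4) using Y by simp
    then obtain j where "j : el th" "Y = app f j" by blast
    then show ?thesis using Y(2) unfolding el_Collect by (intro bexI[of _ j]) (auto simp: el_prd)
  qed
  ultimately show ?thesis using t by blast
qed

context ground_of
begin

interpretation w: generic_in W c r h by (rule gW)

lemma ex_intermediate: assumes a: "limit a" "a : A" and l: "l : el a" "f : W" "app f ` el l = el c" and ne: "M a ~= W"
  shows "EX th X X_name. intermediate (M a) (conds zero a) (conds_le a) (Glow a) A W th X X_name"
proof -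
  interpret Ma: generic_in "M a" "conds zero a" "conds_le a" "Glow a" by (rule M_generic[OF a])
  have AM: "x : A ==> x : M a" for x by (rule M_zf(3)[OF a])
  let ?c = "conds zero a"
  have cA: "?c : A" using a by simp
  obtain th X where t: "th : W" "Ord th" and X: "X : W" "el X <= el (prd th ?c)"
    and rows: "ALL Y:W. el Y <= el ?c --> (EX j:el th. el Y = {p : el ?c. pair j p : el X})"
    using w.ex_power_table[OF WAC A_W[OF cA]] by blast
  have tA: "th : A" using Ord_W t by blast
  have pA: "prd th ?c : A" using tA cA by simp
  obtain rho where rho: "rho : M a" "el X = {x : el (prd th ?c). EX u:Glow a. pair x u : el rho}" using ex_subset_name_M[OF a W_N[OF X(1)] X(2) pA] by blast
  let ?X_name = "mk {z : el rho. pr1 z : el (prd th ?c)}"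
  have elsi: "pair z u : el ?X_name \<longleftrightarrow> pair z u : el rho \<and> z : el (prd th ?c)" for z u unfolding el_Collect by simp
  have X_name: "?X_name : M a" by (rule Ma.sepA[OF _ rho(1)]) (intro Ma.dpred_mem Ma.dterm_pr1 Ma.dterm_var Ma.dterm_const AM pA)
  have "intermediate (M a) ?c (conds_le a) (Glow a) A W th X ?X_name"
  proof (intro intermediate.intro intermediate_axioms.intro Ma.generic_in_axioms)
    show "zf W" "AC W" "AC (M a)" "zf A" "A <= M a" "M a <= W" "M a ~= W" "th : A" "X : W" "?X_name : M a"
      using w.zf_axioms WAC M_zf(2)[OF a] zf_axioms AM cA M_subset_ground[OF a l] ne tA X X_name by auto
    show "dpred W (%e. e 0 : M a)" by (rule dpred_M[OF a l])
    show "x : A" if "x : W" "Ord x" for x using Ord_W that by blast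
    show "EX rho:M a. el e = {x : el v. EX u:Glow a. pair x u : el rho}" if "e : W" "v : A" "el e <= el v" for e v
      using ex_subset_name_M[OF a W_N[OF that(1)] that(3,2)] .
    show "EX j:el th. el Y = {p : el ?c. pair j p : el X}" if "Y : W" "el Y <= el ?c" for Y using rows that by blast
    show "z : el X \<longleftrightarrow> (EX u:Glow a. pair z u : el ?X_name)" for z unfolding rho(2) elsi by blast
    show "pair zero u ~: el ?X_name" for u unfolding elsi el_prd by (auto simp: pair_ne_zero[symmetric])
  qed
  then show ?thesis by blast
qed

theorem ground_not_GA: "\<not> GA W mem"
proof -
  obtain l f where l: "l : A" "f : W" "Ord l" "app f ` el l = el c" using ex_enumeration_poset by blast
  obtain a where a: "a : A" "limit a" "l : el a" using limit_ex l by blast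
  have "Ord a" using a unfolding limit_def by simp
  then have b: "nextlim a : A" "limit (nextlim a)" "a : el (nextlim a)" using nextlim[OF a(1)] rank_Ord by auto
  have "l : el (nextlim a)" using Ord_trans[OF _ b(3) a(3)] b(2) unfolding limit_def by blast
  moreover have "M (nextlim a) ~= W" using M_proper[OF a(2,1)] M_subset_ground[OF a(2,1,3) l(2,4)] by blast
  ultimately obtain th X X_name where "intermediate (M (nextlim a)) (conds zero (nextlim a)) (conds_le (nextlim a)) (Glow (nextlim a)) A W th X X_name"
    using ex_intermediate[OF b(2,1) _ l(2,4)] by blast
  then show ?thesis by (rule intermediate.not_GA)
qed

end

theorem (in easton_ext) not_BA: "\<not> BA N mem"
proof
  assume "BA N mem"
  then obtain W P rl h where im: "inner_model N mem W" and sf: "set_forcing W mem P rl" and sg: "set_generic W mem P rl h"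
    and fe: "forcing_extension W mem P h N mem" and GA: "GA W mem" unfolding BA_def by blast
  interpret N: zf N by (rule N_zf)
  have WN: "W <= N" using im unfolding inner_model_def by blast
  have Wt: "ALL x:W. el x <= W" using im N.elts_A WN unfolding inner_model_def by blast
  have Wo: "x : W" if "x : A" "Ord x" for x using im N.ordinal_Ord A_N that unfolding inner_model_def by blast
  have "countable W" using WN N.cntA countable_subset by blast
  then have Wz: "zf W" "AC W" using im ZFC_iff_zf Wt unfolding inner_model_def by blast+
  interpret w: zf W by (rule Wz)
  obtain c r where gW: "generic_in W c r h" and P: "P = el c" using w.ex_generic_in[OF sf sg] by blast
  then interpret w: generic_in W c r h by blast
  have "N = val h ` W"
  proof (rule w.forcing_extensionD[where Q="%p. p : el c", OF _ _ _ _ fe])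
    show "dpred W (%e. e 0 : el c)" by (intro w.dpred_mem w.dterm_var w.dterm_const w.cA)
    show "P = {p : W. p : el c}" using P w.Atrans[OF w.cA] by blast
  qed (use P w.Gc N.Atrans in blast)+
  then interpret ground_of A G W c r h by (intro ground_of.intro easton_ext_axioms ground_of_axioms.intro gW Wz Wo) (rule sym)
  show False using ground_not_GA GA by blast
qed

section \<open>Invariance under isomorphism\<close>

definition definable_sets where "definable_sets A E = {X. definable A E X}"
definition definable_rels where "definable_rels A E = {R. definable_rel A E R}"

context includes lifting_syntax
begin

definition isomorphism ::
  "('a => 'b => bool) => 'a set => ('a => 'a => bool) => 'b set => ('b => 'b => bool) => bool" where
  "isomorphism R A E B F \<longleftrightarrow> bi_unique R \<and> rel_set R A B \<and> (R ===> R ===> (=)) E F"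

lemma isomorphism_conversep: "isomorphism R A E B F ==> isomorphism R\<inverse>\<inverse> B F A E"
  unfolding isomorphism_def by (auto simp: rel_fun_def)

lemma sat_isomorphism:
  assumes iso: "isomorphism R A E B F" and "!!i. i : fv \<phi> ==> R (v i) (w i)" shows "sat A E \<phi> v \<longleftrightarrow> sat B F \<phi> w"
  using assms(2)
proof (induction \<phi> arbitrary: v w)
  case (Mem i j) then show ?case using iso unfolding isomorphism_def rel_fun_def by simp
next
  case (Eq i j)
  then have "R (v i) (w i)" "R (v j) (w j)" by auto
  then show ?case using iso unfolding isomorphism_def bi_unique_def by (metis sat.simps(2))
next
  case (Forall i \<phi>)
  have s: "sat A E \<phi> (v(i := a)) \<longleftrightarrow> sat B F \<phi> (w(i := b))" if "R a b" for a b
    using Forall.prems that by (intro Forall.IH) auto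
  have "rel_set R A B" using iso unfolding isomorphism_def by blast
  then show ?case unfolding sat.simps rel_set_def using s by blast
next
  case (Neg \<phi>)
  then have "sat A E \<phi> v \<longleftrightarrow> sat B F \<phi> w" by simp
  then show ?case by simp
next
  case (Conj \<phi> \<psi>)
  then have "sat A E \<phi> v \<longleftrightarrow> sat B F \<phi> w" "sat A E \<psi> v \<longleftrightarrow> sat B F \<psi> w" by simp_all
  then show ?case by simp
qed

lemma related_assignment:
  assumes "rel_set R A B" "v ` (S - T) <= A" shows "EX w. w ` (S - T) <= B \<and> (ALL i:S - T. R (v i) (w i))"
proof -
  have "ALL i:S - T. EX b. b : B \<and> R (v i) b" using assms unfolding rel_set_def by blast
  then show ?thesis unfolding image_subset_iff by metis
qed

lemma definable_isomorphism:
  assumes "isomorphism R A E B F" "definable A E X" shows "EX Y:definable_sets B F. rel_set R X Y"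
proof -
  have AB: "rel_set R A B" using assms(1) unfolding isomorphism_def by blast
  obtain \<phi> v where v: "v ` (fv \<phi> - {0}) <= A" "X = {a : A. sat A E \<phi> (v(0 := a))}"
    using assms(2) unfolding definable_def by blast
  obtain w where w: "w ` (fv \<phi> - {0}) <= B" "ALL i:fv \<phi> - {0}. R (v i) (w i)"
    using related_assignment[OF AB v(1)] by blast
  have "sat A E \<phi> (v(0 := a)) \<longleftrightarrow> sat B F \<phi> (w(0 := b))" if "R a b" for a b
    by (rule sat_isomorphism[OF assms(1)]) (use w(2) that in auto)
  then have "rel_set R X {b : B. sat B F \<phi> (w(0 := b))}" unfolding v(2) using AB unfolding rel_set_def by blast
  moreover have "definable B F {b : B. sat B F \<phi> (w(0 := b))}" unfolding definable_def using w(1) by blast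
  ultimately show ?thesis unfolding definable_sets_def by blast
qed

lemma definable_rel_isomorphism:
  assumes "isomorphism R A E B F" "definable_rel A E X" shows "EX Y:definable_rels B F. rel_set (rel_prod R R) X Y"
proof -
  have AB: "rel_set R A B" using assms(1) unfolding isomorphism_def by blast
  obtain \<phi> v where v: "v ` (fv \<phi> - {0, 1}) <= A" "X = {(a, a'). a : A \<and> a' : A \<and> sat A E \<phi> (v(0 := a, 1 := a'))}"
    using assms(2) unfolding definable_rel_def by blast
  obtain w where w: "w ` (fv \<phi> - {0, 1}) <= B" "ALL i:fv \<phi> - {0, 1}. R (v i) (w i)"
    using related_assignment[OF AB v(1)] by blast
  let ?Y = "{(b, b'). b : B \<and> b' : B \<and> sat B F \<phi> (w(0 := b, 1 := b'))}"
  have s: "sat A E \<phi> (v(0 := a, 1 := a')) \<longleftrightarrow> sat B F \<phi> (w(0 := b, 1 := b'))" if "R a b" "R a' b'" for a a' b b'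
    by (rule sat_isomorphism[OF assms(1)]) (use w(2) that in auto)
  have "rel_set (rel_prod R R) X ?Y" unfolding v(2)
  proof (rule rel_setI)
    fix x assume "x : {(a, a'). a : A \<and> a' : A \<and> sat A E \<phi> (v(0 := a, 1 := a'))}"
    then obtain a a' where a: "x = (a, a')" "a : A" "a' : A" "sat A E \<phi> (v(0 := a, 1 := a'))" by blast
    moreover obtain b b' where "b : B" "b' : B" "R a b" "R a' b'" using rel_setD1[OF AB] a by metis
    ultimately show "EX y:?Y. rel_prod R R x y" using s by (intro bexI[of _ "(b, b')"]) auto
  next
    fix y assume "y : ?Y"
    then obtain b b' where b: "y = (b, b')" "b : B" "b' : B" "sat B F \<phi> (w(0 := b, 1 := b'))" by blast
    moreover obtain a a' where "a : A" "a' : A" "R a b" "R a' b'" using rel_setD2[OF AB] b by metis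
    ultimately show "EX x:{(a, a'). a : A \<and> a' : A \<and> sat A E \<phi> (v(0 := a, 1 := a'))}. rel_prod R R x y"
      using s by (intro bexI[of _ "(a, a')"]) auto
  qed
  moreover have "definable_rel B F ?Y" unfolding definable_rel_def using w(1) by blast
  ultimately show ?thesis unfolding definable_rels_def by blast
qed

lemma definable_sets_transfer [transfer_rule]: assumes "bi_unique R"
  shows "(rel_set R ===> (R ===> R ===> (=)) ===> rel_set (rel_set R)) definable_sets definable_sets"
proof (intro rel_funI)
  fix A B and E F :: "_ => _ => bool" assume "rel_set R A B" "(R ===> R ===> (=)) E F"
  then have "isomorphism R A E B F" using assms unfolding isomorphism_def by blast
  from definable_isomorphism[OF this] definable_isomorphism[OF isomorphism_conversep[OF this]]
  show "rel_set (rel_set R) (definable_sets A E) (definable_sets B F)"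
    unfolding rel_set_def[of "rel_set R"] by (auto simp: definable_sets_def)
qed

lemma definable_rels_transfer [transfer_rule]: assumes "bi_unique R"
  shows "(rel_set R ===> (R ===> R ===> (=)) ===> rel_set (rel_set (rel_prod R R))) definable_rels definable_rels"
proof (intro rel_funI)
  fix A B and E F :: "_ => _ => bool" assume "rel_set R A B" "(R ===> R ===> (=)) E F"
  then have "isomorphism R A E B F" using assms unfolding isomorphism_def by blast
  from definable_rel_isomorphism[OF this] definable_rel_isomorphism[OF isomorphism_conversep[OF this]]
  show "rel_set (rel_set (rel_prod R R)) (definable_rels A E) (definable_rels B F)"
    unfolding rel_set_def[of "rel_set (rel_prod R R)"] by (auto simp: definable_rels_def prod.rel_conversep)
qed

text \<open>Bounding every quantifier makes the notions of the theorem accessible to the transfer package.\<close>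

lemma definable_iff_mem: "definable A E X \<longleftrightarrow> X : definable_sets A E"
  and definable_rel_iff_mem: "definable_rel A E S \<longleftrightarrow> S : definable_rels A E"
  by (simp_all add: definable_sets_def definable_rels_def)

lemma definable_rels_subset: "S : definable_rels A E ==> S <= A \<times> A"
  unfolding definable_rels_def definable_rel_def by auto

lemma ordinals_bounded: "{a. ordinal A E a} = Set.filter (ordinal A E) A"
  unfolding ordinal_def by auto

lemma filter_iff: "{x : A. P x} = Set.filter P A"
  by auto

lemma Ex1_mem_iff: "(EX! z. z : X) \<longleftrightarrow> (EX z:X. ALL w:X. w = z)"
  unfolding Ex1_def by blast

lemma replacement_bounded:
  "(ALL S. definable_rel A E S --> (ALL x:A. (ALL a:elts A E x. EX! b. (a, b) : S) --> Q S x)) \<longleftrightarrow>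
   (ALL S:definable_rels A E. ALL x:A. (ALL a:elts A E x. EX b:A. (a, b) : S \<and> (ALL c:A. (a, c) : S --> c = b)) --> Q S x)"
proof -
  have "(EX! b. (a, b) : S) \<longleftrightarrow> (EX b:A. (a, b) : S \<and> (ALL c:A. (a, c) : S --> c = b))" if "S : definable_rels A E" for S a
    using definable_rels_subset[OF that] by blast
  then show ?thesis unfolding definable_rel_iff_mem Ball_def[of "definable_rels A E"] by simp
qed

lemma forcing_poset_bounded: "forcing_poset P r \<longleftrightarrow> (ALL z:r. fst z : P \<and> snd z : P) \<and> (ALL p:P. (p, p) : r) \<and>
  (ALL p:P. ALL q:P. ALL s:P. (p, q) : r --> (q, s) : r --> (p, s) : r) \<and>
  (ALL p:P. ALL q:P. (p, q) : r --> (q, p) : r --> p = q) \<and> (EX t:P. ALL p:P. (p, t) : r)"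
  (is "_ \<longleftrightarrow> ?sub \<and> ?rest")
proof (cases ?sub)
  case True
  then have "r <= P \<times> P" "!!p q. (p, q) : r ==> p : P \<and> q : P" by force+
  then show ?thesis using True unfolding forcing_poset_def partial_order_on_def preorder_on_def refl_on_def trans_def antisym_def by blast
qed (auto simp: forcing_poset_def partial_order_on_def preorder_on_def)

definition le_set where "le_set A E d = {(p, q). EX z:elts A E d. is_opair A E z p q}"

lemma le_set_bounded: "le_set A E d = (UN p:A. UN q:A. if EX z:elts A E d. is_opair A E z p q then {(p, q)} else {})"
proof -
  have "p : A \<and> q : A" if "is_opair A E z p q" for z p q using that unfolding is_opair_def by blast
  then show ?thesis unfolding le_set_def by (auto split: if_splits)
qed

context
  fixes R :: "'a => 'b => bool"
  assumes bi_unique [transfer_rule]: "bi_unique R"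
begin

lemma elts_transfer [transfer_rule]: "(rel_set R ===> (R ===> R ===> (=)) ===> R ===> rel_set R) elts elts"
  unfolding elts_def filter_iff by transfer_prover

lemma is_opair_transfer [transfer_rule]:
  "(rel_set R ===> (R ===> R ===> (=)) ===> R ===> R ===> R ===> (=)) is_opair is_opair"
  unfolding is_opair_def by transfer_prover

lemma ZFC_transfer [transfer_rule]: "(rel_set R ===> (R ===> R ===> (=)) ===> (=)) ZFC ZFC"
  unfolding ZFC_def extensional_model_def definable_iff_mem replacement_bounded Ball_def[symmetric] filter_iff Ex1_mem_iff
  by (transfer_prover_start, transfer_step+, transfer_prover_end)

lemma ordinal_transfer [transfer_rule]: "(rel_set R ===> (R ===> R ===> (=)) ===> R ===> (=)) ordinal ordinal"
  unfolding ordinal_def by transfer_prover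

lemma inner_model_transfer [transfer_rule]:
  "(rel_set R ===> (R ===> R ===> (=)) ===> rel_set R ===> (=)) inner_model inner_model"
  unfolding inner_model_def definable_iff_mem ordinals_bounded by transfer_prover

lemma forcing_poset_transfer [transfer_rule]: "(rel_set R ===> rel_set (rel_prod R R) ===> (=)) forcing_poset forcing_poset"
  unfolding forcing_poset_bounded by transfer_prover

lemma dense_in_transfer [transfer_rule]: "(rel_set R ===> rel_set (rel_prod R R) ===> rel_set R ===> (=)) dense_in dense_in"
  unfolding dense_in_def by transfer_prover

lemma nontrivial_poset_transfer [transfer_rule]:
  "(rel_set R ===> rel_set (rel_prod R R) ===> (=)) nontrivial_poset nontrivial_poset"
  unfolding nontrivial_poset_def compatible_def by transfer_prover

lemma filter_on_transfer [transfer_rule]: "(rel_set R ===> rel_set (rel_prod R R) ===> rel_set R ===> (=)) filter_on filter_on"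
  unfolding filter_on_def by transfer_prover

lemma le_set_transfer [transfer_rule]:
  "(rel_set R ===> (R ===> R ===> (=)) ===> R ===> rel_set (rel_prod R R)) le_set le_set"
  unfolding le_set_bounded by transfer_prover

lemma set_forcing_transfer [transfer_rule]:
  "(rel_set R ===> (R ===> R ===> (=)) ===> rel_set R ===> rel_set (rel_prod R R) ===> (=)) set_forcing set_forcing"
  unfolding set_forcing_def le_set_def[symmetric] by transfer_prover

lemma set_generic_transfer [transfer_rule]:
  "(rel_set R ===> (R ===> R ===> (=)) ===> rel_set R ===> rel_set (rel_prod R R) ===> rel_set R ===> (=)) set_generic set_generic"
  unfolding set_generic_def by transfer_prover

lemma class_forcing_transfer [transfer_rule]:
  "(rel_set R ===> (R ===> R ===> (=)) ===> rel_set R ===> rel_set (rel_prod R R) ===> (=)) class_forcing class_forcing"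
  unfolding class_forcing_def definable_iff_mem definable_rel_iff_mem by transfer_prover

lemma class_generic_transfer [transfer_rule]:
  "(rel_set R ===> (R ===> R ===> (=)) ===> rel_set R ===> rel_set (rel_prod R R) ===> rel_set R ===> (=)) class_generic class_generic"
  unfolding class_generic_def definable_iff_mem imp_conjL Ball_def[symmetric] by transfer_prover

end

lemma names_subset: "names A E P <= A"
  by (auto elim: names.cases)

lemma names_isomorphism:
  assumes iso: "isomorphism R A E B F" and PQ: "rel_set R P Q" and "n : names A E P" "R n m" shows "m : names B F Q"
proof -
  have [transfer_rule]: "bi_unique R" "rel_set R A B" "(R ===> R ===> (=)) E F"
    using iso unfolding isomorphism_def by auto
  from assms(3,4) show ?thesis
  proof (induction arbitrary: m rule: names.induct)
    case (1 n)
    note [transfer_rule] = 1(3)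
    have related: "rel_set R (elts A E n) (elts B F m)" "n : A \<longleftrightarrow> m : B" by transfer_prover+
    show ?case
    proof (intro names.intros ballI)
      show "m : B" using 1(1) related by blast
      fix z' assume "z' : elts B F m"
      then obtain z where z: "z : elts A E n" "R z z'" using rel_setD2[OF related(1)] by blast
      then obtain s p where s: "!!s'. R s s' ==> s' : names B F Q" "p : P" "is_opair A E z s p" using 1(2) by blast
      obtain s' where s': "R s s'" using s(3) rel_setD1[OF \<open>rel_set R A B\<close>] unfolding is_opair_def by blast
      obtain p' where p': "p' : Q" "R p p'" using s(2) rel_setD1[OF PQ] by blast
      note [transfer_rule] = z(2) s' p'(2)
      have "is_opair A E z s p = is_opair B F z' s' p'" by transfer_prover
      then show "EX s p. s : names B F Q \<and> p : Q \<and> is_opair B F z' s p" using s s' p' by blast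
    qed
  qed
qed

lemma names_transfer [transfer_rule]: assumes "bi_unique R"
  shows "(rel_set R ===> (R ===> R ===> (=)) ===> rel_set R ===> rel_set R) names names"
proof (intro rel_funI)
  fix A B P Q and E F :: "_ => _ => bool" assume AB: "rel_set R A B" and "(R ===> R ===> (=)) E F" and PQ: "rel_set R P Q"
  then have iso: "isomorphism R A E B F" using assms unfolding isomorphism_def by blast
  have QP: "rel_set R\<inverse>\<inverse> Q P" using PQ by simp
  show "rel_set R (names A E P) (names B F Q)"
  proof (rule rel_setI)
    fix n assume n: "n : names A E P"
    obtain m where "R n m" using rel_setD1[OF AB subsetD[OF names_subset n]] by blast
    then show "EX m:names B F Q. R n m" using names_isomorphism[OF iso PQ n] by blast
  next
    fix m assume m: "m : names B F Q"
    obtain n where "R n m" using rel_setD2[OF AB subsetD[OF names_subset m]] by blast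
    then show "EX n:names A E P. R n m" using names_isomorphism[OF isomorphism_conversep[OF iso] QP m] by blast
  qed
qed

definition active_names where
  "active_names A E P G n = Set.filter (%s. EX p:G. EX z:elts A E n. is_opair A E z s p) (names A E P)"

lemma active_names_transfer [transfer_rule]: assumes [transfer_rule]: "bi_unique R"
  shows "(rel_set R ===> (R ===> R ===> (=)) ===> rel_set R ===> rel_set R ===> R ===> rel_set R) active_names active_names"
  unfolding active_names_def by transfer_prover

lemma forcing_extension_image:
  fixes A :: "'a set" and B :: "'b set"
  shows "forcing_extension A E P G B F \<longleftrightarrow> extensional_model B F \<and>
  (EX v. v ` names A E P = B \<and> (ALL n:names A E P. elts B F (v n) = v ` active_names A E P G n))"
proof -
  have "{v s |s p. s : names A E P \<and> p : G \<and> (EX z:elts A E n. is_opair A E z s p)} = v ` active_names A E P G n" for v :: "'a => 'b" and n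
    unfolding active_names_def by auto
  then show ?thesis unfolding forcing_extension_def by simp
qed

lemma rel_set_image: "rel_set R X Y ==> (!!x y. x : X ==> R x y ==> S (f x) (g y)) ==> rel_set S (f ` X) (g ` Y)"
  unfolding rel_set_def by fast

lemma forcing_extension_isomorphism:
  assumes R: "isomorphism R A E A' E'" and S: "isomorphism S B F B' F'" and PG: "rel_set R P P'" "rel_set R G G'"
    and ext: "forcing_extension A E P G B F"
  shows "forcing_extension A' E' P' G' B' F'"
proof -
  have [transfer_rule]: "bi_unique R" "rel_set R A A'" "(R ===> R ===> (=)) E E'"
    "bi_unique S" "rel_set S B B'" "(S ===> S ===> (=)) F F'" "rel_set R P P'" "rel_set R G G'"
    using R S PG unfolding isomorphism_def by auto
  obtain v where v: "v ` names A E P = B" "ALL n:names A E P. elts B F (v n) = v ` active_names A E P G n"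
    using ext unfolding forcing_extension_image by blast
  define w where "w m = (SOME u. EX n:names A E P. R n m \<and> S (v n) u)" for m
  have names: "rel_set R (names A E P) (names A' E' P')" by transfer_prover
  note uniqueS = bi_unique_rel_set[OF \<open>bi_unique S\<close>]
  have elts_SS: "rel_set S (elts B F x) (elts B' F' y)" if [transfer_rule]: "S x y" for x y by transfer_prover
  have vw: "S (v n) (w m)" if n: "n : names A E P" "R n m" for n m
  proof -
    have "v n : B" using v(1) n(1) by blast
    then obtain u where "S (v n) u" using rel_setD1[OF \<open>rel_set S B B'\<close>] by blast
    then have "EX u. EX n':names A E P. R n' m \<and> S (v n') u" using n by blast
    then have "EX n':names A E P. R n' m \<and> S (v n') (w m)" unfolding w_def by (rule someI_ex)
    then show ?thesis using bi_uniqueDl[OF \<open>bi_unique R\<close> n(2)] by blast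
  qed
  have "rel_set S (v ` names A E P) (w ` names A' E' P')" by (rule rel_set_image[OF names]) (rule vw)
  then have "w ` names A' E' P' = B'"
    using v(1) bi_uniqueDr[OF uniqueS _ \<open>rel_set S B B'\<close>] by simp
  moreover have "elts B' F' (w m) = w ` active_names A' E' P' G' m" if m: "m : names A' E' P'" for m
  proof -
    obtain n where n: "n : names A E P" "R n m" using rel_setD2[OF names m] by blast
    note [transfer_rule] = n(2)
    have "rel_set R (active_names A E P G n) (active_names A' E' P' G' m)" by transfer_prover
    then have "rel_set S (v ` active_names A E P G n) (w ` active_names A' E' P' G' m)"
      by (rule rel_set_image) (auto simp: active_names_def intro: vw)
    moreover have "rel_set S (elts B F (v n)) (elts B' F' (w m))" by (rule elts_SS[OF vw[OF n]])
    ultimately show ?thesis using bspec[OF v(2) n(1)] bi_uniqueDr[OF uniqueS] by metis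
  qed
  moreover have "extensional_model B F = extensional_model B' F'" unfolding extensional_model_def by transfer_prover
  ultimately show ?thesis using ext unfolding forcing_extension_image by blast
qed

lemma forcing_extension_transfer [transfer_rule]: assumes "bi_unique R" "bi_unique S"
  shows "(rel_set R ===> (R ===> R ===> (=)) ===> rel_set R ===> rel_set R ===> rel_set S ===> (S ===> S ===> (=)) ===> (=))
    forcing_extension forcing_extension"
proof (intro rel_funI iffI)
  fix A A' P P' G G' B B' and E E' F F' :: "_ => _ => bool"
  assume PG: "rel_set R P P'" "rel_set R G G'" and a: "rel_set R A A'" "(R ===> R ===> (=)) E E'" "rel_set S B B'" "(S ===> S ===> (=)) F F'"
  have RS: "isomorphism R A E A' E'" "isomorphism S B F B' F'" using assms a unfolding isomorphism_def by auto
  { assume "forcing_extension A E P G B F"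
    then show "forcing_extension A' E' P' G' B' F'" by (rule forcing_extension_isomorphism[OF RS PG]) }
  have "rel_set R\<inverse>\<inverse> P' P" "rel_set R\<inverse>\<inverse> G' G" using PG by simp_all
  note converse = forcing_extension_isomorphism[OF RS[THEN isomorphism_conversep] this]
  assume "forcing_extension A' E' P' G' B' F'"
  then show "forcing_extension A E P G B F" by (rule converse)
qed

lemma GA_bounded: "GA A E \<longleftrightarrow> \<not> (EX W:Pow A. EX P:Pow A. EX r:Pow (A \<times> A). EX G:Pow A. inner_model A E W \<and> set_forcing W E P r \<and>
  nontrivial_poset P r \<and> set_generic W E P r G \<and> forcing_extension W E P G A E)" (is "_ \<longleftrightarrow> \<not> ?bounded")
  and BA_bounded: "BA A E \<longleftrightarrow> (EX W:Pow A. EX P:Pow A. EX r:Pow (A \<times> A). EX G:Pow A. inner_model A E W \<and> set_forcing W E P r \<and>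
  set_generic W E P r G \<and> forcing_extension W E P G A E \<and> GA W E)"
proof -
  have s: "W : Pow A \<and> P : Pow A \<and> r : Pow (A \<times> A) \<and> G : Pow A"
    if "inner_model A E W" "set_forcing W E P r" "set_generic W E P r G" for W P r G
  proof -
    have "W <= A" using that(1) unfolding inner_model_def by blast
    moreover have "P <= W" using that(2) unfolding set_forcing_def elts_def by blast
    moreover have "r <= P \<times> P" using that(2) unfolding set_forcing_def forcing_poset_def partial_order_on_def preorder_on_def by argo
    moreover have "G <= P" using that(3) unfolding set_generic_def filter_on_def by blast
    ultimately show ?thesis by blast
  qed
  show "GA A E \<longleftrightarrow> \<not> ?bounded" unfolding GA_def using s by meson
  show "BA A E \<longleftrightarrow> (EX W:Pow A. EX P:Pow A. EX r:Pow (A \<times> A). EX G:Pow A. inner_model A E W \<and> set_forcing W E P r \<and>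
    set_generic W E P r G \<and> forcing_extension W E P G A E \<and> GA W E)" unfolding BA_def using s by meson
qed

lemma GA_transfer [transfer_rule]: assumes [transfer_rule]: "bi_unique R" shows "(rel_set R ===> (R ===> R ===> (=)) ===> (=)) GA GA"
  unfolding GA_bounded Sigma_def by (transfer_prover_start, transfer_step+, transfer_prover_end)

lemma BA_transfer [transfer_rule]: assumes [transfer_rule]: "bi_unique R" shows "(rel_set R ===> (R ===> R ===> (=)) ===> (=)) BA BA"
  unfolding BA_bounded Sigma_def by (transfer_prover_start, transfer_step+, transfer_prover_end)

lemma Def_pow_transfer [transfer_rule]: assumes [transfer_rule]: "bi_unique R"
  shows "(rel_set R ===> (R ===> R ===> (=)) ===> rel_set R ===> rel_set R) Def_pow Def_pow"
  unfolding Def_pow_def definable_iff_mem filter_iff by transfer_prover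

lemma rel_set_UN: "rel_set R X Y ==> (!!x y. x : X ==> R x y ==> rel_set S (f x) (g y)) ==> rel_set S (\<Union>(f ` X)) (\<Union>(g ` Y))"
  by (rule rel_funD[OF Union_transfer]) (rule rel_set_image)

lemma isomorphism_L:
  assumes iso: "isomorphism R A E B F" and wf: "wf (mem_rel A E)" "wf (mem_rel B F)"
  shows "isomorphism R (L A E) E (L B F) F"
proof -
  have [transfer_rule]: "bi_unique R" "rel_set R A B" "(R ===> R ===> (=)) E F"
    using iso unfolding isomorphism_def by auto
  have mem: "a : A \<longleftrightarrow> b : B" and elts: "rel_set R (elts A E a) (elts B F b)" if [transfer_rule]: "R a b" for a b
    by transfer_prover+
  have Def_pow: "rel_set R (Def_pow A E X) (Def_pow B F Y)" if [transfer_rule]: "rel_set R X Y" for X Y by transfer_prover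
  have Lset: "R a b --> a : A --> rel_set R (Lset A E a) (Lset B F b)" for a b using wf(1)
  proof (induction a arbitrary: b rule: wf_induct_rule)
    case (less a)
    show ?case
    proof (intro impI)
      assume ab: "R a b" and a: "a : A"
      have b: "b : B" using mem[OF ab] a by blast
      show "rel_set R (Lset A E a) (Lset B F b)" unfolding Lset_unfold[OF wf(1) a] Lset_unfold[OF wf(2) b]
        by (rule rel_set_UN[OF elts[OF ab]], rule Def_pow) (use less a in \<open>auto simp: mem_rel_def elts_def\<close>)
    qed
  qed
  have "rel_set R {a. ordinal A E a} {b. ordinal B F b}" unfolding ordinals_bounded by transfer_prover
  then have "rel_set R (L A E) (L B F)" unfolding L_def
    by (rule rel_set_UN) (use Lset in \<open>auto simp: ordinal_def\<close>)
  then show ?thesis using iso unfolding isomorphism_def by blast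
qed

lemma ZFC_isomorphism: "isomorphism R A E B F ==> ZFC A E \<longleftrightarrow> ZFC B F"
  and BA_isomorphism: "isomorphism R A E B F ==> BA A E \<longleftrightarrow> BA B F"
  unfolding isomorphism_def using rel_funD[OF rel_funD[OF ZFC_transfer]] rel_funD[OF rel_funD[OF BA_transfer]] by metis+

lemma isomorphism_graph:
  assumes "inj_on f A" "!!x y. x : A ==> y : A ==> E x y \<longleftrightarrow> F (f x) (f y)"
  shows "isomorphism (%x y. x : A \<and> y = f x) A E (f ` A) F"
  using assms unfolding isomorphism_def bi_unique_def rel_set_def rel_fun_def inj_on_def by auto

lemma countable_isomorphism_nat:
  assumes "countable A" shows "EX R (B :: nat set) F. isomorphism R A E B F"
proof -
  define f where "f = to_nat_on A"
  have f: "inj_on f A" unfolding f_def using assms by (rule inj_on_to_nat_on)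
  have "E x y \<longleftrightarrow> E (inv_into A f (f x)) (inv_into A f (f y))" if "x : A" "y : A" for x y
    using inv_into_f_f[OF f] that by simp
  from isomorphism_graph[of f A E "%m n. E (inv_into A f m) (inv_into A f n)", OF f this] show ?thesis by blast
qed

lemma related_subset: "rel_set R A B ==> X <= A ==> EX Y. rel_set R X Y"
  by (rule exI[of _ "{y. EX x:X. R x y}"]) (unfold rel_set_def, fast)

lemma class_forcing_extension_isomorphism:
  assumes R: "isomorphism R A E A' E'" and S: "isomorphism S N F N' F'"
    and P: "class_forcing A E P r" and G: "class_generic A E P r G" and N: "forcing_extension A E P G N F"
  shows "EX P' r' G'. class_forcing A' E' P' r' \<and> class_generic A' E' P' r' G' \<and> forcing_extension A' E' P' G' N' F'"
proof -
  have [transfer_rule]: "bi_unique R" "rel_set R A A'" "(R ===> R ===> (=)) E E'" using R unfolding isomorphism_def by auto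
  have "P <= A" using P unfolding class_forcing_def definable_def by blast
  then obtain P' where P': "rel_set R P P'" using related_subset[OF \<open>rel_set R A A'\<close>] by blast
  have "rel_set (rel_prod R R) (P \<times> P) (P' \<times> P')" using P' unfolding rel_set_def by auto
  moreover have "r <= P \<times> P"
    using P unfolding class_forcing_def forcing_poset_def partial_order_on_def preorder_on_def by argo
  ultimately obtain r' where r': "rel_set (rel_prod R R) r r'" using related_subset by blast
  have "G <= P" using G unfolding class_generic_def filter_on_def by blast
  then obtain G' where G': "rel_set R G G'" using related_subset[OF P'] by blast
  note [transfer_rule] = P' r' G'
  have "class_forcing A E P r = class_forcing A' E' P' r'" "class_generic A E P r G = class_generic A' E' P' r' G'"
    by transfer_prover+
  then show ?thesis using P G forcing_extension_isomorphism[OF R S P' G' N] by blast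
qed

end

section \<open>Generic filters and the transitive collapse\<close>

instance fm :: countable by countable_datatype

lemma countable_definable: assumes A: "countable A" shows "countable {X. definable A E X}"
proof (cases "A = {}")
  case True
  then have "{X. definable A E X} <= {{}}" unfolding definable_def by auto
  then show ?thesis by (rule countable_subset) simp
next
  case False
  then obtain a0 where a0: "a0 : A" by blast
  let ?S = "%(\<phi>, xs). {a : A. sat A E \<phi> ((%i. if i < length xs then xs ! i else a0)(0 := a))}"
  have "{X. definable A E X} <= ?S ` (UNIV \<times> lists A)"
  proof
    fix X assume "X : {X. definable A E X}"
    then obtain \<phi> v where v: "v ` (fv \<phi> - {0}) <= A" "X = {a : A. sat A E \<phi> (v(0 := a))}" unfolding definable_def by blast
    define n where "n = Suc (Max (insert 0 (fv \<phi>)))"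
    define xs where "xs = map (%i. if i : fv \<phi> - {0} then v i else a0) [0..<n]"
    have "i < n" if "i : fv \<phi>" for i using that unfolding n_def by (simp add: le_imp_less_Suc)
    then have "sat A E \<phi> (v(0 := a)) \<longleftrightarrow> sat A E \<phi> ((%i. if i < length xs then xs ! i else a0)(0 := a))" for a
      by (intro sat_cong_fv) (auto simp: xs_def)
    then have "X = ?S (\<phi>, xs)" unfolding v(2) by simp
    moreover have "xs : lists A" unfolding xs_def using subsetD[OF v(1) imageI] a0 by auto
    ultimately show "X : ?S ` (UNIV \<times> lists A)" by blast
  qed
  then show ?thesis by (rule countable_subset) (use A in \<open>intro countable_image countable_SIGMA countableI_type countable_lists\<close>)
qed

lemma filter_on_descending_sequence:
  assumes r: "refl_on P r" "trans r" and s: "!!n. s n : P" "!!n. (s (Suc n), s n) : r"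
  shows "filter_on P r {q : P. EX n. (s n, q) : r}" (is "filter_on P r ?G")
proof -
  have mono: "(s (n + k), s n) : r" for n k
  proof (induction k)
    case 0 show ?case using r(1) s(1) unfolding refl_on_def by simp
  next
    case (Suc k) then show ?case using transD[OF r(2) s(2)[of "n + k"]] by simp
  qed
  show ?thesis unfolding filter_on_def
  proof (intro conjI ballI impI)
    show "?G <= P" "?G ~= {}" using mono[of 0 0] s(1)[of 0] by auto
    fix p assume p: "p : ?G"
    { fix q assume "q : P" "(p, q) : r" then show "q : ?G" using p transD[OF r(2)] by blast }
    fix q assume q: "q : ?G"
    obtain n m where nm: "(s n, p) : r" "(s m, q) : r" using p q by blast
    have "(s (n + m), p) : r" "(s (n + m), q) : r"
      using transD[OF r(2) mono nm(1)] transD[OF r(2) mono[of m n] nm(2)] by (simp_all add: add.commute)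
    moreover have "s (n + m) : ?G" using s(1) mono[of "n + m" 0] by auto
    ultimately show "EX s:?G. (s, p) : r \<and> (s, q) : r" by blast
  qed
qed

theorem Rasiowa_Sikorski: assumes P: "forcing_poset P r" and \<D>: "countable \<D>"
  shows "EX G. filter_on P r G \<and> (ALL D:\<D>. dense_in P r D --> G Int D ~= {})"
proof -
  have r: "refl_on P r" "trans r" and "P ~= {}"
    using P unfolding forcing_poset_def partial_order_on_def preorder_on_def by auto
  define dense where "dense = insert P {D : \<D>. dense_in P r D}"
  have P_dense: "dense_in P r P" using r(1) unfolding dense_in_def refl_on_def by blast
  have countable: "countable dense" "dense ~= {}" unfolding dense_def using \<D> by (auto intro: countable_subset)
  define D where "D = from_nat_into dense"
  have D: "dense_in P r (D n)" for n using from_nat_into[OF countable(2), of n] P_dense unfolding D_def dense_def by auto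
  have "EX s. ALL n. s n : P \<and> (s (Suc n), s n) : r \<and> s (Suc n) : D n"
  proof (rule dependent_nat_choice)
    show "EX p. p : P" using \<open>P ~= {}\<close> by blast
    show "EX q. q : P \<and> (q, p) : r \<and> q : D n" if "p : P" for p n using D[of n] that unfolding dense_in_def by blast
  qed
  then obtain s where s: "!!n. s n : P" "!!n. (s (Suc n), s n) : r" "!!n. s (Suc n) : D n" by blast
  have "{q : P. EX n. (s n, q) : r} Int X ~= {}" if "X : \<D>" "dense_in P r X" for X
  proof -
    have "X : dense" unfolding dense_def using that by blast
    then obtain n where "D n = X" unfolding D_def using from_nat_into_surj[OF countable(1)] by blast
    moreover have "(s (Suc n), s (Suc n)) : r" using r(1) s(1) unfolding refl_on_def by blast
    ultimately show ?thesis using s(1,3)[of "Suc n"] s(3)[of n] by blast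
  qed
  then show ?thesis using filter_on_descending_sequence[of P r s, OF r s(1,2)] by blast
qed

context L_model
begin

definition Conds where "Conds = {p. cond zero p}"
definition Conds_le where "Conds_le = {(p, q). cond zero p \<and> cond zero q \<and> el q <= el p}"

lemma class_forcing: "class_forcing A mem Conds Conds_le"
proof -
  have P: "Conds <= A" unfolding Conds_def using condA by blast
  have "partial_order_on Conds Conds_le" unfolding partial_order_on_def preorder_on_def refl_on_def trans_def antisym_def Conds_le_def Conds_def
    by (auto intro: ext_el)
  moreover have "EX t:Conds. ALL p:Conds. (p, t) : Conds_le" unfolding Conds_le_def Conds_def using cond_zero by (intro bexI[of _ zero]) auto
  ultimately have poset: "forcing_poset Conds Conds_le" unfolding forcing_poset_def by blast
  have "dpred A (%e. e 0 : Conds)" unfolding Conds_def mem_Collect_eq by (intro dintro zeroA)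
  then have conds: "definable A mem Conds" using definable_iff_dpred[OF P] by blast
  have pA: "Conds_le <= A \<times> A" unfolding Conds_le_def using condA by blast
  have "dpred A (%e. (e 0, e 1) : Conds_le)" unfolding Conds_le_def mem_Collect_eq prod.case by (intro dintro zeroA)
  then have le: "definable_rel A mem Conds_le" using definable_rel_iff_dpred[OF pA] by blast
  have "Conds ~= elts A mem c" if c: "c : A" for c
  proof
    assume e: "Conds = elts A mem c"
    let ?z = "pair c zero"
    have "upair ?z ?z : el c" using cond_singleton[OF c, of zero zero] e elts_A[OF c] unfolding Conds_def by auto
    moreover have "c : TC (upair ?z ?z)" using pair_TC(1)[of c zero] TC_el[of ?z "upair ?z ?z"] TC_trans by auto
    ultimately have "c : TC c" using TC_el TC_trans by blast
    then show False by simp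
  qed
  then show ?thesis unfolding class_forcing_def using poset conds le by blast
qed

lemma easton_ext_generic: assumes g: "class_generic A mem Conds Conds_le G" shows "easton_ext A G"
proof -
  have f: "G <= Conds" "G ~= {}" "ALL p:G. ALL q:Conds. (p, q) : Conds_le --> q : G" "ALL p:G. ALL q:G. EX s:G. (s, p) : Conds_le \<and> (s, q) : Conds_le"
    using g unfolding class_generic_def filter_on_def by blast+
  show ?thesis
  proof unfold_locales
    show "zero : A" by simp
    show G_cond_in: "cond zero p" if "p : G" for p using that f(1) unfolding Conds_def by blast
    show up: "q : G" if "p : G" "cond zero q" "el q <= el p" for p q using that f(3) G_cond_in unfolding Conds_def Conds_le_def by blast
    show "zero : G" using f(2) up cond_zero by fastforce
    show "EX s:G. el p <= el s \<and> el q <= el s" if "p : G" "q : G" for p q using f(4) that unfolding Conds_le_def by blast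
    fix Q assume Q: "dpred A (%e. Q (e 0))" and d: "!!p. cond zero p ==> EX d. cond zero d \<and> el p <= el d \<and> Q d"
    let ?D = "{p. cond zero p \<and> Q p}"
    have D: "?D <= A" using condA by blast
    have "definable A mem ?D" unfolding definable_iff_dpred[OF D] mem_Collect_eq by (intro dpred_conj Q) (intro dintro zeroA)
    moreover have "dense_in Conds Conds_le ?D" unfolding dense_in_def Conds_def Conds_le_def using d by auto
    ultimately have "G Int ?D ~= {}" using g unfolding class_generic_def by blast
    then show "EX p:G. Q p" by blast
  qed
qed

lemma generic: "EX G. class_generic A mem Conds Conds_le G"
proof -
  have "forcing_poset Conds Conds_le" using class_forcing unfolding class_forcing_def by blast
  from Rasiowa_Sikorski[OF this countable_definable[OF cntA, of mem]] show ?thesis unfolding class_generic_def by blast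
qed

end

lemma (in easton_ext) forcing_extension_N: assumes "class_generic A mem Conds Conds_le G" shows "forcing_extension A mem Conds G N mem"
proof (rule forcing_extensionI[where Q="cond zero"])
  show "dpred A (%e. cond zero (e 0))" by (intro dintro zeroA)
  show "Conds = {p : A. cond zero p}" unfolding Conds_def using condA by blast
  show "G <= Conds" using assms unfolding class_generic_def filter_on_def by blast
qed (use N_def N_trans in auto)

lemma wf_mem_rel: "wf (mem_rel A mem)" by (rule wf_subset[OF wf_mem]) (auto simp: mem_rel_def elts_def)

lemma (in zf) L_eq_Lcls: "L A mem = Lcls"
proof -
  have D: "Def_pow A mem (el X) = el (Defpow X)" if X: "X : A" "el X ~= {} --> zero : el X" for X
  proof (intro set_eqI)
    fix y
    have "definable (el X) mem (el y) --> el y <= el X" unfolding definable_def by blast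
    moreover have "y : el (Defpow X) --> y : A" using X DefpowA Atrans by blast
    ultimately show "y : Def_pow A mem (el X) \<longleftrightarrow> y : el (Defpow X)" unfolding Def_pow_def using Defpow_definable[OF X, of y] elts_A[of y] by auto
  qed
  have Lh: "a : A --> Ord a --> Lset A mem a = el (Lh a)" for a
  proof (induction a rule: el_induct)
    case (step a)
    show ?case
    proof (intro impI)
      assume a: "a : A" "Ord a"
      have b: "b : A" "Ord b" "Lset A mem b = el (Lh b)" if "b : el a" for b using that a step Atrans Ord_in by blast+
      have z: "el (Lh b) ~= {} --> zero : el (Lh b)" if ba: "b : el a" for b
      proof
        assume "el (Lh b) ~= {}"
        then have "el b ~= {}" unfolding el_Lh[OF b(1)[OF ba]] by blast
        then have "zero : el b" using Ord_linear[OF Ord_zero b(2)[OF ba]] by auto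
        moreover have "zero : el (Defpow (Lh zero))" using Ord_Defpow[OF zeroA Ord_zero] .
        ultimately show "zero : el (Lh b)" unfolding el_Lh[OF b(1)[OF ba]] by blast
      qed
      have "Lset A mem a = (UN b:el a. Def_pow A mem (Lset A mem b))" unfolding Lset_unfold[OF wf_mem_rel a(1)] elts_A[OF a(1)] ..
      also have "... = (UN b:el a. el (Defpow (Lh b)))" using b z D[OF LhA] by (intro SUP_cong) auto
      finally show "Lset A mem a = el (Lh a)" unfolding el_Lh[OF a(1)] .
    qed
  qed
  have "L A mem = (UN a:{a. a : A \<and> Ord a}. el (Lh a))" unfolding L_def ordinal_Ord using Lh by (intro SUP_cong) auto
  also have "... = Lcls" unfolding Lcls_def using LhA Atrans by blast
  finally show ?thesis .
qed

definition collapse :: "'a set => ('a => 'a => bool) => 'a => hset" where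
  "collapse M E = wfrec (mem_rel M E) (%f x. mk (f ` elts M E x))"

lemma el_collapse: assumes "countable M" "wf (mem_rel M E)" "x : M" shows "el (collapse M E x) = collapse M E ` elts M E x"
proof -
  have "cut (collapse M E) (mem_rel M E) x ` elts M E x = collapse M E ` elts M E x"
    by (intro image_cong) (auto simp: cut_def mem_rel_def assms(3))
  then have "collapse M E x = mk (collapse M E ` elts M E x)"
    unfolding collapse_def by (subst wfrec[OF assms(2)]) (simp add: collapse_def)
  moreover have "countable (elts M E x)" using assms(1) unfolding elts_def by (rule countable_subset[rotated]) blast
  ultimately show ?thesis by simp
qed

lemma inj_on_collapse:
  assumes "countable M" and wf: "wf (mem_rel M E)" and ext: "extensional_model M E" shows "inj_on (collapse M E) M"
proof -
  note el = el_collapse[OF assms(1,2)]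
  have "x : M --> (ALL y:M. collapse M E x = collapse M E y --> x = y)" for x using wf
  proof (induction x rule: wf_induct_rule)
    case (less x)
    show ?case
    proof (intro impI ballI)
      fix y assume xy: "x : M" "y : M" "collapse M E x = collapse M E y"
      have eq: "collapse M E ` elts M E x = collapse M E ` elts M E y" using el xy by metis
      have IH: "z = z'" if "z : elts M E x" "z' : elts M E y" "collapse M E z = collapse M E z'" for z z'
        using less[of z] that xy(1) unfolding mem_rel_def elts_def by auto
      have "z : elts M E y" if z: "z : elts M E x" for z
      proof -
        obtain z' where "z' : elts M E y" "collapse M E z = collapse M E z'" using eq z by blast
        then show ?thesis using IH[OF z] by blast
      qed
      moreover have "z : elts M E x" if z: "z : elts M E y" for z
      proof -
        obtain z' where "z' : elts M E x" "collapse M E z' = collapse M E z" using eq z by (metis imageE imageI)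
        then show ?thesis using IH[OF _ z] by blast
      qed
      ultimately show "x = y" using ext xy(1,2) unfolding extensional_model_def by blast
    qed
  qed
  then show ?thesis unfolding inj_on_def by blast
qed

theorem Mostowski_collapse:
  assumes "countable M" "wf (mem_rel M E)" "extensional_model M E"
  shows "EX R A. isomorphism R M E A mem \<and> countable A \<and> (ALL x:A. el x <= A)"
proof -
  let ?f = "collapse M E"
  note el = el_collapse[OF assms(1,2)] and inj = inj_on_collapse[OF assms]
  have "E x y \<longleftrightarrow> mem (?f x) (?f y)" if xy: "x : M" "y : M" for x y
    unfolding el[OF xy(2)] using inj_on_image_mem_iff[OF inj xy(1), of "elts M E y"] xy(1) by (auto simp: elts_def)
  then have "isomorphism (%x y. x : M \<and> y = ?f x) M E (?f ` M) mem" by (intro isomorphism_graph inj)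
  moreover have "ALL x:?f ` M. el x <= ?f ` M" using el unfolding elts_def by auto
  ultimately show ?thesis using assms(1) by blast
qed

theorem theoremT:
  fixes M :: "'a set" and E :: "'a \<Rightarrow> 'a \<Rightarrow> bool"
  assumes "countable_transitive_model M E"
  shows "\<exists>P r G. \<exists>(N :: nat set) F.
    class_forcing (L M E) E P r \<and> class_generic (L M E) E P r G \<and>
    forcing_extension (L M E) E P G N F \<and>
    ZFC N F \<and> \<not> BA N F"
proof -
  have M: "countable M" "wf (mem_rel M E)" "ZFC M E"
    using assms unfolding countable_transitive_model_def by auto
  then have "extensional_model M E" unfolding ZFC_def by blast
  then obtain R A where A: "isomorphism R M E A mem" "countable A" "ALL x:A. el x <= A"
    using Mostowski_collapse M by blast
  interpret A: zf A using ZFC_isomorphism[OF A(1)] M(3) ZFC_iff_zf[OF A(2,3)] by blast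
  interpret L: L_model "L A mem" unfolding A.L_eq_Lcls by (rule A.Lcls_L_model)
  obtain G where G: "class_generic (L A mem) mem L.Conds L.Conds_le G" using L.generic by blast
  interpret easton_ext "L A mem" G by (rule L.easton_ext_generic[OF G])
  obtain S and N' :: "nat set" and F where S: "isomorphism S N mem N' F" using countable_isomorphism_nat[OF countable_N] by blast
  have ZFC_N: "ZFC N mem" using ZFC_iff_zf[OF countable_N] N_trans N_zf N_AC by blast
  have "isomorphism R (L M E) E (L A mem) mem" by (rule isomorphism_L[OF A(1) M(2) wf_mem_rel])
  from class_forcing_extension_isomorphism[OF isomorphism_conversep[OF this] S L.class_forcing G forcing_extension_N[OF G]]
  show ?thesis using ZFC_isomorphism[OF S] BA_isomorphism[OF S] ZFC_N not_BA by blast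
qed

end
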